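(* Let $\mathcal M$ be a compact complex supermanifold. The topological space $\mathrm{Aut}_{\bar 0}(\mathcal M)$ is locally compact.
   Context: A complex supermanifold $\mathcal M=(M,\mathcal O_{\mathcal M})$ of dimension $(m|n)$ is a complex manifold $M$ with a sheaf $\mathcal O_{\mathcal M}$ of $\mathbb Z_2$-graded algebras which is locally, on small open $U\subset M$, isomorphic to $\mathcal O_U\otimes\bigwedge\mathbb C^n$, with $\mathcal O_U$ the sheaf of holomorphic functions; it is compact if $M$ is compact. A morphism $\varphi$ has underlying map $\tilde\varphi$ and parity-preserving pullback $\varphi^*$. $\mathrm{Aut}_{\bar 0}(\mathcal M)$ is the set of automorphisms (biholomorphic morphisms $\mathcal M\to\mathcal M$), with the topology generated by the following subbase. For $K\subseteq M$ compact contained in a coordinate domain with odd coordinates $\theta_1,\dots,\theta_n$, $U\subseteq M$ open, $f\in\mathcal O_{\mathcal M}(U)$, and $U_\nu\subseteq\mathbb C$ open ($\nu\in(\mathbb Z_2)^n$), the set of all $\varphi$ with $\tilde\varphi(K)\subseteq U$ and $\varphi_{f,\nu}(K)\subseteq U_\nu$ for all $\nu$, where $\varphi^*(f)=\sum_\nu\varphi_{f,\nu}\theta^\nu$ near $K$ with $\varphi_{f,\nu}$ holomorphic. Manifolds are second-countable, and $\mathrm{Aut}_{\bar 0}(\mathcal M)$ is a second-countable Hausdorff space in this topology. *)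

theory Defs
  imports "HOL-Analysis.Analysis" "HOL-Algebra.Algebraic_Closure_Type" "HOL-Library.Z2"
begin

section \<open>Holomorphic functions of several variables\<close>

text \<open>
  \<open>\<complex>\<^sup>m\<close> is realised, like the library's \<open>Euclidean_space\<close>, by the sequences vanishing from
  index \<open>m\<close> on, with the topology inherited from the product topology. The dimension
  is a natural number, so that \<open>m = 0\<close> is allowed.
\<close>

definition cspace :: "nat \<Rightarrow> (nat \<Rightarrow> complex) set" where
  "cspace m = {z. \<forall>i\<ge>m. z i = 0}"

text \<open>Used for sets \<open>U\<close> that are open in \<open>cspace m\<close>: continuous, and holomorphic in each variable.\<close>

definition holomorphic_several ::
  "nat \<Rightarrow> (nat \<Rightarrow> complex) set \<Rightarrow> ((nat \<Rightarrow> complex) \<Rightarrow> complex) \<Rightarrow> bool" where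
  "holomorphic_several m U f \<longleftrightarrow>
     continuous_on U f \<and>
     (\<forall>z\<in>U. \<forall>i<m. (\<lambda>w. f (z(i := w))) field_differentiable at (z i))"

section \<open>Sheaves of superalgebras\<close>

abbreviation complex_field :: "complex ring" where
  "complex_field \<equiv> ring_of_type_algebra"

text \<open>
  An associative unital complex algebra \<open>A\<close>, stored in a \<open>module\<close> record, with the
  homogeneous components \<open>G 0\<close> and \<open>G 1\<close>. The library's \<open>algebra\<close> locale requires
  commutativity and is not applicable.
\<close>

definition superalgebra :: "(complex, 's) module \<Rightarrow> (bit \<Rightarrow> 's set) \<Rightarrow> bool" where
  "superalgebra A G \<longleftrightarrow>
     ring A \<and> module complex_field A \<and>
     (\<forall>c. \<forall>a\<in>carrier A. \<forall>b\<in>carrier A.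
        (c \<odot>\<^bsub>A\<^esub> a) \<otimes>\<^bsub>A\<^esub> b = c \<odot>\<^bsub>A\<^esub> (a \<otimes>\<^bsub>A\<^esub> b) \<and>
        a \<otimes>\<^bsub>A\<^esub> (c \<odot>\<^bsub>A\<^esub> b) = c \<odot>\<^bsub>A\<^esub> (a \<otimes>\<^bsub>A\<^esub> b)) \<and>
     (\<forall>i. submodule (G i) complex_field A) \<and>
     (\<forall>a\<in>carrier A. \<exists>!p. p \<in> G 0 \<times> G 1 \<and> a = fst p \<oplus>\<^bsub>A\<^esub> snd p) \<and>
     (\<forall>i j. \<forall>a\<in>G i. \<forall>b\<in>G j. a \<otimes>\<^bsub>A\<^esub> b \<in> G (i + j))"

definition superalgebra_hom ::
  "(complex, 's) module \<Rightarrow> (bit \<Rightarrow> 's set) \<Rightarrow> (complex, 't) module \<Rightarrow> (bit \<Rightarrow> 't set)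
     \<Rightarrow> ('s \<Rightarrow> 't) \<Rightarrow> bool" where
  "superalgebra_hom A G B H h \<longleftrightarrow>
     h \<in> ring_hom A B \<and>
     (\<forall>c. \<forall>a\<in>carrier A. h (c \<odot>\<^bsub>A\<^esub> a) = c \<odot>\<^bsub>B\<^esub> h a) \<and>
     (\<forall>i. h ` G i \<subseteq> H i)"

text \<open>
  \<open>sections \<M> U\<close> is \<open>\<O>(U)\<close>, \<open>grading \<M> U i\<close> its component of parity \<open>i\<close>, and
  \<open>restr \<M> U V\<close> the restriction map \<open>\<O>(U) \<rightarrow> \<O>(V)\<close>. The values of these fields are
  constrained for open \<open>V \<subseteq> U\<close> only. The dimension is \<open>(even_dim \<M> | odd_dim \<M>)\<close>.
\<close>

record ('p, 's) superspace =
  even_dim :: nat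
  odd_dim :: nat
  base :: "'p topology"
  atlas :: "('p set \<times> ('p \<Rightarrow> nat \<Rightarrow> complex)) set"
  sections :: "'p set \<Rightarrow> (complex, 's) module"
  grading :: "'p set \<Rightarrow> bit \<Rightarrow> 's set"
  restr :: "'p set \<Rightarrow> 'p set \<Rightarrow> 's \<Rightarrow> 's"

definition opens :: "('p, 's) superspace \<Rightarrow> 'p set set" where
  "opens \<M> = {U. openin (base \<M>) U}"

definition superalgebra_presheaf :: "('p, 's) superspace \<Rightarrow> bool" where
  "superalgebra_presheaf \<M> \<longleftrightarrow>
     (\<forall>U\<in>opens \<M>. superalgebra (sections \<M> U) (grading \<M> U)) \<and>
     (\<forall>U\<in>opens \<M>. \<forall>V\<in>opens \<M>. V \<subseteq> U \<longrightarrow>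
        superalgebra_hom (sections \<M> U) (grading \<M> U) (sections \<M> V) (grading \<M> V) (restr \<M> U V)) \<and>
     (\<forall>U\<in>opens \<M>. \<forall>s\<in>carrier (sections \<M> U). restr \<M> U U s = s) \<and>
     (\<forall>U\<in>opens \<M>. \<forall>V\<in>opens \<M>. \<forall>W\<in>opens \<M>. W \<subseteq> V \<longrightarrow> V \<subseteq> U \<longrightarrow>
        (\<forall>s\<in>carrier (sections \<M> U). restr \<M> V W (restr \<M> U V s) = restr \<M> U W s))"

definition superalgebra_sheaf :: "('p, 's) superspace \<Rightarrow> bool" where
  "superalgebra_sheaf \<M> \<longleftrightarrow>
     superalgebra_presheaf \<M> \<and>
     (\<forall>\<C>\<subseteq>opens \<M>. \<forall>s\<in>carrier (sections \<M> (\<Union>\<C>)). \<forall>t\<in>carrier (sections \<M> (\<Union>\<C>)).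
        (\<forall>V\<in>\<C>. restr \<M> (\<Union>\<C>) V s = restr \<M> (\<Union>\<C>) V t) \<longrightarrow> s = t) \<and>
     (\<forall>\<C>\<subseteq>opens \<M>. \<forall>s.
        (\<forall>V\<in>\<C>. s V \<in> carrier (sections \<M> V)) \<longrightarrow>
        (\<forall>V\<in>\<C>. \<forall>W\<in>\<C>. restr \<M> V (V \<inter> W) (s V) = restr \<M> W (V \<inter> W) (s W)) \<longrightarrow>
        (\<exists>t\<in>carrier (sections \<M> (\<Union>\<C>)). \<forall>V\<in>\<C>. restr \<M> (\<Union>\<C>) V t = s V))"

section \<open>Complex supermanifolds\<close>

definition topological_chart ::
  "('p, 's) superspace \<Rightarrow> 'p set \<Rightarrow> ('p \<Rightarrow> nat \<Rightarrow> complex) \<Rightarrow> bool" where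
  "topological_chart \<M> D \<kappa> \<longleftrightarrow>
     openin (base \<M>) D \<and>
     openin (top_of_set (cspace (even_dim \<M>))) (\<kappa> ` D) \<and>
     homeomorphic_map (subtopology (base \<M>) D) (top_of_set (\<kappa> ` D)) \<kappa>"

definition holomorphic_transition ::
  "nat \<Rightarrow> 'p set \<Rightarrow> ('p \<Rightarrow> nat \<Rightarrow> complex) \<Rightarrow> 'p set \<Rightarrow> ('p \<Rightarrow> nat \<Rightarrow> complex) \<Rightarrow> bool" where
  "holomorphic_transition m D \<kappa> E \<mu> \<longleftrightarrow>
     (\<forall>i<m. holomorphic_several m (\<kappa> ` (D \<inter> E)) (\<lambda>z. \<mu> (inv_into D \<kappa> z) i))"

definition complex_manifold :: "('p, 's) superspace \<Rightarrow> bool" where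
  "complex_manifold \<M> \<longleftrightarrow>
     Hausdorff_space (base \<M>) \<and> second_countable (base \<M>) \<and>
     (\<forall>(D, \<kappa>)\<in>atlas \<M>. topological_chart \<M> D \<kappa>) \<and>
     topspace (base \<M>) = \<Union> (fst ` atlas \<M>) \<and>
     (\<forall>(D, \<kappa>)\<in>atlas \<M>. \<forall>(E, \<mu>)\<in>atlas \<M>. holomorphic_transition (even_dim \<M>) D \<kappa> E \<mu>)"

text \<open>Membership in the maximal atlas.\<close>

definition holomorphic_chart ::
  "('p, 's) superspace \<Rightarrow> 'p set \<Rightarrow> ('p \<Rightarrow> nat \<Rightarrow> complex) \<Rightarrow> bool" where
  "holomorphic_chart \<M> D \<kappa> \<longleftrightarrow>
     topological_chart \<M> D \<kappa> \<and>
     (\<forall>(E, \<mu>)\<in>atlas \<M>. holomorphic_transition (even_dim \<M>) D \<kappa> E \<mu> \<and>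
                        holomorphic_transition (even_dim \<M>) E \<mu> D \<kappa>)"

definition holomorphic_functions :: "('p, 's) superspace \<Rightarrow> 'p set \<Rightarrow> ('p \<Rightarrow> complex) set" where
  "holomorphic_functions \<M> V =
     {f \<in> extensional V. \<forall>(D, \<kappa>)\<in>atlas \<M>.
        holomorphic_several (even_dim \<M>) (\<kappa> ` (D \<inter> V)) (\<lambda>z. f (inv_into D \<kappa> z))}"

text \<open>
  The tensor product of the holomorphic functions on \<open>V\<close> with the exterior algebra of \<open>\<complex>\<^sup>n\<close>.
  A multi-index \<open>\<nu> \<in> (\<int>/2)\<^sup>n\<close> is encoded by its support, a subset of \<open>{..<n}\<close>. The family
  \<open>a\<close> stands for \<open>\<Sum>\<^sub>\<nu> a \<nu> \<theta>\<^sup>\<nu>\<close>, where \<open>\<theta>\<^sup>\<nu>\<close> is the product of the \<open>\<theta>\<^sub>i\<close>, \<open>i \<in> \<nu>\<close>, in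
  increasing order of the indices. For disjoint \<open>\<mu>\<close> and \<open>\<nu>\<close>,
  \<open>\<theta>\<^sup>\<mu> \<theta>\<^sup>\<nu> = wedge_sign \<mu> \<nu> \<theta>\<^bsup>\<mu> \<union> \<nu>\<^esup>\<close>.
\<close>

definition wedge_sign :: "nat set \<Rightarrow> nat set \<Rightarrow> complex" where
  "wedge_sign \<mu> \<nu> = (-1) ^ card {(i, j). i \<in> \<mu> \<and> j \<in> \<nu> \<and> j < i}"

definition multi_indices :: "('p, 's) superspace \<Rightarrow> nat set set" where
  "multi_indices \<M> = Pow {..<odd_dim \<M>}"

definition grassmann ::
  "('p, 's) superspace \<Rightarrow> 'p set \<Rightarrow> (complex, nat set \<Rightarrow> 'p \<Rightarrow> complex) module" where
  "grassmann \<M> V =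
     \<lparr> carrier = multi_indices \<M> \<rightarrow>\<^sub>E holomorphic_functions \<M> V,
       monoid.mult = (\<lambda>a b. \<lambda>\<nu>\<in>multi_indices \<M>. \<lambda>p\<in>V.
         \<Sum>\<mu>\<in>Pow \<nu>. wedge_sign \<mu> (\<nu> - \<mu>) * a \<mu> p * b (\<nu> - \<mu>) p),
       monoid.one = (\<lambda>\<nu>\<in>multi_indices \<M>. \<lambda>p\<in>V. if \<nu> = {} then 1 else 0),
       ring.zero = (\<lambda>\<nu>\<in>multi_indices \<M>. \<lambda>p\<in>V. 0),
       ring.add = (\<lambda>a b. \<lambda>\<nu>\<in>multi_indices \<M>. \<lambda>p\<in>V. a \<nu> p + b \<nu> p),
       module.smult = (\<lambda>c a. \<lambda>\<nu>\<in>multi_indices \<M>. \<lambda>p\<in>V. c * a \<nu> p) \<rparr>"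

definition grassmann_grading ::
  "('p, 's) superspace \<Rightarrow> 'p set \<Rightarrow> bit \<Rightarrow> (nat set \<Rightarrow> 'p \<Rightarrow> complex) set" where
  "grassmann_grading \<M> V i =
     {a \<in> carrier (grassmann \<M> V).
        \<forall>\<nu>\<in>multi_indices \<M>. of_nat (card \<nu>) \<noteq> i \<longrightarrow> (\<forall>p\<in>V. a \<nu> p = 0)}"

text \<open>
  An isomorphism of sheaves of superalgebras over the open set \<open>W\<close> from the structure sheaf
  to the local model; \<open>\<Phi> V\<close> is its component on the sections over \<open>V\<close>.
\<close>

definition local_splitting ::
  "('p, 's) superspace \<Rightarrow> 'p set \<Rightarrow> ('p set \<Rightarrow> 's \<Rightarrow> nat set \<Rightarrow> 'p \<Rightarrow> complex) \<Rightarrow> bool" where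
  "local_splitting \<M> W \<Phi> \<longleftrightarrow>
     openin (base \<M>) W \<and>
     (\<forall>V\<in>opens \<M>. V \<subseteq> W \<longrightarrow>
        superalgebra_hom (sections \<M> V) (grading \<M> V) (grassmann \<M> V) (grassmann_grading \<M> V) (\<Phi> V) \<and>
        bij_betw (\<Phi> V) (carrier (sections \<M> V)) (carrier (grassmann \<M> V))) \<and>
     (\<forall>V\<in>opens \<M>. \<forall>V'\<in>opens \<M>. V \<subseteq> W \<longrightarrow> V' \<subseteq> V \<longrightarrow>
        (\<forall>s\<in>carrier (sections \<M> V). \<forall>\<nu>\<in>multi_indices \<M>.
           \<Phi> V' (restr \<M> V V' s) \<nu> = restrict (\<Phi> V s \<nu>) V'))"

definition complex_supermanifold :: "('p, 's) superspace \<Rightarrow> bool" where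
  "complex_supermanifold \<M> \<longleftrightarrow>
     complex_manifold \<M> \<and> superalgebra_sheaf \<M> \<and>
     (\<forall>p\<in>topspace (base \<M>). \<exists>W \<Phi>. p \<in> W \<and> local_splitting \<M> W \<Phi>)"

definition compact_supermanifold :: "('p, 's) superspace \<Rightarrow> bool" where
  "compact_supermanifold \<M> \<longleftrightarrow> complex_supermanifold \<M> \<and> compact_space (base \<M>)"

text \<open>
  A coordinate system on \<open>W\<close>. Even and odd coordinates \<open>(x, \<theta>)\<close> determine the isomorphism
  \<open>\<Phi>\<close> sending \<open>\<theta>\<^sub>j\<close> to the \<open>j\<close>-th generator of the exterior algebra and \<open>x\<^sub>i\<close> to the \<open>i\<close>-th
  component of the underlying chart \<open>\<kappa>\<close>; conversely, \<open>\<kappa>\<close> and \<open>\<Phi>\<close> determine \<open>(x, \<theta>)\<close>.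
\<close>

definition coordinate_system ::
  "('p, 's) superspace \<Rightarrow> 'p set \<Rightarrow> ('p \<Rightarrow> nat \<Rightarrow> complex)
     \<Rightarrow> ('p set \<Rightarrow> 's \<Rightarrow> nat set \<Rightarrow> 'p \<Rightarrow> complex) \<Rightarrow> bool" where
  "coordinate_system \<M> W \<kappa> \<Phi> \<longleftrightarrow> holomorphic_chart \<M> W \<kappa> \<and> local_splitting \<M> W \<Phi>"

section \<open>Morphisms and automorphisms\<close>

text \<open>
  A morphism is the pair of its underlying map and its pullback, a family of maps indexed by
  the open sets of the target. Both are made extensional (undefined outside their domains), so
  that equal morphisms are equal as pairs.
\<close>

type_synonym ('p, 's, 'q, 't) morphism = "('p \<Rightarrow> 'q) \<times> ('q set \<Rightarrow> 't \<Rightarrow> 's)"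

definition preimage ::
  "('p, 's) superspace \<Rightarrow> ('p, 's, 'q, 't) morphism \<Rightarrow> 'q set \<Rightarrow> 'p set" where
  "preimage \<M> \<phi> U = {p \<in> topspace (base \<M>). fst \<phi> p \<in> U}"

definition holomorphic_map ::
  "('p, 's) superspace \<Rightarrow> ('q, 't) superspace \<Rightarrow> ('p \<Rightarrow> 'q) \<Rightarrow> bool" where
  "holomorphic_map \<M> \<N> f \<longleftrightarrow>
     continuous_map (base \<M>) (base \<N>) f \<and>
     (\<forall>(D, \<kappa>)\<in>atlas \<M>. \<forall>(E, \<mu>)\<in>atlas \<N>. \<forall>i<even_dim \<N>.
        holomorphic_several (even_dim \<M>) (\<kappa> ` {p \<in> D. f p \<in> E})
          (\<lambda>z. \<mu> (f (inv_into D \<kappa> z)) i))"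

definition supermorphism ::
  "('p, 's) superspace \<Rightarrow> ('q, 't) superspace \<Rightarrow> ('p, 's, 'q, 't) morphism \<Rightarrow> bool" where
  "supermorphism \<M> \<N> \<phi> \<longleftrightarrow>
     fst \<phi> \<in> extensional (topspace (base \<M>)) \<and>
     holomorphic_map \<M> \<N> (fst \<phi>) \<and>
     snd \<phi> \<in> extensional (opens \<N>) \<and>
     (\<forall>U\<in>opens \<N>.
        snd \<phi> U \<in> extensional (carrier (sections \<N> U)) \<and>
        superalgebra_hom (sections \<N> U) (grading \<N> U)
          (sections \<M> (preimage \<M> \<phi> U)) (grading \<M> (preimage \<M> \<phi> U)) (snd \<phi> U)) \<and>
     (\<forall>U\<in>opens \<N>. \<forall>V\<in>opens \<N>. V \<subseteq> U \<longrightarrow>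
        (\<forall>s\<in>carrier (sections \<N> U).
           snd \<phi> V (restr \<N> U V s) = restr \<M> (preimage \<M> \<phi> U) (preimage \<M> \<phi> V) (snd \<phi> U s)))"

definition id_morphism :: "('p, 's) superspace \<Rightarrow> ('p, 's, 'p, 's) morphism" where
  "id_morphism \<M> =
     (\<lambda>p\<in>topspace (base \<M>). p, \<lambda>U\<in>opens \<M>. \<lambda>s\<in>carrier (sections \<M> U). s)"

text \<open>The composite \<open>\<phi> \<circ> \<psi>\<close> of endomorphisms, with pullback \<open>\<psi>\<^sup>* \<circ> \<phi>\<^sup>*\<close>.\<close>

definition comp_morphism ::
  "('p, 's) superspace \<Rightarrow> ('p, 's, 'p, 's) morphism \<Rightarrow> ('p, 's, 'p, 's) morphism
     \<Rightarrow> ('p, 's, 'p, 's) morphism" where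
  "comp_morphism \<M> \<phi> \<psi> =
     (\<lambda>p\<in>topspace (base \<M>). fst \<phi> (fst \<psi> p),
      \<lambda>U\<in>opens \<M>. \<lambda>s\<in>carrier (sections \<M> U). snd \<psi> (preimage \<M> \<phi> U) (snd \<phi> U s))"

definition automorphisms :: "('p, 's) superspace \<Rightarrow> ('p, 's, 'p, 's) morphism set" where
  "automorphisms \<M> =
     {\<phi>. supermorphism \<M> \<M> \<phi> \<and>
         (\<exists>\<psi>. supermorphism \<M> \<M> \<psi> \<and>
              comp_morphism \<M> \<phi> \<psi> = id_morphism \<M> \<and> comp_morphism \<M> \<psi> \<phi> = id_morphism \<M>)}"

section \<open>The topology on the set of automorphisms\<close>

text \<open>
  The coefficient \<open>\<phi>\<^bsub>f,\<nu>\<^esub>\<close> of \<open>\<phi>\<^sup>*(f)\<close> at \<open>\<theta>\<^sup>\<nu>\<close>, for \<open>f\<close> a section over \<open>U\<close>: a holomorphic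
  function on the part of \<open>W\<close> that the underlying map of \<open>\<phi>\<close> sends into \<open>U\<close>.
\<close>

definition pullback_coeff ::
  "('p, 's) superspace \<Rightarrow> 'p set \<Rightarrow> ('p set \<Rightarrow> 's \<Rightarrow> nat set \<Rightarrow> 'p \<Rightarrow> complex)
     \<Rightarrow> 'p set \<Rightarrow> 's \<Rightarrow> ('p, 's, 'p, 's) morphism \<Rightarrow> nat set \<Rightarrow> 'p \<Rightarrow> complex" where
  "pullback_coeff \<M> W \<Phi> U f \<phi> =
     \<Phi> (preimage \<M> \<phi> U \<inter> W)
       (restr \<M> (preimage \<M> \<phi> U) (preimage \<M> \<phi> U \<inter> W) (snd \<phi> U f))"

definition automorphism_subbasic ::
  "('p, 's) superspace \<Rightarrow> 'p set \<Rightarrow> ('p set \<Rightarrow> 's \<Rightarrow> nat set \<Rightarrow> 'p \<Rightarrow> complex)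
     \<Rightarrow> 'p set \<Rightarrow> 'p set \<Rightarrow> 's \<Rightarrow> (nat set \<Rightarrow> complex set) \<Rightarrow> ('p, 's, 'p, 's) morphism set" where
  "automorphism_subbasic \<M> W \<Phi> K U f \<Omega> =
     {\<phi> \<in> automorphisms \<M>. fst \<phi> ` K \<subseteq> U \<and>
        (\<forall>\<nu>\<in>multi_indices \<M>. pullback_coeff \<M> W \<Phi> U f \<phi> \<nu> ` K \<subseteq> \<Omega> \<nu>)}"

definition automorphism_topology ::
  "('p, 's) superspace \<Rightarrow> ('p, 's, 'p, 's) morphism topology" where
  "automorphism_topology \<M> =
     topology_generated_by
       {automorphism_subbasic \<M> W \<Phi> K U f \<Omega> | W \<kappa> \<Phi> K U f \<Omega>.
          coordinate_system \<M> W \<kappa> \<Phi> \<and> compactin (base \<M>) K \<and> K \<subseteq> W \<and>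
          openin (base \<M>) U \<and> f \<in> carrier (sections \<M> U) \<and>
          (\<forall>\<nu>\<in>multi_indices \<M>. open (\<Omega> \<nu>))}"

end

theory Submission
  imports Defs "HOL-Complex_Analysis.Complex_Analysis" "Jordan_Normal_Form.Determinant"
begin

text \<open>
  On the underlying compact manifold, an automorphism \<open>\<phi>\<close> has a neighbourhood in which the maps and
  their inverses send small pieces of the manifold into compact parts of charts. By Montel's theorem
  such a family of holomorphic maps has compact closure, and bounding the inverses keeps the limits
  invertible. For supermanifolds one has to control the pullbacks \<open>\<phi>\<^sup>*\<close> as well, by finitely
  many conditions that are open around \<open>\<phi>\<close> and pass to limits.

  \<^item> It is enough to bound the coefficients of the pulled back coordinates \<open>x\<^sub>i\<close> and monomials
    \<open>\<theta>\<^sup>\<rho>\<close>. At a point \<open>p\<close>, the pullback of a function \<open>h\<close> is a homomorphism to an exterior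
    algebra. The Hadamard decomposition \<open>h = h(c) + \<Sum>\<^sub>i (x\<^sub>i - c\<^sub>i) h\<^sub>i\<close> around the image \<open>c\<close> of \<open>p\<close>
    expresses it by the nilpotent elements \<open>\<phi>\<^sup>*(x\<^sub>i) - c\<^sub>i\<close> and the pullbacks of the \<open>h\<^sub>i\<close>. Iterating
    \<open>n + 1\<close> times exhausts the nilpotents and bounds \<open>\<phi>\<^sup>* h\<close> linearly in \<open>sup \<bar>h\<bar>\<close>
    (\<open>pc_function_sec_bound\<close>, \<open>pc_bound\<close>).

  \<^item> Limits are taken along ultrafilters, along which bounded families of numbers converge. The
    coefficients of \<open>\<phi>\<^sup>* s\<close> are bounded holomorphic functions, hence equicontinuous; their pointwise
    limits are holomorphic and the convergence is locally uniform. So the local limits glue to a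
    section, and all identities between sections survive: the limit is again a morphism
    (\<open>global_limit\<close>, \<open>smor_lim\<close>).

  \<^item> The limit is invertible on the underlying manifold, because the inverse maps converge as well
    (\<open>conv_continuously_inverse\<close>). For the odd directions, one more coefficient is controlled:
    \<open>\<phi>\<^sup>*(\<theta>\<^sub>1 \<dots> \<theta>\<^sub>n) = d \<theta>\<^sub>1 \<dots> \<theta>\<^sub>n\<close>, where \<open>d\<close> is the determinant of the linear part of
    \<open>\<phi>\<^sup>*\<close> in the odd coordinates. It vanishes nowhere for an automorphism
    (\<open>automorphism_nondegenerate\<close>), a lower bound on \<open>\<bar>d\<bar>\<close> passes to the limit, and a morphism with
    biholomorphic underlying map and \<open>d \<noteq> 0\<close> everywhere is an automorphism
    (\<open>nondegenerate_automorphism\<close>).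

  Every point \<open>p\<close> of the manifold thus gives a closed condition that holds in a neighbourhood of
  \<open>\<phi>\<close> (\<open>control_exists\<close>). By compactness finitely many points suffice to control everything, and
  every ultrafilter on the intersection of these conditions converges in it
  (\<open>ultrafilter_limit_in_controls\<close>), so the intersection is a compact neighbourhood of \<open>\<phi>\<close>.
\<close>

section \<open>Bounded holomorphic functions on polydiscs\<close>

text \<open>
  On the disc of radius \<open>r/2\<close> around \<open>c\<close> this is the Schwarz lemma for \<open>f - f c\<close>, which is bounded
  by \<open>2 M\<close>; further away from \<open>c\<close>, the bound \<open>2 M\<close> itself is good enough.
\<close>

lemma Schwarz_estimate_off_centre:
  fixes f :: "complex \<Rightarrow> complex"
  assumes hol: "f holomorphic_on ball q r" and bd: "\<And>w. w \<in> ball q r \<Longrightarrow> cmod (f w) \<le> M"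
    and c: "c \<in> ball q (r/2)" and w: "w \<in> ball q r"
  shows "cmod (f w - f c) \<le> 4 * M / r * cmod (w - c)"
proof -
  have r: "r > 0" using w zero_le_dist[of q w] by (simp only: mem_ball)
  define \<rho> where "\<rho> = r/2"
  have \<rho>: "\<rho> > 0" using r by (simp add: \<rho>_def)
  have sub: "ball c \<rho> \<subseteq> ball q r"
  proof
    fix x assume x: "x \<in> ball c \<rho>"
    have "dist q x \<le> dist q c + dist c x" by (rule dist_triangle)
    with x c show "x \<in> ball q r" by (simp add: \<rho>_def)
  qed
  have cin: "c \<in> ball q r" using sub \<rho> centre_in_ball by blast
  have M0: "M \<ge> 0" by (rule order.trans[OF norm_ge_zero bd[OF w]])
  have two: "cmod (f v - f c) \<le> 2 * M" if "v \<in> ball q r" for v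
    using norm_triangle_ineq4[of "f v" "f c"] bd[OF that] bd[OF cin] by linarith
  show ?thesis
  proof (cases "w \<in> ball c \<rho>")
    case False
    then have "cmod (w - c) \<ge> \<rho>" by (simp add: dist_norm norm_minus_commute)
    then have "4 * M / r * cmod (w - c) \<ge> 4 * M / r * \<rho>"
      using M0 r by (intro mult_left_mono) auto
    then show ?thesis using two[OF w] r by (simp add: \<rho>_def)
  next
    case True
    \<comment> \<open>The Schwarz lemma asks for a strict bound on the disc, hence the margin \<open>e\<close>.\<close>
    have est: "cmod (f w - f c) \<le> (2 * M + e) * cmod (w - c) / \<rho>" if e: "e > 0" for e :: real
    proof -
      define g where "g = (\<lambda>z::complex. (f (c + \<rho> * z) - f c) / (2 * M + e))"
      have pos: "2 * M + e > 0" using M0 e by simp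
      have im: "c + \<rho> * z \<in> ball c \<rho>" if "z \<in> ball 0 1" for z :: complex
        using that \<rho> by (simp add: dist_norm norm_mult)
      have "(\<lambda>z. c + \<rho> * z) holomorphic_on ball 0 1" by (intro holomorphic_intros)
      then have "(f \<circ> (\<lambda>z. c + \<rho> * z)) holomorphic_on ball 0 1"
        by (rule holomorphic_on_compose_gen[OF _ hol]) (use im sub in auto)
      then have "(\<lambda>z. f (c + \<rho> * z)) holomorphic_on ball 0 1" by (simp add: o_def)
      moreover have "complex_of_real (2 * M + e) \<noteq> 0" using pos by (simp only: of_real_eq_0_iff)
      ultimately have 1: "g holomorphic_on ball 0 1"
        unfolding g_def by (intro holomorphic_on_divide holomorphic_on_diff holomorphic_on_const)
      have 3: "cmod (g z) < 1" if "cmod z < 1" for z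
      proof -
        have "c + \<rho> * z \<in> ball q r" using im[of z] that sub by auto
        then have "cmod (f (c + \<rho> * z) - f c) < 2 * M + e" using two e by fastforce
        moreover have "cmod (of_real (2 * M + e)) = 2 * M + e" using pos by (simp only: norm_of_real abs_of_pos)
        ultimately show ?thesis using pos by (simp add: g_def norm_divide)
      qed
      define z where "z = (w - c) / \<rho>"
      have z: "cmod z < 1" using True \<rho> by (simp add: z_def norm_divide dist_norm norm_minus_commute)
      have "cmod (g z) \<le> cmod z"
        by (rule Schwarz_Lemma(1)[OF 1 _ 3 z]) (simp_all add: g_def)
      moreover have "cmod (g z) = cmod (f w - f c) / (2 * M + e)"
        using \<rho> pos by (simp add: g_def z_def norm_divide del: of_real_add of_real_mult)
      moreover have "cmod z = cmod (w - c) / \<rho>" using \<rho> by (simp add: z_def norm_divide)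
      ultimately have "cmod (f w - f c) / (2 * M + e) \<le> cmod (w - c) / \<rho>" by simp
      then have "cmod (f w - f c) \<le> cmod (w - c) / \<rho> * (2 * M + e)"
        by (rule pos_divide_le_eq[OF pos, THEN iffD1])
      then show ?thesis by (simp add: mult.commute)
    qed
    have "cmod (f w - f c) \<le> 2 * M * cmod (w - c) / \<rho>"
    proof (rule field_le_epsilon)
      fix d :: real assume d: "d > 0"
      show "cmod (f w - f c) \<le> 2 * M * cmod (w - c) / \<rho> + d"
      proof (cases "w = c")
        case False
        define k where "k = cmod (w - c)"
        have k: "k > 0" using False by (simp add: k_def)
        have "(2 * M + d * \<rho> / k) * k / \<rho> = 2 * M * k / \<rho> + d"
          using k \<rho> by (simp add: distrib_right add_divide_distrib)
        then show ?thesis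
          using est[of "d * \<rho> / k"] d \<rho> k by (simp add: k_def)
      qed (use d in auto)
    qed
    then show ?thesis by (simp add: \<rho>_def)
  qed
qed

definition polydisc :: "nat \<Rightarrow> (nat \<Rightarrow> complex) \<Rightarrow> real \<Rightarrow> (nat \<Rightarrow> complex) set" where
  "polydisc m q r = {z \<in> cspace m. \<forall>i<m. cmod (z i - q i) < r}"

lemma polydisc_mono: "r \<le> s \<Longrightarrow> polydisc m q r \<subseteq> polydisc m q s"
  by (auto simp: polydisc_def intro: order.strict_trans2)

lemma polydisc_centre: "q \<in> cspace m \<Longrightarrow> r > 0 \<Longrightarrow> q \<in> polydisc m q r"
  by (auto simp: polydisc_def)

lemma polydisc_upd:
  "z \<in> polydisc m q r \<Longrightarrow> i < m \<Longrightarrow> w \<in> ball (q i) r \<Longrightarrow> z(i := w) \<in> polydisc m q r"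
  by (auto simp: polydisc_def cspace_def dist_norm norm_minus_commute)

lemma polydisc_coord: "z \<in> polydisc m q r \<Longrightarrow> i < m \<Longrightarrow> z i \<in> ball (q i) r"
  by (auto simp: polydisc_def dist_norm norm_minus_commute)

lemma open_coordinate_box:
  fixes q :: "nat \<Rightarrow> complex"
  shows "open {z. \<forall>i<m. cmod (z i - q i) < r}"
proof -
  have "open (\<Inter>i\<in>{..<m}. {z. cmod (z i - q i) < r})"
    by (intro open_INT ballI finite_lessThan open_Collect_less continuous_intros) auto
  moreover have "(\<Inter>i\<in>{..<m}. {z. cmod (z i - q i) < r}) = {z. \<forall>i<m. cmod (z i - q i) < r}" by auto
  ultimately show ?thesis by metis
qed

lemma openin_polydisc: "openin (top_of_set (cspace m)) (polydisc m q r)"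
  unfolding openin_open polydisc_def
  by (rule exI[of _ "{z. \<forall>i<m. cmod (z i - q i) < r}"]) (use open_coordinate_box in auto)

lemma polydisc_in_open:
  assumes "openin (top_of_set (cspace m)) U" "q \<in> U"
  obtains r where "r > 0" "polydisc m q r \<subseteq> U"
proof -
  obtain T where T: "open T" "U = cspace m \<inter> T" using assms(1) by (auto simp: openin_open)
  obtain Y where Y: "q \<in> PiE UNIV Y" "\<And>i. open (Y i)" "PiE UNIV Y \<subseteq> T"
    using product_topology_open_contains_basis[where I = UNIV and T = "\<lambda>_::nat. euclidean :: complex topology" and U = T and x = q] assms T
    by (auto simp: euclidean_product_topology)
  have "\<exists>e>0. ball (q i) e \<subseteq> Y i" for i
    using Y(1) Y(2)[of i] open_contains_ball[of "Y i"] by auto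
  then have "\<exists>e. \<forall>i. e i > 0 \<and> ball (q i) (e i) \<subseteq> Y i" by (intro choice) auto
  then obtain e where e: "\<And>i. e i > 0 \<and> ball (q i) (e i) \<subseteq> Y i" by blast
  define r where "r = Min (insert 1 (e ` {..<m}))"
  have r: "r > 0" using e by (auto simp: r_def)
  have re: "r \<le> e i" if "i < m" for i using that by (auto simp: r_def)
  have qc: "q \<in> cspace m" using assms T by auto
  have "polydisc m q r \<subseteq> U"
  proof
    fix z assume z: "z \<in> polydisc m q r"
    have "z i \<in> Y i" for i
    proof (cases "i < m")
      case True
      have "cmod (z i - q i) < e i" using z True re[OF True] by (auto simp: polydisc_def)
      then show ?thesis using e[of i] by (auto simp: dist_norm norm_minus_commute)
    next
      case False
      then have "z i = q i" using z qc by (auto simp: polydisc_def cspace_def)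
      then show ?thesis using Y(1) by auto
    qed
    then have "z \<in> PiE UNIV Y" by auto
    then show "z \<in> U" using Y(3) T z by (auto simp: polydisc_def)
  qed
  with r that show thesis by blast
qed

definition separately_holomorphic ::
  "nat \<Rightarrow> (nat \<Rightarrow> complex) set \<Rightarrow> ((nat \<Rightarrow> complex) \<Rightarrow> complex) \<Rightarrow> bool" where
  "separately_holomorphic m U f \<longleftrightarrow>
     (\<forall>z\<in>U. \<forall>i<m. (\<lambda>w. f (z(i := w))) field_differentiable at (z i))"

lemma holomorphic_several_iff:
  "holomorphic_several m U f \<longleftrightarrow> continuous_on U f \<and> separately_holomorphic m U f"
  by (simp add: holomorphic_several_def separately_holomorphic_def)

lemma separately_holomorphic_slice:
  assumes "separately_holomorphic m (polydisc m q r) f" "z \<in> polydisc m q r" "i < m"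
  shows "(\<lambda>w. f (z(i := w))) holomorphic_on ball (q i) r"
proof -
  have "(\<lambda>w. f (z(i := w))) field_differentiable at w" if "w \<in> ball (q i) r" for w
    using assms(1) polydisc_upd[OF assms(2,3) that] assms(3)
    by (force simp: separately_holomorphic_def)
  then show ?thesis
    by (simp add: holomorphic_on_def field_differentiable_at_within)
qed

lemma separately_holomorphic_on_polydiscI:
  assumes "\<And>z i. z \<in> polydisc m q r \<Longrightarrow> i < m \<Longrightarrow> (\<lambda>w. f (z(i := w))) holomorphic_on ball (q i) r"
  shows "separately_holomorphic m (polydisc m q r) f"
  unfolding separately_holomorphic_def
  using assms polydisc_coord by (blast intro: holomorphic_on_imp_differentiable_at[OF _ open_ball])

text \<open>Pass from \<open>w\<close> to \<open>z\<close> by changing one coordinate at a time.\<close>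

lemma separately_holomorphic_Lipschitz:
  assumes sep: "separately_holomorphic m (polydisc m q r) f"
    and bd: "\<And>z. z \<in> polydisc m q r \<Longrightarrow> cmod (f z) \<le> M"
    and w: "w \<in> polydisc m q (r/2)" and z: "z \<in> polydisc m q r" and r: "r > 0"
  shows "cmod (f z - f w) \<le> 4 * M / r * (\<Sum>i<m. cmod (z i - w i))"
proof -
  define h where "h j = (\<lambda>i. if i < j then z i else w i)" for j :: nat
  have wr: "w \<in> polydisc m q r" using w polydisc_mono[of "r/2" r m q] r by auto
  have hin: "h j \<in> polydisc m q r" for j
    using wr z by (auto simp: h_def polydisc_def cspace_def)
  have h0: "h 0 = w" by (auto simp: h_def)
  have hm: "h m = z" using wr z by (auto simp: h_def polydisc_def cspace_def fun_eq_iff)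
  have step: "cmod (f (h (Suc i)) - f (h i)) \<le> 4 * M / r * cmod (z i - w i)" if i: "i < m" for i
  proof -
    have e1: "h (Suc i) = (h i)(i := z i)" and e2: "h i = (h i)(i := w i)"
      by (auto simp: h_def fun_eq_iff less_Suc_eq)
    have "cmod (f ((h i)(i := z i)) - f ((h i)(i := w i))) \<le> 4 * M / r * cmod (z i - w i)"
      by (rule Schwarz_estimate_off_centre[where f = "\<lambda>v. f ((h i)(i := v))" and q = "q i"])
         (use separately_holomorphic_slice[OF sep hin i] polydisc_upd[OF hin i] bd
              polydisc_coord[OF w i] polydisc_coord[OF z i] in auto)
    then show ?thesis using e1 e2 by metis
  qed
  have "f z - f w = (\<Sum>i<m. f (h (Suc i)) - f (h i))"
    by (simp only: sum_lessThan_telescope[of "\<lambda>i. f (h i)"] h0 hm)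
  then have "cmod (f z - f w) \<le> (\<Sum>i<m. cmod (f (h (Suc i)) - f (h i)))"
    by (simp only: norm_sum)
  also have "\<dots> \<le> (\<Sum>i<m. 4 * M / r * cmod (z i - w i))"
    by (rule sum_mono) (use step in auto)
  finally show ?thesis by (simp add: sum_distrib_left)
qed

text \<open>
  Osgood's lemma: the Lipschitz estimate makes a bounded separately holomorphic function continuous.
  So continuity never has to be checked for the functions constructed below.
\<close>

lemma bounded_separately_holomorphic_imp_several:
  assumes sep: "separately_holomorphic m (polydisc m q r) f"
    and bd: "\<And>z. z \<in> polydisc m q r \<Longrightarrow> cmod (f z) \<le> M"
  shows "holomorphic_several m (polydisc m q r) f"
proof -
  have "continuous_on (polydisc m q r) f"
    unfolding continuous_on_def
  proof
    fix z assume z: "z \<in> polydisc m q r"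
    obtain s where s: "s > 0" "polydisc m z s \<subseteq> polydisc m q r"
      using polydisc_in_open[OF openin_polydisc z] by blast
    have zc: "z \<in> cspace m" using z by (auto simp: polydisc_def)
    have sep': "separately_holomorphic m (polydisc m z s) f"
      using sep s(2) by (auto simp: separately_holomorphic_def)
    have est: "cmod (f y - f z) \<le> 4 * M / s * (\<Sum>i<m. cmod (y i - z i))" if "y \<in> polydisc m z s" for y
      by (rule separately_holomorphic_Lipschitz[OF sep' _ _ that s(1)])
         (use s bd polydisc_centre[OF zc] in auto)
    have lim: "((\<lambda>y. 4 * M / s * (\<Sum>i<m. cmod (y i - z i))) \<longlongrightarrow> 4 * M / s * (\<Sum>i<m. cmod (z i - z i)))
                 (at z within polydisc m q r)"
    proof -
      have "((\<lambda>y. y i) \<longlongrightarrow> z i) (at z within polydisc m q r)" for i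
        using continuous_on_product_coordinates[of i, where 'b = complex]
        by (auto simp: continuous_on_def intro: tendsto_within_subset)
      then show ?thesis by (intro tendsto_intros)
    qed
    have ev: "\<forall>\<^sub>F y in at z within polydisc m q r. y \<in> polydisc m z s"
    proof -
      have "\<forall>\<^sub>F y in at z within polydisc m q r. y \<in> {y. \<forall>i<m. cmod (y i - z i) < s}"
        by (rule eventually_at_topological[THEN iffD2])
           (use open_coordinate_box[of m z s] s in auto)
      moreover have "\<forall>\<^sub>F y in at z within polydisc m q r. y \<in> polydisc m q r"
        by (simp add: eventually_at_filter)
      ultimately show ?thesis by eventually_elim (auto simp: polydisc_def)
    qed
    have "((\<lambda>y. f y - f z) \<longlongrightarrow> 0) (at z within polydisc m q r)"
    proof (rule Lim_null_comparison)
      show "\<forall>\<^sub>F y in at z within polydisc m q r.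
              norm (f y - f z) \<le> 4 * M / s * (\<Sum>i<m. cmod (y i - z i))"
        using ev by (rule eventually_mono) (rule est)
      show "((\<lambda>y. 4 * M / s * (\<Sum>i<m. cmod (y i - z i))) \<longlongrightarrow> 0) (at z within polydisc m q r)"
        using lim by simp
    qed
    then show "(f \<longlongrightarrow> f z) (at z within polydisc m q r)"
      by (simp add: LIM_zero_iff)
  qed
  with sep show ?thesis by (simp add: holomorphic_several_iff)
qed

text \<open>
  At \<open>z\<^sub>i = c\<close> the quotient is completed by the derivative. It is then holomorphic in \<open>z\<^sub>i\<close> by removal
  of the singularity. In another variable \<open>z\<^sub>l\<close>, its values at \<open>z\<^sub>i = c\<close> are the locally uniform
  limit of those at \<open>z\<^sub>i = v\<close> for \<open>v \<rightarrow> c\<close>: by the estimate for \<open>D\<close> itself as a function of \<open>z\<^sub>i\<close>,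
  the convergence is uniform.
\<close>

lemma difference_quotient_holomorphic:
  assumes hol: "separately_holomorphic m (polydisc m q r) f"
    and bd: "\<And>z. z \<in> polydisc m q r \<Longrightarrow> cmod (f z) \<le> M"
    and i: "i < m" and c: "c \<in> ball (q i) (r/2)" and r: "r > 0"
  obtains D where "separately_holomorphic m (polydisc m q r) D"
    "\<And>z. z \<in> polydisc m q r \<Longrightarrow> cmod (D z) \<le> 4 * M / r"
    "\<And>z. f z = f (z(i := c)) + (z i - c) * D z"
proof -
  let ?P = "polydisc m q r"
  define D where "D = (\<lambda>z. if z i = c then deriv (\<lambda>w. f (z(i := w))) c
                            else (f z - f (z(i := c))) / (z i - c))"
  have cb: "c \<in> ball (q i) r" using c r by (auto simp: dist_norm)
  have slice: "(\<lambda>w. D (z(i := w))) holomorphic_on ball (q i) r" if z: "z \<in> ?P" for z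
  proof -
    have "(\<lambda>w. if w = c then deriv (\<lambda>w. f (z(i := w))) c
               else (f (z(i := w)) - f (z(i := c))) / (w - c)) holomorphic_on ball (q i) r"
      using pole_lemma_open[OF separately_holomorphic_slice[OF hol z i] open_ball, of c] .
    then show ?thesis by (simp add: D_def cong: if_cong)
  qed
  have off: "cmod (D (z(i := w))) \<le> 4 * M / r" if z: "z \<in> ?P" and w: "w \<in> ball (q i) r" "w \<noteq> c" for z w
  proof -
    have "cmod (f (z(i := w)) - f (z(i := c))) \<le> 4 * M / r * cmod (w - c)"
      by (rule Schwarz_estimate_off_centre[where f = "\<lambda>v. f (z(i := v))" and q = "q i"])
         (use separately_holomorphic_slice[OF hol z i] polydisc_upd[OF z i] bd c w in auto)
    moreover have "cmod (w - c) > 0" using w by simp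
    ultimately have "cmod (f (z(i := w)) - f (z(i := c))) / cmod (w - c) \<le> 4 * M / r"
      by (simp only: pos_divide_le_eq)
    then show ?thesis using w by (simp add: D_def norm_divide)
  qed
  have all: "cmod (D (z(i := w))) \<le> 4 * M / r" if z: "z \<in> ?P" and w: "w \<in> ball (q i) r" for z w
  proof (cases "w = c")
    case True
    have "isCont (\<lambda>w. D (z(i := w))) c"
      using holomorphic_on_imp_continuous_on[OF slice[OF z]] cb
      by (simp only: continuous_on_eq_continuous_at[OF open_ball])
    then have "((\<lambda>w. cmod (D (z(i := w)))) \<longlongrightarrow> cmod (D (z(i := c)))) (at c)"
      using isCont_def tendsto_norm by blast
    moreover have "\<forall>\<^sub>F w in at c. cmod (D (z(i := w))) \<le> 4 * M / r"
      unfolding eventually_at_topological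
      by (rule exI[of _ "ball (q i) r"]) (use cb off[OF z] in auto)
    ultimately have "cmod (D (z(i := c))) \<le> 4 * M / r"
      by (rule tendsto_upperbound) simp
    then show ?thesis using True by simp
  qed (use off[OF z w] in auto)
  have bound: "cmod (D z) \<le> 4 * M / r" if z: "z \<in> ?P" for z
    using all[OF z polydisc_coord[OF z i]] by simp
  have sep: "separately_holomorphic m ?P D"
  proof (rule separately_holomorphic_on_polydiscI)
    fix z l assume z: "z \<in> ?P" and l: "l < m"
    show "(\<lambda>w. D (z(l := w))) holomorphic_on ball (q l) r"
    proof (cases "l = i")
      case True then show ?thesis using slice[OF z] by simp
    next
      case False
      define G where "G v w = D (z(l := w, i := v))" for v w
      have G_hol: "G v holomorphic_on ball (q l) r" if v: "v \<in> ball (q i) r" "v \<noteq> c" for v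
      proof -
        have "G v = (\<lambda>w. (f ((z(i := v))(l := w)) - f ((z(i := c))(l := w))) / (v - c))"
          using False v by (simp add: G_def D_def fun_eq_iff fun_upd_twist)
        then show ?thesis
          using separately_holomorphic_slice[OF hol polydisc_upd[OF z i] l] v cb
          by (auto intro!: holomorphic_intros)
      qed
      have zl: "z(l := w) \<in> ?P" if "w \<in> ball (q l) r" for w
        using polydisc_upd[OF z l that] .
      have "G c holomorphic_on ball (q l) r"
        unfolding holomorphic_on_def
      proof
        fix w0 assume w0: "w0 \<in> ball (q l) r"
        obtain e where e: "e > 0" "cball w0 e \<subseteq> ball (q l) r"
          using w0 open_contains_cball[THEN iffD1, OF open_ball] by blast
        have near: "\<forall>\<^sub>F v in at c. v \<in> ball (q i) r \<and> v \<noteq> c"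
          unfolding eventually_at_topological
          by (rule exI[of _ "ball (q i) r"]) (use cb in auto)
        have lim: "uniform_limit (cball w0 e) G (G c) (at c)"
        proof (rule uniform_limitI)
          fix d :: real assume d: "d > 0"
          define L where "L = 4 * (4 * M / r) / r"
          have "M \<ge> 0" by (rule order.trans[OF norm_ge_zero bd[OF z]])
          then have L: "L \<ge> 0" using r by (simp add: L_def)
          have "\<forall>\<^sub>F v in at c. dist v c < d / (L + 1)"
            using d L by (auto simp: eventually_at intro!: exI[of _ "d / (L + 1)"])
          with near show "\<forall>\<^sub>F v in at c. \<forall>w\<in>cball w0 e. dist (G v w) (G c w) < d"
          proof eventually_elim
            case (elim v)
            show ?case
            proof
              fix w assume "w \<in> cball w0 e"
              then have w: "w \<in> ball (q l) r" using e by auto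
              have "cmod (D (z(l := w, i := v)) - D (z(l := w, i := c))) \<le> L * cmod (v - c)"
                unfolding L_def
                by (rule Schwarz_estimate_off_centre[where f = "\<lambda>v. D (z(l := w, i := v))" and q = "q i"])
                   (use slice[OF zl[OF w]] all[OF zl[OF w]] c elim in auto)
              also have "\<dots> \<le> (L + 1) * cmod (v - c)" by (simp add: mult_right_mono)
              also have "\<dots> < d" using elim L by (simp add: dist_norm field_simps)
              finally show "dist (G v w) (G c w) < d" by (simp add: G_def dist_norm)
            qed
          qed
        qed
        have "\<forall>\<^sub>F v in at c. continuous_on (cball w0 e) (G v) \<and> G v holomorphic_on ball w0 e"
          using near
        proof eventually_elim
          case (elim v)
          then have "G v holomorphic_on cball w0 e"
            using G_hol e(2) holomorphic_on_subset by blast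
          then show ?case
            by (auto intro: holomorphic_on_imp_continuous_on holomorphic_on_subset[OF _ ball_subset_cball])
        qed
        then have "G c holomorphic_on ball w0 e"
          using holomorphic_uniform_limit[OF _ lim] by auto
        then show "G c field_differentiable at w0 within ball (q l) r"
          using e(1) holomorphic_on_imp_differentiable_at[of "G c" "ball w0 e" w0]
          by (simp add: field_differentiable_at_within)
      qed
      moreover have "(\<lambda>w. D (z(l := w))) = G (z i)"
      proof -
        have "z(l := w, i := z i) = z(l := w)" for w using False by (auto simp: fun_eq_iff)
        then show ?thesis by (intro ext) (simp add: G_def)
      qed
      ultimately show ?thesis
        using G_hol polydisc_coord[OF z i] by (cases "z i = c") auto
    qed
  qed
  have "f z = f (z(i := c)) + (z i - c) * D z" for z
  proof (cases "z i = c")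
    case True
    then have "z(i := c) = z" by auto
    then show ?thesis using True by simp
  qed (simp add: D_def)
  with sep bound that show thesis by blast
qed

text \<open>
  Replacing the coordinates by those of \<open>c\<close> one after the other and dividing each difference
  by the corresponding \<open>z\<^sub>i - c\<^sub>i\<close> gives the quotients. It matters that they live on the same
  polydisc as \<open>f\<close> and that the bound is linear in \<open>M\<close>: the lemma will be iterated.
\<close>

lemma Hadamard_decomposition:
  assumes hol: "separately_holomorphic m (polydisc m q r) f"
    and bd: "\<And>z. z \<in> polydisc m q r \<Longrightarrow> cmod (f z) \<le> M"
    and c: "c \<in> polydisc m q (r/2)" and r: "r > 0"
  obtains h where
    "\<And>i. i < m \<Longrightarrow> holomorphic_several m (polydisc m q r) (h i)"
    "\<And>i z. i < m \<Longrightarrow> z \<in> polydisc m q r \<Longrightarrow> cmod (h i z) \<le> 4 * M / r"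
    "\<And>z. z \<in> polydisc m q r \<Longrightarrow> f z = f c + (\<Sum>i<m. (z i - c i) * h i z)"
proof -
  let ?P = "polydisc m q r"
  have cr: "c \<in> ?P" using c polydisc_mono[of "r/2" r m q] r by auto
  define u where "u k z = (\<lambda>i. if i < k then c i else z i)" for k :: nat and z :: "nat \<Rightarrow> complex"
  have u: "u k z \<in> ?P" if "z \<in> ?P" for k z
    using that cr by (auto simp: u_def polydisc_def cspace_def)
  have ex: "\<exists>Di. i < m \<longrightarrow> separately_holomorphic m ?P Di \<and>
          (\<forall>z\<in>?P. cmod (Di z) \<le> 4 * M / r) \<and> (\<forall>z. f z = f (z(i := c i)) + (z i - c i) * Di z)" for i
  proof (cases "i < m")
    case True
    obtain Di where "separately_holomorphic m ?P Di"
        "\<And>z. z \<in> ?P \<Longrightarrow> cmod (Di z) \<le> 4 * M / r"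
        "\<And>z. f z = f (z(i := c i)) + (z i - c i) * Di z"
      using difference_quotient_holomorphic[OF hol bd True polydisc_coord[OF c True] r] by blast
    then show ?thesis by (intro exI[of _ Di] impI conjI ballI allI)
  qed auto
  have "\<exists>D. \<forall>i. i < m \<longrightarrow> separately_holomorphic m ?P (D i) \<and>
          (\<forall>z\<in>?P. cmod (D i z) \<le> 4 * M / r) \<and>
          (\<forall>z. f z = f (z(i := c i)) + (z i - c i) * D i z)"
    by (rule choice) (rule allI, rule ex)
  then obtain D where D: "\<And>i. i < m \<Longrightarrow> separately_holomorphic m ?P (D i)"
      "\<And>i z. i < m \<Longrightarrow> z \<in> ?P \<Longrightarrow> cmod (D i z) \<le> 4 * M / r"
      "\<And>i z. i < m \<Longrightarrow> f z = f (z(i := c i)) + (z i - c i) * D i z"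
    by blast
  define h where "h i z = D i (u i z)" for i z
  have hb: "cmod (h i z) \<le> 4 * M / r" if "i < m" "z \<in> ?P" for i z
    using D(2)[OF that(1) u[OF that(2)]] by (simp add: h_def)
  have hh: "holomorphic_several m ?P (h i)" if i: "i < m" for i
  proof (rule bounded_separately_holomorphic_imp_several[OF _ hb[OF i]])
    show "separately_holomorphic m ?P (h i)"
    proof (rule separately_holomorphic_on_polydiscI)
      fix z l assume z: "z \<in> ?P" and l: "l < m"
      show "(\<lambda>w. h i (z(l := w))) holomorphic_on ball (q l) r"
      proof (cases "l < i")
        case True
        then have "u i (z(l := w)) = u i z" for w by (auto simp: u_def fun_eq_iff)
        then have "(\<lambda>w. h i (z(l := w))) = (\<lambda>w. h i z)" by (simp add: h_def)
        then show ?thesis by simp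
      next
        case False
        then have "u i (z(l := w)) = (u i z)(l := w)" for w by (auto simp: u_def fun_eq_iff)
        then have "(\<lambda>w. h i (z(l := w))) = (\<lambda>w. D i ((u i z)(l := w)))" by (simp add: h_def)
        then show ?thesis using separately_holomorphic_slice[OF D(1)[OF i] u[OF z] l] by simp
      qed
    qed
  qed auto
  have tele: "f z = f (u k z) + (\<Sum>i<k. (z i - c i) * h i z)" if "k \<le> m" for k z
    using that
  proof (induction k)
    case 0 then show ?case by (simp add: u_def)
  next
    case (Suc k)
    have "f (u k z) = f ((u k z)(k := c k)) + (u k z k - c k) * D k (u k z)"
      by (rule D(3)) (use Suc.prems in simp)
    moreover have "(u k z)(k := c k) = u (Suc k) z" by (auto simp: u_def fun_eq_iff less_Suc_eq)
    moreover have "u k z k = z k" by (simp add: u_def)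
    ultimately show ?case using Suc by (simp add: h_def)
  qed
  have "f z = f c + (\<Sum>i<m. (z i - c i) * h i z)" if z: "z \<in> ?P" for z
  proof -
    have "u m z = c" using z cr by (auto simp: u_def polydisc_def cspace_def fun_eq_iff)
    then show ?thesis using tele[of m z] by simp
  qed
  with hb hh that show thesis by blast
qed


section \<open>Ultrafilters and compactness\<close>

text \<open>
  Along an ultrafilter every family in a compact set converges. Used in place of sequences, this
  avoids passing to subsequences and any countability of the space of automorphisms.
\<close>

definition ultrafilter :: "'a filter \<Rightarrow> bool" where
  "ultrafilter F \<longleftrightarrow> F \<noteq> bot \<and> (\<forall>P. eventually P F \<or> eventually (\<lambda>x. \<not> P x) F)"

lemma ultrafilter_refines:
  fixes F :: "'a filter"
  assumes "F \<noteq> bot"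
  obtains U where "U \<le> F" "ultrafilter U"
proof -
  define A where "A = {G. G \<le> F \<and> G \<noteq> bot}"
  have "\<exists>U\<in>A. \<forall>G\<in>A. G \<le> U \<longrightarrow> G = U"
  proof (rule predicate_Zorn)
    show "partial_order_on A (relation_of (\<lambda>a b. b \<le> a) A)"
      by (rule partial_order_on_relation_ofI) auto
    fix C assume C: "C \<in> Chains (relation_of (\<lambda>a b. b \<le> a) A)"
    have CA: "C \<subseteq> A" using C by (auto simp: Chains_def relation_of_def)
    have lin: "G \<le> H \<or> H \<le> G" if "G \<in> C" "H \<in> C" for G H
      using C that by (auto simp: Chains_def relation_of_def)
    show "\<exists>u\<in>A. \<forall>a\<in>C. u \<le> a"
    proof (cases "C = {}")
      case True then show ?thesis using assms by (auto simp: A_def)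
    next
      case False
      have "eventually (\<lambda>_. False) (Inf C) \<longleftrightarrow> (\<exists>b\<in>C. eventually (\<lambda>_. False) b)"
        by (rule eventually_Inf_base[OF False]) (metis inf.absorb1 inf.absorb2 lin order_refl)
      then have "Inf C \<noteq> bot" using CA by (auto simp: trivial_limit_def A_def)
      moreover have "Inf C \<le> F" using False CA by (auto simp: A_def intro: Inf_lower2)
      ultimately show ?thesis by (auto simp: A_def intro!: bexI[of _ "Inf C"] Inf_lower)
    qed
  qed
  then obtain U where U: "U \<in> A" "\<And>G. G \<in> A \<Longrightarrow> G \<le> U \<Longrightarrow> G = U" by blast
  have "eventually P U \<or> eventually (\<lambda>x. \<not> P x) U" for P
  proof (cases "eventually (\<lambda>x. \<not> P x) U")
    case False
    define G where "G = inf U (principal {x. P x})"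
    have "G \<noteq> bot" using False by (simp add: G_def trivial_limit_def eventually_inf_principal)
    moreover have "G \<le> U" by (simp add: G_def)
    moreover have "G \<le> F" using U(1) by (auto simp: A_def G_def intro: le_infI1)
    ultimately have "G = U" using U(2) by (simp add: A_def)
    moreover have "eventually P G" by (simp add: G_def eventually_inf_principal)
    ultimately show ?thesis by simp
  qed simp
  then have "ultrafilter U" using U(1) by (simp add: ultrafilter_def A_def)
  then show thesis using that[of U] U(1) by (simp add: A_def)
qed

lemma ultrafilter_eventually_not:
  "ultrafilter F \<Longrightarrow> \<not> eventually P F \<Longrightarrow> eventually (\<lambda>x. \<not> P x) F"
  by (auto simp: ultrafilter_def)

text \<open>
  If no finite part of an open cover of \<open>C\<close> covers \<open>C\<close>, then the complements of its members
  generate a proper filter on \<open>C\<close>, and an ultrafilter below it can have no limit in \<open>C\<close>.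
\<close>

lemma compactin_if_ultrafilters_converge:
  assumes CX: "C \<subseteq> topspace T"
    and conv: "\<And>F. ultrafilter F \<Longrightarrow> eventually (\<lambda>x. x \<in> C) F \<Longrightarrow> \<exists>l\<in>C. limitin T (\<lambda>x. x) l F"
  shows "compactin T C"
  unfolding compactin_def
proof (intro conjI allI impI CX)
  fix \<U> assume \<U>: "Ball \<U> (openin T) \<and> C \<subseteq> \<Union>\<U>"
  show "\<exists>\<F>. finite \<F> \<and> \<F> \<subseteq> \<U> \<and> C \<subseteq> \<Union>\<F>"
  proof (rule ccontr)
    assume none: "\<not> ?thesis"
    \<comment> \<open>The member \<open>{}\<close> keeps the filter on \<open>C\<close> even if the cover is empty.\<close>
    define G where "G = (INF V\<in>insert {} \<U>. principal (C - V))"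
    have "G \<noteq> bot"
      unfolding G_def
    proof (rule INF_filter_not_bot)
      fix B assume B: "B \<subseteq> insert {} \<U>" "finite B"
      have "(\<Inter>b\<in>B. C - b) \<noteq> {}"
      proof -
        have "\<not> C \<subseteq> \<Union>(B - {{}})" using none B by (metis Diff_subset_conv finite_Diff insert_is_Un)
        then obtain x where "x \<in> C" "x \<notin> \<Union>(B - {{}})" by blast
        then show ?thesis by (cases "B = {}") auto
      qed
      then show "(INF b\<in>B. principal (C - b)) \<noteq> bot"
        using B(2) by (simp add: INF_principal_finite principal_eq_bot_iff)
    qed
    then obtain F where F: "F \<le> G" "ultrafilter F" using ultrafilter_refines by blast
    have ev: "eventually (\<lambda>x. x \<in> C - V) F" if "V \<in> insert {} \<U>" for V
    proof -
      have "G \<le> principal (C - V)" unfolding G_def by (rule INF_lower[OF that])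
      from order.trans[OF F(1) this] show ?thesis by (simp only: le_principal)
    qed
    have "eventually (\<lambda>x. x \<in> C) F" using ev[of "{}"] by simp
    then obtain l where l: "l \<in> C" "limitin T (\<lambda>x. x) l F" using conv F(2) by blast
    then obtain V where V: "V \<in> \<U>" "l \<in> V" using \<U> by blast
    have "eventually (\<lambda>x. x \<in> V) F" using l(2) V \<U> by (auto simp: limitin_def)
    with ev[of V] V have "eventually (\<lambda>_. False) F" by (auto elim: eventually_elim2)
    then show False using F(2) by (simp add: ultrafilter_def trivial_limit_def)
  qed
qed

lemma ultrafilter_limit_in_compact:
  assumes K: "compactin T K" and F: "ultrafilter F" and ev: "eventually (\<lambda>\<alpha>. f \<alpha> \<in> K) F"
  obtains (limit) l where "l \<in> K" "limitin T f l F"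
proof (rule ccontr)
  assume "\<not> thesis"
  then have none: "\<not> limitin T f l F" if "l \<in> K" for l using limit that by blast
  have "\<exists>V. openin T V \<and> l \<in> V \<and> eventually (\<lambda>\<alpha>. f \<alpha> \<notin> V) F" if l: "l \<in> K" for l
  proof -
    have "l \<in> topspace T" using compactin_subset_topspace[OF K] l by blast
    then obtain V where "openin T V" "l \<in> V" "\<not> eventually (\<lambda>\<alpha>. f \<alpha> \<in> V) F"
      using none[OF l] by (auto simp: limitin_def)
    then show ?thesis using ultrafilter_eventually_not[OF F] by blast
  qed
  then obtain V where V: "\<And>l. l \<in> K \<Longrightarrow> openin T (V l) \<and> l \<in> V l \<and> eventually (\<lambda>\<alpha>. f \<alpha> \<notin> V l) F"
    by metis
  obtain \<F> where \<F>: "finite \<F>" "\<F> \<subseteq> V ` K" "K \<subseteq> \<Union>\<F>"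
    using compactinD[OF K, of "V ` K"] V by blast
  have "eventually (\<lambda>\<alpha>. \<forall>W\<in>\<F>. f \<alpha> \<notin> W) F"
    by (rule eventually_ball_finite[OF \<F>(1)]) (use \<F>(2) V in blast)
  with ev have "eventually (\<lambda>_. False) F"
    by eventually_elim (use \<F>(3) in blast)
  then show False using F by (simp add: ultrafilter_def trivial_limit_def)
qed

lemma ultrafilter_bounded_limit:
  fixes f :: "'i \<Rightarrow> complex"
  assumes "ultrafilter F" "eventually (\<lambda>\<alpha>. cmod (f \<alpha>) \<le> B) F"
  obtains l where "(f \<longlongrightarrow> l) F"
proof -
  have "compactin euclidean (cball (0::complex) B)" by simp
  moreover have "eventually (\<lambda>\<alpha>. f \<alpha> \<in> cball 0 B) F" using assms(2) by simp
  ultimately show thesis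
    using ultrafilter_limit_in_compact[OF _ assms(1)] that limitin_canonical_iff by metis
qed

lemma limitin_topology_generated_by:
  assumes l: "l \<in> \<Union>S" and ev: "\<And>B. B \<in> S \<Longrightarrow> l \<in> B \<Longrightarrow> eventually (\<lambda>x. f x \<in> B) F"
  shows "limitin (topology_generated_by S) f l F"
  unfolding limitin_def
proof (intro conjI allI impI)
  show "l \<in> topspace (topology_generated_by S)" using l by simp
  fix U assume U: "openin (topology_generated_by S) U \<and> l \<in> U"
  then have "generate_topology_on S U" using openin_topology_generated_by by blast
  then have "l \<in> U \<longrightarrow> eventually (\<lambda>x. f x \<in> U) F"
  proof induction
    case (Int a b) then show ?case by (auto intro: eventually_conj elim: eventually_mono)
  next
    case (UN K)
    show ?case
    proof
      assume "l \<in> \<Union>K"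
      then obtain k where k: "k \<in> K" "l \<in> k" by blast
      then have "eventually (\<lambda>x. f x \<in> k) F" using UN by blast
      then show "eventually (\<lambda>x. f x \<in> \<Union>K) F" by (rule eventually_mono) (use k in blast)
    qed
  qed (use ev in auto)
  then show "eventually (\<lambda>x. f x \<in> U) F" using U by blast
qed

text \<open>
  The argument of Arzela and Ascoli: every point of \<open>K\<close> is close to one of finitely many points,
  at which the family converges simultaneously.
\<close>

lemma equicontinuous_pointwise_imp_uniform_limit:
  fixes f :: "'i \<Rightarrow> 'p \<Rightarrow> complex"
  assumes K: "compactin T K" and F: "F \<noteq> bot"
    and eq: "\<And>p e. p \<in> K \<Longrightarrow> e > 0 \<Longrightarrow> \<exists>Y. openin T Y \<and> p \<in> Y \<and>
               eventually (\<lambda>\<alpha>. \<forall>y\<in>Y \<inter> K. cmod (f \<alpha> y - f \<alpha> p) \<le> e) F"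
    and pw: "\<And>p. p \<in> K \<Longrightarrow> ((\<lambda>\<alpha>. f \<alpha> p) \<longlongrightarrow> g p) F"
  shows "uniform_limit K f g F"
proof (rule uniform_limitI)
  fix e :: real assume e: "e > 0"
  define d where "d = e / 4"
  have d: "d > 0" using e by (simp add: d_def)
  have "\<exists>Y. \<forall>p\<in>K. openin T (Y p) \<and> p \<in> Y p \<and>
               eventually (\<lambda>\<alpha>. \<forall>y\<in>Y p \<inter> K. cmod (f \<alpha> y - f \<alpha> p) \<le> d) F"
    by (rule bchoice) (use eq d in blast)
  then obtain Y where Y: "\<And>p. p \<in> K \<Longrightarrow> openin T (Y p)" "\<And>p. p \<in> K \<Longrightarrow> p \<in> Y p"
      "\<And>p. p \<in> K \<Longrightarrow> eventually (\<lambda>\<alpha>. \<forall>y\<in>Y p \<inter> K. cmod (f \<alpha> y - f \<alpha> p) \<le> d) F"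
    by blast
  obtain \<F> where \<F>: "finite \<F>" "\<F> \<subseteq> Y ` K" "K \<subseteq> \<Union>\<F>"
    using compactinD[OF K, of "Y ` K"] Y(1,2) by blast
  then obtain K0 where K0: "finite K0" "K0 \<subseteq> K" "K \<subseteq> (\<Union>p\<in>K0. Y p)"
    using finite_subset_image[OF \<F>(1,2)] by blast
  have near: "cmod (g y - g p) \<le> d" if p: "p \<in> K" and y: "y \<in> Y p \<inter> K" for p y
  proof (rule tendsto_upperbound[OF _ _ F])
    show "((\<lambda>\<alpha>. cmod (f \<alpha> y - f \<alpha> p)) \<longlongrightarrow> cmod (g y - g p)) F"
      using pw[OF p] pw[of y] y by (intro tendsto_intros) auto
    show "eventually (\<lambda>\<alpha>. cmod (f \<alpha> y - f \<alpha> p) \<le> d) F"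
      using Y(3)[OF p] by eventually_elim (use y in blast)
  qed
  have "eventually (\<lambda>\<alpha>. \<forall>p\<in>K0. (\<forall>y\<in>Y p \<inter> K. cmod (f \<alpha> y - f \<alpha> p) \<le> d) \<and> dist (f \<alpha> p) (g p) < d) F"
  proof (rule eventually_ball_finite[OF K0(1)], rule ballI)
    fix p assume "p \<in> K0"
    then have p: "p \<in> K" using K0(2) by blast
    show "eventually (\<lambda>\<alpha>. (\<forall>y\<in>Y p \<inter> K. cmod (f \<alpha> y - f \<alpha> p) \<le> d) \<and> dist (f \<alpha> p) (g p) < d) F"
      by (rule eventually_conj[OF Y(3)[OF p] tendstoD[OF pw[OF p] d]])
  qed
  then show "eventually (\<lambda>\<alpha>. \<forall>y\<in>K. dist (f \<alpha> y) (g y) < e) F"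
  proof eventually_elim
    case (elim \<alpha>)
    show ?case
    proof
      fix y assume y: "y \<in> K"
      then obtain p where p: "p \<in> K0" "y \<in> Y p" using K0(3) by blast
      have "dist (f \<alpha> y) (f \<alpha> p) \<le> d" "dist (f \<alpha> p) (g p) < d" "dist (g p) (g y) \<le> d"
        using elim p y near[of p y] K0(2) by (auto simp: dist_norm norm_minus_commute)
      then show "dist (f \<alpha> y) (g y) < e"
        using dist_triangle[of "f \<alpha> y" "g y" "f \<alpha> p"] dist_triangle[of "f \<alpha> p" "g y" "g p"] d
        unfolding d_def by linarith
    qed
  qed
qed

text \<open>
  Vitali's theorem in its easy form: the Schwarz estimate makes the family equicontinuous, so the
  convergence is locally uniform.
\<close>

lemma bounded_holomorphic_pointwise_limit:
  assumes F: "F \<noteq> bot"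
    and ev: "eventually (\<lambda>\<alpha>. h \<alpha> holomorphic_on ball q r \<and> (\<forall>w\<in>ball q r. cmod (h \<alpha> w) \<le> B)) F"
    and pw: "\<And>w. w \<in> ball q r \<Longrightarrow> ((\<lambda>\<alpha>. h \<alpha> w) \<longlongrightarrow> g w) F"
  shows "g holomorphic_on ball q r"
  unfolding holomorphic_on_def
proof
  fix w0 assume w0: "w0 \<in> ball q r"
  obtain e where e: "e > 0" "cball w0 e \<subseteq> ball q r"
    using w0 open_contains_cball[THEN iffD1, OF open_ball] by blast
  have lim: "uniform_limit (cball w0 e) h g F"
  proof (rule equicontinuous_pointwise_imp_uniform_limit[of euclidean])
    fix p d assume p: "p \<in> cball w0 e" and d: "(d::real) > 0"
    obtain s where s: "s > 0" "ball p s \<subseteq> ball q r"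
      using p e open_contains_ball[THEN iffD1, OF open_ball] by blast
    define L where "L = 4 * \<bar>B\<bar> / s"
    have L: "L \<ge> 0" using s by (simp add: L_def)
    define t where "t = min s (d / (L + 1))"
    have t: "t > 0" "L * t \<le> d"
    proof -
      show "t > 0" using s d L by (simp add: t_def)
      have "L * t \<le> L * (d / (L + 1))" using L by (intro mult_left_mono) (auto simp: t_def)
      also have "\<dots> \<le> d" using L d by (simp add: divide_simps)
      finally show "L * t \<le> d" .
    qed
    have "eventually (\<lambda>\<alpha>. \<forall>y\<in>ball p t \<inter> cball w0 e. cmod (h \<alpha> y - h \<alpha> p) \<le> d) F"
      using ev
    proof eventually_elim
      case (elim \<alpha>)
      show ?case
      proof
        fix y assume y: "y \<in> ball p t \<inter> cball w0 e"
        have "cmod (h \<alpha> y - h \<alpha> p) \<le> 4 * \<bar>B\<bar> / s * cmod (y - p)"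
        proof (rule Schwarz_estimate_off_centre[where q = p])
          show "h \<alpha> holomorphic_on ball p s" using elim s holomorphic_on_subset by blast
          show "cmod (h \<alpha> w) \<le> \<bar>B\<bar>" if "w \<in> ball p s" for w using elim s that by force
        qed (use s y in \<open>auto simp: t_def\<close>)
        also have "\<dots> \<le> L * t" unfolding L_def
          using y s by (intro mult_left_mono) (auto simp: dist_norm norm_minus_commute)
        finally show "cmod (h \<alpha> y - h \<alpha> p) \<le> d" using t by linarith
      qed
    qed
    then show "\<exists>Y. openin euclidean Y \<and> p \<in> Y \<and>
                 eventually (\<lambda>\<alpha>. \<forall>y\<in>Y \<inter> cball w0 e. cmod (h \<alpha> y - h \<alpha> p) \<le> d) F"
      using t by (intro exI[of _ "ball p t"]) auto
  qed (use F pw e in auto)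
  have "eventually (\<lambda>\<alpha>. continuous_on (cball w0 e) (h \<alpha>) \<and> h \<alpha> holomorphic_on ball w0 e) F"
    using ev
  proof eventually_elim
    case (elim \<alpha>)
    then have "h \<alpha> holomorphic_on cball w0 e" using e(2) holomorphic_on_subset by blast
    then show ?case
      by (auto intro: holomorphic_on_imp_continuous_on holomorphic_on_subset[OF _ ball_subset_cball])
  qed
  then have "g holomorphic_on ball w0 e"
    using holomorphic_uniform_limit[OF _ lim] F by auto
  then show "g field_differentiable at w0 within ball q r"
    using e(1) holomorphic_on_imp_differentiable_at[of g "ball w0 e" w0]
    by (simp add: field_differentiable_at_within)
qed


section \<open>Holomorphic functions on the underlying manifold\<close>

lemma at_within_openin:
  assumes "openin (top_of_set S) W" "z \<in> W" "W \<subseteq> U" "U \<subseteq> S"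
  shows "at z within U = at z within W"
proof -
  obtain T where T: "open T" "W = S \<inter> T" using assms(1) by (auto simp: openin_open)
  show ?thesis by (rule at_within_nhd[of z T]) (use T assms in auto)
qed

lemma holomorphic_several_local:
  assumes U: "U \<subseteq> cspace m"
    and loc: "\<And>z. z \<in> U \<Longrightarrow> \<exists>W. openin (top_of_set (cspace m)) W \<and> z \<in> W \<and> W \<subseteq> U \<and> holomorphic_several m W f"
  shows "holomorphic_several m U f"
  unfolding holomorphic_several_def
proof (intro conjI ballI allI impI)
  show "continuous_on U f"
    unfolding continuous_on_def
  proof
    fix z assume z: "z \<in> U"
    obtain W where W: "openin (top_of_set (cspace m)) W" "z \<in> W" "W \<subseteq> U" "holomorphic_several m W f"
      using loc[OF z] by blast
    then have "(f \<longlongrightarrow> f z) (at z within W)"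
      by (simp add: holomorphic_several_def continuous_on_def)
    then show "(f \<longlongrightarrow> f z) (at z within U)"
      using at_within_openin[OF W(1-3) U] by simp
  qed
  fix z i assume "z \<in> U" "i < m"
  then show "(\<lambda>w. f (z(i := w))) field_differentiable at (z i)"
    using loc[of z] by (auto simp: holomorphic_several_def)
qed

lemma holomorphic_several_cong:
  assumes V: "openin (top_of_set (cspace m)) V" and eq: "\<And>z. z \<in> V \<Longrightarrow> f z = g z"
    and f: "holomorphic_several m V f"
  shows "holomorphic_several m V g"
  unfolding holomorphic_several_def
proof (intro conjI ballI allI impI)
  show "continuous_on V g"
    using f eq by (auto simp: holomorphic_several_def cong: continuous_on_cong)
  fix z i assume z: "z \<in> V" and i: "i < m"
  obtain r where r: "r > 0" "polydisc m z r \<subseteq> V" using polydisc_in_open[OF V z] by blast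
  have zc: "z \<in> cspace m" using openin_imp_subset[OF V] z by auto
  have "(\<lambda>w. f (z(i := w))) field_differentiable at (z i)"
    using f z i by (simp add: holomorphic_several_def)
  then obtain d where d: "((\<lambda>w. f (z(i := w))) has_field_derivative d) (at (z i))"
    by (auto simp: field_differentiable_def)
  have "((\<lambda>w. g (z(i := w))) has_field_derivative d) (at (z i))"
    by (rule has_field_derivative_transform_within_open[OF d open_ball[of "z i" r]])
       (use r polydisc_upd[OF polydisc_centre[OF zc r(1)] i] eq in auto)
  then show "(\<lambda>w. g (z(i := w))) field_differentiable at (z i)"
    by (auto simp: field_differentiable_def)
qed

lemma holomorphic_several_subset:
  "holomorphic_several m U f \<Longrightarrow> V \<subseteq> U \<Longrightarrow> holomorphic_several m V f"
  by (auto simp: holomorphic_several_def intro: continuous_on_subset)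

locale compact_super =
  fixes \<M> :: "('p, 's) superspace"
  assumes compact_supermanifold: "compact_supermanifold \<M>"
begin

abbreviation m where "m \<equiv> even_dim \<M>"
abbreviation n where "n \<equiv> odd_dim \<M>"

lemma super: "complex_supermanifold \<M>" and compact_base: "compact_space (base \<M>)"
  using compact_supermanifold by (auto simp: compact_supermanifold_def)

lemma manifold: "complex_manifold \<M>" and sheaf: "superalgebra_sheaf \<M>"
  using super by (auto simp: complex_supermanifold_def)

lemma Hausdorff_base: "Hausdorff_space (base \<M>)"
  using manifold by (simp add: complex_manifold_def)

lemma shrink_open:
  assumes "openin (base \<M>) U" "p \<in> U"
  obtains B where "openin (base \<M>) B" "p \<in> B" "base \<M> closure_of B \<subseteq> U"
proof -
  have "regular_space (base \<M>)"
    using compact_Hausdorff_imp_regular_space compact_base Hausdorff_base by blast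
  moreover have "closedin (base \<M>) (topspace (base \<M>) - U)" using assms(1) by (simp add: closedin_diff)
  moreover have "p \<in> topspace (base \<M>) - (topspace (base \<M>) - U)"
    using assms openin_subset by fastforce
  ultimately have "\<exists>B V. openin (base \<M>) B \<and> openin (base \<M>) V \<and> p \<in> B \<and>
      topspace (base \<M>) - U \<subseteq> V \<and> disjnt B V"
    by (simp add: regular_space_def)
  then obtain B V where B: "openin (base \<M>) B" "openin (base \<M>) V" "p \<in> B"
      "topspace (base \<M>) - U \<subseteq> V" "disjnt B V"
    by blast
  have "base \<M> closure_of B \<subseteq> topspace (base \<M>) - V"
    by (rule closure_of_minimal) (use B openin_subset[OF B(1)] in \<open>auto simp: disjnt_iff\<close>)
  then have "base \<M> closure_of B \<subseteq> U" using B(4) by blast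
  with B that show thesis by blast
qed

lemma compactin_closure: "compactin (base \<M>) (base \<M> closure_of B)"
  using closedin_compact_space[OF compact_base] closedin_closure_of by blast

lemma atlas_chart:
  assumes "(D, \<kappa>) \<in> atlas \<M>"
  shows "topological_chart \<M> D \<kappa>"
  using assms manifold by (auto simp: complex_manifold_def)

lemma atlas_cover:
  assumes "p \<in> topspace (base \<M>)"
  obtains D \<kappa> where "(D, \<kappa>) \<in> atlas \<M>" "p \<in> D"
  using assms manifold by (auto simp: complex_manifold_def)

lemma atlas_transition:
  "(D, \<kappa>) \<in> atlas \<M> \<Longrightarrow> (E, \<mu>) \<in> atlas \<M> \<Longrightarrow> holomorphic_transition m D \<kappa> E \<mu>"
  using manifold by (auto simp: complex_manifold_def)

lemma chart_homeomorphic: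
  assumes "(D, \<kappa>) \<in> atlas \<M>"
  shows "homeomorphic_map (subtopology (base \<M>) D) (top_of_set (\<kappa> ` D)) \<kappa>"
    and "openin (base \<M>) D" and "openin (top_of_set (cspace m)) (\<kappa> ` D)"
  using atlas_chart[OF assms] by (auto simp: topological_chart_def)

lemma chart_inj: assumes "(D, \<kappa>) \<in> atlas \<M>" shows "inj_on \<kappa> D"
proof -
  have "topspace (subtopology (base \<M>) D) = D"
    using openin_subset[OF chart_homeomorphic(2)[OF assms]] by (auto simp: topspace_subtopology)
  then show ?thesis using homeomorphic_imp_injective_map[OF chart_homeomorphic(1)[OF assms]] by simp
qed

lemma chart_inv [simp]:
  assumes "(D, \<kappa>) \<in> atlas \<M>" "p \<in> D" shows "inv_into D \<kappa> (\<kappa> p) = p"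
  using chart_inj[OF assms(1)] assms(2) by simp

lemma chart_cspace:
  assumes "(D, \<kappa>) \<in> atlas \<M>" "p \<in> D" shows "\<kappa> p \<in> cspace m"
  using openin_imp_subset[OF chart_homeomorphic(3)[OF assms(1)]] assms(2) by blast

lemma chart_image_open:
  assumes "(D, \<kappa>) \<in> atlas \<M>" "openin (base \<M>) V"
  shows "openin (top_of_set (cspace m)) (\<kappa> ` (D \<inter> V))"
proof -
  have "openin (subtopology (base \<M>) D) (D \<inter> V)"
    using assms(2) by (simp add: openin_subtopology_Int2)
  then have "openin (top_of_set (\<kappa> ` D)) (\<kappa> ` (D \<inter> V))"
    using homeomorphic_imp_open_map[OF chart_homeomorphic(1)[OF assms(1)]] by (simp add: open_map_def)
  then show ?thesis using chart_homeomorphic(3)[OF assms(1)] openin_trans by blast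
qed

lemma chart_preimage_open:
  assumes "(D, \<kappa>) \<in> atlas \<M>" "openin (top_of_set (cspace m)) S"
  shows "openin (base \<M>) {p \<in> D. \<kappa> p \<in> S}"
proof -
  have sub: "D \<subseteq> topspace (base \<M>)" using openin_subset[OF chart_homeomorphic(2)[OF assms(1)]] .
  have "openin (top_of_set (\<kappa> ` D)) (\<kappa> ` D \<inter> S)"
  proof -
    obtain T where T: "open T" "S = cspace m \<inter> T" using assms(2) by (auto simp: openin_open)
    have "\<kappa> ` D \<inter> S = \<kappa> ` D \<inter> T" using T chart_cspace[OF assms(1)] by auto
    then show ?thesis using T(1) by (auto simp: openin_open)
  qed
  then have "openin (subtopology (base \<M>) D) {p \<in> topspace (subtopology (base \<M>) D). \<kappa> p \<in> \<kappa> ` D \<inter> S}"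
    using homeomorphic_imp_continuous_map[OF chart_homeomorphic(1)[OF assms(1)]]
      openin_continuous_map_preimage by blast
  moreover have "{p \<in> topspace (subtopology (base \<M>) D). \<kappa> p \<in> \<kappa> ` D \<inter> S} = {p \<in> D. \<kappa> p \<in> S}"
    using sub by (auto simp: topspace_subtopology)
  ultimately show ?thesis
    using chart_homeomorphic(2)[OF assms(1)] by (simp add: openin_open_subtopology)
qed

definition chart_disc :: "'p set \<Rightarrow> ('p \<Rightarrow> nat \<Rightarrow> complex) \<Rightarrow> 'p \<Rightarrow> real \<Rightarrow> 'p set" where
  "chart_disc D \<kappa> p r = {x \<in> D. \<kappa> x \<in> polydisc m (\<kappa> p) r}"

lemma openin_chart_disc: "(D, \<kappa>) \<in> atlas \<M> \<Longrightarrow> openin (base \<M>) (chart_disc D \<kappa> p r)"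
  unfolding chart_disc_def by (rule chart_preimage_open[OF _ openin_polydisc])

lemma chart_disc_centre:
  "(D, \<kappa>) \<in> atlas \<M> \<Longrightarrow> p \<in> D \<Longrightarrow> r > 0 \<Longrightarrow> p \<in> chart_disc D \<kappa> p r"
  by (simp add: chart_disc_def polydisc_centre chart_cspace)

lemma chart_disc_exists:
  assumes at: "(D, \<kappa>) \<in> atlas \<M>" and V: "openin (base \<M>) V" and p: "p \<in> D" "p \<in> V"
  obtains r where "r > 0" "polydisc m (\<kappa> p) r \<subseteq> \<kappa> ` (D \<inter> V)"
    "\<forall>s\<le>r. chart_disc D \<kappa> p s \<subseteq> D \<inter> V"
    "\<forall>s\<le>r. \<kappa> ` chart_disc D \<kappa> p s = polydisc m (\<kappa> p) s"
proof -
  obtain r where r: "r > 0" "polydisc m (\<kappa> p) r \<subseteq> \<kappa> ` (D \<inter> V)"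
    using polydisc_in_open[OF chart_image_open[OF at V], of "\<kappa> p"] p by blast
  have 1: "chart_disc D \<kappa> p s \<subseteq> D \<inter> V" if s: "s \<le> r" for s
  proof
    fix x assume x: "x \<in> chart_disc D \<kappa> p s"
    then have "\<kappa> x \<in> polydisc m (\<kappa> p) r" "x \<in> D"
      using polydisc_mono[OF s, of m "\<kappa> p"] by (auto simp: chart_disc_def)
    then have "\<kappa> x \<in> \<kappa> ` (D \<inter> V)" using r(2) by blast
    then obtain y where "y \<in> D" "y \<in> V" "\<kappa> x = \<kappa> y" by blast
    then show "x \<in> D \<inter> V" using inj_onD[OF chart_inj[OF at]] \<open>x \<in> D\<close> by blast
  qed
  have 2: "\<kappa> ` chart_disc D \<kappa> p s = polydisc m (\<kappa> p) s" if s: "s \<le> r" for s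
  proof
    show "polydisc m (\<kappa> p) s \<subseteq> \<kappa> ` chart_disc D \<kappa> p s"
    proof
      fix z assume z: "z \<in> polydisc m (\<kappa> p) s"
      then obtain x where "z = \<kappa> x" "x \<in> D" using r(2) polydisc_mono[OF s, of m "\<kappa> p"] by blast
      with z show "z \<in> \<kappa> ` chart_disc D \<kappa> p s" by (auto simp: chart_disc_def)
    qed
  qed (auto simp: chart_disc_def)
  show thesis by (rule that[OF r]) (use 1 2 in auto)
qed

text \<open>
  Membership in \<open>holomorphic_functions\<close> without the requirement of extensionality, so that
  restriction to a smaller set does not change the function.
\<close>

definition holo :: "'p set \<Rightarrow> ('p \<Rightarrow> complex) \<Rightarrow> bool" where
  "holo V f \<longleftrightarrow> (\<forall>(D, \<kappa>)\<in>atlas \<M>. holomorphic_several m (\<kappa> ` (D \<inter> V)) (\<lambda>z. f (inv_into D \<kappa> z)))"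

lemma holo_chart:
  "holo V f \<Longrightarrow> (D, \<kappa>) \<in> atlas \<M> \<Longrightarrow> holomorphic_several m (\<kappa> ` (D \<inter> V)) (\<lambda>z. f (inv_into D \<kappa> z))"
  by (auto simp: holo_def)

lemma holo_cong:
  assumes V: "openin (base \<M>) V" and eq: "\<And>x. x \<in> V \<Longrightarrow> f x = g x" and f: "holo V f"
  shows "holo V g"
  unfolding holo_def
proof (clarify)
  fix D \<kappa> assume at: "(D, \<kappa>) \<in> atlas \<M>"
  show "holomorphic_several m (\<kappa> ` (D \<inter> V)) (\<lambda>z. g (inv_into D \<kappa> z))"
    by (rule holomorphic_several_cong[OF chart_image_open[OF at V] _ holo_chart[OF f at]])
       (use at eq in auto)
qed

lemma holomorphic_functions_iff:
  assumes V: "openin (base \<M>) V"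
  shows "f \<in> holomorphic_functions \<M> V \<longleftrightarrow> f \<in> extensional V \<and> holo V f"
  by (simp add: holomorphic_functions_def holo_def)

lemma restrict_holomorphic:
  assumes "openin (base \<M>) V" "holo V f"
  shows "restrict f V \<in> holomorphic_functions \<M> V"
  using assms by (simp add: holomorphic_functions_iff holo_cong[of V f])

lemma holo_subset: "holo V f \<Longrightarrow> W \<subseteq> V \<Longrightarrow> holo W f"
  unfolding holo_def
  by (clarify, drule(1) bspec, clarify, erule holomorphic_several_subset) blast

lemma holo_local:
  assumes V: "openin (base \<M>) V"
    and loc: "\<And>p. p \<in> V \<Longrightarrow> \<exists>Y. openin (base \<M>) Y \<and> p \<in> Y \<and> Y \<subseteq> V \<and> holo Y f"
  shows "holo V f"
  unfolding holo_def
proof (clarify)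
  fix D \<kappa> assume at: "(D, \<kappa>) \<in> atlas \<M>"
  show "holomorphic_several m (\<kappa> ` (D \<inter> V)) (\<lambda>z. f (inv_into D \<kappa> z))"
  proof (rule holomorphic_several_local)
    show "\<kappa> ` (D \<inter> V) \<subseteq> cspace m" using chart_cspace[OF at] by auto
    fix z assume "z \<in> \<kappa> ` (D \<inter> V)"
    then obtain p where p: "p \<in> D" "p \<in> V" "z = \<kappa> p" by blast
    obtain Y where Y: "openin (base \<M>) Y" "p \<in> Y" "Y \<subseteq> V" "holo Y f" using loc[OF p(2)] by blast
    show "\<exists>W. openin (top_of_set (cspace m)) W \<and> z \<in> W \<and> W \<subseteq> \<kappa> ` (D \<inter> V) \<and>
              holomorphic_several m W (\<lambda>z. f (inv_into D \<kappa> z))"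
      by (rule exI[of _ "\<kappa> ` (D \<inter> Y)"])
         (use chart_image_open[OF at Y(1)] p Y holo_chart[OF Y(4) at] in auto)
  qed
qed

lemma holo_const: "holo V (\<lambda>_. c)"
  by (simp add: holo_def holomorphic_several_def)

lemma holo_add: "holo V f \<Longrightarrow> holo V g \<Longrightarrow> holo V (\<lambda>x. f x + g x)"
  by (auto simp: holo_def holomorphic_several_def intro!: continuous_intros field_differentiable_add)

lemma holo_mult: "holo V f \<Longrightarrow> holo V g \<Longrightarrow> holo V (\<lambda>x. f x * g x)"
  by (auto simp: holo_def holomorphic_several_def intro!: continuous_intros field_differentiable_mult)

lemma holo_sum: "(\<And>i. i \<in> I \<Longrightarrow> holo V (f i)) \<Longrightarrow> holo V (\<lambda>x. \<Sum>i\<in>I. f i x)"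
  by (induction I rule: infinite_finite_induct) (auto intro: holo_const holo_add)

lemma holo_inverse:
  assumes f: "holo V f" and nz: "\<And>x. x \<in> V \<Longrightarrow> f x \<noteq> 0"
  shows "holo V (\<lambda>x. inverse (f x))"
  unfolding holo_def holomorphic_several_def
proof (clarify, intro conjI ballI allI impI)
  fix D \<kappa> assume at: "(D, \<kappa>) \<in> atlas \<M>"
  note h = holo_chart[OF f at, unfolded holomorphic_several_def]
  have nz': "f (inv_into D \<kappa> z) \<noteq> 0" if "z \<in> \<kappa> ` (D \<inter> V)" for z
    using that nz at by auto
  show "continuous_on (\<kappa> ` (D \<inter> V)) (\<lambda>z. inverse (f (inv_into D \<kappa> z)))"
    using h nz' by (intro continuous_intros) auto
  fix z i assume z: "z \<in> \<kappa> ` (D \<inter> V)" and i: "i < m"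
  have "(\<lambda>w. f (inv_into D \<kappa> (z(i := w)))) field_differentiable at (z i)" using h z i by blast
  then show "(\<lambda>w. inverse (f (inv_into D \<kappa> (z(i := w))))) field_differentiable at (z i)"
    by (rule field_differentiable_inverse) (use nz'[OF z] in simp)
qed

lemma holo_coordinate:
  assumes "(E, \<mu>) \<in> atlas \<M>" "i < m" shows "holo E (\<lambda>x. \<mu> x i)"
  using atlas_transition[OF _ assms(1)] assms(2) by (auto simp: holo_def holomorphic_transition_def)

lemma holo_continuous:
  assumes V: "openin (base \<M>) V" and f: "holo V f" and T: "open T"
  shows "openin (base \<M>) {x \<in> V. f x \<in> T}"
proof (subst openin_subopen, rule ballI)
  fix p assume p: "p \<in> {x \<in> V. f x \<in> T}"
  have "p \<in> topspace (base \<M>)" using p openin_subset[OF V] by auto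
  then obtain D \<kappa> where at: "(D, \<kappa>) \<in> atlas \<M>" and pD: "p \<in> D" using atlas_cover by blast
  have "continuous_on (\<kappa> ` (D \<inter> V)) (\<lambda>z. f (inv_into D \<kappa> z))"
    using holo_chart[OF f at] by (simp add: holomorphic_several_def)
  then have "openin (top_of_set (\<kappa> ` (D \<inter> V))) (\<kappa> ` (D \<inter> V) \<inter> (\<lambda>z. f (inv_into D \<kappa> z)) -` T)"
    using T continuous_openin_preimage_gen by blast
  then have o: "openin (top_of_set (cspace m)) (\<kappa> ` (D \<inter> V) \<inter> (\<lambda>z. f (inv_into D \<kappa> z)) -` T)"
    using chart_image_open[OF at V] openin_trans by blast
  let ?S = "{x \<in> D. \<kappa> x \<in> \<kappa> ` (D \<inter> V) \<inter> (\<lambda>z. f (inv_into D \<kappa> z)) -` T}"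
  have "openin (base \<M>) ?S" by (rule chart_preimage_open[OF at o])
  moreover have "p \<in> ?S" using p pD at by auto
  moreover have "?S \<subseteq> {x \<in> V. f x \<in> T}"
  proof
    fix x assume x: "x \<in> ?S"
    then obtain y where y: "y \<in> D" "y \<in> V" "\<kappa> x = \<kappa> y" "x \<in> D" "f (inv_into D \<kappa> (\<kappa> x)) \<in> T" by blast
    then have "x = y" using inj_onD[OF chart_inj[OF at]] by blast
    then show "x \<in> {x \<in> V. f x \<in> T}" using at y by simp
  qed
  ultimately show "\<exists>S. openin (base \<M>) S \<and> p \<in> S \<and> S \<subseteq> {x \<in> V. f x \<in> T}" by blast
qed

lemma holo_locally_bounded:
  assumes V: "openin (base \<M>) V" and f: "holo V f" and p: "p \<in> V"
  obtains Y where "openin (base \<M>) Y" "p \<in> Y" "Y \<subseteq> V" "\<And>x. x \<in> Y \<Longrightarrow> cmod (f x) \<le> cmod (f p) + 1"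
proof -
  have "openin (base \<M>) {x \<in> V. f x \<in> ball (f p) 1}" by (rule holo_continuous[OF V f open_ball])
  moreover have "cmod (f x) \<le> cmod (f p) + 1" if "f x \<in> ball (f p) 1" for x
    using that norm_triangle_ineq2[of "f x" "f p"] by (auto simp: dist_norm norm_minus_commute)
  ultimately show thesis using that[of "{x \<in> V. f x \<in> ball (f p) 1}"] p by auto
qed

text \<open>
  The Lipschitz constant of the estimate on a polydisc depends on \<open>B\<close> only, whence one \<open>Y\<close> serves all
  functions bounded by \<open>B\<close>.
\<close>

lemma bounded_holo_equicontinuous:
  assumes V: "openin (base \<M>) V" and p: "p \<in> V" and e: "e > 0"
  obtains Y where "openin (base \<M>) Y" "p \<in> Y" "Y \<subseteq> V"
    "\<forall>f. holo V f \<longrightarrow> (\<forall>x\<in>V. cmod (f x) \<le> B) \<longrightarrow> (\<forall>y\<in>Y. cmod (f y - f p) \<le> e)"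
proof -
  have "p \<in> topspace (base \<M>)" using p openin_subset[OF V] by auto
  then obtain D \<kappa> where at: "(D, \<kappa>) \<in> atlas \<M>" and pD: "p \<in> D" using atlas_cover by blast
  obtain r where r: "r > 0" "polydisc m (\<kappa> p) r \<subseteq> \<kappa> ` (D \<inter> V)"
      "\<forall>s\<le>r. chart_disc D \<kappa> p s \<subseteq> D \<inter> V"
    by (rule chart_disc_exists[OF at V pD p]) (rule that)
  define L where "L = 4 * \<bar>B\<bar> / r"
  have L: "L \<ge> 0" using r by (simp add: L_def)
  define s where "s = min r (e / (L * m + 1))"
  have s: "s > 0" using r L e by (auto simp: s_def intro!: divide_pos_pos add_nonneg_pos mult_nonneg_nonneg)
  have Lms: "L * (m * s) \<le> e"
  proof -
    have "L * m * s \<le> L * m * (e / (L * m + 1))" using L by (intro mult_left_mono) (auto simp: s_def)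
    also have "\<dots> = e * (L * m) / (L * m + 1)" by simp
    also have "\<dots> \<le> e * (L * m + 1) / (L * m + 1)" using L e by (intro divide_right_mono mult_left_mono) auto
    also have "\<dots> = e"
    proof -
      have "L * m \<ge> 0" using L by simp
      then have "L * m + 1 \<noteq> 0" by linarith
      then show ?thesis by simp
    qed
    finally show ?thesis by (simp add: mult.assoc)
  qed
  have est: "cmod (f y - f p) \<le> e"
    if f: "holo V f" and bd: "\<And>x. x \<in> V \<Longrightarrow> cmod (f x) \<le> B" and y: "y \<in> chart_disc D \<kappa> p s" for f y
  proof -
    let ?u = "\<lambda>z. f (inv_into D \<kappa> z)"
    have yD: "y \<in> D" "\<kappa> y \<in> polydisc m (\<kappa> p) s" using y by (auto simp: chart_disc_def)
    have sr: "polydisc m (\<kappa> p) s \<subseteq> polydisc m (\<kappa> p) r" by (rule polydisc_mono) (simp add: s_def)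
    have "holomorphic_several m (polydisc m (\<kappa> p) r) ?u"
      using holomorphic_several_subset[OF holo_chart[OF f at] r(2)] .
    then have sep: "separately_holomorphic m (polydisc m (\<kappa> p) r) ?u" by (simp add: holomorphic_several_iff)
    have bu: "cmod (?u z) \<le> \<bar>B\<bar>" if "z \<in> polydisc m (\<kappa> p) r" for z
    proof -
      obtain x where "x \<in> D" "x \<in> V" "z = \<kappa> x" using r(2) \<open>z \<in> _\<close> by blast
      then show ?thesis using at bd[of x] by auto
    qed
    have "cmod (?u (\<kappa> y) - ?u (\<kappa> p)) \<le> 4 * \<bar>B\<bar> / r * (\<Sum>i<m. cmod (\<kappa> y i - \<kappa> p i))"
      by (rule separately_holomorphic_Lipschitz[OF sep bu _ _ r(1)])
         (use yD sr r polydisc_centre[OF chart_cspace[OF at pD]] in auto)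
    also have "\<dots> \<le> L * (\<Sum>i<m. s)"
      unfolding L_def using yD r by (intro mult_left_mono sum_mono) (auto simp: polydisc_def less_imp_le)
    also have "\<dots> \<le> e" using Lms by simp
    finally show ?thesis using at yD pD by simp
  qed
  show thesis
    by (rule that[of "chart_disc D \<kappa> p s"])
       (use openin_chart_disc[OF at] chart_disc_centre[OF at pD s] r(3) est in \<open>auto simp: s_def\<close>)
qed

lemma holo_uniform_limit_on_compact:
  assumes F: "F \<noteq> bot" and V: "openin (base \<M>) V" and K: "compactin (base \<M>) K" "K \<subseteq> V"
    and ev: "eventually (\<lambda>\<alpha>. holo V (f \<alpha>) \<and> (\<forall>x\<in>V. cmod (f \<alpha> x) \<le> B)) F"
    and pw: "\<And>x. x \<in> V \<Longrightarrow> ((\<lambda>\<alpha>. f \<alpha> x) \<longlongrightarrow> g x) F"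
  shows "uniform_limit K f g F"
proof (rule equicontinuous_pointwise_imp_uniform_limit[OF K(1) F])
  fix p e assume p: "p \<in> K" and e: "(e::real) > 0"
  then have pV: "p \<in> V" using K by blast
  obtain Y where Y: "openin (base \<M>) Y" "p \<in> Y" "Y \<subseteq> V"
      "\<forall>f. holo V f \<longrightarrow> (\<forall>x\<in>V. cmod (f x) \<le> B) \<longrightarrow> (\<forall>y\<in>Y. cmod (f y - f p) \<le> e)"
    by (rule bounded_holo_equicontinuous[OF V pV e, of B]) (rule that)
  have "eventually (\<lambda>\<alpha>. \<forall>y\<in>Y \<inter> K. cmod (f \<alpha> y - f \<alpha> p) \<le> e) F"
    using ev by eventually_elim (use Y(4) in auto)
  then show "\<exists>Y. openin (base \<M>) Y \<and> p \<in> Y \<and> eventually (\<lambda>\<alpha>. \<forall>y\<in>Y \<inter> K. cmod (f \<alpha> y - f \<alpha> p) \<le> e) F"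
    using Y(1,2) by blast
qed (use pw K in auto)

lemma holo_pointwise_limit:
  assumes F: "F \<noteq> bot" and V: "openin (base \<M>) V"
    and ev: "eventually (\<lambda>\<alpha>. holo V (f \<alpha>) \<and> (\<forall>x\<in>V. cmod (f \<alpha> x) \<le> B)) F"
    and pw: "\<And>x. x \<in> V \<Longrightarrow> ((\<lambda>\<alpha>. f \<alpha> x) \<longlongrightarrow> g x) F"
  shows "holo V g"
  unfolding holo_def
proof (clarify)
  fix D \<kappa> assume at: "(D, \<kappa>) \<in> atlas \<M>"
  let ?I = "inv_into D \<kappa>"
  have inV: "?I z \<in> V" if "z \<in> \<kappa> ` (D \<inter> V)" for z using that at by auto
  show "holomorphic_several m (\<kappa> ` (D \<inter> V)) (\<lambda>z. g (?I z))"
  proof (rule holomorphic_several_local)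
    show "\<kappa> ` (D \<inter> V) \<subseteq> cspace m" using chart_cspace[OF at] by auto
    fix q assume q: "q \<in> \<kappa> ` (D \<inter> V)"
    obtain r where r: "r > 0" "polydisc m q r \<subseteq> \<kappa> ` (D \<inter> V)"
      using polydisc_in_open[OF chart_image_open[OF at V] q] by blast
    have qc: "q \<in> cspace m" using q chart_cspace[OF at] by auto
    have gb: "cmod (g (?I z)) \<le> B" if z: "z \<in> polydisc m q r" for z
    proof (rule tendsto_upperbound[OF _ _ F])
      have zV: "?I z \<in> V" using inV r z by blast
      show "((\<lambda>\<alpha>. cmod (f \<alpha> (?I z))) \<longlongrightarrow> cmod (g (?I z))) F"
        by (intro tendsto_norm pw[OF zV])
      show "eventually (\<lambda>\<alpha>. cmod (f \<alpha> (?I z)) \<le> B) F"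
        using ev by eventually_elim (use zV in blast)
    qed
    have "separately_holomorphic m (polydisc m q r) (\<lambda>z. g (?I z))"
    proof (rule separately_holomorphic_on_polydiscI)
      fix z i assume z: "z \<in> polydisc m q r" and i: "i < m"
      have zV: "?I (z(i := w)) \<in> V" if "w \<in> ball (q i) r" for w
        using inV r(2) polydisc_upd[OF z i that] by blast
      show "(\<lambda>w. g (?I (z(i := w)))) holomorphic_on ball (q i) r"
      proof (rule bounded_holomorphic_pointwise_limit[OF F, where h = "\<lambda>\<alpha> w. f \<alpha> (?I (z(i := w)))"])
        show "eventually (\<lambda>\<alpha>. (\<lambda>w. f \<alpha> (?I (z(i := w)))) holomorphic_on ball (q i) r \<and>
                (\<forall>w\<in>ball (q i) r. cmod (f \<alpha> (?I (z(i := w)))) \<le> B)) F"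
          using ev
        proof eventually_elim
          case (elim \<alpha>)
          then have "holomorphic_several m (polydisc m q r) (\<lambda>z. f \<alpha> (?I z))"
            using holomorphic_several_subset[OF holo_chart[OF _ at] r(2)] by blast
          then have "separately_holomorphic m (polydisc m q r) (\<lambda>z. f \<alpha> (?I z))"
            by (simp add: holomorphic_several_iff)
          from separately_holomorphic_slice[OF this z i] elim zV show ?case by auto
        qed
      qed (use pw zV in auto)
    qed
    then have "holomorphic_several m (polydisc m q r) (\<lambda>z. g (?I z))"
      using gb by (rule bounded_separately_holomorphic_imp_several)
    then show "\<exists>W. openin (top_of_set (cspace m)) W \<and> q \<in> W \<and> W \<subseteq> \<kappa> ` (D \<inter> V) \<and>
              holomorphic_several m W (\<lambda>z. g (?I z))"
      by (intro exI[of _ "polydisc m q r"] conjI openin_polydisc polydisc_centre[OF qc r(1)] r(2))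
  qed
qed

end


section \<open>The exterior algebra in coefficients\<close>

definition wedge :: "(nat set \<Rightarrow> complex) \<Rightarrow> (nat set \<Rightarrow> complex) \<Rightarrow> nat set \<Rightarrow> complex" where
  "wedge x y \<nu> = (\<Sum>\<mu>\<in>Pow \<nu>. wedge_sign \<mu> (\<nu> - \<mu>) * x \<mu> * y (\<nu> - \<mu>))"

lemma wedge_sign_empty [simp]: "wedge_sign {} \<nu> = 1" "wedge_sign \<nu> {} = 1"
  by (simp_all add: wedge_sign_def)

lemma wedge_sign_square: "wedge_sign \<mu> \<nu> * wedge_sign \<mu> \<nu> = 1"
  by (simp add: wedge_sign_def flip: power_add)

lemma wedge_sign_nonzero: "wedge_sign \<mu> \<nu> \<noteq> 0"
  by (simp add: wedge_sign_def)

lemma norm_wedge_sign [simp]: "cmod (wedge_sign \<mu> \<nu>) = 1"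
  by (simp add: wedge_sign_def norm_power)

lemma finite_inversions: "finite A \<Longrightarrow> finite B \<Longrightarrow> finite {(i, j). i \<in> A \<and> j \<in> B \<and> j < i}"
  by (rule finite_subset[of _ "A \<times> B"]) auto

lemma wedge_sign_Un_left:
  assumes "finite A" "finite B" "finite C" "A \<inter> B = {}"
  shows "wedge_sign (A \<union> B) C = wedge_sign A C * wedge_sign B C"
proof -
  have "{(i, j). i \<in> A \<union> B \<and> j \<in> C \<and> j < i} =
        {(i, j). i \<in> A \<and> j \<in> C \<and> j < i} \<union> {(i, j). i \<in> B \<and> j \<in> C \<and> j < i}" by auto
  then have "card {(i, j). i \<in> A \<union> B \<and> j \<in> C \<and> j < i} =
        card {(i, j). i \<in> A \<and> j \<in> C \<and> j < i} + card {(i, j). i \<in> B \<and> j \<in> C \<and> j < i}"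
    using assms by (simp only:) (rule card_Un_disjoint, auto intro: finite_inversions)
  then show ?thesis by (simp add: wedge_sign_def power_add)
qed

lemma wedge_sign_Un_right:
  assumes "finite A" "finite B" "finite C" "B \<inter> C = {}"
  shows "wedge_sign A (B \<union> C) = wedge_sign A B * wedge_sign A C"
proof -
  have "{(i, j). i \<in> A \<and> j \<in> B \<union> C \<and> j < i} =
        {(i, j). i \<in> A \<and> j \<in> B \<and> j < i} \<union> {(i, j). i \<in> A \<and> j \<in> C \<and> j < i}" by auto
  then have "card {(i, j). i \<in> A \<and> j \<in> B \<union> C \<and> j < i} =
        card {(i, j). i \<in> A \<and> j \<in> B \<and> j < i} + card {(i, j). i \<in> A \<and> j \<in> C \<and> j < i}"
    using assms by (simp only:) (rule card_Un_disjoint, auto intro: finite_inversions)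
  then show ?thesis by (simp add: wedge_sign_def power_add)
qed

text \<open>Both sides are the sum over all partitions of \<open>\<nu>\<close> into three parts.\<close>

lemma wedge_assoc:
  assumes "finite \<nu>"
  shows "wedge (wedge x y) z \<nu> = wedge x (wedge y z) \<nu>"
proof -
  have fin: "finite \<mu>" if "\<mu> \<subseteq> \<nu>" for \<mu> using assms that finite_subset by blast
  have "wedge (wedge x y) z \<nu> =
    (\<Sum>\<mu>\<in>Pow \<nu>. \<Sum>\<rho>\<in>Pow \<mu>. wedge_sign \<mu> (\<nu> - \<mu>) * wedge_sign \<rho> (\<mu> - \<rho>) * x \<rho> * y (\<mu> - \<rho>) * z (\<nu> - \<mu>))"
    by (simp add: wedge_def sum_distrib_left sum_distrib_right mult.assoc)
  also have "\<dots> = (\<Sum>(\<mu>, \<rho>)\<in>(SIGMA \<mu>:Pow \<nu>. Pow \<mu>).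
      wedge_sign \<mu> (\<nu> - \<mu>) * wedge_sign \<rho> (\<mu> - \<rho>) * x \<rho> * y (\<mu> - \<rho>) * z (\<nu> - \<mu>))"
    by (rule sum.Sigma) (use assms fin in auto)
  also have "\<dots> = (\<Sum>(\<rho>, \<sigma>)\<in>(SIGMA \<rho>:Pow \<nu>. Pow (\<nu> - \<rho>)).
      wedge_sign \<rho> (\<nu> - \<rho>) * wedge_sign \<sigma> (\<nu> - \<rho> - \<sigma>) * x \<rho> * y \<sigma> * z (\<nu> - \<rho> - \<sigma>))"
  proof (rule sum.reindex_bij_witness[of _ "\<lambda>(\<rho>, \<sigma>). (\<rho> \<union> \<sigma>, \<rho>)" "\<lambda>(\<mu>, \<rho>). (\<rho>, \<mu> - \<rho>)"])
    fix a assume "a \<in> (SIGMA \<mu>:Pow \<nu>. Pow \<mu>)"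
    then obtain \<mu> \<rho> where a: "a = (\<mu>, \<rho>)" "\<mu> \<subseteq> \<nu>" "\<rho> \<subseteq> \<mu>" by auto
    define \<sigma> \<tau> where "\<sigma> = \<mu> - \<rho>" and "\<tau> = \<nu> - \<mu>"
    have f: "finite \<rho>" "finite \<sigma>" "finite \<tau>" using a fin unfolding \<sigma>_def \<tau>_def by blast+
    have e: "\<mu> = \<rho> \<union> \<sigma>" "\<nu> - \<rho> = \<sigma> \<union> \<tau>" "\<nu> - \<rho> - \<sigma> = \<tau>" "\<nu> - \<mu> = \<tau>"
      using a by (auto simp: \<sigma>_def \<tau>_def)
    have d: "\<rho> \<inter> \<sigma> = {}" "\<sigma> \<inter> \<tau> = {}" using a by (auto simp: \<sigma>_def \<tau>_def)
    have "wedge_sign \<mu> (\<nu> - \<mu>) * wedge_sign \<rho> \<sigma> = wedge_sign \<rho> (\<nu> - \<rho>) * wedge_sign \<sigma> (\<nu> - \<rho> - \<sigma>)"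
      unfolding e(4) unfolding e(3) unfolding e(2) unfolding e(1)
      by (simp add: wedge_sign_Un_left[OF f(1,2,3) d(1)] wedge_sign_Un_right[OF f(1,2,3) d(2)])
    then show "(case case a of (\<mu>, \<rho>) \<Rightarrow> (\<rho>, \<mu> - \<rho>) of (\<rho>, \<sigma>) \<Rightarrow>
        wedge_sign \<rho> (\<nu> - \<rho>) * wedge_sign \<sigma> (\<nu> - \<rho> - \<sigma>) * x \<rho> * y \<sigma> * z (\<nu> - \<rho> - \<sigma>)) =
      (case a of (\<mu>, \<rho>) \<Rightarrow>
        wedge_sign \<mu> (\<nu> - \<mu>) * wedge_sign \<rho> (\<mu> - \<rho>) * x \<rho> * y (\<mu> - \<rho>) * z (\<nu> - \<mu>))"
      unfolding a(1) prod.case \<sigma>_def[symmetric] by (simp only: e(3) e(4))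
  qed auto
  also have "\<dots> = (\<Sum>\<rho>\<in>Pow \<nu>. \<Sum>\<sigma>\<in>Pow (\<nu> - \<rho>).
      wedge_sign \<rho> (\<nu> - \<rho>) * wedge_sign \<sigma> (\<nu> - \<rho> - \<sigma>) * x \<rho> * y \<sigma> * z (\<nu> - \<rho> - \<sigma>))"
    by (rule sum.Sigma[symmetric]) (use assms in auto)
  also have "\<dots> = wedge x (wedge y z) \<nu>"
    by (simp add: wedge_def sum_distrib_left mult_ac)
  finally show ?thesis .
qed

lemma wedge_empty [simp]: "wedge x y {} = x {} * y {}"
  by (simp add: wedge_def)

definition unit_coeff :: "nat set \<Rightarrow> nat set \<Rightarrow> complex" where
  "unit_coeff \<mu> \<nu> = (if \<nu> = \<mu> then 1 else 0)"

lemma wedge_scalar_left: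
  assumes "finite \<nu>" "\<And>\<mu>. \<mu> \<subseteq> \<nu> \<Longrightarrow> \<mu> \<noteq> {} \<Longrightarrow> x \<mu> = 0"
  shows "wedge x y \<nu> = x {} * y \<nu>"
proof -
  have "wedge x y \<nu> = (\<Sum>\<mu>\<in>{{}}. wedge_sign \<mu> (\<nu> - \<mu>) * x \<mu> * y (\<nu> - \<mu>))"
    unfolding wedge_def by (rule sum.mono_neutral_right) (use assms in auto)
  then show ?thesis by simp
qed

lemma wedge_scalar_right:
  assumes "finite \<nu>" "\<And>\<mu>. \<mu> \<subseteq> \<nu> \<Longrightarrow> \<mu> \<noteq> {} \<Longrightarrow> y \<mu> = 0"
  shows "wedge x y \<nu> = x \<nu> * y {}"
proof -
  have "wedge x y \<nu> = (\<Sum>\<mu>\<in>{\<nu>}. wedge_sign \<mu> (\<nu> - \<mu>) * x \<mu> * y (\<nu> - \<mu>))"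
    unfolding wedge_def
  proof (rule sum.mono_neutral_right)
    show "\<forall>\<mu>\<in>Pow \<nu> - {\<nu>}. wedge_sign \<mu> (\<nu> - \<mu>) * x \<mu> * y (\<nu> - \<mu>) = 0"
    proof
      fix \<mu> assume "\<mu> \<in> Pow \<nu> - {\<nu>}"
      then have "y (\<nu> - \<mu>) = 0" by (intro assms(2)) auto
      then show "wedge_sign \<mu> (\<nu> - \<mu>) * x \<mu> * y (\<nu> - \<mu>) = 0" by simp
    qed
  qed (use assms in auto)
  then show ?thesis by simp
qed

lemma wedge_cong:
  assumes "\<And>\<mu>. \<mu> \<subseteq> \<nu> \<Longrightarrow> x \<mu> = x' \<mu>" "\<And>\<mu>. \<mu> \<subseteq> \<nu> \<Longrightarrow> y \<mu> = y' \<mu>"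
  shows "wedge x y \<nu> = wedge x' y' \<nu>"
  unfolding wedge_def by (rule sum.cong) (use assms in auto)

lemma wedge_add_right: "wedge x (\<lambda>\<mu>. y \<mu> + z \<mu>) \<nu> = wedge x y \<nu> + wedge x z \<nu>"
  by (simp add: wedge_def distrib_left sum.distrib)

lemma wedge_scale_right: "wedge x (\<lambda>\<mu>. c * y \<mu>) \<nu> = c * wedge x y \<nu>"
  by (simp add: wedge_def sum_distrib_left mult_ac)

lemma wedge_zero_right [simp]: "wedge x (\<lambda>_. 0) \<nu> = 0"
  by (simp add: wedge_def)

lemma wedge_sum_right: "wedge x (\<lambda>\<mu>. \<Sum>i\<in>J. y i \<mu>) \<nu> = (\<Sum>i\<in>J. wedge x (y i) \<nu>)"
  by (induction J rule: infinite_finite_induct) (simp_all add: wedge_add_right)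

lemma wedge_unit:
  assumes \<mu>: "finite \<mu>" and \<rho>: "finite \<rho>" and \<nu>: "finite \<nu>"
  shows "wedge (unit_coeff \<mu>) (unit_coeff \<rho>) \<nu> =
           (if \<mu> \<inter> \<rho> = {} \<and> \<nu> = \<mu> \<union> \<rho> then wedge_sign \<mu> \<rho> else 0)"
proof (cases "\<mu> \<subseteq> \<nu>")
  case True
  have "wedge (unit_coeff \<mu>) (unit_coeff \<rho>) \<nu> =
        (\<Sum>\<sigma>\<in>{\<mu>}. wedge_sign \<sigma> (\<nu> - \<sigma>) * unit_coeff \<mu> \<sigma> * unit_coeff \<rho> (\<nu> - \<sigma>))"
    unfolding wedge_def by (rule sum.mono_neutral_right) (use True \<nu> in \<open>auto simp: unit_coeff_def\<close>)
  also have "\<dots> = wedge_sign \<mu> (\<nu> - \<mu>) * unit_coeff \<rho> (\<nu> - \<mu>)" by (simp add: unit_coeff_def)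
  also have "\<dots> = (if \<mu> \<inter> \<rho> = {} \<and> \<nu> = \<mu> \<union> \<rho> then wedge_sign \<mu> \<rho> else 0)"
  proof (cases "\<mu> \<inter> \<rho> = {} \<and> \<nu> = \<mu> \<union> \<rho>")
    case True
    then have "\<nu> - \<mu> = \<rho>" by auto
    with True show ?thesis by (simp add: unit_coeff_def)
  next
    case False
    then have "\<nu> - \<mu> \<noteq> \<rho>" using True by auto
    then have "unit_coeff \<rho> (\<nu> - \<mu>) = 0" by (simp add: unit_coeff_def)
    with False show ?thesis by (simp only: if_False mult_zero_right)
  qed
  finally show ?thesis .
next
  case False
  then have "wedge (unit_coeff \<mu>) (unit_coeff \<rho>) \<nu> = 0"
    unfolding wedge_def by (intro sum.neutral) (auto simp: unit_coeff_def)
  with False show ?thesis by auto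
qed

text \<open>The powers of the ideal generated by the odd elements.\<close>

definition order_ge :: "nat \<Rightarrow> nat \<Rightarrow> (nat set \<Rightarrow> complex) \<Rightarrow> bool" where
  "order_ge N k x \<longleftrightarrow> (\<forall>\<nu>\<subseteq>{..<N}. card \<nu> < k \<longrightarrow> x \<nu> = 0)"

lemma order_ge_0 [simp]: "order_ge N 0 x"
  by (simp add: order_ge_def)

lemma order_ge_1: "order_ge N (Suc 0) x \<longleftrightarrow> x {} = 0"
proof -
  have "\<nu> \<subseteq> {..<N} \<and> card \<nu> < Suc 0 \<longleftrightarrow> \<nu> = {}" for \<nu>
    using finite_subset[of \<nu> "{..<N}"] by auto
  then show ?thesis unfolding order_ge_def by (metis empty_subsetI)
qed

lemma order_ge_wedge:
  assumes x: "order_ge N a x" and y: "order_ge N b y"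
  shows "order_ge N (a + b) (wedge x y)"
  unfolding order_ge_def
proof (intro allI impI)
  fix \<nu> assume \<nu>: "\<nu> \<subseteq> {..<N}" "card \<nu> < a + b"
  have fin: "finite \<nu>" using \<nu>(1) finite_subset by blast
  show "wedge x y \<nu> = 0"
    unfolding wedge_def
  proof (rule sum.neutral, rule ballI)
    fix \<mu> assume \<mu>: "\<mu> \<in> Pow \<nu>"
    have "card \<nu> = card \<mu> + card (\<nu> - \<mu>)"
      using \<mu> fin by (metis Pow_iff add.commute card_Diff_subset card_mono finite_subset le_add_diff_inverse2)
    then have "card \<mu> < a \<or> card (\<nu> - \<mu>) < b" using \<nu>(2) by linarith
    moreover have "\<mu> \<subseteq> {..<N}" "\<nu> - \<mu> \<subseteq> {..<N}" using \<mu> \<nu>(1) by auto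
    ultimately have "x \<mu> = 0 \<or> y (\<nu> - \<mu>) = 0" using x y unfolding order_ge_def by blast
    then show "wedge_sign \<mu> (\<nu> - \<mu>) * x \<mu> * y (\<nu> - \<mu>) = 0" by auto
  qed
qed

lemma order_ge_large:
  assumes "order_ge N k x" "k > N" "\<nu> \<subseteq> {..<N}" shows "x \<nu> = 0"
proof -
  have "card \<nu> \<le> N" using assms(3) card_mono[of "{..<N}" \<nu>] by simp
  with assms show ?thesis by (auto simp: order_ge_def)
qed

lemma order_ge_mono: "order_ge N k x \<Longrightarrow> j \<le> k \<Longrightarrow> order_ge N j x"
  by (auto simp: order_ge_def)

lemma wedge_bound:
  assumes x: "\<And>\<mu>. \<mu> \<subseteq> {..<N} \<Longrightarrow> cmod (x \<mu>) \<le> a" and y: "\<And>\<mu>. \<mu> \<subseteq> {..<N} \<Longrightarrow> cmod (y \<mu>) \<le> b"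
    and \<nu>: "\<nu> \<subseteq> {..<N}"
  shows "cmod (wedge x y \<nu>) \<le> 2 ^ N * a * b"
proof -
  have a: "0 \<le> a" using order.trans[OF norm_ge_zero x[of "{}"]] by simp
  have b: "0 \<le> b" using order.trans[OF norm_ge_zero y[of "{}"]] by simp
  have fin: "finite \<nu>" using \<nu> finite_subset by blast
  have "cmod (wedge x y \<nu>) \<le> (\<Sum>\<mu>\<in>Pow \<nu>. cmod (wedge_sign \<mu> (\<nu> - \<mu>) * x \<mu> * y (\<nu> - \<mu>)))"
    unfolding wedge_def by (rule norm_sum)
  also have "\<dots> \<le> (\<Sum>\<mu>\<in>Pow \<nu>. a * b)"
  proof (rule sum_mono)
    fix \<mu> assume \<mu>: "\<mu> \<in> Pow \<nu>"
    have "\<mu> \<subseteq> {..<N}" "\<nu> - \<mu> \<subseteq> {..<N}" using \<mu> \<nu> by auto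
    then have "cmod (x \<mu>) * cmod (y (\<nu> - \<mu>)) \<le> a * b"
      by (intro mult_mono x y a norm_ge_zero)
    then show "cmod (wedge_sign \<mu> (\<nu> - \<mu>) * x \<mu> * y (\<nu> - \<mu>)) \<le> a * b"
      by (simp add: norm_mult)
  qed
  also have "\<dots> = 2 ^ card \<nu> * (a * b)" using fin by (simp add: card_Pow)
  also have "\<dots> \<le> 2 ^ N * (a * b)"
    using a b card_mono[of "{..<N}" \<nu>] \<nu> by (intro mult_right_mono power_increasing) auto
  finally show ?thesis by (simp add: mult.assoc)
qed

section \<open>Coefficients of sections\<close>

lemma carrier_complex_field [simp]:
  "carrier complex_field = UNIV"
  by (simp add: ring_of_type_algebra_def)

context compact_super
begin

abbreviation Sec :: "'p set \<Rightarrow> 's set" where "Sec V \<equiv> carrier (sections \<M> V)"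

abbreviation multi :: "nat set set" where "multi \<equiv> Pow {..<n}"

lemma multi_indices_eq: "multi_indices \<M> = multi" by (simp add: multi_indices_def)

lemma opens_iff [simp]: "V \<in> opens \<M> \<longleftrightarrow> openin (base \<M>) V" by (simp add: opens_def)

lemma presheaf: "superalgebra_presheaf \<M>" using sheaf by (simp add: superalgebra_sheaf_def)

lemma sections_superalgebra:
  "openin (base \<M>) V \<Longrightarrow> superalgebra (sections \<M> V) (grading \<M> V)"
  using presheaf by (simp add: superalgebra_presheaf_def)

lemma sections_ring: "openin (base \<M>) V \<Longrightarrow> ring (sections \<M> V)"
  using sections_superalgebra by (simp add: superalgebra_def)

lemma sections_smult_closed:
  "openin (base \<M>) V \<Longrightarrow> s \<in> Sec V \<Longrightarrow> c \<odot>\<^bsub>sections \<M> V\<^esub> s \<in> Sec V"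
  using sections_superalgebra[of V] module.smult_closed[of complex_field "sections \<M> V" c s]
  by (simp add: superalgebra_def)

lemma sections_closed [simp]:
  assumes "openin (base \<M>) V"
  shows "\<one>\<^bsub>sections \<M> V\<^esub> \<in> Sec V" "\<zero>\<^bsub>sections \<M> V\<^esub> \<in> Sec V"
    "s \<in> Sec V \<Longrightarrow> t \<in> Sec V \<Longrightarrow> s \<otimes>\<^bsub>sections \<M> V\<^esub> t \<in> Sec V"
    "s \<in> Sec V \<Longrightarrow> t \<in> Sec V \<Longrightarrow> s \<oplus>\<^bsub>sections \<M> V\<^esub> t \<in> Sec V"
  using ring.ring_simprules(1,2,5,6)[OF sections_ring[OF assms]] by auto

lemma restr_hom:
  "openin (base \<M>) U \<Longrightarrow> openin (base \<M>) V \<Longrightarrow> V \<subseteq> U \<Longrightarrow>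
     superalgebra_hom (sections \<M> U) (grading \<M> U) (sections \<M> V) (grading \<M> V) (restr \<M> U V)"
  using presheaf by (simp add: superalgebra_presheaf_def)

lemma restr_closed [simp]:
  "openin (base \<M>) U \<Longrightarrow> openin (base \<M>) V \<Longrightarrow> V \<subseteq> U \<Longrightarrow> s \<in> Sec U \<Longrightarrow> restr \<M> U V s \<in> Sec V"
  using restr_hom[of U V] ring_hom_closed by (fastforce simp: superalgebra_hom_def)

lemma restr_id: "openin (base \<M>) U \<Longrightarrow> s \<in> Sec U \<Longrightarrow> restr \<M> U U s = s"
  using presheaf by (simp add: superalgebra_presheaf_def)

lemma restr_restr:
  "openin (base \<M>) U \<Longrightarrow> openin (base \<M>) V \<Longrightarrow> openin (base \<M>) W \<Longrightarrow> W \<subseteq> V \<Longrightarrow> V \<subseteq> U \<Longrightarrow>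
     s \<in> Sec U \<Longrightarrow> restr \<M> V W (restr \<M> U V s) = restr \<M> U W s"
  using presheaf by (simp add: superalgebra_presheaf_def)

abbreviation spl where "spl W \<Phi> \<equiv> local_splitting \<M> W \<Phi>"

lemma spl_open: "spl W \<Phi> \<Longrightarrow> openin (base \<M>) W"
  by (simp add: local_splitting_def)

lemma spl_hom:
  "spl W \<Phi> \<Longrightarrow> openin (base \<M>) V \<Longrightarrow> V \<subseteq> W \<Longrightarrow>
     superalgebra_hom (sections \<M> V) (grading \<M> V) (grassmann \<M> V) (grassmann_grading \<M> V) (\<Phi> V)"
  "spl W \<Phi> \<Longrightarrow> openin (base \<M>) V \<Longrightarrow> V \<subseteq> W \<Longrightarrow>
     bij_betw (\<Phi> V) (Sec V) (carrier (grassmann \<M> V))"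
  by (auto simp: local_splitting_def)

lemma spl_restr:
  "spl W \<Phi> \<Longrightarrow> openin (base \<M>) V \<Longrightarrow> openin (base \<M>) V' \<Longrightarrow> V \<subseteq> W \<Longrightarrow> V' \<subseteq> V \<Longrightarrow> s \<in> Sec V \<Longrightarrow>
     \<nu> \<in> multi \<Longrightarrow> \<Phi> V' (restr \<M> V V' s) \<nu> = restrict (\<Phi> V s \<nu>) V'"
  by (simp add: local_splitting_def multi_indices_eq)

lemma spl_exists:
  assumes "p \<in> topspace (base \<M>)" obtains W \<Phi> where "p \<in> W" "spl W \<Phi>"
  using super assms by (auto simp: complex_supermanifold_def)

text \<open>
  The set \<open>V\<close> need not lie in \<open>W\<close>: pulled back sections live over preimages, which have no reason
  to be contained in the domain of a splitting. The value matters for \<open>x \<in> V \<inter> W\<close> only.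
\<close>

definition coeff ::
  "('p set \<Rightarrow> 's \<Rightarrow> nat set \<Rightarrow> 'p \<Rightarrow> complex) \<Rightarrow> 'p set \<Rightarrow> 'p set \<Rightarrow> 's \<Rightarrow> 'p \<Rightarrow> nat set \<Rightarrow> complex" where
  "coeff \<Phi> W V t x \<nu> = \<Phi> (V \<inter> W) (restr \<M> V (V \<inter> W) t) \<nu> x"

lemma grassmann_carrier_holo:
  "openin (base \<M>) V \<Longrightarrow> a \<in> carrier (grassmann \<M> V) \<Longrightarrow> \<nu> \<in> multi \<Longrightarrow> holo V (a \<nu>)"
  by (auto simp: grassmann_def multi_indices_eq holomorphic_functions_iff PiE_iff)

context
  fixes W \<Phi> V
  assumes W: "spl W \<Phi>" and V: "openin (base \<M>) V"
begin

lemma VW: "openin (base \<M>) (V \<inter> W)"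
  using V spl_open[OF W] by blast

lemma coeff_image: "t \<in> Sec V \<Longrightarrow> \<Phi> (V \<inter> W) (restr \<M> V (V \<inter> W) t) \<in> carrier (grassmann \<M> (V \<inter> W))"
  using spl_hom(2)[OF W VW] restr_closed[OF V VW] by (auto dest: bij_betwE)

lemma coeff_holo: "t \<in> Sec V \<Longrightarrow> \<nu> \<in> multi \<Longrightarrow> holo (V \<inter> W) (\<lambda>x. coeff \<Phi> W V t x \<nu>)"
  unfolding coeff_def using grassmann_carrier_holo[OF VW coeff_image] by auto

lemma hom_V: "restr \<M> V (V \<inter> W) \<in> Ring.ring_hom (sections \<M> V) (sections \<M> (V \<inter> W))"
  and hom_W: "\<Phi> (V \<inter> W) \<in> Ring.ring_hom (sections \<M> (V \<inter> W)) (grassmann \<M> (V \<inter> W))"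
  using restr_hom[OF V VW] spl_hom(1)[OF W VW] by (auto simp: superalgebra_hom_def)

lemma coeff_mult:
  assumes "s \<in> Sec V" "t \<in> Sec V" "x \<in> V" "x \<in> W" "\<nu> \<in> multi"
  shows "coeff \<Phi> W V (s \<otimes>\<^bsub>sections \<M> V\<^esub> t) x \<nu> = wedge (coeff \<Phi> W V s x) (coeff \<Phi> W V t x) \<nu>"
proof -
  have "\<Phi> (V \<inter> W) (restr \<M> V (V \<inter> W) (s \<otimes>\<^bsub>sections \<M> V\<^esub> t)) =
    \<Phi> (V \<inter> W) (restr \<M> V (V \<inter> W) s) \<otimes>\<^bsub>grassmann \<M> (V \<inter> W)\<^esub> \<Phi> (V \<inter> W) (restr \<M> V (V \<inter> W) t)"
    using assms restr_closed[OF V VW]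
    by (simp add: ring_hom_mult[OF hom_V] ring_hom_mult[OF hom_W])
  then show ?thesis
    using assms by (simp add: coeff_def wedge_def grassmann_def multi_indices_eq)
qed

lemma coeff_add:
  assumes "s \<in> Sec V" "t \<in> Sec V" "x \<in> V" "x \<in> W" "\<nu> \<in> multi"
  shows "coeff \<Phi> W V (s \<oplus>\<^bsub>sections \<M> V\<^esub> t) x \<nu> = coeff \<Phi> W V s x \<nu> + coeff \<Phi> W V t x \<nu>"
proof -
  have "\<Phi> (V \<inter> W) (restr \<M> V (V \<inter> W) (s \<oplus>\<^bsub>sections \<M> V\<^esub> t)) =
    \<Phi> (V \<inter> W) (restr \<M> V (V \<inter> W) s) \<oplus>\<^bsub>grassmann \<M> (V \<inter> W)\<^esub> \<Phi> (V \<inter> W) (restr \<M> V (V \<inter> W) t)"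
    using assms restr_closed[OF V VW]
    by (simp add: ring_hom_add[OF hom_V] ring_hom_add[OF hom_W])
  then show ?thesis
    using assms by (simp add: coeff_def grassmann_def multi_indices_eq)
qed

lemma coeff_smult:
  assumes "s \<in> Sec V" "x \<in> V" "x \<in> W" "\<nu> \<in> multi"
  shows "coeff \<Phi> W V (c \<odot>\<^bsub>sections \<M> V\<^esub> s) x \<nu> = c * coeff \<Phi> W V s x \<nu>"
proof -
  have "\<Phi> (V \<inter> W) (restr \<M> V (V \<inter> W) (c \<odot>\<^bsub>sections \<M> V\<^esub> s)) =
    c \<odot>\<^bsub>grassmann \<M> (V \<inter> W)\<^esub> \<Phi> (V \<inter> W) (restr \<M> V (V \<inter> W) s)"
    using assms restr_closed[OF V VW] restr_hom[OF V VW] spl_hom(1)[OF W VW]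
    by (simp add: superalgebra_hom_def)
  then show ?thesis
    using assms by (simp add: coeff_def grassmann_def multi_indices_eq)
qed

lemma coeff_one:
  assumes "x \<in> V" "x \<in> W" "\<nu> \<in> multi"
  shows "coeff \<Phi> W V \<one>\<^bsub>sections \<M> V\<^esub> x \<nu> = unit_coeff {} \<nu>"
proof -
  have "\<Phi> (V \<inter> W) (restr \<M> V (V \<inter> W) \<one>\<^bsub>sections \<M> V\<^esub>) = \<one>\<^bsub>grassmann \<M> (V \<inter> W)\<^esub>"
    by (simp add: ring_hom_one[OF hom_V] ring_hom_one[OF hom_W])
  then show ?thesis
    using assms by (simp add: coeff_def grassmann_def multi_indices_eq unit_coeff_def)
qed

lemma coeff_restr:
  assumes V': "openin (base \<M>) V'" "V' \<subseteq> V" and "t \<in> Sec V" "x \<in> V'" "x \<in> W" "\<nu> \<in> multi"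
  shows "coeff \<Phi> W V' (restr \<M> V V' t) x \<nu> = coeff \<Phi> W V t x \<nu>"
proof -
  have V'W: "openin (base \<M>) (V' \<inter> W)" using V' spl_open[OF W] by blast
  have "V' \<inter> W \<subseteq> V" using V'(2) by blast
  then have "restr \<M> V' (V' \<inter> W) (restr \<M> V V' t) = restr \<M> (V \<inter> W) (V' \<inter> W) (restr \<M> V (V \<inter> W) t)"
    using restr_restr[OF V V'(1) V'W _ V'(2) assms(3)] restr_restr[OF V VW V'W _ _ assms(3)] V'(2) by auto
  then have "coeff \<Phi> W V' (restr \<M> V V' t) x \<nu> =
      \<Phi> (V' \<inter> W) (restr \<M> (V \<inter> W) (V' \<inter> W) (restr \<M> V (V \<inter> W) t)) \<nu> x"
    by (simp add: coeff_def)
  also have "\<dots> = restrict (\<Phi> (V \<inter> W) (restr \<M> V (V \<inter> W) t) \<nu>) (V' \<inter> W) x"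
    using spl_restr[OF W VW V'W _ _ restr_closed[OF V VW _ assms(3)] assms(6)] V'(2)
    by (simp add: inf.coboundedI1)
  finally show ?thesis using assms by (simp add: coeff_def)
qed

lemma coeff_exists:
  assumes sub: "V \<subseteq> W" and a: "\<And>\<nu>. \<nu> \<in> multi \<Longrightarrow> holo V (a \<nu>)"
  shows "\<exists>s\<in>Sec V. \<forall>x\<in>V. \<forall>\<nu>\<in>multi. coeff \<Phi> W V s x \<nu> = a \<nu> x"
proof -
  have [simp]: "V \<inter> W = V" using sub by blast
  define b where "b = (\<lambda>\<nu>\<in>multi. restrict (a \<nu>) V)"
  have "b \<in> carrier (grassmann \<M> V)"
    using restrict_holomorphic[OF V a] by (auto simp: b_def grassmann_def multi_indices_eq)
  then obtain s where s: "s \<in> Sec V" "\<Phi> V s = b"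
    using spl_hom(2)[OF W V sub] by (metis bij_betw_imp_surj_on imageE)
  then have "\<forall>x\<in>V. \<forall>\<nu>\<in>multi. coeff \<Phi> W V s x \<nu> = a \<nu> x"
    by (simp add: coeff_def restr_id[OF V] b_def)
  with s show ?thesis by blast
qed

end

text \<open>Separation in the sheaf reduces the claim to small open sets, over which a splitting is injective.\<close>

lemma coeff_eqI:
  assumes V: "openin (base \<M>) V" and s: "s \<in> Sec V" and t: "t \<in> Sec V"
    and eq: "\<And>x. x \<in> V \<Longrightarrow> \<exists>W \<Phi> Y. spl W \<Phi> \<and> openin (base \<M>) Y \<and> x \<in> Y \<and> Y \<subseteq> V \<inter> W \<and>
               (\<forall>y\<in>Y. \<forall>\<nu>\<in>multi. coeff \<Phi> W V s y \<nu> = coeff \<Phi> W V t y \<nu>)"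
  shows "s = t"
proof -
  define C where "C = {Y. openin (base \<M>) Y \<and> Y \<subseteq> V \<and> restr \<M> V Y s = restr \<M> V Y t}"
  have "V \<subseteq> \<Union>C"
  proof
    fix x assume x: "x \<in> V"
    obtain W \<Phi> Y where Y: "spl W \<Phi>" "openin (base \<M>) Y" "x \<in> Y" "Y \<subseteq> V \<inter> W"
        "\<forall>y\<in>Y. \<forall>\<nu>\<in>multi. coeff \<Phi> W V s y \<nu> = coeff \<Phi> W V t y \<nu>"
      using eq[OF x] by (elim exE conjE) (rule that)
    have [simp]: "Y \<inter> W = Y" using Y(4) by blast
    have YV: "Y \<subseteq> V" "Y \<subseteq> W" using Y(4) by auto
    let ?s = "restr \<M> V Y s" and ?t = "restr \<M> V Y t"
    have in_Y: "?s \<in> Sec Y" "?t \<in> Sec Y" using restr_closed[OF V Y(2) YV(1)] s t by auto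
    have car: "\<Phi> Y ?s \<in> carrier (grassmann \<M> Y)" "\<Phi> Y ?t \<in> carrier (grassmann \<M> Y)"
      using spl_hom(2)[OF Y(1,2) YV(2)] in_Y by (auto dest: bij_betwE)
    have "\<Phi> Y ?s = \<Phi> Y ?t"
    proof (rule ext, rule ext)
      fix \<nu> y
      show "\<Phi> Y ?s \<nu> y = \<Phi> Y ?t \<nu> y"
      proof (cases "\<nu> \<in> multi")
        case True
        show ?thesis
        proof (cases "y \<in> Y")
          case yY: True
          have "coeff \<Phi> W Y ?s y \<nu> = coeff \<Phi> W Y ?t y \<nu>"
            using coeff_restr[OF Y(1) V Y(2) YV(1) s yY _ True]
              coeff_restr[OF Y(1) V Y(2) YV(1) t yY _ True] Y(5) yY True YV(2) by auto
          then show ?thesis using in_Y by (simp add: coeff_def restr_id[OF Y(2)])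
        next
          case False
          have "\<Phi> Y ?s \<nu> \<in> extensional Y" "\<Phi> Y ?t \<nu> \<in> extensional Y"
            using car True by (auto simp: grassmann_def multi_indices_eq PiE_iff holomorphic_functions_iff[OF Y(2)])
          then show ?thesis using False by (simp add: extensional_def)
        qed
      next
        case False
        then have "\<Phi> Y ?s \<nu> = undefined" "\<Phi> Y ?t \<nu> = undefined"
          using car by (auto simp: grassmann_def multi_indices_eq PiE_iff extensional_def)
        then show ?thesis by simp
      qed
    qed
    then have "?s = ?t"
      using spl_hom(2)[OF Y(1,2) YV(2)] in_Y by (meson bij_betw_imp_inj_on inj_onD)
    then show "x \<in> \<Union>C" using Y YV by (auto simp: C_def)
  qed
  then have UC: "\<Union>C = V" by (auto simp: C_def)
  have "C \<subseteq> opens \<M>" by (auto simp: C_def)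
  moreover have "\<forall>Y\<in>C. restr \<M> (\<Union>C) Y s = restr \<M> (\<Union>C) Y t" using UC by (auto simp: C_def)
  ultimately show "s = t"
    using sheaf s t UC by (auto simp: superalgebra_sheaf_def)
qed

lemma coeff_eqI_everywhere:
  assumes V: "openin (base \<M>) V" and s: "s \<in> Sec V" and t: "t \<in> Sec V"
    and eq: "\<And>W \<Phi> y \<nu>. spl W \<Phi> \<Longrightarrow> y \<in> V \<Longrightarrow> y \<in> W \<Longrightarrow> \<nu> \<in> multi \<Longrightarrow> coeff \<Phi> W V s y \<nu> = coeff \<Phi> W V t y \<nu>"
  shows "s = t"
proof (rule coeff_eqI[OF V s t])
  fix x assume x: "x \<in> V"
  then obtain W \<Phi> where W: "x \<in> W" "spl W \<Phi>" using spl_exists openin_subset[OF V] by blast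
  show "\<exists>W \<Phi> Y. spl W \<Phi> \<and> openin (base \<M>) Y \<and> x \<in> Y \<and> Y \<subseteq> V \<inter> W \<and>
      (\<forall>y\<in>Y. \<forall>\<nu>\<in>multi. coeff \<Phi> W V s y \<nu> = coeff \<Phi> W V t y \<nu>)"
    using W x VW[OF W(2) V] eq by (intro exI[of _ W] exI[of _ \<Phi>] exI[of _ "V \<inter> W"]) simp
qed

lemma coeff_eqI_splitting:
  assumes W: "spl W \<Phi>" and V: "openin (base \<M>) V" "V \<subseteq> W" and s: "s \<in> Sec V" and t: "t \<in> Sec V"
    and eq: "\<And>y \<nu>. y \<in> V \<Longrightarrow> \<nu> \<in> multi \<Longrightarrow> coeff \<Phi> W V s y \<nu> = coeff \<Phi> W V t y \<nu>"
  shows "s = t"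
proof (rule coeff_eqI[OF V(1) s t])
  fix x assume "x \<in> V"
  then show "\<exists>W \<Phi> Y. spl W \<Phi> \<and> openin (base \<M>) Y \<and> x \<in> Y \<and> Y \<subseteq> V \<inter> W \<and>
               (\<forall>y\<in>Y. \<forall>\<nu>\<in>multi. coeff \<Phi> W V s y \<nu> = coeff \<Phi> W V t y \<nu>)"
    using W V eq by (intro exI[of _ W] exI[of _ \<Phi>] exI[of _ V] conjI ballI) simp_all
qed

definition sec where
  "sec \<Phi> W V a = (SOME s. s \<in> Sec V \<and> (\<forall>x\<in>V. \<forall>\<nu>\<in>multi. coeff \<Phi> W V s x \<nu> = a \<nu> x))"

lemma
  assumes "spl W \<Phi>" "openin (base \<M>) V" "V \<subseteq> W" "\<And>\<nu>. \<nu> \<in> multi \<Longrightarrow> holo V (a \<nu>)"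
  shows sec_closed: "sec \<Phi> W V a \<in> Sec V"
    and coeff_sec: "x \<in> V \<Longrightarrow> \<nu> \<in> multi \<Longrightarrow> coeff \<Phi> W V (sec \<Phi> W V a) x \<nu> = a \<nu> x"
proof -
  have "\<exists>s. s \<in> Sec V \<and> (\<forall>x\<in>V. \<forall>\<nu>\<in>multi. coeff \<Phi> W V s x \<nu> = a \<nu> x)"
    using coeff_exists[OF assms] by (simp only: Bex_def)
  from someI_ex[OF this] show "sec \<Phi> W V a \<in> Sec V"
      "x \<in> V \<Longrightarrow> \<nu> \<in> multi \<Longrightarrow> coeff \<Phi> W V (sec \<Phi> W V a) x \<nu> = a \<nu> x"
    unfolding sec_def by blast+
qed


section \<open>Pullbacks in coefficients\<close>

abbreviation smor where "smor \<phi> \<equiv> supermorphism \<M> \<M> \<phi>"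
abbreviation pre where "pre \<equiv> preimage \<M>"

lemma smor_continuous: "smor \<phi> \<Longrightarrow> continuous_map (base \<M>) (base \<M>) (fst \<phi>)"
  by (simp add: supermorphism_def holomorphic_map_def)

lemma smor_topspace: "smor \<phi> \<Longrightarrow> p \<in> topspace (base \<M>) \<Longrightarrow> fst \<phi> p \<in> topspace (base \<M>)"
  using smor_continuous[of \<phi>] by (auto simp: continuous_map_def)

lemma pre_iff: "x \<in> pre \<phi> U \<longleftrightarrow> x \<in> topspace (base \<M>) \<and> fst \<phi> x \<in> U"
  by (simp add: preimage_def)

lemma pre_open: "smor \<phi> \<Longrightarrow> openin (base \<M>) U \<Longrightarrow> openin (base \<M>) (pre \<phi> U)"
  unfolding preimage_def using smor_continuous openin_continuous_map_preimage by blast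

lemma pre_mono: "U \<subseteq> V \<Longrightarrow> pre \<phi> U \<subseteq> pre \<phi> V"
  by (auto simp: preimage_def)

lemma smor_hom:
  assumes "smor \<phi>" "openin (base \<M>) U"
  shows "superalgebra_hom (sections \<M> U) (grading \<M> U)
           (sections \<M> (pre \<phi> U)) (grading \<M> (pre \<phi> U)) (snd \<phi> U)"
    and "snd \<phi> U \<in> Ring.ring_hom (sections \<M> U) (sections \<M> (pre \<phi> U))"
  using assms by (simp_all add: supermorphism_def superalgebra_hom_def)

lemma smor_closed: "smor \<phi> \<Longrightarrow> openin (base \<M>) U \<Longrightarrow> s \<in> Sec U \<Longrightarrow> snd \<phi> U s \<in> Sec (pre \<phi> U)"
  using ring_hom_closed[OF smor_hom(2)] by blast

lemma smor_natural:
  "smor \<phi> \<Longrightarrow> openin (base \<M>) U \<Longrightarrow> openin (base \<M>) V \<Longrightarrow> V \<subseteq> U \<Longrightarrow> s \<in> Sec U \<Longrightarrow>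
     snd \<phi> V (restr \<M> U V s) = restr \<M> (pre \<phi> U) (pre \<phi> V) (snd \<phi> U s)"
  by (simp add: supermorphism_def)

text \<open>
  The coefficients of \<open>\<phi>\<^sup>* s\<close> at the point \<open>x\<close>. For fixed \<open>\<phi>\<close> and \<open>x\<close> they are, as a function of
  \<open>s\<close>, a homomorphism to the exterior algebra; morphisms are studied through these
  homomorphisms.
\<close>

definition pc where
  "pc \<phi> \<Phi> W U s x \<nu> = coeff \<Phi> W (pre \<phi> U) (snd \<phi> U s) x \<nu>"

lemma pullback_coeff_eq: "pullback_coeff \<M> W \<Phi> U f \<phi> \<nu> x = pc \<phi> \<Phi> W U f x \<nu>"
  by (simp add: pullback_coeff_def pc_def coeff_def)

text \<open>
  A function as a section, by means of a splitting: functions are not sections of the structure sheaf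
  in a canonical way.
\<close>

definition function_sec where
  "function_sec \<Phi> W V f = sec \<Phi> W V (\<lambda>\<nu>. if \<nu> = {} then f else (\<lambda>_. 0))"

definition monomial_sec where
  "monomial_sec \<Phi> W V \<mu> = sec \<Phi> W V (\<lambda>\<nu> x. unit_coeff \<mu> \<nu>)"

context
  fixes Z \<Psi> U
  assumes Z: "spl Z \<Psi>" and U: "openin (base \<M>) U" and UZ: "U \<subseteq> Z"
begin

lemma function_sec_closed: "holo U f \<Longrightarrow> function_sec \<Psi> Z U f \<in> Sec U"
  unfolding function_sec_def by (rule sec_closed[OF Z U UZ]) (simp add: holo_const)

lemma coeff_function_sec:
  "holo U f \<Longrightarrow> x \<in> U \<Longrightarrow> \<nu> \<in> multi \<Longrightarrow> coeff \<Psi> Z U (function_sec \<Psi> Z U f) x \<nu> = (if \<nu> = {} then f x else 0)"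
  unfolding function_sec_def by (subst coeff_sec[OF Z U UZ]) (simp_all add: holo_const)

lemma monomial_sec_closed: "monomial_sec \<Psi> Z U \<mu> \<in> Sec U"
  unfolding monomial_sec_def by (rule sec_closed[OF Z U UZ]) (simp add: holo_const)

lemma coeff_monomial_sec:
  "x \<in> U \<Longrightarrow> \<nu> \<in> multi \<Longrightarrow> coeff \<Psi> Z U (monomial_sec \<Psi> Z U \<mu>) x \<nu> = unit_coeff \<mu> \<nu>"
  unfolding monomial_sec_def by (subst coeff_sec[OF Z U UZ]) (simp_all add: holo_const)

lemma finite_multi: "\<nu> \<in> multi \<Longrightarrow> finite \<nu>"
  using finite_subset by blast

lemma coeff_function_sec_mult:
  assumes f: "holo U f" and s: "s \<in> Sec U" and x: "x \<in> U" and \<nu>: "\<nu> \<in> multi"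
  shows "coeff \<Psi> Z U (function_sec \<Psi> Z U f \<otimes>\<^bsub>sections \<M> U\<^esub> s) x \<nu> = f x * coeff \<Psi> Z U s x \<nu>"
proof -
  have xZ: "x \<in> Z" using x UZ by blast
  have sub: "\<mu> \<in> multi" if "\<mu> \<subseteq> \<nu>" for \<mu> using that \<nu> by auto
  show ?thesis
    by (subst coeff_mult[OF Z U function_sec_closed[OF f] s x xZ \<nu>], subst wedge_scalar_left)
       (use sub in \<open>simp_all add: finite_multi[OF \<nu>] coeff_function_sec[OF f x]\<close>)
qed

lemma function_sec_add:
  assumes "holo U f" "holo U g"
  shows "function_sec \<Psi> Z U (\<lambda>x. f x + g x) = function_sec \<Psi> Z U f \<oplus>\<^bsub>sections \<M> U\<^esub> function_sec \<Psi> Z U g"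
proof (rule coeff_eqI_splitting[OF Z U UZ])
  fix y \<nu> assume y: "y \<in> U" and \<nu>: "\<nu> \<in> multi"
  then have "y \<in> Z" using UZ by blast
  with y \<nu> show "coeff \<Psi> Z U (function_sec \<Psi> Z U (\<lambda>x. f x + g x)) y \<nu> =
      coeff \<Psi> Z U (function_sec \<Psi> Z U f \<oplus>\<^bsub>sections \<M> U\<^esub> function_sec \<Psi> Z U g) y \<nu>"
    using assms by (subst coeff_add[OF Z U]) (simp_all add: function_sec_closed coeff_function_sec holo_add)
qed (use assms U in \<open>simp_all add: function_sec_closed holo_add\<close>)

lemma function_sec_mult:
  assumes "holo U f" "holo U g"
  shows "function_sec \<Psi> Z U (\<lambda>x. f x * g x) = function_sec \<Psi> Z U f \<otimes>\<^bsub>sections \<M> U\<^esub> function_sec \<Psi> Z U g"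
proof (rule coeff_eqI_splitting[OF Z U UZ])
  fix y \<nu> assume y: "y \<in> U" and \<nu>: "\<nu> \<in> multi"
  then show "coeff \<Psi> Z U (function_sec \<Psi> Z U (\<lambda>x. f x * g x)) y \<nu> =
      coeff \<Psi> Z U (function_sec \<Psi> Z U f \<otimes>\<^bsub>sections \<M> U\<^esub> function_sec \<Psi> Z U g) y \<nu>"
    using assms by (subst coeff_function_sec_mult) (simp_all add: function_sec_closed coeff_function_sec holo_mult)
qed (use assms U in \<open>simp_all add: function_sec_closed holo_mult\<close>)

lemma function_sec_const: "function_sec \<Psi> Z U (\<lambda>_. c) = c \<odot>\<^bsub>sections \<M> U\<^esub> \<one>\<^bsub>sections \<M> U\<^esub>"
proof (rule coeff_eqI_splitting[OF Z U UZ])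
  fix y \<nu> assume y: "y \<in> U" and \<nu>: "\<nu> \<in> multi"
  then have yZ: "y \<in> Z" using UZ by blast
  with y \<nu> show "coeff \<Psi> Z U (function_sec \<Psi> Z U (\<lambda>_. c)) y \<nu> =
      coeff \<Psi> Z U (c \<odot>\<^bsub>sections \<M> U\<^esub> \<one>\<^bsub>sections \<M> U\<^esub>) y \<nu>"
    using U by (subst coeff_smult[OF Z U]) (simp_all add: coeff_function_sec holo_const coeff_one[OF Z U] unit_coeff_def)
qed (use U in \<open>simp_all add: function_sec_closed holo_const sections_smult_closed\<close>)

lemma restr_function_sec:
  assumes f: "holo U f" and V: "openin (base \<M>) V" "V \<subseteq> U"
  shows "restr \<M> U V (function_sec \<Psi> Z U f) = function_sec \<Psi> Z V f"
proof -
  have VZ: "V \<subseteq> Z" using V UZ by blast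
  have fV: "holo V f" using f V holo_subset by blast
  have in_V: "function_sec \<Psi> Z V f \<in> Sec V"
    unfolding function_sec_def by (rule sec_closed[OF Z V(1) VZ]) (simp add: holo_const fV)
  show ?thesis
  proof (rule coeff_eqI_splitting[OF Z V(1) VZ restr_closed[OF U V function_sec_closed[OF f]] in_V])
    fix y \<nu> assume y: "y \<in> V" and \<nu>: "\<nu> \<in> multi"
    then have yZ: "y \<in> Z" and yU: "y \<in> U" using VZ V by auto
    show "coeff \<Psi> Z V (restr \<M> U V (function_sec \<Psi> Z U f)) y \<nu> = coeff \<Psi> Z V (function_sec \<Psi> Z V f) y \<nu>"
      unfolding coeff_restr[OF Z U V function_sec_closed[OF f] y yZ \<nu>] coeff_function_sec[OF f yU \<nu>]
      unfolding function_sec_def by (subst coeff_sec[OF Z V(1) VZ]) (use y \<nu> fV in \<open>simp_all add: holo_const\<close>)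
  qed
qed

lemma restr_monomial_sec:
  assumes V: "openin (base \<M>) V" "V \<subseteq> U"
  shows "restr \<M> U V (monomial_sec \<Psi> Z U \<mu>) = monomial_sec \<Psi> Z V \<mu>"
proof -
  have VZ: "V \<subseteq> Z" using V UZ by blast
  have in_V: "monomial_sec \<Psi> Z V \<mu> \<in> Sec V"
    unfolding monomial_sec_def by (rule sec_closed[OF Z V(1) VZ]) (simp add: holo_const)
  show ?thesis
  proof (rule coeff_eqI_splitting[OF Z V(1) VZ restr_closed[OF U V monomial_sec_closed] in_V])
    fix y \<nu> assume y: "y \<in> V" and \<nu>: "\<nu> \<in> multi"
    then have yZ: "y \<in> Z" and yU: "y \<in> U" using VZ V by auto
    show "coeff \<Psi> Z V (restr \<M> U V (monomial_sec \<Psi> Z U \<mu>)) y \<nu> = coeff \<Psi> Z V (monomial_sec \<Psi> Z V \<mu>) y \<nu>"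
      unfolding coeff_restr[OF Z U V monomial_sec_closed y yZ \<nu>] coeff_monomial_sec[OF yU \<nu>]
      unfolding monomial_sec_def by (subst coeff_sec[OF Z V(1) VZ]) (use y \<nu> in \<open>simp_all add: holo_const\<close>)
  qed
qed

lemma monomial_sec_mult:
  assumes "\<mu> \<in> multi" "\<rho> \<in> multi" "\<mu> \<inter> \<rho> = {}"
  shows "monomial_sec \<Psi> Z U \<mu> \<otimes>\<^bsub>sections \<M> U\<^esub> monomial_sec \<Psi> Z U \<rho> = wedge_sign \<mu> \<rho> \<odot>\<^bsub>sections \<M> U\<^esub> monomial_sec \<Psi> Z U (\<mu> \<union> \<rho>)"
proof (rule coeff_eqI_splitting[OF Z U UZ])
  fix y \<nu> assume y: "y \<in> U" and \<nu>: "\<nu> \<in> multi"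
  then have yZ: "y \<in> Z" using UZ by blast
  have sub: "\<sigma> \<in> multi" if "\<sigma> \<subseteq> \<nu>" for \<sigma> using that \<nu> by auto
  have "coeff \<Psi> Z U (monomial_sec \<Psi> Z U \<mu> \<otimes>\<^bsub>sections \<M> U\<^esub> monomial_sec \<Psi> Z U \<rho>) y \<nu> =
      wedge (unit_coeff \<mu>) (unit_coeff \<rho>) \<nu>"
    by (subst coeff_mult[OF Z U monomial_sec_closed monomial_sec_closed y yZ \<nu>], rule wedge_cong)
       (simp_all add: coeff_monomial_sec[OF y sub])
  also have "\<dots> = coeff \<Psi> Z U (wedge_sign \<mu> \<rho> \<odot>\<^bsub>sections \<M> U\<^esub> monomial_sec \<Psi> Z U (\<mu> \<union> \<rho>)) y \<nu>"
    using assms(3)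
    by (subst coeff_smult[OF Z U monomial_sec_closed y yZ \<nu>])
       (simp add: wedge_unit finite_multi[OF assms(1)] finite_multi[OF assms(2)] finite_multi[OF \<nu>]
          coeff_monomial_sec[OF y \<nu>] unit_coeff_def)
  finally show "coeff \<Psi> Z U (monomial_sec \<Psi> Z U \<mu> \<otimes>\<^bsub>sections \<M> U\<^esub> monomial_sec \<Psi> Z U \<rho>) y \<nu> =
      coeff \<Psi> Z U (wedge_sign \<mu> \<rho> \<odot>\<^bsub>sections \<M> U\<^esub> monomial_sec \<Psi> Z U (\<mu> \<union> \<rho>)) y \<nu>" .
qed (use U in \<open>simp_all add: monomial_sec_closed sections_smult_closed\<close>)

lemma monomial_sec_mult_overlap:
  assumes "\<mu> \<in> multi" "\<rho> \<in> multi" "\<mu> \<inter> \<rho> \<noteq> {}"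
  shows "monomial_sec \<Psi> Z U \<mu> \<otimes>\<^bsub>sections \<M> U\<^esub> monomial_sec \<Psi> Z U \<rho> = 0 \<odot>\<^bsub>sections \<M> U\<^esub> \<one>\<^bsub>sections \<M> U\<^esub>"
proof (rule coeff_eqI_splitting[OF Z U UZ])
  fix y \<nu> assume y: "y \<in> U" and \<nu>: "\<nu> \<in> multi"
  then have yZ: "y \<in> Z" using UZ by blast
  have sub: "\<sigma> \<in> multi" if "\<sigma> \<subseteq> \<nu>" for \<sigma> using that \<nu> by auto
  have "coeff \<Psi> Z U (monomial_sec \<Psi> Z U \<mu> \<otimes>\<^bsub>sections \<M> U\<^esub> monomial_sec \<Psi> Z U \<rho>) y \<nu> =
      wedge (unit_coeff \<mu>) (unit_coeff \<rho>) \<nu>"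
    by (subst coeff_mult[OF Z U monomial_sec_closed monomial_sec_closed y yZ \<nu>], rule wedge_cong)
       (simp_all add: coeff_monomial_sec[OF y sub])
  also have "\<dots> = 0"
    using assms(3) by (simp add: wedge_unit finite_multi[OF assms(1)] finite_multi[OF assms(2)] finite_multi[OF \<nu>])
  also have "\<dots> = coeff \<Psi> Z U (0 \<odot>\<^bsub>sections \<M> U\<^esub> \<one>\<^bsub>sections \<M> U\<^esub>) y \<nu>"
    using U by (subst coeff_smult[OF Z U _ y yZ \<nu>]) simp_all
  finally show "coeff \<Psi> Z U (monomial_sec \<Psi> Z U \<mu> \<otimes>\<^bsub>sections \<M> U\<^esub> monomial_sec \<Psi> Z U \<rho>) y \<nu> =
      coeff \<Psi> Z U (0 \<odot>\<^bsub>sections \<M> U\<^esub> \<one>\<^bsub>sections \<M> U\<^esub>) y \<nu>" .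
qed (use U in \<open>simp_all add: monomial_sec_closed sections_smult_closed\<close>)

end

context
  fixes \<phi> W \<Phi> U x
  assumes \<phi>: "smor \<phi>" and W: "spl W \<Phi>" and U: "openin (base \<M>) U" and x: "x \<in> pre \<phi> U" "x \<in> W"
begin

lemma pc_mult:
  assumes "s \<in> Sec U" "t \<in> Sec U" "\<nu> \<in> multi"
  shows "pc \<phi> \<Phi> W U (s \<otimes>\<^bsub>sections \<M> U\<^esub> t) x \<nu> = wedge (pc \<phi> \<Phi> W U s x) (pc \<phi> \<Phi> W U t x) \<nu>"
proof -
  have "pc \<phi> \<Phi> W U (s \<otimes>\<^bsub>sections \<M> U\<^esub> t) x \<nu> =
     wedge (coeff \<Phi> W (pre \<phi> U) (snd \<phi> U s) x) (coeff \<Phi> W (pre \<phi> U) (snd \<phi> U t) x) \<nu>"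
    unfolding pc_def ring_hom_mult[OF smor_hom(2)[OF \<phi> U] assms(1,2)]
    by (rule coeff_mult[OF W pre_open[OF \<phi> U] smor_closed[OF \<phi> U assms(1)] smor_closed[OF \<phi> U assms(2)] x assms(3)])
  also have "\<dots> = wedge (pc \<phi> \<Phi> W U s x) (pc \<phi> \<Phi> W U t x) \<nu>"
    by (rule wedge_cong) (simp_all add: pc_def)
  finally show ?thesis .
qed

lemma pc_add:
  assumes "s \<in> Sec U" "t \<in> Sec U" "\<nu> \<in> multi"
  shows "pc \<phi> \<Phi> W U (s \<oplus>\<^bsub>sections \<M> U\<^esub> t) x \<nu> = pc \<phi> \<Phi> W U s x \<nu> + pc \<phi> \<Phi> W U t x \<nu>"
  unfolding pc_def ring_hom_add[OF smor_hom(2)[OF \<phi> U] assms(1,2)]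
  by (rule coeff_add[OF W pre_open[OF \<phi> U] smor_closed[OF \<phi> U assms(1)] smor_closed[OF \<phi> U assms(2)] x assms(3)])

lemma pc_smult:
  assumes "s \<in> Sec U" "\<nu> \<in> multi"
  shows "pc \<phi> \<Phi> W U (c \<odot>\<^bsub>sections \<M> U\<^esub> s) x \<nu> = c * pc \<phi> \<Phi> W U s x \<nu>"
proof -
  have "snd \<phi> U (c \<odot>\<^bsub>sections \<M> U\<^esub> s) = c \<odot>\<^bsub>sections \<M> (pre \<phi> U)\<^esub> snd \<phi> U s"
    using smor_hom(1)[OF \<phi> U] assms(1) by (simp add: superalgebra_hom_def)
  then show ?thesis
    unfolding pc_def
    using coeff_smult[OF W pre_open[OF \<phi> U] smor_closed[OF \<phi> U assms(1)] x assms(2)] by simp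
qed

lemma pc_one: "\<nu> \<in> multi \<Longrightarrow> pc \<phi> \<Phi> W U \<one>\<^bsub>sections \<M> U\<^esub> x \<nu> = unit_coeff {} \<nu>"
  unfolding pc_def ring_hom_one[OF smor_hom(2)[OF \<phi> U]]
  by (rule coeff_one[OF W pre_open[OF \<phi> U] x])

lemma pc_restr:
  assumes "openin (base \<M>) V" "U \<subseteq> V" "s \<in> Sec V" "\<nu> \<in> multi"
  shows "pc \<phi> \<Phi> W U (restr \<M> V U s) x \<nu> = pc \<phi> \<Phi> W V s x \<nu>"
  unfolding pc_def smor_natural[OF \<phi> assms(1) U assms(2,3)]
  by (rule coeff_restr[OF W pre_open[OF \<phi> assms(1)] pre_open[OF \<phi> U] pre_mono[OF assms(2)]
        smor_closed[OF \<phi> assms(1,3)] x assms(4)])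

lemma pc_body_power:
  assumes r: "r \<in> Sec U"
  shows "r [^]\<^bsub>sections \<M> U\<^esub> (k::nat) \<in> Sec U"
    and "pc \<phi> \<Phi> W U (r [^]\<^bsub>sections \<M> U\<^esub> k) x {} = pc \<phi> \<Phi> W U r x {} ^ k"
proof -
  interpret R: ring "sections \<M> U" by (rule sections_ring[OF U])
  show c: "r [^]\<^bsub>sections \<M> U\<^esub> k \<in> Sec U" for k :: nat using r by simp
  show "pc \<phi> \<Phi> W U (r [^]\<^bsub>sections \<M> U\<^esub> k) x {} = pc \<phi> \<Phi> W U r x {} ^ k"
    by (induction k) (simp_all add: pc_one unit_coeff_def pc_mult[OF c r])
qed

end

lemma coeff_power_order:
  assumes Z: "spl Z \<Psi>" and U: "openin (base \<M>) U" and r: "r \<in> Sec U" and x: "x \<in> U" "x \<in> Z"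
    and r0: "coeff \<Psi> Z U r x {} = 0"
  shows "order_ge n k (coeff \<Psi> Z U (r [^]\<^bsub>sections \<M> U\<^esub> (k::nat)) x)"
proof -
  interpret R: ring "sections \<M> U" by (rule sections_ring[OF U])
  show ?thesis
  proof (induction k)
    case (Suc k)
    have "order_ge n (k + 1) (wedge (coeff \<Psi> Z U (r [^]\<^bsub>sections \<M> U\<^esub> k) x) (coeff \<Psi> Z U r x))"
      by (rule order_ge_wedge[OF Suc]) (simp add: order_ge_1 r0)
    then show ?case
      by (simp add: order_ge_def coeff_mult[OF Z U R.nat_pow_closed[OF r] r x])
  qed simp
qed

text \<open>
  That \<open>\<phi>\<^sup>*\<close> covers composition with the underlying map is not part of the definition of a
  morphism. It holds because a section with nonvanishing body is, up to a nilpotent, invertible: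
  if the body of \<open>\<phi>\<^sup>* s\<close> at \<open>p\<close> were \<open>d \<noteq> s\<^sub>\<emptyset>(\<phi> p)\<close>, then \<open>s - d\<close> would be such a
  section near \<open>\<phi> p\<close>, whereas the body of \<open>\<phi>\<^sup>*(s - d)\<close> vanishes at \<open>p\<close>.
\<close>

lemma pc_body:
  assumes \<phi>: "smor \<phi>" and W: "spl W \<Phi>" and Z: "spl Z \<Psi>" and U: "openin (base \<M>) U"
    and s: "s \<in> Sec U" and p: "p \<in> pre \<phi> U" "p \<in> W" "fst \<phi> p \<in> Z"
  shows "pc \<phi> \<Phi> W U s p {} = coeff \<Psi> Z U s (fst \<phi> p) {}"
proof (rule ccontr)
  assume ne: "\<not> ?thesis"
  have pt: "p \<in> topspace (base \<M>)" and q: "fst \<phi> p \<in> U" using p by (auto simp: pre_iff)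
  define d where "d = pc \<phi> \<Phi> W U s p {}"
  define f where "f = (\<lambda>x. coeff \<Psi> Z U s x {} + (- d))"
  have f_hol: "holo (U \<inter> Z) f"
    unfolding f_def by (intro holo_add holo_const coeff_holo[OF Z U s]) auto
  define V where "V = {x \<in> U \<inter> Z. f x \<in> - {0}}"
  have V: "openin (base \<M>) V"
    unfolding V_def by (rule holo_continuous[OF VW[OF Z U] f_hol]) auto
  have VU: "V \<subseteq> U" and VZ: "V \<subseteq> Z" by (auto simp: V_def)
  have qV: "fst \<phi> p \<in> V" using q p ne by (auto simp: V_def f_def d_def)
  then have pV: "p \<in> pre \<phi> V" using pt by (simp add: pre_iff)
  interpret R: ring "sections \<M> V" by (rule sections_ring[OF V])
  note P = \<phi> W V pV p(2)
  have fV: "holo V f" using f_hol VU VZ holo_subset by blast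
  have gV: "holo V (\<lambda>x. inverse (f x))" by (rule holo_inverse[OF fV]) (auto simp: V_def)
  define s' where "s' = restr \<M> U V s"
  have s': "s' \<in> Sec V" unfolding s'_def by (rule restr_closed[OF U V VU s])
  have cs': "coeff \<Psi> Z V s' x \<nu> = coeff \<Psi> Z U s x \<nu>" if "x \<in> V" "\<nu> \<in> multi" for x \<nu>
    unfolding s'_def by (rule coeff_restr[OF Z U V VU s that(1) _ that(2)]) (use that VZ in auto)
  define u where "u = s' \<oplus>\<^bsub>sections \<M> V\<^esub> ((- d) \<odot>\<^bsub>sections \<M> V\<^esub> \<one>\<^bsub>sections \<M> V\<^esub>)"
  have d1: "(- d) \<odot>\<^bsub>sections \<M> V\<^esub> \<one>\<^bsub>sections \<M> V\<^esub> \<in> Sec V"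
    by (rule sections_smult_closed[OF V]) simp
  have uV: "u \<in> Sec V" unfolding u_def using s' d1 V by simp
  have cu: "coeff \<Psi> Z V u x {} = f x" if "x \<in> V" for x
  proof -
    have "x \<in> Z" using that VZ by blast
    then show ?thesis
      unfolding u_def f_def using V that
      by (simp add: coeff_add[OF Z V s' d1] coeff_smult[OF Z V] coeff_one[OF Z V] unit_coeff_def cs')
  qed
  define r where "r = sec \<Psi> Z V (\<lambda>\<nu> x. if \<nu> = {} then 0 else coeff \<Psi> Z V u x \<nu>)"
  have cholo: "holo V (\<lambda>x. coeff \<Psi> Z V u x \<nu>)" if "\<nu> \<in> multi" for \<nu>
    using coeff_holo[OF Z V uV that] VZ by (simp add: inf.absorb1)
  have hr: "holo V ((\<lambda>\<nu> x. if \<nu> = {} then 0 else coeff \<Psi> Z V u x \<nu>) \<nu>)" if "\<nu> \<in> multi" for \<nu>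
    using cholo[OF that] by (cases "\<nu> = {}") (simp_all add: holo_const)
  have rV: "r \<in> Sec V" unfolding r_def by (rule sec_closed[OF Z V VZ hr])
  have cr: "coeff \<Psi> Z V r x \<nu> = (if \<nu> = {} then 0 else coeff \<Psi> Z V u x \<nu>)" if "x \<in> V" "\<nu> \<in> multi" for x \<nu>
    unfolding r_def by (rule coeff_sec[OF Z V VZ hr that])
  let ?F = "function_sec \<Psi> Z V f" and ?G = "function_sec \<Psi> Z V (\<lambda>x. inverse (f x))"
  have FV: "?F \<in> Sec V" and GV: "?G \<in> Sec V" using function_sec_closed[OF Z V VZ] fV gV by auto
  have "u = ?F \<oplus>\<^bsub>sections \<M> V\<^esub> r"
  proof (rule coeff_eqI_splitting[OF Z V VZ uV])
    fix y \<nu> assume y: "y \<in> V" and \<nu>: "\<nu> \<in> multi"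
    then have yZ: "y \<in> Z" using VZ by blast
    show "coeff \<Psi> Z V u y \<nu> = coeff \<Psi> Z V (?F \<oplus>\<^bsub>sections \<M> V\<^esub> r) y \<nu>"
      unfolding coeff_add[OF Z V FV rV y yZ \<nu>] cr[OF y \<nu>] coeff_function_sec[OF Z V VZ fV y \<nu>]
      using cu[OF y] by simp
  qed (use FV rV in simp)
  then have "pc \<phi> \<Phi> W V u p {} = pc \<phi> \<Phi> W V ?F p {} + pc \<phi> \<Phi> W V r p {}"
    using pc_add[OF P FV rV, of "{}"] by simp
  moreover have "pc \<phi> \<Phi> W V u p {} = 0"
  proof -
    have "pc \<phi> \<Phi> W V s' p {} = d"
      unfolding s'_def d_def by (rule pc_restr[OF P U VU s]) simp
    then show ?thesis
      using V by (simp add: u_def pc_add[OF P s' d1] pc_smult[OF P] pc_one[OF P] unit_coeff_def)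
  qed
  moreover have "pc \<phi> \<Phi> W V r p {} = 0"
  proof -
    have z: "0 \<odot>\<^bsub>sections \<M> V\<^esub> \<one>\<^bsub>sections \<M> V\<^esub> \<in> Sec V"
      by (rule sections_smult_closed[OF V]) simp
    have "r [^]\<^bsub>sections \<M> V\<^esub> Suc n = 0 \<odot>\<^bsub>sections \<M> V\<^esub> \<one>\<^bsub>sections \<M> V\<^esub>"
    proof (rule coeff_eqI_splitting[OF Z V VZ R.nat_pow_closed[OF rV] z])
      fix y \<nu> assume y: "y \<in> V" and \<nu>: "\<nu> \<in> multi"
      then have yZ: "y \<in> Z" using VZ by blast
      have "order_ge n (Suc n) (coeff \<Psi> Z V (r [^]\<^bsub>sections \<M> V\<^esub> Suc n) y)"
        by (rule coeff_power_order[OF Z V rV y yZ]) (simp add: cr[OF y])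
      then have "coeff \<Psi> Z V (r [^]\<^bsub>sections \<M> V\<^esub> Suc n) y \<nu> = 0"
        using \<nu> order_ge_large by blast
      then show "coeff \<Psi> Z V (r [^]\<^bsub>sections \<M> V\<^esub> Suc n) y \<nu> =
          coeff \<Psi> Z V (0 \<odot>\<^bsub>sections \<M> V\<^esub> \<one>\<^bsub>sections \<M> V\<^esub>) y \<nu>"
        using V by (simp add: coeff_smult[OF Z V _ y yZ \<nu>])
    qed
    then have "pc \<phi> \<Phi> W V r p {} ^ Suc n = pc \<phi> \<Phi> W V (0 \<odot>\<^bsub>sections \<M> V\<^esub> \<one>\<^bsub>sections \<M> V\<^esub>) p {}"
      using pc_body_power(2)[OF P rV, of "Suc n"] by simp
    also have "\<dots> = 0" using V by (simp add: pc_smult[OF P])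
    finally show ?thesis by auto
  qed
  ultimately have F0: "pc \<phi> \<Phi> W V ?F p {} = 0" by simp
  have "function_sec \<Psi> Z V (\<lambda>x. f x * inverse (f x)) = \<one>\<^bsub>sections \<M> V\<^esub>"
  proof (rule coeff_eqI_splitting[OF Z V VZ])
    fix y \<nu> assume y: "y \<in> V" and \<nu>: "\<nu> \<in> multi"
    then have yZ: "y \<in> Z" and "f y \<noteq> 0" using VZ by (auto simp: V_def)
    then show "coeff \<Psi> Z V (function_sec \<Psi> Z V (\<lambda>x. f x * inverse (f x))) y \<nu> = coeff \<Psi> Z V \<one>\<^bsub>sections \<M> V\<^esub> y \<nu>"
      using coeff_function_sec[OF Z V VZ holo_mult[OF fV gV] y \<nu>] coeff_one[OF Z V y yZ \<nu>]
      by (simp add: unit_coeff_def)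
  qed (use V in \<open>simp_all add: function_sec_closed[OF Z V VZ holo_mult[OF fV gV]]\<close>)
  then have "?F \<otimes>\<^bsub>sections \<M> V\<^esub> ?G = \<one>\<^bsub>sections \<M> V\<^esub>"
    using function_sec_mult[OF Z V VZ fV gV] by simp
  then have "pc \<phi> \<Phi> W V ?F p {} * pc \<phi> \<Phi> W V ?G p {} = 1"
    using pc_mult[OF P FV GV, of "{}"] pc_one[OF P, of "{}"] by (simp add: unit_coeff_def)
  with F0 show False by simp
qed

end


section \<open>Bounding pullbacks by the pullbacks of coordinates\<close>

text \<open>
  Chain rule: by the Hadamard decomposition around \<open>c = G w\<^sub>0\<close>, \<open>u(G w) - u(c)\<close> is a sum of
  products of a function that vanishes at \<open>w\<^sub>0\<close> and is differentiable there with a function that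
  is merely continuous, and such products are differentiable.
\<close>

lemma holomorphic_several_chain:
  assumes u: "holomorphic_several k P u" and P: "openin (top_of_set (cspace k)) P"
    and T: "open T" "w0 \<in> T" and GP: "\<And>w. w \<in> T \<Longrightarrow> G w \<in> P"
    and G: "\<And>i. i < k \<Longrightarrow> (\<lambda>w. G w i) holomorphic_on T"
  shows "(\<lambda>w. u (G w)) field_differentiable at w0"
proof -
  define c where "c = G w0"
  have c: "c \<in> P" using GP[OF T(2)] by (simp add: c_def)
  have PC: "P \<subseteq> cspace k" using openin_imp_subset[OF P] .
  have G_cont: "continuous_on T G"
  proof (rule continuous_on_coordinatewise_then_product)
    fix i show "continuous_on T (\<lambda>w. G w i)"
    proof (cases "i < k")
      case True then show ?thesis using G holomorphic_on_imp_continuous_on by blast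
    next
      case False
      have "G w i = 0" if "w \<in> T" for w
        using subsetD[OF PC GP[OF that]] False by (simp add: cspace_def)
      then have "continuous_on T (\<lambda>w. G w i) \<longleftrightarrow> continuous_on T (\<lambda>w. 0::complex)"
        by (intro continuous_on_cong) auto
      then show ?thesis by simp
    qed
  qed
  have u_cont: "continuous_on P u" using u by (simp add: holomorphic_several_def)
  have "openin (top_of_set P) (P \<inter> u -` ball (u c) 1)"
    using u_cont open_ball continuous_openin_preimage_gen by blast
  then have o: "openin (top_of_set (cspace k)) (P \<inter> u -` ball (u c) 1)" using P openin_trans by blast
  obtain r where r: "r > 0" "polydisc k c r \<subseteq> P \<inter> u -` ball (u c) 1"
    by (rule polydisc_in_open[OF o, of c]) (use c in auto)
  have rP: "polydisc k c r \<subseteq> P" using r by blast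
  have sep: "separately_holomorphic k (polydisc k c r) u"
    using holomorphic_several_subset[OF u rP] by (simp add: holomorphic_several_iff)
  have bd: "cmod (u z) \<le> cmod (u c) + 1" if "z \<in> polydisc k c r" for z
  proof -
    have "dist (u c) (u z) < 1" using r(2) that by auto
    then show ?thesis using norm_triangle_ineq2[of "u z" "u c"] by (simp add: dist_norm norm_minus_commute)
  qed
  have cc: "c \<in> polydisc k c (r/2)" using polydisc_centre[of c k "r/2"] c PC r by auto
  obtain h where h: "\<And>i. i < k \<Longrightarrow> holomorphic_several k (polydisc k c r) (h i)"
    "\<And>i z. i < k \<Longrightarrow> z \<in> polydisc k c r \<Longrightarrow> cmod (h i z) \<le> 4 * (cmod (u c) + 1) / r"
    "\<And>z. z \<in> polydisc k c r \<Longrightarrow> u z = u c + (\<Sum>i<k. (z i - c i) * h i z)"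
    by (rule Hadamard_decomposition[OF sep bd cc r(1)]) blast+
  obtain Q where Q: "open Q" "polydisc k c r = cspace k \<inter> Q"
    using openin_polydisc[of k c r] by (auto simp: openin_open)
  define S where "S = T \<inter> G -` Q"
  have S: "open S" using continuous_open_preimage[OF G_cont T(1) Q(1)] by (simp add: S_def)
  have SG: "G w \<in> polydisc k c r" if "w \<in> S" for w
    using that GP[of w] PC Q by (auto simp: S_def)
  have w0S: "w0 \<in> S"
  proof -
    have "c \<in> polydisc k c r" using polydisc_centre[of c k r] c PC r by auto
    then show ?thesis using T Q by (auto simp: S_def c_def)
  qed
  have term_deriv: "(\<lambda>w. (G w i - c i) * h i (G w)) field_differentiable at w0" if i: "i < k" for i
  proof -
    obtain d where d: "((\<lambda>w. G w i) has_field_derivative d) (at w0)"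
      using holomorphic_on_imp_differentiable_at[OF G[OF i] T] by (auto simp: field_differentiable_def)
    have q: "((\<lambda>w. (G w i - c i) / (w - w0)) \<longlongrightarrow> d) (at w0)"
      using d by (simp add: has_field_derivative_iff c_def)
    have "continuous_on S (\<lambda>w. h i (G w))"
      by (rule continuous_on_compose2[of "polydisc k c r"])
         (use h(1)[OF i] G_cont SG in \<open>auto simp: holomorphic_several_def S_def intro: continuous_on_subset\<close>)
    then have "isCont (\<lambda>w. h i (G w)) w0"
      using S w0S by (simp add: continuous_on_eq_continuous_at)
    then have "((\<lambda>w. h i (G w)) \<longlongrightarrow> h i (G w0)) (at w0)" by (simp add: isCont_def)
    with q have "((\<lambda>w. (G w i - c i) / (w - w0) * h i (G w)) \<longlongrightarrow> d * h i (G w0)) (at w0)"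
      by (rule tendsto_mult)
    then have "((\<lambda>w. (G w i - c i) * h i (G w)) has_field_derivative (d * h i (G w0))) (at w0)"
      by (simp add: has_field_derivative_iff c_def)
    then show ?thesis by (auto simp: field_differentiable_def)
  qed
  have "(\<lambda>w. u c + (\<Sum>i<k. (G w i - c i) * h i (G w))) field_differentiable at w0"
    by (intro field_differentiable_add field_differentiable_const field_differentiable_sum term_deriv) auto
  then obtain D where "((\<lambda>w. u c + (\<Sum>i<k. (G w i - c i) * h i (G w))) has_field_derivative D) (at w0)"
    by (auto simp: field_differentiable_def)
  then have "((\<lambda>w. u (G w)) has_field_derivative D) (at w0)"
    by (rule has_field_derivative_transform_within_open[OF _ S w0S]) (simp add: h(3)[OF SG])
  then show ?thesis by (auto simp: field_differentiable_def)
qed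

text \<open>
  The constant after \<open>d\<close> nested Hadamard decompositions: each produces \<open>k\<close> quotients, of size
  \<open>4 / r\<close> relative to the function, and multiplies their pullbacks by a nilpotent of size \<open>R\<close> in an
  exterior algebra on \<open>N\<close> generators.
\<close>

primrec iterated_bound :: "nat \<Rightarrow> nat \<Rightarrow> real \<Rightarrow> real \<Rightarrow> nat \<Rightarrow> real" where
  "iterated_bound k N r R 0 = 0"
| "iterated_bound k N r R (Suc d) = 1 + k * (iterated_bound k N r R d * (2 ^ N * R) * (4 / r))"

lemma iterated_bound_nonneg: "r > 0 \<Longrightarrow> R \<ge> 0 \<Longrightarrow> iterated_bound k N r R d \<ge> 0"
  by (induction d) auto

context compact_super
begin

text \<open>The chain rule for the transition maps between \<open>(E, \<mu>)\<close> and the other charts of the atlas.\<close>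

lemma holo_of_chart:
  assumes at: "(E, \<mu>) \<in> atlas \<M>" and V: "openin (base \<M>) V" "V \<subseteq> E"
    and u: "holomorphic_several m (\<mu> ` V) u"
  shows "holo V (\<lambda>x. u (\<mu> x))"
  unfolding holo_def
proof (clarify)
  fix D \<kappa> assume at': "(D, \<kappa>) \<in> atlas \<M>"
  let ?I = "inv_into D \<kappa>" and ?S = "\<kappa> ` (D \<inter> V)"
  have EV: "E \<inter> V = V" using V by blast
  have So: "openin (top_of_set (cspace m)) ?S" by (rule chart_image_open[OF at' V(1)])
  have Vo: "openin (top_of_set (cspace m)) (\<mu> ` V)" using chart_image_open[OF at V(1)] EV by simp
  have IV: "?I z \<in> V" if "z \<in> ?S" for z using that at' by auto
  have sub: "?S \<subseteq> \<kappa> ` (D \<inter> E)" using V by blast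
  have tr: "holomorphic_several m ?S (\<lambda>z. \<mu> (?I z) i)" if "i < m" for i
    using atlas_transition[OF at' at] that holomorphic_several_subset[OF _ sub]
    by (auto simp: holomorphic_transition_def)
  have trc: "continuous_on ?S (\<lambda>z. \<mu> (?I z))"
  proof (rule continuous_on_coordinatewise_then_product)
    fix i show "continuous_on ?S (\<lambda>z. \<mu> (?I z) i)"
    proof (cases "i < m")
      case True then show ?thesis using tr by (simp add: holomorphic_several_def)
    next
      case False
      have "\<mu> (?I z) i = 0" if "z \<in> ?S" for z
        using chart_cspace[OF at, of "?I z"] IV[OF that] V False by (auto simp: cspace_def)
      then have "continuous_on ?S (\<lambda>z. \<mu> (?I z) i) \<longleftrightarrow> continuous_on ?S (\<lambda>z. 0::complex)"
        by (intro continuous_on_cong) auto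
      then show ?thesis by simp
    qed
  qed
  show "holomorphic_several m ?S (\<lambda>z. u (\<mu> (?I z)))"
    unfolding holomorphic_several_def
  proof (intro conjI ballI allI impI)
    show "continuous_on ?S (\<lambda>z. u (\<mu> (?I z)))"
      by (rule continuous_on_compose2[OF _ trc]) (use u IV in \<open>auto simp: holomorphic_several_def\<close>)
    fix z l assume z: "z \<in> ?S" and l: "l < m"
    obtain r where r: "r > 0" "polydisc m z r \<subseteq> ?S" using polydisc_in_open[OF So z] by blast
    have zc: "z \<in> polydisc m z r"
      using z r chart_cspace[OF at'] by (auto intro!: polydisc_centre)
    show "(\<lambda>w. u (\<mu> (?I (z(l := w))))) field_differentiable at (z l)"
    proof (rule holomorphic_several_chain[OF u Vo open_ball, of _ "z l" r])
      show "\<mu> (?I (z(l := w))) \<in> \<mu> ` V" if "w \<in> ball (z l) r" for w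
        using IV polydisc_upd[OF zc l that] r by blast
      show "(\<lambda>w. \<mu> (?I (z(l := w))) i) holomorphic_on ball (z l) r" if "i < m" for i
      proof -
        have "separately_holomorphic m (polydisc m z r) (\<lambda>z. \<mu> (?I z) i)"
          using holomorphic_several_subset[OF tr[OF that] r(2)] by (simp add: holomorphic_several_iff)
        from separately_holomorphic_slice[OF this zc l] show ?thesis .
      qed
    qed (use r in simp)
  qed
qed

lemma holo_pullback:
  assumes \<phi>: "smor \<phi>" and U: "openin (base \<M>) U" and f: "holo U f"
  shows "holo (pre \<phi> U) (\<lambda>x. f (fst \<phi> x))"
proof (rule holo_local[OF pre_open[OF \<phi> U]])
  fix p assume p: "p \<in> pre \<phi> U"
  then have pt: "p \<in> topspace (base \<M>)" and qt: "fst \<phi> p \<in> U" by (auto simp: pre_iff)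
  obtain W \<Phi> where W: "p \<in> W" "spl W \<Phi>" using spl_exists[OF pt] by blast
  obtain Z \<Psi> where Z: "fst \<phi> p \<in> Z" "spl Z \<Psi>" using spl_exists[OF smor_topspace[OF \<phi> pt]] by blast
  define V where "V = U \<inter> Z"
  have V: "openin (base \<M>) V" "V \<subseteq> Z" using U spl_open[OF Z(2)] by (auto simp: V_def)
  have fV: "holo V f" using f holo_subset by (auto simp: V_def)
  let ?s = "function_sec \<Psi> Z V f"
  have s: "?s \<in> Sec V" by (rule function_sec_closed[OF Z(2) V fV])
  have "holo (pre \<phi> V \<inter> W) (\<lambda>x. pc \<phi> \<Phi> W V ?s x {})"
    unfolding pc_def by (rule coeff_holo[OF W(2) pre_open[OF \<phi> V(1)] smor_closed[OF \<phi> V(1) s]]) simp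
  then have "holo (pre \<phi> V \<inter> W) (\<lambda>x. f (fst \<phi> x))"
  proof (rule holo_cong[rotated 2])
    show o: "openin (base \<M>) (pre \<phi> V \<inter> W)" using VW[OF W(2) pre_open[OF \<phi> V(1)]] .
    fix x assume x: "x \<in> pre \<phi> V \<inter> W"
    then have "fst \<phi> x \<in> V" by (simp add: pre_iff)
    then show "pc \<phi> \<Phi> W V ?s x {} = f (fst \<phi> x)"
      using x V pc_body[OF \<phi> W(2) Z(2) V(1) s, of x] coeff_function_sec[OF Z(2) V fV, of "fst \<phi> x" "{}"] by auto
  qed
  then show "\<exists>Y. openin (base \<M>) Y \<and> p \<in> Y \<and> Y \<subseteq> pre \<phi> U \<and> holo Y (\<lambda>x. f (fst \<phi> x))"
    using VW[OF W(2) pre_open[OF \<phi> V(1)]] pt qt W Z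
    by (intro exI[of _ "pre \<phi> V \<inter> W"]) (auto simp: pre_iff V_def)
qed

lemma holomorphic_mapI:
  assumes cont: "continuous_map (base \<M>) (base \<M>) g"
    and pull: "\<And>V f. openin (base \<M>) V \<Longrightarrow> holo V f \<Longrightarrow> holo {x \<in> topspace (base \<M>). g x \<in> V} (\<lambda>x. f (g x))"
  shows "holomorphic_map \<M> \<M> g"
  unfolding holomorphic_map_def
proof (intro conjI cont ballI, clarify)
  fix D \<kappa> E \<mu> i assume at: "(D, \<kappa>) \<in> atlas \<M>" "(E, \<mu>) \<in> atlas \<M>" and i: "i < m"
  have "holo {x \<in> topspace (base \<M>). g x \<in> E} (\<lambda>x. \<mu> (g x) i)"
    by (rule pull[OF chart_homeomorphic(2)[OF at(2)] holo_coordinate[OF at(2) i]])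
  from holo_chart[OF this at(1)]
  have "holomorphic_several m (\<kappa> ` (D \<inter> {x \<in> topspace (base \<M>). g x \<in> E})) (\<lambda>z. \<mu> (g (inv_into D \<kappa> z)) i)" .
  moreover have "D \<inter> {x \<in> topspace (base \<M>). g x \<in> E} = {p \<in> D. g p \<in> E}"
    using openin_subset[OF chart_homeomorphic(2)[OF at(1)]] by auto
  ultimately show "holomorphic_several m (\<kappa> ` {p \<in> D. g p \<in> E}) (\<lambda>z. \<mu> (g (inv_into D \<kappa> z)) i)" by simp
qed

lemma grading_submodule:
  "openin (base \<M>) U \<Longrightarrow> submodule (grading \<M> U i) complex_field (sections \<M> U)"
  using sections_superalgebra by (simp add: superalgebra_def)

lemma grading_subset: "openin (base \<M>) U \<Longrightarrow> grading \<M> U i \<subseteq> Sec U"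
  using subgroup.subset[OF submodule.axioms(1)[OF grading_submodule[of U i]]] by simp

lemma pre_id: "openin (base \<M>) U \<Longrightarrow> pre (id_morphism \<M>) U = U"
  using openin_subset[of "base \<M>" U] by (auto simp: preimage_def id_morphism_def)

lemma snd_id: "openin (base \<M>) U \<Longrightarrow> s \<in> Sec U \<Longrightarrow> snd (id_morphism \<M>) U s = s"
  by (simp add: id_morphism_def)

lemma smor_id: "smor (id_morphism \<M>)"
  unfolding supermorphism_def
proof (intro conjI ballI impI)
  show "holomorphic_map \<M> \<M> (fst (id_morphism \<M>))"
  proof (rule holomorphic_mapI)
    have "continuous_map (base \<M>) (base \<M>) (\<lambda>x. x)" by simp
    then show "continuous_map (base \<M>) (base \<M>) (fst (id_morphism \<M>))"
      by (rule continuous_map_eq) (simp add: id_morphism_def)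
    fix V f assume V: "openin (base \<M>) V" and f: "holo V f"
    have "{x \<in> topspace (base \<M>). fst (id_morphism \<M>) x \<in> V} = V" using pre_id[OF V] by (simp add: preimage_def)
    moreover have "holo V (\<lambda>x. f (fst (id_morphism \<M>) x))"
      by (rule holo_cong[OF V _ f]) (use openin_subset[OF V] in \<open>auto simp: id_morphism_def\<close>)
    ultimately show "holo {x \<in> topspace (base \<M>). fst (id_morphism \<M>) x \<in> V} (\<lambda>x. f (fst (id_morphism \<M>) x))" by simp
  qed
  fix U assume "U \<in> opens \<M>"
  then have U: "openin (base \<M>) U" by simp
  show "snd (id_morphism \<M>) U \<in> extensional (Sec U)" using U by (simp add: id_morphism_def)
  interpret R: ring "sections \<M> U" by (rule sections_ring[OF U])
  have gr: "grading \<M> U i \<subseteq> Sec U" for i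
    by (rule grading_subset[OF U])
  show "superalgebra_hom (sections \<M> U) (grading \<M> U) (sections \<M> (pre (id_morphism \<M>) U))
          (grading \<M> (pre (id_morphism \<M>) U)) (snd (id_morphism \<M>) U)"
    unfolding superalgebra_hom_def pre_id[OF U]
    using snd_id[OF U] gr sections_smult_closed[OF U]
    by (auto simp: Ring.ring_hom_def subset_iff)
  fix V s assume "V \<in> opens \<M>" and VU: "V \<subseteq> U" and s: "s \<in> Sec U"
  then have V: "openin (base \<M>) V" by simp
  show "snd (id_morphism \<M>) V (restr \<M> U V s) =
      restr \<M> (pre (id_morphism \<M>) U) (pre (id_morphism \<M>) V) (snd (id_morphism \<M>) U s)"
    by (simp add: pre_id[OF U] pre_id[OF V] snd_id[OF U s] snd_id[OF V restr_closed[OF U V VU s]])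
qed (auto simp: id_morphism_def)

lemma pc_id: "openin (base \<M>) U \<Longrightarrow> s \<in> Sec U \<Longrightarrow> pc (id_morphism \<M>) \<Phi> W U s x \<nu> = coeff \<Phi> W U s x \<nu>"
  by (simp add: pc_def pre_id snd_id)

text \<open>
  By \<open>pc_body\<close>, the pullback of a single \<open>\<theta>\<^sub>j\<close> has vanishing body, that is, order at least \<open>1\<close>;
  orders add under products.
\<close>

lemma pc_monomial_sec_order:
  assumes \<phi>: "smor \<phi>" and W: "spl W \<Phi>" and Z: "spl Z \<Psi>" and U: "openin (base \<M>) U" "U \<subseteq> Z"
    and x: "x \<in> pre \<phi> U" "x \<in> W" and \<mu>: "\<mu> \<in> multi"
  shows "order_ge n (card \<mu>) (pc \<phi> \<Phi> W U (monomial_sec \<Psi> Z U \<mu>) x)"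
proof -
  have fx: "fst \<phi> x \<in> U" "fst \<phi> x \<in> Z" using x U by (auto simp: pre_iff)
  have "finite \<mu>" using \<mu> finite_subset by blast
  then show ?thesis using \<mu>
  proof (induction \<mu>)
    case (insert j \<mu>)
    note P = \<phi> W U(1) x and C = monomial_sec_closed[OF Z U]
    have mj: "\<mu> \<in> multi" "{j} \<in> multi" "\<mu> \<inter> {j} = {}" using insert by auto
    have "pc \<phi> \<Phi> W U (monomial_sec \<Psi> Z U {j}) x {} = 0"
      unfolding pc_body[OF \<phi> W Z U(1) C x fx(2)] by (subst coeff_monomial_sec[OF Z U fx(1)]) (auto simp: unit_coeff_def)
    then have "order_ge n (card \<mu> + 1) (wedge (pc \<phi> \<Phi> W U (monomial_sec \<Psi> Z U \<mu>) x) (pc \<phi> \<Phi> W U (monomial_sec \<Psi> Z U {j}) x))"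
      by (intro order_ge_wedge insert.IH mj) (simp add: order_ge_1)
    moreover have "wedge (pc \<phi> \<Phi> W U (monomial_sec \<Psi> Z U \<mu>) x) (pc \<phi> \<Phi> W U (monomial_sec \<Psi> Z U {j}) x) \<nu> =
        wedge_sign \<mu> {j} * pc \<phi> \<Phi> W U (monomial_sec \<Psi> Z U (insert j \<mu>)) x \<nu>" if "\<nu> \<in> multi" for \<nu>
      unfolding pc_mult[OF P C C that, symmetric] monomial_sec_mult[OF Z U mj]
      using pc_smult[OF P C that] by simp
    ultimately show ?case
      using insert.hyps wedge_sign_nonzero by (auto simp: order_ge_def)
  qed simp
qed

lemma function_sec_cong:
  assumes Z: "spl Z \<Psi>" and U: "openin (base \<M>) U" "U \<subseteq> Z" and f: "holo U f" and eq: "\<And>x. x \<in> U \<Longrightarrow> f x = g x"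
  shows "function_sec \<Psi> Z U f = function_sec \<Psi> Z U g"
proof -
  have g: "holo U g" by (rule holo_cong[OF U(1) eq f])
  show ?thesis
    by (rule coeff_eqI_splitting[OF Z U function_sec_closed[OF Z U f] function_sec_closed[OF Z U g]])
       (simp add: coeff_function_sec[OF Z U f] coeff_function_sec[OF Z U g] eq)
qed

text \<open>Writing a section as \<open>\<Sum>\<^sub>\<nu> s\<^sub>\<nu> \<theta>\<^sup>\<nu>\<close> and pulling back term by term.\<close>

lemma pc_expand:
  assumes \<phi>: "smor \<phi>" and W: "spl W \<Phi>" and Z: "spl Z \<Psi>" and U: "openin (base \<M>) U" "U \<subseteq> Z"
    and x: "x \<in> pre \<phi> U" "x \<in> W" and s: "s \<in> Sec U" and \<rho>: "\<rho> \<in> multi"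
  shows "pc \<phi> \<Phi> W U s x \<rho> =
    (\<Sum>\<nu>\<in>multi. wedge (pc \<phi> \<Phi> W U (function_sec \<Psi> Z U (\<lambda>y. coeff \<Psi> Z U s y \<nu>)) x)
                       (pc \<phi> \<Phi> W U (monomial_sec \<Psi> Z U \<nu>) x) \<rho>)"
proof -
  note P = \<phi> W U(1) x
  have UZ: "U \<inter> Z = U" using U by blast
  have ch: "holo U (\<lambda>y. coeff \<Psi> Z U s y \<nu>)" if "\<nu> \<in> multi" for \<nu>
    using coeff_holo[OF Z U(1) s that] UZ by simp
  define part where "part A = sec \<Psi> Z U (\<lambda>\<nu> y. if \<nu> \<in> A then coeff \<Psi> Z U s y \<nu> else 0)" for A
  have ph: "holo U ((\<lambda>\<nu> y. if \<nu> \<in> A then coeff \<Psi> Z U s y \<nu> else 0) \<nu>)" if "\<nu> \<in> multi" for A \<nu>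
    using ch[OF that] by (cases "\<nu> \<in> A") (simp_all add: holo_const)
  have pC: "part A \<in> Sec U" for A unfolding part_def by (rule sec_closed[OF Z U ph])
  have cp: "coeff \<Psi> Z U (part A) y \<nu> = (if \<nu> \<in> A then coeff \<Psi> Z U s y \<nu> else 0)"
    if "y \<in> U" "\<nu> \<in> multi" for A y \<nu>
    unfolding part_def by (rule coeff_sec[OF Z U ph that])
  let ?f = "\<lambda>\<nu>. function_sec \<Psi> Z U (\<lambda>y. coeff \<Psi> Z U s y \<nu>)" and ?e = "monomial_sec \<Psi> Z U"
  have fC: "?f \<nu> \<in> Sec U" if "\<nu> \<in> multi" for \<nu> by (rule function_sec_closed[OF Z U ch[OF that]])
  have eC: "?e \<nu> \<in> Sec U" for \<nu> by (rule monomial_sec_closed[OF Z U])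
  have "pc \<phi> \<Phi> W U (part A) x \<rho> = (\<Sum>\<nu>\<in>A. wedge (pc \<phi> \<Phi> W U (?f \<nu>) x) (pc \<phi> \<Phi> W U (?e \<nu>) x) \<rho>)"
    if "finite A" "A \<subseteq> multi" for A
    using that
  proof (induction A)
    case empty
    have z: "0 \<odot>\<^bsub>sections \<M> U\<^esub> \<one>\<^bsub>sections \<M> U\<^esub> \<in> Sec U" by (rule sections_smult_closed[OF U(1)]) (simp add: U(1))
    have "part {} = 0 \<odot>\<^bsub>sections \<M> U\<^esub> \<one>\<^bsub>sections \<M> U\<^esub>"
    proof (rule coeff_eqI_splitting[OF Z U pC z])
      fix y \<nu> assume y: "y \<in> U" and \<nu>: "\<nu> \<in> multi"
      then have "y \<in> Z" using U by blast
      then show "coeff \<Psi> Z U (part {}) y \<nu> = coeff \<Psi> Z U (0 \<odot>\<^bsub>sections \<M> U\<^esub> \<one>\<^bsub>sections \<M> U\<^esub>) y \<nu>"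
        using coeff_smult[OF Z U(1) _ y _ \<nu>, of "\<one>\<^bsub>sections \<M> U\<^esub>" 0] cp[OF y \<nu>] U(1) by simp
    qed
    then show ?case using pc_smult[OF P _ \<rho>, of "\<one>\<^bsub>sections \<M> U\<^esub>" 0] U(1) by simp
  next
    case (insert \<nu>0 A)
    then have \<nu>0: "\<nu>0 \<in> multi" by auto
    have prod: "?f \<nu>0 \<otimes>\<^bsub>sections \<M> U\<^esub> ?e \<nu>0 \<in> Sec U" using fC[OF \<nu>0] eC U(1) by simp
    have "part (insert \<nu>0 A) = part A \<oplus>\<^bsub>sections \<M> U\<^esub> (?f \<nu>0 \<otimes>\<^bsub>sections \<M> U\<^esub> ?e \<nu>0)"
    proof (rule coeff_eqI_splitting[OF Z U pC])
      fix y \<nu> assume y: "y \<in> U" and \<nu>: "\<nu> \<in> multi"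
      then have yZ: "y \<in> Z" using U by blast
      show "coeff \<Psi> Z U (part (insert \<nu>0 A)) y \<nu> =
          coeff \<Psi> Z U (part A \<oplus>\<^bsub>sections \<M> U\<^esub> (?f \<nu>0 \<otimes>\<^bsub>sections \<M> U\<^esub> ?e \<nu>0)) y \<nu>"
        unfolding coeff_add[OF Z U(1) pC prod y yZ \<nu>] coeff_function_sec_mult[OF Z U ch[OF \<nu>0] eC y \<nu>]
          coeff_monomial_sec[OF Z U y \<nu>] cp[OF y \<nu>]
        using insert.hyps by (auto simp: unit_coeff_def)
    qed (use pC prod U(1) in simp)
    then show ?case
      using insert pc_add[OF P pC prod \<rho>] pc_mult[OF P fC[OF \<nu>0] eC \<rho>] by simp
  qed
  from this[of multi] have "pc \<phi> \<Phi> W U (part multi) x \<rho> =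
      (\<Sum>\<nu>\<in>multi. wedge (pc \<phi> \<Phi> W U (?f \<nu>) x) (pc \<phi> \<Phi> W U (?e \<nu>) x) \<rho>)" by simp
  moreover have "part multi = s"
    by (rule coeff_eqI_splitting[OF Z U pC s]) (simp add: cp)
  ultimately show ?thesis by simp
qed


text \<open>
  \<open>\<phi>\<close> and a point \<open>p\<close> give an algebra homomorphism from sections near \<open>\<phi> p\<close> to the exterior
  algebra. On a function \<open>h\<close>, the Hadamard decomposition reduces it to the homomorphism on the
  quotients \<open>h\<^sub>i\<close>, multiplied by the nilpotent parts of the pulled back coordinates; after
  \<open>n + 1\<close> steps the product of the nilpotents is \<open>0\<close>. The multiplier \<open>y\<close> carries the product
  accumulated so far, and \<open>d\<close> counts the steps that remain until its order exceeds \<open>n\<close>.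
\<close>

lemma pc_function_sec_bound:
  assumes \<phi>: "smor \<phi>" and W: "spl W \<Phi>" and Z: "spl Z \<Psi>" and at: "(E, \<mu>) \<in> atlas \<M>"
    and q: "q \<in> E" and r: "r > 0" and R: "R \<ge> 0"
    and P: "chart_disc E \<mu> q r \<subseteq> E \<inter> Z" "\<mu> ` chart_disc E \<mu> q r = polydisc m (\<mu> q) r"
    and p: "p \<in> pre \<phi> (chart_disc E \<mu> q r)" "p \<in> W" and half: "\<mu> (fst \<phi> p) \<in> polydisc m (\<mu> q) (r/2)"
    and X: "\<And>i \<nu>. i < m \<Longrightarrow> \<nu> \<in> multi \<Longrightarrow>
              cmod (pc \<phi> \<Phi> W (E \<inter> Z) (function_sec \<Psi> Z (E \<inter> Z) (\<lambda>x. \<mu> x i)) p \<nu>) \<le> R"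
    and h: "holo (chart_disc E \<mu> q r) h" "\<And>x. x \<in> chart_disc E \<mu> q r \<Longrightarrow> cmod (h x) \<le> B"
    and y: "\<And>\<nu>. \<nu> \<in> multi \<Longrightarrow> cmod (y \<nu>) \<le> a" "order_ge n (Suc n - d) y" and \<nu>: "\<nu> \<in> multi"
  shows "cmod (wedge y (pc \<phi> \<Phi> W (chart_disc E \<mu> q r) (function_sec \<Psi> Z (chart_disc E \<mu> q r) h) p) \<nu>)
           \<le> iterated_bound m n r R d * a * B"
  using h y \<nu>
proof (induction d arbitrary: h B y a \<nu>)
  case 0
  have "wedge y x \<nu> = 0" for x
    unfolding wedge_def
  proof (rule sum.neutral, rule ballI)
    fix \<mu> assume "\<mu> \<in> Pow \<nu>"
    then have "y \<mu> = 0" using 0(4,5) order_ge_large[of n "Suc n" y \<mu>] by auto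
    then show "wedge_sign \<mu> (\<nu> - \<mu>) * y \<mu> * x (\<nu> - \<mu>) = 0" by simp
  qed
  then show ?case by simp
next
  case (Suc d)
  let ?P = "chart_disc E \<mu> q r" and ?Q = "E \<inter> Z"
  have PO: "openin (base \<M>) ?P" by (rule openin_chart_disc[OF at])
  have QO: "openin (base \<M>) ?Q" using chart_homeomorphic(2)[OF at] spl_open[OF Z] by blast
  have PZ: "?P \<subseteq> Z" and PE: "?P \<subseteq> E" using P by auto
  note pcr = \<phi> W PO p and fc = function_sec_closed[OF Z PO PZ]
  define pf where "pf f = pc \<phi> \<Phi> W ?P (function_sec \<Psi> Z ?P f) p" for f
  have fp: "fst \<phi> p \<in> ?P" using p by (simp add: pre_iff)
  define c where "c = \<mu> (fst \<phi> p)"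
  have pf_add: "pf (\<lambda>x. f x + g x) \<rho> = pf f \<rho> + pf g \<rho>" if "holo ?P f" "holo ?P g" "\<rho> \<in> multi" for f g \<rho>
    unfolding pf_def function_sec_add[OF Z PO PZ that(1,2)]
    by (rule pc_add[OF pcr fc[OF that(1)] fc[OF that(2)] that(3)])
  have pf_mult: "pf (\<lambda>x. f x * g x) \<rho> = wedge (pf f) (pf g) \<rho>" if "holo ?P f" "holo ?P g" "\<rho> \<in> multi" for f g \<rho>
    unfolding pf_def function_sec_mult[OF Z PO PZ that(1,2)]
    by (rule pc_mult[OF pcr fc[OF that(1)] fc[OF that(2)] that(3)])
  have pf_const: "pf (\<lambda>_. z) \<rho> = z * unit_coeff {} \<rho>" if "\<rho> \<in> multi" for z \<rho>
    unfolding pf_def function_sec_const[OF Z PO PZ]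
    using pc_smult[OF pcr _ that, of "\<one>\<^bsub>sections \<M> ?P\<^esub>" z] pc_one[OF pcr that] PO by simp
  have pf_sum: "pf (\<lambda>x. \<Sum>i\<in>I. f i x) \<rho> = (\<Sum>i\<in>I. pf (f i) \<rho>)"
    if "finite I" "\<And>i. i \<in> I \<Longrightarrow> holo ?P (f i)" "\<rho> \<in> multi" for I :: "nat set" and f \<rho>
    using that(1,2)
  proof (induction I)
    case empty then show ?case using pf_const[OF that(3), of 0] by simp
  next
    case (insert i I)
    then have "pf (\<lambda>x. f i x + (\<Sum>i\<in>I. f i x)) \<rho> = pf (f i) \<rho> + pf (\<lambda>x. \<Sum>i\<in>I. f i x) \<rho>"
      by (intro pf_add holo_sum that(3)) auto
    with insert show ?case by simp
  qed
  have pf_body: "pf f {} = f (fst \<phi> p)" if "holo ?P f" for f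
    unfolding pf_def using pc_body[OF \<phi> W Z PO fc[OF that] p] fp PZ
      coeff_function_sec[OF Z PO PZ that fp, of "{}"] by auto
  have coord_Q: "holo ?Q (\<lambda>x. \<mu> x i)" and coord: "holo ?P (\<lambda>x. \<mu> x i)" if "i < m" for i
    using holo_coordinate[OF at that] holo_subset PE by blast+
  have pf_coord: "cmod (pf (\<lambda>x. \<mu> x i) \<rho>) \<le> R" if "i < m" "\<rho> \<in> multi" for i \<rho>
  proof -
    have "pf (\<lambda>x. \<mu> x i) \<rho> = pc \<phi> \<Phi> W ?P (restr \<M> ?Q ?P (function_sec \<Psi> Z ?Q (\<lambda>x. \<mu> x i))) p \<rho>"
      unfolding pf_def by (subst restr_function_sec[OF Z QO _ coord_Q[OF that(1)] PO P(1)]) auto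
    also have "\<dots> = pc \<phi> \<Phi> W ?Q (function_sec \<Psi> Z ?Q (\<lambda>x. \<mu> x i)) p \<rho>"
      by (rule pc_restr[OF pcr QO P(1) function_sec_closed[OF Z QO _ coord_Q[OF that(1)]] that(2)]) auto
    finally show ?thesis using X[OF that] by simp
  qed
  \<comment> \<open>The nilpotent part of the pulled back \<open>i\<close>-th coordinate.\<close>
  define N where "N i = pf (\<lambda>x. \<mu> x i + (- c i))" for i
  have ci: "holo ?P (\<lambda>x. \<mu> x i + (- c i))" if "i < m" for i
    by (intro holo_add coord that holo_const)
  have N_order: "order_ge n 1 (N i)" if "i < m" for i
    using pf_body[OF ci[OF that]] by (simp add: order_ge_1 N_def c_def)
  have N_bound: "cmod (N i \<rho>) \<le> R" if "i < m" "\<rho> \<in> multi" for i \<rho>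
  proof (cases "\<rho> = {}")
    case True
    then show ?thesis using pf_body[OF ci[OF that(1)]] R by (simp add: N_def c_def)
  next
    case False
    have "N i \<rho> = pf (\<lambda>x. \<mu> x i) \<rho> + pf (\<lambda>_. - c i) \<rho>"
      unfolding N_def by (rule pf_add[OF coord[OF that(1)] holo_const that(2)])
    then show ?thesis using pf_coord[OF that] pf_const[OF that(2)] False by (simp add: unit_coeff_def)
  qed
  let ?I = "inv_into E \<mu>"
  have IP: "?I z \<in> ?P" if "z \<in> polydisc m (\<mu> q) r" for z
  proof -
    have "z \<in> \<mu> ` ?P" using that by (simp only: P(2))
    then obtain x where "x \<in> ?P" "z = \<mu> x" by (elim imageE)
    then show ?thesis using PE chart_inv[OF at] by auto
  qed
  have EP: "E \<inter> ?P = ?P" using PE by blast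
  have "holomorphic_several m (polydisc m (\<mu> q) r) (\<lambda>z. h (?I z))"
    using holo_chart[OF Suc.prems(1) at] by (simp add: EP P(2))
  then have sep: "separately_holomorphic m (polydisc m (\<mu> q) r) (\<lambda>z. h (?I z))"
    by (simp add: holomorphic_several_iff)
  have hb: "cmod (h (?I z)) \<le> B" if "z \<in> polydisc m (\<mu> q) r" for z using IP[OF that] Suc.prems(2) by blast
  have half': "c \<in> polydisc m (\<mu> q) (r/2)" using half by (simp add: c_def)
  obtain g where g: "\<And>i. i < m \<Longrightarrow> holomorphic_several m (polydisc m (\<mu> q) r) (g i)"
    "\<And>i z. i < m \<Longrightarrow> z \<in> polydisc m (\<mu> q) r \<Longrightarrow> cmod (g i z) \<le> 4 * B / r"
    "\<And>z. z \<in> polydisc m (\<mu> q) r \<Longrightarrow> h (?I z) = h (?I c) + (\<Sum>i<m. (z i - c i) * g i z)"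
    by (rule Hadamard_decomposition[OF sep hb half' r]) blast+
  define k where "k i x = g i (\<mu> x)" for i x
  have k_hol: "holo ?P (k i)" if "i < m" for i
    unfolding k_def by (rule holo_of_chart[OF at PO PE]) (simp add: P(2) g(1)[OF that])
  have k_bd: "cmod (k i x) \<le> 4 * B / r" if "i < m" "x \<in> ?P" for i x
    unfolding k_def using imageI[OF that(2), of \<mu>] by (intro g(2)[OF that(1)]) (simp only: P(2))
  have fpE: "fst \<phi> p \<in> E" using fp PE by blast
  have dec: "h x = h (fst \<phi> p) + (\<Sum>i<m. (\<mu> x i + (- c i)) * k i x)" if x: "x \<in> ?P" for x
  proof -
    have "\<mu> x \<in> polydisc m (\<mu> q) r" using imageI[OF x, of \<mu>] by (simp only: P(2))
    from g(3)[OF this] show ?thesis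
      using chart_inv[OF at] x PE fpE by (auto simp: k_def c_def)
  qed
  have prod_hol: "holo ?P (\<lambda>x. (\<mu> x i + (- c i)) * k i x)" if "i < m" for i
    by (rule holo_mult[OF ci[OF that] k_hol[OF that]])
  \<comment> \<open>The pulled back Hadamard decomposition. Its right hand side is multiplied by \<open>y\<close> below, and
    each factor \<open>N i\<close> is absorbed into the multiplier.\<close>
  have pfh: "pf h \<rho> = h (fst \<phi> p) * unit_coeff {} \<rho> + (\<Sum>i<m. wedge (N i) (pf (k i)) \<rho>)" if \<rho>: "\<rho> \<in> multi" for \<rho>
  proof -
    have sum_hol: "holo ?P (\<lambda>x. \<Sum>i<m. (\<mu> x i + (- c i)) * k i x)" by (rule holo_sum) (use prod_hol in simp)
    have "pf h \<rho> = pf (\<lambda>x. h (fst \<phi> p) + (\<Sum>i<m. (\<mu> x i + (- c i)) * k i x)) \<rho>"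
      unfolding pf_def by (subst function_sec_cong[OF Z PO PZ Suc.prems(1) dec]) auto
    also have "\<dots> = pf (\<lambda>_. h (fst \<phi> p)) \<rho> + (\<Sum>i<m. pf (\<lambda>x. (\<mu> x i + (- c i)) * k i x) \<rho>)"
      by (subst pf_add[OF holo_const sum_hol \<rho>], subst pf_sum) (use prod_hol \<rho> in auto)
    also have "\<dots> = h (fst \<phi> p) * unit_coeff {} \<rho> + (\<Sum>i<m. wedge (N i) (pf (k i)) \<rho>)"
      unfolding N_def using pf_const[OF \<rho>] pf_mult[OF ci k_hol \<rho>] by simp
    finally show ?thesis .
  qed
  have finnu: "finite \<nu>" using Suc.prems(5) finite_subset by blast
  have submulti: "\<rho> \<in> multi" if "\<rho> \<subseteq> \<nu>" for \<rho> using that Suc.prems(5) by auto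
  have B0: "B \<ge> 0" using order.trans[OF norm_ge_zero Suc.prems(2)[OF fp]] .
  have a0: "a \<ge> 0" using order.trans[OF norm_ge_zero Suc.prems(3)[of "{}"]] by simp
  have K0: "iterated_bound m n r R d \<ge> 0" by (rule iterated_bound_nonneg[OF r R])
  have "wedge y (pf h) \<nu> =
      wedge y (\<lambda>\<rho>. h (fst \<phi> p) * unit_coeff {} \<rho> + (\<Sum>i<m. wedge (N i) (pf (k i)) \<rho>)) \<nu>"
    by (rule wedge_cong) (use pfh submulti in auto)
  also have "\<dots> = h (fst \<phi> p) * wedge y (unit_coeff {}) \<nu> + (\<Sum>i<m. wedge y (wedge (N i) (pf (k i))) \<nu>)"
    by (simp only: wedge_add_right wedge_scale_right wedge_sum_right)
  also have "wedge y (unit_coeff {}) \<nu> = y \<nu>"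
    by (subst wedge_scalar_right) (use finnu in \<open>auto simp: unit_coeff_def\<close>)
  also have "(\<Sum>i<m. wedge y (wedge (N i) (pf (k i))) \<nu>) = (\<Sum>i<m. wedge (wedge y (N i)) (pf (k i)) \<nu>)"
    by (simp only: wedge_assoc[OF finnu])
  finally have eq: "wedge y (pf h) \<nu> = h (fst \<phi> p) * y \<nu> + (\<Sum>i<m. wedge (wedge y (N i)) (pf (k i)) \<nu>)" .
  have each: "cmod (wedge (wedge y (N i)) (pf (k i)) \<nu>) \<le> iterated_bound m n r R d * (2 ^ n * a * R) * (4 * B / r)"
    if i: "i < m" for i
    unfolding pf_def
  proof (rule Suc.IH[OF k_hol[OF i] k_bd[OF i] _ _ Suc.prems(5)])
    show "cmod (wedge y (N i) \<rho>) \<le> 2 ^ n * a * R" if "\<rho> \<in> multi" for \<rho>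
      by (rule wedge_bound) (use Suc.prems(3) N_bound[OF i] that in auto)
    have "order_ge n ((Suc n - Suc d) + 1) (wedge y (N i))"
      by (rule order_ge_wedge[OF Suc.prems(4) N_order[OF i]])
    then show "order_ge n (Suc n - d) (wedge y (N i))" by (rule order_ge_mono) linarith
  qed
  have "cmod (wedge y (pf h) \<nu>) \<le> cmod (h (fst \<phi> p)) * cmod (y \<nu>) +
      (\<Sum>i<m. cmod (wedge (wedge y (N i)) (pf (k i)) \<nu>))"
    unfolding eq by (rule order.trans[OF norm_triangle_ineq]) (auto simp: norm_mult intro: norm_sum)
  also have "\<dots> \<le> B * a + (\<Sum>i<m. iterated_bound m n r R d * (2 ^ n * a * R) * (4 * B / r))"
    using each Suc.prems(2)[OF fp] Suc.prems(3)[OF Suc.prems(5)] B0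
    by (intro add_mono mult_mono sum_mono) auto
  also have "\<dots> = iterated_bound m n r R (Suc d) * a * B"
    using r by (simp add: algebra_simps)
  finally show ?case unfolding pf_def .
qed

definition pullback_bound :: "real \<Rightarrow> real \<Rightarrow> real" where
  "pullback_bound r R = 2 ^ n * (2 ^ n * iterated_bound m n r R (Suc n) * R)"

lemma pullback_bound_nonneg: "r > 0 \<Longrightarrow> R \<ge> 0 \<Longrightarrow> pullback_bound r R \<ge> 0"
  unfolding pullback_bound_def by (intro mult_nonneg_nonneg iterated_bound_nonneg) auto

lemma pc_bound:
  assumes \<phi>: "smor \<phi>" and W: "spl W \<Phi>" and Z: "spl Z \<Psi>" and at: "(E, \<mu>) \<in> atlas \<M>"
    and q: "q \<in> E" and r: "r > 0" and R: "R \<ge> 0"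
    and P: "chart_disc E \<mu> q r \<subseteq> E \<inter> Z" "\<mu> ` chart_disc E \<mu> q r = polydisc m (\<mu> q) r"
    and p: "p \<in> pre \<phi> (chart_disc E \<mu> q r)" "p \<in> W" and half: "\<mu> (fst \<phi> p) \<in> polydisc m (\<mu> q) (r/2)"
    and X: "\<And>i \<nu>. i < m \<Longrightarrow> \<nu> \<in> multi \<Longrightarrow>
              cmod (pc \<phi> \<Phi> W (E \<inter> Z) (function_sec \<Psi> Z (E \<inter> Z) (\<lambda>x. \<mu> x i)) p \<nu>) \<le> R"
    and T: "\<And>\<nu> \<rho>. \<nu> \<in> multi \<Longrightarrow> \<rho> \<in> multi \<Longrightarrow>
              cmod (pc \<phi> \<Phi> W (E \<inter> Z) (monomial_sec \<Psi> Z (E \<inter> Z) \<nu>) p \<rho>) \<le> R"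
    and s: "s \<in> Sec (chart_disc E \<mu> q r)"
    and B: "\<And>x \<nu>. x \<in> chart_disc E \<mu> q r \<Longrightarrow> \<nu> \<in> multi \<Longrightarrow>
              cmod (coeff \<Psi> Z (chart_disc E \<mu> q r) s x \<nu>) \<le> B"
    and \<rho>: "\<rho> \<in> multi"
  shows "cmod (pc \<phi> \<Phi> W (chart_disc E \<mu> q r) s p \<rho>) \<le> pullback_bound r R * B"
proof -
  let ?P = "chart_disc E \<mu> q r" and ?Q = "E \<inter> Z"
  have PO: "openin (base \<M>) ?P" by (rule openin_chart_disc[OF at])
  have QO: "openin (base \<M>) ?Q" using chart_homeomorphic(2)[OF at] spl_open[OF Z] by blast
  have PZ: "?P \<subseteq> Z" and PE: "?P \<subseteq> E" using P by auto
  have PZ': "?P \<inter> Z = ?P" using PZ by blast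
  let ?K = "iterated_bound m n r R (Suc n)"
  have F: "cmod (pc \<phi> \<Phi> W ?P (function_sec \<Psi> Z ?P (\<lambda>y. coeff \<Psi> Z ?P s y \<nu>)) p \<sigma>) \<le> ?K * B"
    if \<nu>: "\<nu> \<in> multi" and \<sigma>: "\<sigma> \<in> multi" for \<nu> \<sigma>
  proof -
    have hol: "holo ?P (\<lambda>y. coeff \<Psi> Z ?P s y \<nu>)" using coeff_holo[OF Z PO s \<nu>] PZ' by simp
    have "cmod (wedge (unit_coeff {}) (pc \<phi> \<Phi> W ?P (function_sec \<Psi> Z ?P (\<lambda>y. coeff \<Psi> Z ?P s y \<nu>)) p) \<sigma>) \<le> ?K * 1 * B"
      by (rule pc_function_sec_bound[OF \<phi> W Z at q r R P p half X hol])
         (use B[OF _ \<nu>] \<sigma> in \<open>auto simp: unit_coeff_def\<close>)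
    moreover have "finite \<sigma>" using \<sigma> finite_subset by blast
    ultimately show ?thesis by (simp add: wedge_scalar_left unit_coeff_def)
  qed
  have G: "cmod (pc \<phi> \<Phi> W ?P (monomial_sec \<Psi> Z ?P \<nu>) p \<sigma>) \<le> R" if \<nu>: "\<nu> \<in> multi" and \<sigma>: "\<sigma> \<in> multi" for \<nu> \<sigma>
  proof -
    have "monomial_sec \<Psi> Z ?P \<nu> = restr \<M> ?Q ?P (monomial_sec \<Psi> Z ?Q \<nu>)"
      by (rule restr_monomial_sec[OF Z QO _ PO P(1), symmetric]) auto
    then have "pc \<phi> \<Phi> W ?P (monomial_sec \<Psi> Z ?P \<nu>) p \<sigma> = pc \<phi> \<Phi> W ?Q (monomial_sec \<Psi> Z ?Q \<nu>) p \<sigma>"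
      using pc_restr[OF \<phi> W PO p QO P(1) monomial_sec_closed[OF Z QO] \<sigma>] by auto
    then show ?thesis using T[OF \<nu> \<sigma>] by simp
  qed
  have "cmod (pc \<phi> \<Phi> W ?P s p \<rho>) \<le> (\<Sum>\<nu>\<in>multi. 2 ^ n * (?K * B) * R)"
    unfolding pc_expand[OF \<phi> W Z PO PZ p s \<rho>]
  proof (rule order.trans[OF norm_sum], rule sum_mono)
    fix \<nu> assume \<nu>: "\<nu> \<in> multi"
    show "cmod (wedge (pc \<phi> \<Phi> W ?P (function_sec \<Psi> Z ?P (\<lambda>y. coeff \<Psi> Z ?P s y \<nu>)) p)
        (pc \<phi> \<Phi> W ?P (monomial_sec \<Psi> Z ?P \<nu>) p) \<rho>) \<le> 2 ^ n * (?K * B) * R"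
      by (rule wedge_bound) (use F[OF \<nu>] G[OF \<nu>] \<rho> in auto)
  qed
  also have "\<dots> = pullback_bound r R * B"
    by (simp add: pullback_bound_def card_Pow)
  finally show ?thesis .
qed

section \<open>Continuous convergence of the underlying maps\<close>

text \<open>
  Continuous convergence, the form of locally uniform convergence that refers to the topologies of
  source and target only. It makes limits compatible with composition.
\<close>

definition conv_continuously :: "'i filter \<Rightarrow> ('i \<Rightarrow> 'p \<Rightarrow> 'p) \<Rightarrow> ('p \<Rightarrow> 'p) \<Rightarrow> bool" where
  "conv_continuously F \<beta> g \<longleftrightarrow> (\<forall>y\<in>topspace (base \<M>). g y \<in> topspace (base \<M>) \<and>
     (\<forall>V. openin (base \<M>) V \<and> g y \<in> V \<longrightarrow>
        (\<exists>Y. openin (base \<M>) Y \<and> y \<in> Y \<and> eventually (\<lambda>\<alpha>. \<beta> \<alpha> ` Y \<subseteq> V) F)))"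

text \<open>
  Holomorphic maps in terms of pullbacks of functions, as it is the pulled back functions whose
  limits are known to be holomorphic.
\<close>

definition holo_map :: "('p \<Rightarrow> 'p) \<Rightarrow> bool" where
  "holo_map g \<longleftrightarrow> (\<forall>V f. openin (base \<M>) V \<longrightarrow> holo V f \<longrightarrow>
      openin (base \<M>) {x \<in> topspace (base \<M>). g x \<in> V} \<and>
      holo {x \<in> topspace (base \<M>). g x \<in> V} (\<lambda>x. f (g x)))"

lemma holo_map_smor: "smor \<phi> \<Longrightarrow> holo_map (fst \<phi>)"
  using pre_open holo_pullback by (simp add: holo_map_def preimage_def)

lemma holo_mapD:
  assumes "holo_map g" "openin (base \<M>) V" "holo V f" "Y \<subseteq> topspace (base \<M>)" "g ` Y \<subseteq> V"
  shows "holo Y (\<lambda>x. f (g x))"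
proof -
  have "holo {x \<in> topspace (base \<M>). g x \<in> V} (\<lambda>x. f (g x))" using assms(1-3) by (simp add: holo_map_def)
  then show ?thesis by (rule holo_subset) (use assms(4,5) in auto)
qed

lemma conv_continuouslyD:
  assumes "conv_continuously F \<beta> g" "y \<in> topspace (base \<M>)" "openin (base \<M>) V" "g y \<in> V"
  obtains Y where "openin (base \<M>) Y" "y \<in> Y" "eventually (\<lambda>\<alpha>. \<beta> \<alpha> ` Y \<subseteq> V) F"
  using assms unfolding conv_continuously_def by blast

lemma conv_continuously_limit:
  assumes "conv_continuously F \<beta> g" "y \<in> topspace (base \<M>)"
  shows "limitin (base \<M>) (\<lambda>\<alpha>. \<beta> \<alpha> y) (g y) F"
  unfolding limitin_def
proof (intro conjI allI impI)
  show "g y \<in> topspace (base \<M>)" using assms by (simp add: conv_continuously_def)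
  fix V assume V: "openin (base \<M>) V \<and> g y \<in> V"
  obtain Y where Y: "openin (base \<M>) Y" "y \<in> Y" "eventually (\<lambda>\<alpha>. \<beta> \<alpha> ` Y \<subseteq> V) F"
    by (rule conv_continuouslyD[OF assms, of V]) (use V in auto)
  show "eventually (\<lambda>\<alpha>. \<beta> \<alpha> y \<in> V) F" using Y(3) by eventually_elim (use Y(2) in auto)
qed

lemma limit_in_closed:
  assumes F: "F \<noteq> bot" and l: "limitin (base \<M>) f l F" and C: "closedin (base \<M>) C"
    and ev: "eventually (\<lambda>\<alpha>. f \<alpha> \<in> C) F"
  shows "l \<in> C"
  using limitin_closedin[OF l C ev] F by simp

text \<open>
  Around \<open>y\<close> the maps take values in a compact part of one chart, so their coordinates are bounded
  holomorphic functions, and such families are equicontinuous.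
\<close>

lemma conv_continuously_exists:
  assumes F: "ultrafilter F"
    and loc: "\<And>y. y \<in> topspace (base \<M>) \<Longrightarrow> \<exists>Y E \<mu> K. openin (base \<M>) Y \<and> y \<in> Y \<and> (E, \<mu>) \<in> atlas \<M> \<and>
        compactin (base \<M>) K \<and> K \<subseteq> E \<and> eventually (\<lambda>\<alpha>. holo_map (\<beta> \<alpha>) \<and> \<beta> \<alpha> ` Y \<subseteq> K) F"
  obtains g where "conv_continuously F \<beta> g"
proof -
  have "\<exists>z. limitin (base \<M>) (\<lambda>\<alpha>. \<beta> \<alpha> y) z F \<and>
      (\<forall>V. openin (base \<M>) V \<and> z \<in> V \<longrightarrow>
        (\<exists>Y. openin (base \<M>) Y \<and> y \<in> Y \<and> eventually (\<lambda>\<alpha>. \<beta> \<alpha> ` Y \<subseteq> V) F))"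
    if y: "y \<in> topspace (base \<M>)" for y
  proof -
    from loc[OF y] obtain Y E \<mu> K where L: "openin (base \<M>) Y" "y \<in> Y" "(E, \<mu>) \<in> atlas \<M>"
        "compactin (base \<M>) K" "K \<subseteq> E" "eventually (\<lambda>\<alpha>. holo_map (\<beta> \<alpha>) \<and> \<beta> \<alpha> ` Y \<subseteq> K) F"
      by (elim exE conjE) (rule that)
    have "eventually (\<lambda>\<alpha>. \<beta> \<alpha> y \<in> K) F" using L(6) by eventually_elim (use L(2) in auto)
    then obtain z where z: "z \<in> K" "limitin (base \<M>) (\<lambda>\<alpha>. \<beta> \<alpha> y) z F"
      by (rule ultrafilter_limit_in_compact[OF L(4) F])
    have EO: "openin (base \<M>) E" by (rule chart_homeomorphic(2)[OF L(3)])
    have zE: "z \<in> E" using z L by blast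
    have YT: "Y \<subseteq> topspace (base \<M>)" by (rule openin_subset[OF L(1)])
    have "\<exists>B. \<forall>x\<in>K. \<forall>i<m. cmod (\<mu> x i) \<le> B"
    proof -
      have "\<exists>B. \<forall>x\<in>K. cmod (\<mu> x i) \<le> B" if i: "i < m" for i
      proof -
        define C where "C = {{x \<in> E. \<mu> x i \<in> ball 0 (real k)} |k::nat. True}"
        have "\<forall>S\<in>C. openin (base \<M>) S"
          unfolding C_def using holo_continuous[OF EO holo_coordinate[OF L(3) i] open_ball] by blast
        moreover have "K \<subseteq> \<Union>C"
        proof
          fix x assume "x \<in> K"
          obtain k :: nat where "cmod (\<mu> x i) < real k" using reals_Archimedean2 by blast
          then show "x \<in> \<Union>C" using \<open>x \<in> K\<close> L(5) by (auto simp: C_def)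
        qed
        ultimately have "\<exists>C'. finite C' \<and> C' \<subseteq> C \<and> K \<subseteq> \<Union>C'"
          by (intro compactinD[OF L(4)]) auto
        then obtain C' where C': "finite C'" "C' \<subseteq> C" "K \<subseteq> \<Union>C'" by (elim exE conjE)
        have "\<exists>B. \<forall>x\<in>\<Union>C'. cmod (\<mu> x i) \<le> B"
          using C'(1,2)
        proof (induction C')
          case (insert S C')
          then obtain B where B: "\<forall>x\<in>\<Union>C'. cmod (\<mu> x i) \<le> B" by blast
          obtain k :: nat where k: "S = {x \<in> E. \<mu> x i \<in> ball 0 (real k)}" using insert by (auto simp: C_def)
          show ?case
            by (rule exI[of _ "max B (real k)"]) (use B k in \<open>auto simp: le_max_iff_disj\<close>)
        qed simp
        then show ?thesis using C'(3) by blast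
      qed
      then obtain B where B: "\<And>i x. i < m \<Longrightarrow> x \<in> K \<Longrightarrow> cmod (\<mu> x i) \<le> B i" by metis
      have "cmod (\<mu> x i) \<le> (\<Sum>j<m. \<bar>B j\<bar>)" if "i < m" "x \<in> K" for i x
      proof -
        have "\<bar>B i\<bar> \<le> (\<Sum>j<m. \<bar>B j\<bar>)" by (rule member_le_sum) (use that in auto)
        with B[OF that] show ?thesis by linarith
      qed
      then show ?thesis by blast
    qed
    then obtain B where B: "\<And>x i. x \<in> K \<Longrightarrow> i < m \<Longrightarrow> cmod (\<mu> x i) \<le> B" by blast
    have "\<exists>Y'. openin (base \<M>) Y' \<and> y \<in> Y' \<and> eventually (\<lambda>\<alpha>. \<beta> \<alpha> ` Y' \<subseteq> V) F"
      if V: "openin (base \<M>) V" "z \<in> V" for V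
    proof -
      obtain r where r: "r > 0" "polydisc m (\<mu> z) r \<subseteq> \<mu> ` (E \<inter> V)"
        "\<forall>s\<le>r. chart_disc E \<mu> z s \<subseteq> E \<inter> V" "\<forall>s\<le>r. \<mu> ` chart_disc E \<mu> z s = polydisc m (\<mu> z) s"
        by (rule chart_disc_exists[OF L(3) V(1) zE V(2)]) (rule that)
      have r2: "r/2 > 0" using r by simp
      \<comment> \<open>Within \<open>r/2\<close> by equicontinuity, and \<open>\<beta>\<^sub>\<alpha> y\<close> is eventually within \<open>r/2\<close> of the limit.\<close>
      obtain Y' where Y': "openin (base \<M>) Y'" "y \<in> Y'" "Y' \<subseteq> Y"
        "\<forall>f. holo Y f \<longrightarrow> (\<forall>x\<in>Y. cmod (f x) \<le> B) \<longrightarrow> (\<forall>x\<in>Y'. cmod (f x - f y) \<le> r/2)"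
        by (rule bounded_holo_equicontinuous[OF L(1,2) r2]) (rule that)
      have "openin (base \<M>) (chart_disc E \<mu> z (r/2))" by (rule openin_chart_disc[OF L(3)])
      moreover have "z \<in> chart_disc E \<mu> z (r/2)" by (rule chart_disc_centre[OF L(3) zE r2])
      ultimately have "eventually (\<lambda>\<alpha>. \<beta> \<alpha> y \<in> chart_disc E \<mu> z (r/2)) F"
        using z(2) by (auto simp: limitin_def)
      with L(6) have "eventually (\<lambda>\<alpha>. \<beta> \<alpha> ` Y' \<subseteq> V) F"
      proof eventually_elim
        case (elim \<alpha>)
        show ?case
        proof
          fix w assume "w \<in> \<beta> \<alpha> ` Y'"
          then obtain x where x: "x \<in> Y'" "w = \<beta> \<alpha> x" by blast
          have wE: "w \<in> E" "w \<in> K" using x elim Y'(3) L(5) by auto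
          have "cmod (\<mu> w i - \<mu> z i) < r" if i: "i < m" for i
          proof -
            have "holo Y (\<lambda>x. \<mu> (\<beta> \<alpha> x) i)"
              by (rule holo_mapD[OF _ EO holo_coordinate[OF L(3) i] YT]) (use elim L(5) in auto)
            moreover have "\<forall>x\<in>Y. cmod (\<mu> (\<beta> \<alpha> x) i) \<le> B" using elim B i by blast
            ultimately have "cmod (\<mu> w i - \<mu> (\<beta> \<alpha> y) i) \<le> r/2" using Y'(4) x by blast
            moreover have "cmod (\<mu> (\<beta> \<alpha> y) i - \<mu> z i) < r/2"
              using elim i by (auto simp: chart_disc_def polydisc_def)
            ultimately show ?thesis
              using norm_triangle_ineq[of "\<mu> w i - \<mu> (\<beta> \<alpha> y) i" "\<mu> (\<beta> \<alpha> y) i - \<mu> z i"] by simp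
          qed
          then have "w \<in> chart_disc E \<mu> z r"
            using wE chart_cspace[OF L(3)] by (auto simp: chart_disc_def polydisc_def)
          then show "w \<in> V" using r(3) by blast
        qed
      qed
      then show ?thesis using Y'(1,2) by blast
    qed
    with z(2) show ?thesis by blast
  qed
  then obtain g where g: "\<And>y. y \<in> topspace (base \<M>) \<Longrightarrow> limitin (base \<M>) (\<lambda>\<alpha>. \<beta> \<alpha> y) (g y) F \<and>
      (\<forall>V. openin (base \<M>) V \<and> g y \<in> V \<longrightarrow>
        (\<exists>Y. openin (base \<M>) Y \<and> y \<in> Y \<and> eventually (\<lambda>\<alpha>. \<beta> \<alpha> ` Y \<subseteq> V) F))"
    using bchoice[of "topspace (base \<M>)"] by metis
  have "conv_continuously F \<beta> g"
    unfolding conv_continuously_def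
  proof (intro ballI conjI)
    fix y assume y: "y \<in> topspace (base \<M>)"
    show "g y \<in> topspace (base \<M>)" using g[OF y] by (simp add: limitin_def)
    show "\<forall>V. openin (base \<M>) V \<and> g y \<in> V \<longrightarrow>
        (\<exists>Y. openin (base \<M>) Y \<and> y \<in> Y \<and> eventually (\<lambda>\<alpha>. \<beta> \<alpha> ` Y \<subseteq> V) F)"
      using g[OF y] by (rule conjunct2)
  qed
  then show thesis by (rule that)
qed

lemma conv_continuously_continuous:
  assumes F: "F \<noteq> bot" and g: "conv_continuously F \<beta> g"
  shows "continuous_map (base \<M>) (base \<M>) g"
  unfolding continuous_map_def
proof (intro conjI allI impI)
  show "g \<in> topspace (base \<M>) \<rightarrow> topspace (base \<M>)" using g by (auto simp: conv_continuously_def)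
  fix U assume U: "openin (base \<M>) U"
  show "openin (base \<M>) {x \<in> topspace (base \<M>). g x \<in> U}"
  proof (subst openin_subopen, rule ballI)
    fix y assume "y \<in> {x \<in> topspace (base \<M>). g x \<in> U}"
    then have y: "y \<in> topspace (base \<M>)" "g y \<in> U" by auto
    obtain B where B: "openin (base \<M>) B" "g y \<in> B" "base \<M> closure_of B \<subseteq> U"
      using shrink_open[OF U y(2)] by blast
    obtain Y where Y: "openin (base \<M>) Y" "y \<in> Y" "eventually (\<lambda>\<alpha>. \<beta> \<alpha> ` Y \<subseteq> B) F"
      by (rule conv_continuouslyD[OF g y(1) B(1,2)])
    have YT: "Y \<subseteq> topspace (base \<M>)" by (rule openin_subset[OF Y(1)])
    have "g x \<in> U" if x: "x \<in> Y" for x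
    proof -
      have "eventually (\<lambda>\<alpha>. \<beta> \<alpha> x \<in> base \<M> closure_of B) F"
        using Y(3) by eventually_elim (use x closure_of_subset[OF openin_subset[OF B(1)]] in auto)
      then have "g x \<in> base \<M> closure_of B"
        using limit_in_closed[OF F conv_continuously_limit[OF g] closedin_closure_of] x YT by blast
      then show ?thesis using B(3) by blast
    qed
    then show "\<exists>T. openin (base \<M>) T \<and> y \<in> T \<and> T \<subseteq> {x \<in> topspace (base \<M>). g x \<in> U}"
      using Y(1,2) YT by blast
  qed
qed

text \<open>
  Locally, the pullbacks of a function by the maps of the family are bounded, so their pointwise
  limit is holomorphic.
\<close>

lemma conv_continuously_holo_map:
  assumes F: "F \<noteq> bot" and g: "conv_continuously F \<beta> g" and h: "eventually (\<lambda>\<alpha>. holo_map (\<beta> \<alpha>)) F"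
  shows "holo_map g"
  unfolding holo_map_def
proof (intro allI impI conjI)
  fix V f assume V: "openin (base \<M>) V" and f: "holo V f"
  let ?S = "{x \<in> topspace (base \<M>). g x \<in> V}"
  show S: "openin (base \<M>) ?S"
    using conv_continuously_continuous[OF F g] V by (rule openin_continuous_map_preimage)
  show "holo ?S (\<lambda>x. f (g x))"
  proof (rule holo_local[OF S])
    fix y assume "y \<in> ?S"
    then have y: "y \<in> topspace (base \<M>)" "g y \<in> V" by auto
    obtain V' where V': "openin (base \<M>) V'" "g y \<in> V'" "V' \<subseteq> V"
      "\<And>x. x \<in> V' \<Longrightarrow> cmod (f x) \<le> cmod (f (g y)) + 1"
      using holo_locally_bounded[OF V f y(2)] by blast
    obtain Y0 where Y0: "openin (base \<M>) Y0" "y \<in> Y0" "eventually (\<lambda>\<alpha>. \<beta> \<alpha> ` Y0 \<subseteq> V') F"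
      by (rule conv_continuouslyD[OF g y(1) V'(1,2)])
    define Y where "Y = Y0 \<inter> {x \<in> topspace (base \<M>). g x \<in> V'}"
    have Y: "openin (base \<M>) Y" "y \<in> Y" "Y \<subseteq> ?S"
      using Y0 V' y openin_continuous_map_preimage[OF conv_continuously_continuous[OF F g] V'(1)] by (auto simp: Y_def)
    have YT: "Y \<subseteq> topspace (base \<M>)" by (rule openin_subset[OF Y(1)])
    have "holo Y (\<lambda>x. f (g x))"
    proof (rule holo_pointwise_limit[OF F Y(1), where f = "\<lambda>\<alpha> x. f (\<beta> \<alpha> x)"])
      show "eventually (\<lambda>\<alpha>. holo Y (\<lambda>x. f (\<beta> \<alpha> x)) \<and> (\<forall>x\<in>Y. cmod (f (\<beta> \<alpha> x)) \<le> cmod (f (g y)) + 1)) F"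
        using Y0(3) h
      proof eventually_elim
        case (elim \<alpha>)
        then have im: "\<beta> \<alpha> ` Y \<subseteq> V'" by (auto simp: Y_def)
        then show ?case using holo_mapD[OF elim(2) V f YT] V'(3,4) by blast
      qed
      fix x assume x: "x \<in> Y"
      then have gx: "g x \<in> V" and xt: "x \<in> topspace (base \<M>)" using V' YT by (auto simp: Y_def)
      show "((\<lambda>\<alpha>. f (\<beta> \<alpha> x)) \<longlongrightarrow> f (g x)) F"
      proof (rule tendstoI)
        fix e :: real assume e: "e > 0"
        have "openin (base \<M>) {w \<in> V. f w \<in> ball (f (g x)) e}" by (rule holo_continuous[OF V f open_ball])
        then have "eventually (\<lambda>\<alpha>. \<beta> \<alpha> x \<in> {w \<in> V. f w \<in> ball (f (g x)) e}) F"
          by (rule limitinD[OF conv_continuously_limit[OF g xt]]) (use gx e in auto)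
        then show "eventually (\<lambda>\<alpha>. dist (f (\<beta> \<alpha> x)) (f (g x)) < e) F"
          by eventually_elim (simp add: dist_commute)
      qed
    qed
    then show "\<exists>Y. openin (base \<M>) Y \<and> y \<in> Y \<and> Y \<subseteq> ?S \<and> holo Y (\<lambda>x. f (g x))"
      using Y by blast
  qed
qed

lemma conv_continuously_inverse:
  assumes F: "F \<noteq> bot" and g: "conv_continuously F \<beta> g" and h: "conv_continuously F \<gamma> h"
    and inv: "eventually (\<lambda>\<alpha>. \<forall>y\<in>topspace (base \<M>). \<beta> \<alpha> (\<gamma> \<alpha> y) = y) F" and y: "y \<in> topspace (base \<M>)"
  shows "g (h y) = y"
proof (rule ccontr)
  assume ne: "g (h y) \<noteq> y"
  have hy: "h y \<in> topspace (base \<M>)" using h y by (simp add: conv_continuously_def)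
  then have gy: "g (h y) \<in> topspace (base \<M>)" using g by (simp add: conv_continuously_def)
  obtain U V where UV: "openin (base \<M>) U" "openin (base \<M>) V" "g (h y) \<in> U" "y \<in> V" "disjnt U V"
    using Hausdorff_base gy y ne unfolding Hausdorff_space_def by blast
  obtain Y where Y: "openin (base \<M>) Y" "h y \<in> Y" "eventually (\<lambda>\<alpha>. \<beta> \<alpha> ` Y \<subseteq> U) F"
    by (rule conv_continuouslyD[OF g hy UV(1,3)])
  have "eventually (\<lambda>\<alpha>. \<gamma> \<alpha> y \<in> Y) F"
    using conv_continuously_limit[OF h y] Y(1,2) by (simp add: limitin_def)
  with Y(3) inv have "eventually (\<lambda>_. False) F"
  proof eventually_elim
    case (elim \<alpha>)
    then have "\<beta> \<alpha> (\<gamma> \<alpha> y) \<in> U" by blast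
    then have "y \<in> U" using elim y by simp
    then show False using UV by (auto simp: disjnt_iff)
  qed
  then show False using F by (simp add: trivial_limit_def)
qed


section \<open>Limits of morphisms along an ultrafilter\<close>

lemma finite_family_locally_bounded:
  assumes V: "openin (base \<M>) V" and x: "x \<in> V" and J: "finite J" and f: "\<And>j. j \<in> J \<Longrightarrow> holo V (f j)"
  obtains Y B where "openin (base \<M>) Y" "x \<in> Y" "Y \<subseteq> V" "0 \<le> B" "\<forall>j\<in>J. \<forall>y\<in>Y. cmod (f j y) \<le> B"
proof -
  have "\<exists>Y B. openin (base \<M>) Y \<and> x \<in> Y \<and> Y \<subseteq> V \<and> 0 \<le> B \<and> (\<forall>j\<in>J. \<forall>y\<in>Y. cmod (f j y) \<le> B)"
    using J f
  proof (induction J)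
    case empty
    then show ?case using V x by (intro exI[of _ V] exI[of _ "0::real"]) auto
  next
    case (insert j J)
    then have "\<exists>Y B. openin (base \<M>) Y \<and> x \<in> Y \<and> Y \<subseteq> V \<and> 0 \<le> B \<and> (\<forall>j\<in>J. \<forall>y\<in>Y. cmod (f j y) \<le> B)"
      by auto
    then obtain Y B where Y: "openin (base \<M>) Y" "x \<in> Y" "Y \<subseteq> V" "0 \<le> B" "\<forall>j\<in>J. \<forall>y\<in>Y. cmod (f j y) \<le> B"
      by (elim exE conjE) (rule that)
    have "holo V (f j)" using insert by auto
    then obtain Y' where Y': "openin (base \<M>) Y'" "x \<in> Y'" "Y' \<subseteq> V"
        "\<And>y. y \<in> Y' \<Longrightarrow> cmod (f j y) \<le> cmod (f j x) + 1"
      using holo_locally_bounded[OF V _ x] by blast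
    show ?case
    proof (intro exI[of _ "Y \<inter> Y'"] exI[of _ "B + (cmod (f j x) + 1)"] conjI ballI)
      fix k y assume k: "k \<in> insert j J" and y: "y \<in> Y \<inter> Y'"
      have nn: "0 \<le> cmod (f j x)" by simp
      show "cmod (f k y) \<le> B + (cmod (f j x) + 1)"
      proof (cases "k = j")
        case True
        then show ?thesis using Y'(4)[of y] y Y(4) by auto
      next
        case False
        then have "cmod (f k y) \<le> B" using Y(5) k y by blast
        then show ?thesis using nn by linarith
      qed
    qed (use Y Y' in auto)
  qed
  then show thesis by (elim exE conjE) (rule that)
qed

text \<open>Change of the splitting, as the pullback under the identity.\<close>

lemma coeff_change_splitting:
  assumes W1: "spl W1 \<Phi>1" and W2: "spl W2 \<Phi>2" and x: "x \<in> W1" "x \<in> W2"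
    and Y1: "openin (base \<M>) Y1" "x \<in> Y1" "Y1 \<subseteq> W1"
  obtains P Y C where "openin (base \<M>) P" "x \<in> P" "P \<subseteq> Y1" "openin (base \<M>) Y" "x \<in> Y" "Y \<subseteq> P \<inter> W2" "0 \<le> C"
    "\<forall>t\<in>Sec P. \<forall>B. (\<forall>y\<in>P. \<forall>\<nu>\<in>multi. cmod (coeff \<Phi>1 W1 P t y \<nu>) \<le> B) \<longrightarrow>
        (\<forall>y\<in>Y. \<forall>\<nu>\<in>multi. cmod (coeff \<Phi>2 W2 P t y \<nu>) \<le> C * B)"
proof -
  have xt: "x \<in> topspace (base \<M>)" using Y1 openin_subset by blast
  obtain E \<mu> where at: "(E, \<mu>) \<in> atlas \<M>" and xE: "x \<in> E" using atlas_cover[OF xt] by blast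
  let ?Q = "E \<inter> W1"
  have QO: "openin (base \<M>) ?Q" using chart_homeomorphic(2)[OF at] spl_open[OF W1] by blast
  have QW: "?Q \<subseteq> W1" by blast
  have Q2: "openin (base \<M>) (?Q \<inter> W2)" by (rule VW[OF W2 QO])
  have xQ2: "x \<in> ?Q \<inter> W2" using xE x by simp
  have cQ: "holo ?Q (\<lambda>y. \<mu> y i)" if "i < m" for i
    using holo_coordinate[OF at that] holo_subset by blast
  have fC: "function_sec \<Phi>1 W1 ?Q (\<lambda>y. \<mu> y i) \<in> Sec ?Q" if "i < m" for i by (rule function_sec_closed[OF W1 QO QW cQ[OF that]])
  have eC: "monomial_sec \<Phi>1 W1 ?Q \<nu> \<in> Sec ?Q" for \<nu> by (rule monomial_sec_closed[OF W1 QO QW])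
  obtain Y3 R1 where Y3: "openin (base \<M>) Y3" "x \<in> Y3" "Y3 \<subseteq> ?Q \<inter> W2" "0 \<le> R1"
    "\<forall>j\<in>{..<m} \<times> multi. \<forall>y\<in>Y3. cmod ((\<lambda>j y. coeff \<Phi>2 W2 ?Q (function_sec \<Phi>1 W1 ?Q (\<lambda>y. \<mu> y (fst j))) y (snd j)) j y) \<le> R1"
    by (rule finite_family_locally_bounded[OF Q2 xQ2, of "{..<m} \<times> multi"
          "\<lambda>j y. coeff \<Phi>2 W2 ?Q (function_sec \<Phi>1 W1 ?Q (\<lambda>y. \<mu> y (fst j))) y (snd j)"])
       (simp, clarify, rule coeff_holo[OF W2 QO fC], simp_all add: that)
  obtain Y4 R2 where Y4: "openin (base \<M>) Y4" "x \<in> Y4" "Y4 \<subseteq> ?Q \<inter> W2" "0 \<le> R2"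
    "\<forall>j\<in>multi \<times> multi. \<forall>y\<in>Y4. cmod ((\<lambda>j y. coeff \<Phi>2 W2 ?Q (monomial_sec \<Phi>1 W1 ?Q (fst j)) y (snd j)) j y) \<le> R2"
    by (rule finite_family_locally_bounded[OF Q2 xQ2, of "multi \<times> multi"
          "\<lambda>j y. coeff \<Phi>2 W2 ?Q (monomial_sec \<Phi>1 W1 ?Q (fst j)) y (snd j)"])
       (simp, clarify, rule coeff_holo[OF W2 QO eC], simp_all add: that)
  define R where "R = max R1 R2"
  have R0: "R \<ge> 0" using Y3 by (simp add: R_def)
  obtain r where r: "r > 0" "polydisc m (\<mu> x) r \<subseteq> \<mu> ` (E \<inter> (Y1 \<inter> W1))"
    "\<forall>s\<le>r. chart_disc E \<mu> x s \<subseteq> E \<inter> (Y1 \<inter> W1)" "\<forall>s\<le>r. \<mu> ` chart_disc E \<mu> x s = polydisc m (\<mu> x) s"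
    by (rule chart_disc_exists[OF at _ xE, of "Y1 \<inter> W1"]) (use Y1 x spl_open[OF W1] in auto)
  let ?P = "chart_disc E \<mu> x r"
  have PO: "openin (base \<M>) ?P" by (rule openin_chart_disc[OF at])
  have r2: "r/2 > 0" using r by simp
  have PY: "?P \<subseteq> E \<inter> (Y1 \<inter> W1)" and Pim: "\<mu> ` ?P = polydisc m (\<mu> x) r" using r(3,4) by auto
  define Y where "Y = chart_disc E \<mu> x (r/2) \<inter> Y3 \<inter> Y4"
  have half_sub: "chart_disc E \<mu> x (r/2) \<subseteq> ?P"
    using polydisc_mono[of "r/2" r m "\<mu> x"] r(1) by (auto simp: chart_disc_def)
  show thesis
  proof (rule that[of ?P Y "pullback_bound r R"])
    show "openin (base \<M>) Y" unfolding Y_def by (intro openin_Int openin_chart_disc[OF at] Y3 Y4)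
    show "x \<in> Y" using chart_disc_centre[OF at xE r2] Y3 Y4 by (simp add: Y_def)
    show "Y \<subseteq> ?P \<inter> W2" using half_sub Y3 by (auto simp: Y_def)
    show "0 \<le> pullback_bound r R" by (rule pullback_bound_nonneg[OF r(1) R0])
    show "?P \<subseteq> Y1" using PY by blast
    show "\<forall>t\<in>Sec ?P. \<forall>B. (\<forall>y\<in>?P. \<forall>\<nu>\<in>multi. cmod (coeff \<Phi>1 W1 ?P t y \<nu>) \<le> B) \<longrightarrow>
        (\<forall>y\<in>Y. \<forall>\<nu>\<in>multi. cmod (coeff \<Phi>2 W2 ?P t y \<nu>) \<le> pullback_bound r R * B)"
    proof (intro ballI allI impI)
      fix t B y \<nu> assume t: "t \<in> Sec ?P" and B: "\<forall>y\<in>?P. \<forall>\<nu>\<in>multi. cmod (coeff \<Phi>1 W1 ?P t y \<nu>) \<le> B"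
        and y: "y \<in> Y" and \<nu>: "\<nu> \<in> multi"
      have yP: "y \<in> ?P" "y \<in> W2" "y \<in> Y3" "y \<in> Y4" using y half_sub Y3 by (auto simp: Y_def)
      have yt: "y \<in> topspace (base \<M>)" using yP openin_subset[OF PO] by blast
      then have idy: "fst (id_morphism \<M>) y = y" by (simp add: id_morphism_def)
      have "cmod (pc (id_morphism \<M>) \<Phi>2 W2 ?P t y \<nu>) \<le> pullback_bound r R * B"
      proof (rule pc_bound[OF smor_id W2 W1 at xE r(1) R0 _ Pim _ yP(2) _ _ _ t _ \<nu>])
        show "?P \<subseteq> E \<inter> W1" using PY by blast
        show "y \<in> pre (id_morphism \<M>) ?P" using pre_id[OF PO] yP by simp
        show "\<mu> (fst (id_morphism \<M>) y) \<in> polydisc m (\<mu> x) (r/2)"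
          using y unfolding idy by (simp add: Y_def chart_disc_def)
        show "cmod (pc (id_morphism \<M>) \<Phi>2 W2 ?Q (function_sec \<Phi>1 W1 ?Q (\<lambda>x. \<mu> x i)) y \<rho>) \<le> R"
          if "i < m" "\<rho> \<in> multi" for i \<rho>
          unfolding pc_id[OF QO fC[OF that(1)]] using Y3(5) that yP by (force simp: R_def le_max_iff_disj)
        show "cmod (pc (id_morphism \<M>) \<Phi>2 W2 ?Q (monomial_sec \<Phi>1 W1 ?Q \<sigma>) y \<rho>) \<le> R"
          if "\<sigma> \<in> multi" "\<rho> \<in> multi" for \<sigma> \<rho>
          unfolding pc_id[OF QO eC] using Y4(5) that yP by (force simp: R_def le_max_iff_disj)
        show "cmod (coeff \<Phi>1 W1 ?P t z \<rho>) \<le> B" if "z \<in> ?P" "\<rho> \<in> multi" for z \<rho> using B that by blast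
      qed
      then show "cmod (coeff \<Phi>2 W2 ?P t y \<nu>) \<le> pullback_bound r R * B" by (simp only: pc_id[OF PO t])
    qed
  qed (use PO chart_disc_centre[OF at xE r(1)] in auto)
qed

lemma superalgebra_hom_grading: "superalgebra_hom A G B H h \<Longrightarrow> s \<in> G i \<Longrightarrow> h s \<in> H i"
  unfolding superalgebra_hom_def image_subset_iff by blast

lemma grading_coeff:
  assumes W: "spl W \<Phi>" and V: "openin (base \<M>) V" and s: "s \<in> grading \<M> V i"
    and x: "x \<in> V" "x \<in> W" and \<nu>: "\<nu> \<in> multi" "of_nat (card \<nu>) \<noteq> i"
  shows "coeff \<Phi> W V s x \<nu> = 0"
proof -
  have "restr \<M> V (V \<inter> W) s \<in> grading \<M> (V \<inter> W) i"
    by (rule superalgebra_hom_grading[OF restr_hom[OF V VW[OF W V]] s]) simp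
  then have "\<Phi> (V \<inter> W) (restr \<M> V (V \<inter> W) s) \<in> grassmann_grading \<M> (V \<inter> W) i"
    by (rule superalgebra_hom_grading[OF spl_hom(1)[OF W VW[OF W V]], rotated]) simp
  then show ?thesis using x \<nu> by (auto simp: coeff_def grassmann_grading_def multi_indices_eq)
qed

text \<open>
  In the decomposition of \<open>t\<close> into homogeneous parts, the part of the other parity has no nonzero
  coefficient.
\<close>

lemma grading_if_coeff:
  assumes V: "openin (base \<M>) V" and t: "t \<in> Sec V"
    and z: "\<And>W \<Phi> x \<nu>. spl W \<Phi> \<Longrightarrow> x \<in> V \<Longrightarrow> x \<in> W \<Longrightarrow> \<nu> \<in> multi \<Longrightarrow> of_nat (card \<nu>) \<noteq> i \<Longrightarrow> coeff \<Phi> W V t x \<nu> = 0"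
  shows "t \<in> grading \<M> V i"
proof -
  interpret R: ring "sections \<M> V" by (rule sections_ring[OF V])
  have "\<exists>!p. p \<in> grading \<M> V 0 \<times> grading \<M> V 1 \<and> t = fst p \<oplus>\<^bsub>sections \<M> V\<^esub> snd p"
    using sections_superalgebra[OF V] t by (simp add: superalgebra_def)
  then obtain p where "p \<in> grading \<M> V 0 \<times> grading \<M> V 1" "t = fst p \<oplus>\<^bsub>sections \<M> V\<^esub> snd p"
    by (elim ex1E conjE) (rule that)
  then obtain a b where ab: "a \<in> grading \<M> V 0" "b \<in> grading \<M> V 1" "t = a \<oplus>\<^bsub>sections \<M> V\<^esub> b"
    using that[of "fst p" "snd p"] by (simp add: mem_Times_iff)
  have abS: "a \<in> Sec V" "b \<in> Sec V" using ab grading_subset[OF V] by auto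
  have zero: "u = \<zero>\<^bsub>sections \<M> V\<^esub>"
    if u: "u \<in> grading \<M> V j" and v: "v \<in> grading \<M> V i" and eq: "t = u \<oplus>\<^bsub>sections \<M> V\<^esub> v" and ji: "j \<noteq> i" for u v j
  proof -
    have uS: "u \<in> Sec V" and vS: "v \<in> Sec V" using u v grading_subset[OF V] by auto
    have "u \<oplus>\<^bsub>sections \<M> V\<^esub> u = u"
    proof (rule coeff_eqI[OF V _ uS])
      fix x assume x: "x \<in> V"
      then obtain W \<Phi> where W: "x \<in> W" "spl W \<Phi>" using spl_exists openin_subset[OF V] by blast
      have "coeff \<Phi> W V (u \<oplus>\<^bsub>sections \<M> V\<^esub> u) y \<nu> = coeff \<Phi> W V u y \<nu>"
        if y: "y \<in> V \<inter> W" and \<nu>: "\<nu> \<in> multi" for y \<nu>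
      proof -
        have yy: "y \<in> V" "y \<in> W" using y by auto
        have "coeff \<Phi> W V u y \<nu> = 0"
        proof (cases "of_nat (card \<nu>) = j")
          case False then show ?thesis using grading_coeff[OF W(2) V u yy \<nu>] by blast
        next
          case True
          then have ne: "of_nat (card \<nu>) \<noteq> i" using ji by simp
          have "coeff \<Phi> W V t y \<nu> = 0" by (rule z[OF W(2) yy \<nu> ne])
          moreover have "coeff \<Phi> W V v y \<nu> = 0" by (rule grading_coeff[OF W(2) V v yy \<nu> ne])
          ultimately show ?thesis using coeff_add[OF W(2) V uS vS yy \<nu>] eq by simp
        qed
        then show ?thesis using coeff_add[OF W(2) V uS uS yy \<nu>] by simp
      qed
      then show "\<exists>W \<Phi> Y. spl W \<Phi> \<and> openin (base \<M>) Y \<and> x \<in> Y \<and> Y \<subseteq> V \<inter> W \<and>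
          (\<forall>y\<in>Y. \<forall>\<nu>\<in>multi. coeff \<Phi> W V (u \<oplus>\<^bsub>sections \<M> V\<^esub> u) y \<nu> = coeff \<Phi> W V u y \<nu>)"
        using W x VW[OF W(2) V] by (intro exI[of _ W] exI[of _ \<Phi>] exI[of _ "V \<inter> W"]) simp
    qed (use uS in simp)
    then show ?thesis using uS R.add.l_cancel_one by blast
  qed
  have "i = 0 \<or> i = 1" by (cases i) auto
  then show ?thesis
  proof
    assume i: "i = 0"
    have "b = \<zero>\<^bsub>sections \<M> V\<^esub>"
      by (rule zero[OF ab(2)]) (use ab i abS R.add.m_comm in auto)
    then show ?thesis using ab i abS by simp
  next
    assume i: "i = 1"
    have "a = \<zero>\<^bsub>sections \<M> V\<^esub>"
      by (rule zero[OF ab(1)]) (use ab i in auto)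
    then show ?thesis using ab i abS by simp
  qed
qed

text \<open>
  What a family of morphisms with converging underlying maps has to satisfy in order to converge:
  near every point, the pullbacks of some coordinates of the target are eventually bounded.
\<close>

definition controlled :: "'i filter \<Rightarrow> ('i \<Rightarrow> ('p, 's, 'p, 's) morphism) \<Rightarrow> ('p \<Rightarrow> 'p) \<Rightarrow> bool" where
  "controlled F \<phi> g \<longleftrightarrow> (\<forall>p\<in>topspace (base \<M>). \<exists>W \<Phi> E \<mu> Z \<Psi> Y R.
     spl W \<Phi> \<and> (E, \<mu>) \<in> atlas \<M> \<and> spl Z \<Psi> \<and> g p \<in> E \<inter> Z \<and>
     openin (base \<M>) Y \<and> p \<in> Y \<and> Y \<subseteq> W \<and> (0::real) \<le> R \<and>
     eventually (\<lambda>\<alpha>. \<forall>x\<in>Y. \<forall>\<nu>\<in>multi.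
        (\<forall>i<m. cmod (pc (\<phi> \<alpha>) \<Phi> W (E \<inter> Z) (function_sec \<Psi> Z (E \<inter> Z) (\<lambda>y. \<mu> y i)) x \<nu>) \<le> R) \<and>
        (\<forall>\<rho>\<in>multi. cmod (pc (\<phi> \<alpha>) \<Phi> W (E \<inter> Z) (monomial_sec \<Psi> Z (E \<inter> Z) \<rho>) x \<nu>) \<le> R)) F)"

text \<open>
  Continuous convergence of \<open>\<phi>\<^sub>\<alpha>\<^sup>* s\<close> to \<open>t\<close> at \<open>x\<close>. Asking for it in every splitting around \<open>x\<close>
  makes the relation independent of choices, so that limits found in different splittings can be
  compared and glued.
\<close>

definition approx where
  "approx F \<phi> U s V t x \<longleftrightarrow> (\<forall>W \<Phi>. spl W \<Phi> \<longrightarrow> x \<in> W \<longrightarrow> (\<forall>e>0. \<exists>Y. openin (base \<M>) Y \<and> x \<in> Y \<and> Y \<subseteq> V \<inter> W \<and>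
     eventually (\<lambda>\<alpha>. fst (\<phi> \<alpha>) ` Y \<subseteq> U \<and>
       (\<forall>y\<in>Y. \<forall>\<nu>\<in>multi. cmod (pc (\<phi> \<alpha>) \<Phi> W U s y \<nu> - coeff \<Phi> W V t y \<nu>) < e)) F))"

lemma approx_pointwise:
  assumes "approx F \<phi> U s V t x" "spl W \<Phi>" "x \<in> W" "\<nu> \<in> multi"
  shows "((\<lambda>\<alpha>. pc (\<phi> \<alpha>) \<Phi> W U s x \<nu>) \<longlongrightarrow> coeff \<Phi> W V t x \<nu>) F"
proof (rule tendstoI)
  fix e :: real assume "e > 0"
  then have "\<exists>Y. openin (base \<M>) Y \<and> x \<in> Y \<and> Y \<subseteq> V \<inter> W \<and> eventually (\<lambda>\<alpha>. fst (\<phi> \<alpha>) ` Y \<subseteq> U \<and>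
       (\<forall>y\<in>Y. \<forall>\<nu>\<in>multi. cmod (pc (\<phi> \<alpha>) \<Phi> W U s y \<nu> - coeff \<Phi> W V t y \<nu>) < e)) F"
    using assms(1-3) by (simp add: approx_def)
  then obtain Y where Y: "x \<in> Y" "eventually (\<lambda>\<alpha>. fst (\<phi> \<alpha>) ` Y \<subseteq> U \<and>
       (\<forall>y\<in>Y. \<forall>\<nu>\<in>multi. cmod (pc (\<phi> \<alpha>) \<Phi> W U s y \<nu> - coeff \<Phi> W V t y \<nu>) < e)) F"
    by (elim exE conjE) (rule that)
  from Y(2) show "eventually (\<lambda>\<alpha>. dist (pc (\<phi> \<alpha>) \<Phi> W U s x \<nu>) (coeff \<Phi> W V t x \<nu>) < e) F"
    by eventually_elim (use Y(1) assms(4) in \<open>auto simp: dist_norm\<close>)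
qed

lemma approx_transfer:
  assumes ap: "approx F \<phi> U s V t x" and V: "openin (base \<M>) V" and V': "openin (base \<M>) V'" and x: "x \<in> V'"
    and eq: "\<And>W \<Phi> y \<nu>. spl W \<Phi> \<Longrightarrow> y \<in> V \<Longrightarrow> y \<in> V' \<Longrightarrow> y \<in> W \<Longrightarrow> \<nu> \<in> multi \<Longrightarrow> coeff \<Phi> W V t y \<nu> = coeff \<Phi> W V' t' y \<nu>"
  shows "approx F \<phi> U s V' t' x"
  unfolding approx_def
proof (intro allI impI)
  fix W \<Phi> and e :: real assume W: "spl W \<Phi>" and xW: "x \<in> W" and e: "e > 0"
  have "\<exists>Y. openin (base \<M>) Y \<and> x \<in> Y \<and> Y \<subseteq> V \<inter> W \<and> eventually (\<lambda>\<alpha>. fst (\<phi> \<alpha>) ` Y \<subseteq> U \<and>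
       (\<forall>y\<in>Y. \<forall>\<nu>\<in>multi. cmod (pc (\<phi> \<alpha>) \<Phi> W U s y \<nu> - coeff \<Phi> W V t y \<nu>) < e)) F"
    using ap W xW e by (simp add: approx_def)
  then obtain Y where Y: "openin (base \<M>) Y" "x \<in> Y" "Y \<subseteq> V \<inter> W" "eventually (\<lambda>\<alpha>. fst (\<phi> \<alpha>) ` Y \<subseteq> U \<and>
       (\<forall>y\<in>Y. \<forall>\<nu>\<in>multi. cmod (pc (\<phi> \<alpha>) \<Phi> W U s y \<nu> - coeff \<Phi> W V t y \<nu>) < e)) F"
    by (elim exE conjE) (rule that)
  have "eventually (\<lambda>\<alpha>. fst (\<phi> \<alpha>) ` (Y \<inter> V') \<subseteq> U \<and>
       (\<forall>y\<in>Y \<inter> V'. \<forall>\<nu>\<in>multi. cmod (pc (\<phi> \<alpha>) \<Phi> W U s y \<nu> - coeff \<Phi> W V' t' y \<nu>) < e)) F"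
    using Y(4)
  proof eventually_elim
    case (elim \<alpha>)
    have "cmod (pc (\<phi> \<alpha>) \<Phi> W U s y \<nu> - coeff \<Phi> W V' t' y \<nu>) < e" if y: "y \<in> Y \<inter> V'" and \<nu>: "\<nu> \<in> multi" for y \<nu>
    proof -
      have "coeff \<Phi> W V t y \<nu> = coeff \<Phi> W V' t' y \<nu>" by (rule eq[OF W _ _ _ \<nu>]) (use y Y(3) in auto)
      then show ?thesis using elim y \<nu> by (metis IntD1)
    qed
    with elim show ?case by blast
  qed
  then show "\<exists>Y. openin (base \<M>) Y \<and> x \<in> Y \<and> Y \<subseteq> V' \<inter> W \<and> eventually (\<lambda>\<alpha>. fst (\<phi> \<alpha>) ` Y \<subseteq> U \<and>
       (\<forall>y\<in>Y. \<forall>\<nu>\<in>multi. cmod (pc (\<phi> \<alpha>) \<Phi> W U s y \<nu> - coeff \<Phi> W V' t' y \<nu>) < e)) F"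
    using Y x V' by (intro exI[of _ "Y \<inter> V'"]) auto
qed


definition limit_pre :: "('p \<Rightarrow> 'p) \<Rightarrow> 'p set \<Rightarrow> 'p set" where
  "limit_pre g U = {x \<in> topspace (base \<M>). g x \<in> U}"

text \<open>
  The pullback of \<open>s\<close> is the section to which the \<open>\<phi>\<^sub>\<alpha>\<^sup>* s\<close> converge; \<open>global_limit\<close> provides it for
  controlled families, and it is unique since its coefficients are pointwise limits.
\<close>

definition limit_morphism ::
    "'i filter \<Rightarrow> ('i \<Rightarrow> ('p, 's, 'p, 's) morphism) \<Rightarrow> ('p \<Rightarrow> 'p) \<Rightarrow> ('p, 's, 'p, 's) morphism" where
  "limit_morphism F \<phi> g = (restrict g (topspace (base \<M>)),
     \<lambda>U\<in>opens \<M>. \<lambda>s\<in>Sec U. SOME t. t \<in> Sec (limit_pre g U) \<and>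
       (\<forall>x\<in>limit_pre g U. approx F \<phi> U s (limit_pre g U) t x))"

context
  fixes F :: "'i filter" and \<phi> :: "'i \<Rightarrow> ('p, 's, 'p, 's) morphism" and g :: "'p \<Rightarrow> 'p"
  assumes F: "ultrafilter F" and smor_ev: "eventually (\<lambda>\<alpha>. smor (\<phi> \<alpha>)) F"
    and body: "conv_continuously F (\<lambda>\<alpha>. fst (\<phi> \<alpha>)) g" and ctrl: "controlled F \<phi> g"
begin

abbreviation "gpre \<equiv> limit_pre g"

abbreviation "lim_morphism \<equiv> limit_morphism F \<phi> g"

lemma F_nonbot: "F \<noteq> bot" using F by (simp add: ultrafilter_def)

lemma gpre_open: "openin (base \<M>) U \<Longrightarrow> openin (base \<M>) (gpre U)"
  unfolding limit_pre_def by (rule openin_continuous_map_preimage[OF conv_continuously_continuous[OF F_nonbot body]])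

text \<open>\<open>pc_bound\<close> carries the bounds over from the coordinates to all sections.\<close>

lemma pullbacks_locally_bounded:
  assumes U: "openin (base \<M>) U" and s: "s \<in> Sec U" and p: "p \<in> gpre U"
  obtains W \<Phi> Y B where "spl W \<Phi>" "openin (base \<M>) Y" "p \<in> Y" "Y \<subseteq> W"
    "eventually (\<lambda>\<alpha>. fst (\<phi> \<alpha>) ` Y \<subseteq> U \<and> (\<forall>x\<in>Y. \<forall>\<nu>\<in>multi. cmod (pc (\<phi> \<alpha>) \<Phi> W U s x \<nu>) \<le> B)) F"
proof -
  have pt: "p \<in> topspace (base \<M>)" and gU: "g p \<in> U" using p by (auto simp: limit_pre_def)
  let ?ctl = "\<lambda>W \<Phi> E \<mu> Z \<Psi> Y R \<alpha>. \<forall>x\<in>Y. \<forall>\<nu>\<in>multi.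
        (\<forall>i<m. cmod (pc (\<phi> \<alpha>) \<Phi> W (E \<inter> Z) (function_sec \<Psi> Z (E \<inter> Z) (\<lambda>y. \<mu> y i)) x \<nu>) \<le> R) \<and>
        (\<forall>\<rho>\<in>multi. cmod (pc (\<phi> \<alpha>) \<Phi> W (E \<inter> Z) (monomial_sec \<Psi> Z (E \<inter> Z) \<rho>) x \<nu>) \<le> R)"
  have "\<exists>W \<Phi> E \<mu> Z \<Psi> Y R. spl W \<Phi> \<and> (E, \<mu>) \<in> atlas \<M> \<and> spl Z \<Psi> \<and> g p \<in> E \<inter> Z \<and>
     openin (base \<M>) Y \<and> p \<in> Y \<and> Y \<subseteq> W \<and> (0::real) \<le> R \<and> eventually (?ctl W \<Phi> E \<mu> Z \<Psi> Y R) F"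
    using ctrl pt unfolding controlled_def by (rule bspec)
  then obtain W \<Phi> E \<mu> Z \<Psi> Y R where W: "spl W \<Phi>" and at: "(E, \<mu>) \<in> atlas \<M>" and Z: "spl Z \<Psi>"
    and gp: "g p \<in> E \<inter> Z" and Y: "openin (base \<M>) Y" "p \<in> Y" "Y \<subseteq> W" and R: "(0::real) \<le> R"
    and ev: "eventually (?ctl W \<Phi> E \<mu> Z \<Psi> Y R) F"
    by (elim exE conjE) (rule that)
  have UZ: "openin (base \<M>) (U \<inter> Z)" by (rule VW[OF Z U])
  have gUZ: "g p \<in> U \<inter> Z" using gU gp by simp
  have finm: "finite multi" by simp
  obtain V B where V: "openin (base \<M>) V" "g p \<in> V" "V \<subseteq> U \<inter> Z" "0 \<le> B"
    "\<forall>\<nu>\<in>multi. \<forall>y\<in>V. cmod (coeff \<Psi> Z U s y \<nu>) \<le> B"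
    by (rule finite_family_locally_bounded[OF UZ gUZ finm, where f = "\<lambda>\<nu> y. coeff \<Psi> Z U s y \<nu>"])
       (rule coeff_holo[OF Z U s], assumption, rule that)
  have gE: "g p \<in> E" using gp by simp
  obtain r where r: "r > 0" "polydisc m (\<mu> (g p)) r \<subseteq> \<mu> ` (E \<inter> V)"
    "\<forall>s\<le>r. chart_disc E \<mu> (g p) s \<subseteq> E \<inter> V" "\<forall>s\<le>r. \<mu> ` chart_disc E \<mu> (g p) s = polydisc m (\<mu> (g p)) s"
    by (rule chart_disc_exists[OF at V(1) gE V(2)]) (rule that)
  let ?P = "chart_disc E \<mu> (g p) r" and ?H = "chart_disc E \<mu> (g p) (r/2)"
  have PO: "openin (base \<M>) ?P" and HO: "openin (base \<M>) ?H" by (rule openin_chart_disc[OF at])+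
  have r2: "r/2 > 0" using r by simp
  have PV: "?P \<subseteq> E \<inter> V" and Pim: "\<mu> ` ?P = polydisc m (\<mu> (g p)) r" using r(3,4) by auto
  have PEZ: "?P \<subseteq> E \<inter> Z" and PU: "?P \<subseteq> U" using PV V(3) by auto
  have HP: "?H \<subseteq> ?P" using polydisc_mono[of "r/2" r m "\<mu> (g p)"] r(1) by (auto simp: chart_disc_def)
  obtain Y1 where Y1: "openin (base \<M>) Y1" "p \<in> Y1" "eventually (\<lambda>\<alpha>. fst (\<phi> \<alpha>) ` Y1 \<subseteq> ?H) F"
    by (rule conv_continuouslyD[OF body pt HO chart_disc_centre[OF at gE r2]])
  have YT: "Y \<subseteq> topspace (base \<M>)" by (rule openin_subset[OF Y(1)])
  have "eventually (\<lambda>\<alpha>. fst (\<phi> \<alpha>) ` (Y \<inter> Y1) \<subseteq> U \<and>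
      (\<forall>x\<in>Y \<inter> Y1. \<forall>\<nu>\<in>multi. cmod (pc (\<phi> \<alpha>) \<Phi> W U s x \<nu>) \<le> pullback_bound r R * B)) F"
    using smor_ev ev Y1(3)
  proof eventually_elim
    case (elim \<alpha>)
    have im: "fst (\<phi> \<alpha>) x \<in> ?H" if "x \<in> Y \<inter> Y1" for x using elim(3) that by blast
    have "cmod (pc (\<phi> \<alpha>) \<Phi> W U s x \<nu>) \<le> pullback_bound r R * B" if x: "x \<in> Y \<inter> Y1" and \<nu>: "\<nu> \<in> multi" for x \<nu>
    proof -
      have xW: "x \<in> W" and xY: "x \<in> Y" and xt: "x \<in> topspace (base \<M>)" using x Y YT by auto
      have xP: "x \<in> pre (\<phi> \<alpha>) ?P" using im[OF x] HP xt by (auto simp: pre_iff)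
      have half: "\<mu> (fst (\<phi> \<alpha>) x) \<in> polydisc m (\<mu> (g p)) (r/2)" using im[OF x] by (simp add: chart_disc_def)
      have sP: "restr \<M> U ?P s \<in> Sec ?P" by (rule restr_closed[OF U PO PU s])
      have "cmod (pc (\<phi> \<alpha>) \<Phi> W ?P (restr \<M> U ?P s) x \<nu>) \<le> pullback_bound r R * B"
      proof (rule pc_bound[OF elim(1) W Z at gE r(1) R PEZ Pim xP xW half _ _ sP _ \<nu>])
        show "cmod (pc (\<phi> \<alpha>) \<Phi> W (E \<inter> Z) (function_sec \<Psi> Z (E \<inter> Z) (\<lambda>y. \<mu> y i)) x \<rho>) \<le> R"
          if "i < m" "\<rho> \<in> multi" for i \<rho> using elim(2) xY that by simp
        show "cmod (pc (\<phi> \<alpha>) \<Phi> W (E \<inter> Z) (monomial_sec \<Psi> Z (E \<inter> Z) \<sigma>) x \<rho>) \<le> R"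
          if "\<sigma> \<in> multi" "\<rho> \<in> multi" for \<sigma> \<rho> using elim(2) xY that by simp
        show "cmod (coeff \<Psi> Z ?P (restr \<M> U ?P s) z \<rho>) \<le> B" if z: "z \<in> ?P" and \<rho>: "\<rho> \<in> multi" for z \<rho>
        proof -
          have "z \<in> V" "z \<in> Z" using z PV PEZ by auto
          then show ?thesis using coeff_restr[OF Z U PO PU s z _ \<rho>] V(5) \<rho> by simp
        qed
      qed
      then show ?thesis using pc_restr[OF elim(1) W PO xP xW U PU s \<nu>] by simp
    qed
    moreover have "fst (\<phi> \<alpha>) ` (Y \<inter> Y1) \<subseteq> U" using im HP PU by blast
    ultimately show ?case by blast
  qed
  then show thesis
    by (intro that[OF W, of "Y \<inter> Y1"]) (use Y Y1 in auto)
qed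

text \<open>
  Along the ultrafilter the bounded coefficients in one splitting converge pointwise, to holomorphic
  functions, which are the coefficients of the limit. The convergence is uniform on compact sets and
  therefore inherited by every other splitting.
\<close>

lemma local_limit:
  assumes U: "openin (base \<M>) U" and s: "s \<in> Sec U" and p: "p \<in> gpre U"
  obtains V t where "openin (base \<M>) V" "p \<in> V" "V \<subseteq> gpre U" "t \<in> Sec V" "\<forall>x\<in>V. approx F \<phi> U s V t x"
proof -
  obtain W \<Phi> Y0 B where W: "spl W \<Phi>" and Y0: "openin (base \<M>) Y0" "p \<in> Y0" "Y0 \<subseteq> W"
    and ev0: "eventually (\<lambda>\<alpha>. fst (\<phi> \<alpha>) ` Y0 \<subseteq> U \<and> (\<forall>x\<in>Y0. \<forall>\<nu>\<in>multi. cmod (pc (\<phi> \<alpha>) \<Phi> W U s x \<nu>) \<le> B)) F"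
    by (rule pullbacks_locally_bounded[OF U s p]) (rule that)
  define V where "V = Y0 \<inter> gpre U"
  have V: "openin (base \<M>) V" "p \<in> V" "V \<subseteq> W" "V \<subseteq> gpre U"
    using Y0 p gpre_open[OF U] by (auto simp: V_def)
  have VT: "V \<subseteq> topspace (base \<M>)" by (rule openin_subset[OF V(1)])
  have ev: "eventually (\<lambda>\<alpha>. smor (\<phi> \<alpha>) \<and> V \<subseteq> pre (\<phi> \<alpha>) U \<and> (\<forall>x\<in>V. \<forall>\<nu>\<in>multi. cmod (pc (\<phi> \<alpha>) \<Phi> W U s x \<nu>) \<le> B)) F"
    using ev0 smor_ev
  proof eventually_elim
    case (elim \<alpha>)
    have "V \<subseteq> Y0" by (simp add: V_def)
    then have "x \<in> pre (\<phi> \<alpha>) U" if "x \<in> V" for x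
      unfolding pre_iff using elim(1) VT that by blast
    then show ?case using elim \<open>V \<subseteq> Y0\<close> by blast
  qed
  have "\<exists>l. ((\<lambda>\<alpha>. pc (\<phi> \<alpha>) \<Phi> W U s x \<nu>) \<longlongrightarrow> l) F" if "x \<in> V" "\<nu> \<in> multi" for x \<nu>
  proof -
    have "eventually (\<lambda>\<alpha>. cmod (pc (\<phi> \<alpha>) \<Phi> W U s x \<nu>) \<le> B) F"
      using ev by eventually_elim (use that in blast)
    then obtain l where "((\<lambda>\<alpha>. pc (\<phi> \<alpha>) \<Phi> W U s x \<nu>) \<longlongrightarrow> l) F"
      by (rule ultrafilter_bounded_limit[OF F])
    then show ?thesis by blast
  qed
  then have "\<forall>\<nu>. \<forall>x. \<exists>l. x \<in> V \<longrightarrow> \<nu> \<in> multi \<longrightarrow> ((\<lambda>\<alpha>. pc (\<phi> \<alpha>) \<Phi> W U s x \<nu>) \<longlongrightarrow> l) F"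
    by blast
  then obtain a where a: "\<And>x \<nu>. x \<in> V \<Longrightarrow> \<nu> \<in> multi \<Longrightarrow> ((\<lambda>\<alpha>. pc (\<phi> \<alpha>) \<Phi> W U s x \<nu>) \<longlongrightarrow> a \<nu> x) F"
    unfolding choice_iff by blast
  have hol_ev: "eventually (\<lambda>\<alpha>. holo V (\<lambda>x. pc (\<phi> \<alpha>) \<Phi> W U s x \<nu>) \<and> (\<forall>x\<in>V. cmod (pc (\<phi> \<alpha>) \<Phi> W U s x \<nu>) \<le> B)) F"
    if \<nu>: "\<nu> \<in> multi" for \<nu>
    using ev
  proof eventually_elim
    case (elim \<alpha>)
    have "holo (pre (\<phi> \<alpha>) U \<inter> W) (\<lambda>x. pc (\<phi> \<alpha>) \<Phi> W U s x \<nu>)"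
      unfolding pc_def using elim by (intro coeff_holo[OF W pre_open[OF _ U] smor_closed[OF _ U s] \<nu>]) simp_all
    moreover have "V \<subseteq> pre (\<phi> \<alpha>) U \<inter> W" using elim V(3) by simp
    ultimately have "holo V (\<lambda>x. pc (\<phi> \<alpha>) \<Phi> W U s x \<nu>)" by (rule holo_subset)
    moreover have "\<forall>x\<in>V. cmod (pc (\<phi> \<alpha>) \<Phi> W U s x \<nu>) \<le> B" using elim \<nu> by simp
    ultimately show ?case by (rule conjI)
  qed
  have ahol: "holo V (a \<nu>)" if \<nu>: "\<nu> \<in> multi" for \<nu>
    by (rule holo_pointwise_limit[OF F_nonbot V(1) hol_ev[OF \<nu>] a[OF _ \<nu>]])
  define t where "t = sec \<Phi> W V a"
  have tV: "t \<in> Sec V" unfolding t_def by (rule sec_closed[OF W V(1,3) ahol])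
  have ct: "coeff \<Phi> W V t x \<nu> = a \<nu> x" if "x \<in> V" "\<nu> \<in> multi" for x \<nu>
    unfolding t_def by (rule coeff_sec[OF W V(1,3) ahol that])
  have "approx F \<phi> U s V t x" if x: "x \<in> V" for x
    unfolding approx_def
  proof (intro allI impI)
    fix W2 \<Phi>2 and e :: real assume W2: "spl W2 \<Phi>2" and x2: "x \<in> W2" and e: "e > 0"
    obtain Y1 where Y1: "openin (base \<M>) Y1" "x \<in> Y1" "base \<M> closure_of Y1 \<subseteq> V"
      using shrink_open[OF V(1) x] by blast
    have Y1c: "Y1 \<subseteq> base \<M> closure_of Y1" by (rule closure_of_subset[OF openin_subset[OF Y1(1)]])
    have Y1W: "Y1 \<subseteq> W" using Y1c Y1(3) V(3) by blast
    have xW: "x \<in> W" using x V by blast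
    obtain P Y C where P: "openin (base \<M>) P" "x \<in> P" "P \<subseteq> Y1" and Y: "openin (base \<M>) Y" "x \<in> Y" "Y \<subseteq> P \<inter> W2"
      and C: "0 \<le> C" "\<forall>t\<in>Sec P. \<forall>B. (\<forall>y\<in>P. \<forall>\<nu>\<in>multi. cmod (coeff \<Phi> W P t y \<nu>) \<le> B) \<longrightarrow>
        (\<forall>y\<in>Y. \<forall>\<nu>\<in>multi. cmod (coeff \<Phi>2 W2 P t y \<nu>) \<le> C * B)"
      by (rule coeff_change_splitting[OF W W2 xW x2 Y1(1,2) Y1W]) (rule that)
    define d where "d = e / (C + 1)"
    have d: "d > 0" "C * d < e" using C(1) e by (simp_all add: d_def divide_simps)
    have unif: "uniform_limit (base \<M> closure_of Y1) (\<lambda>\<alpha> x. pc (\<phi> \<alpha>) \<Phi> W U s x \<nu>) (a \<nu>) F" if \<nu>: "\<nu> \<in> multi" for \<nu>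
      by (rule holo_uniform_limit_on_compact[OF F_nonbot V(1) compactin_closure Y1(3) hol_ev[OF \<nu>] a[OF _ \<nu>]])
    have "eventually (\<lambda>\<alpha>. \<forall>\<nu>\<in>multi. \<forall>y\<in>base \<M> closure_of Y1. dist (pc (\<phi> \<alpha>) \<Phi> W U s y \<nu>) (a \<nu> y) < d) F"
      by (rule eventually_ball_finite) (use uniform_limitD[OF unif d(1)] in auto)
    with ev have "eventually (\<lambda>\<alpha>. fst (\<phi> \<alpha>) ` Y \<subseteq> U \<and>
       (\<forall>y\<in>Y. \<forall>\<nu>\<in>multi. cmod (pc (\<phi> \<alpha>) \<Phi>2 W2 U s y \<nu> - coeff \<Phi>2 W2 V t y \<nu>) < e)) F"
    proof eventually_elim
      case (elim \<alpha>)
      have sm: "smor (\<phi> \<alpha>)" and VP: "V \<subseteq> pre (\<phi> \<alpha>) U" using elim by auto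
      have PV: "P \<subseteq> V" using P(3) Y1c Y1(3) by blast
      have Ppre: "P \<subseteq> pre (\<phi> \<alpha>) U" using PV VP by blast
      note pO = pre_open[OF sm U] and sC = smor_closed[OF sm U s]
      let ?u = "restr \<M> (pre (\<phi> \<alpha>) U) P (snd (\<phi> \<alpha>) U s)" and ?v = "restr \<M> V P t"
      have uP: "?u \<in> Sec P" by (rule restr_closed[OF pO P(1) Ppre sC])
      have vP: "?v \<in> Sec P" by (rule restr_closed[OF V(1) P(1) PV tV])
      have vP': "(- 1) \<odot>\<^bsub>sections \<M> P\<^esub> ?v \<in> Sec P" by (rule sections_smult_closed[OF P(1) vP])
      let ?D = "?u \<oplus>\<^bsub>sections \<M> P\<^esub> ((- 1) \<odot>\<^bsub>sections \<M> P\<^esub> ?v)"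
      have DP: "?D \<in> Sec P" using uP vP' P(1) by simp
      have cD: "coeff \<Phi>' W' P ?D y \<nu> = pc (\<phi> \<alpha>) \<Phi>' W' U s y \<nu> - coeff \<Phi>' W' V t y \<nu>"
        if W': "spl W' \<Phi>'" and y: "y \<in> P" "y \<in> W'" and \<nu>: "\<nu> \<in> multi" for W' \<Phi>' y \<nu>
        using coeff_add[OF W' P(1) uP vP' y \<nu>] coeff_smult[OF W' P(1) vP y \<nu>, of "- 1"]
          coeff_restr[OF W' pO P(1) Ppre sC y \<nu>] coeff_restr[OF W' V(1) P(1) PV tV y \<nu>]
        by (simp add: pc_def)
      have "cmod (coeff \<Phi> W P ?D y \<nu>) \<le> d" if y: "y \<in> P" and \<nu>: "\<nu> \<in> multi" for y \<nu>
      proof -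
        have yV: "y \<in> V" and yW: "y \<in> W" and yc: "y \<in> base \<M> closure_of Y1"
          using y PV V(3) P(3) Y1c by auto
        have "dist (pc (\<phi> \<alpha>) \<Phi> W U s y \<nu>) (a \<nu> y) < d" using elim yc \<nu> by blast
        then show ?thesis unfolding cD[OF W y yW \<nu>] ct[OF yV \<nu>] by (simp add: dist_norm)
      qed
      then have bd: "\<forall>y\<in>Y. \<forall>\<nu>\<in>multi. cmod (coeff \<Phi>2 W2 P ?D y \<nu>) \<le> C * d"
        using C(2) DP by blast
      have "cmod (pc (\<phi> \<alpha>) \<Phi>2 W2 U s y \<nu> - coeff \<Phi>2 W2 V t y \<nu>) < e" if y: "y \<in> Y" and \<nu>: "\<nu> \<in> multi" for y \<nu>
      proof -
        have yy: "y \<in> P" "y \<in> W2" using y Y(3) by auto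
        show ?thesis using bd[rule_format, OF y \<nu>] d(2) unfolding cD[OF W2 yy \<nu>] by linarith
      qed
      moreover have "fst (\<phi> \<alpha>) ` Y \<subseteq> U"
      proof clarify
        fix y assume "y \<in> Y"
        then have "y \<in> pre (\<phi> \<alpha>) U" using Y(3) Ppre by blast
        then show "fst (\<phi> \<alpha>) y \<in> U" by (simp add: pre_iff)
      qed
      ultimately show ?case by blast
    qed
    moreover have "Y \<subseteq> V \<inter> W2" using Y(3) P(3) Y1c Y1(3) by blast
    ultimately show "\<exists>Y. openin (base \<M>) Y \<and> x \<in> Y \<and> Y \<subseteq> V \<inter> W2 \<and> eventually (\<lambda>\<alpha>. fst (\<phi> \<alpha>) ` Y \<subseteq> U \<and>
       (\<forall>y\<in>Y. \<forall>\<nu>\<in>multi. cmod (pc (\<phi> \<alpha>) \<Phi>2 W2 U s y \<nu> - coeff \<Phi>2 W2 V t y \<nu>) < e)) F"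
      using Y(1,2) by blast
  qed
  with V tV show thesis by (intro that[of V t]) auto
qed

text \<open>
  On overlaps the coefficients of the local limits are limits of the same numbers, so the local
  limits agree there.
\<close>

lemma global_limit:
  assumes U: "openin (base \<M>) U" and s: "s \<in> Sec U"
  shows "\<exists>t. t \<in> Sec (gpre U) \<and> (\<forall>x\<in>gpre U. approx F \<phi> U s (gpre U) t x)"
proof -
  define C where "C = {V. openin (base \<M>) V \<and> V \<subseteq> gpre U \<and> (\<exists>t. t \<in> Sec V \<and> (\<forall>x\<in>V. approx F \<phi> U s V t x))}"
  have UC: "\<Union>C = gpre U"
  proof
    show "gpre U \<subseteq> \<Union>C"
    proof
      fix p assume "p \<in> gpre U"
      then obtain V t where "openin (base \<M>) V" "p \<in> V" "V \<subseteq> gpre U" "t \<in> Sec V" "\<forall>x\<in>V. approx F \<phi> U s V t x"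
        by (rule local_limit[OF U s]) (rule that)
      then show "p \<in> \<Union>C" by (auto simp: C_def)
    qed
  qed (auto simp: C_def)
  define T where "T V = (SOME t. t \<in> Sec V \<and> (\<forall>x\<in>V. approx F \<phi> U s V t x))" for V
  have T: "openin (base \<M>) V" "T V \<in> Sec V" "x \<in> V \<Longrightarrow> approx F \<phi> U s V (T V) x" if "V \<in> C" for V x
  proof -
    have ex: "\<exists>t. t \<in> Sec V \<and> (\<forall>x\<in>V. approx F \<phi> U s V t x)" and o: "openin (base \<M>) V"
      using that by (auto simp: C_def)
    show "openin (base \<M>) V" by (rule o)
    show "T V \<in> Sec V" "x \<in> V \<Longrightarrow> approx F \<phi> U s V (T V) x"
      using someI_ex[OF ex] unfolding T_def[symmetric] by auto
  qed
  have CO: "C \<subseteq> opens \<M>" using T(1) by auto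
  have compat: "restr \<M> V (V \<inter> V') (T V) = restr \<M> V' (V \<inter> V') (T V')" if V: "V \<in> C" and V': "V' \<in> C" for V V'
  proof (rule coeff_eqI)
    show o: "openin (base \<M>) (V \<inter> V')" using T(1)[OF V] T(1)[OF V'] by blast
    show "restr \<M> V (V \<inter> V') (T V) \<in> Sec (V \<inter> V')" by (rule restr_closed[OF T(1)[OF V] o _ T(2)[OF V]]) simp
    show "restr \<M> V' (V \<inter> V') (T V') \<in> Sec (V \<inter> V')" by (rule restr_closed[OF T(1)[OF V'] o _ T(2)[OF V']]) simp
    fix x assume x: "x \<in> V \<inter> V'"
    then obtain W \<Phi> where W: "x \<in> W" "spl W \<Phi>" using spl_exists openin_subset[OF o] by blast
    have "coeff \<Phi> W (V \<inter> V') (restr \<M> V (V \<inter> V') (T V)) y \<nu> = coeff \<Phi> W (V \<inter> V') (restr \<M> V' (V \<inter> V') (T V')) y \<nu>"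
      if y: "y \<in> V \<inter> V' \<inter> W" and \<nu>: "\<nu> \<in> multi" for y \<nu>
    proof -
      have yy: "y \<in> V \<inter> V'" "y \<in> W" "y \<in> V" "y \<in> V'" using y by auto
      have "coeff \<Phi> W V (T V) y \<nu> = coeff \<Phi> W V' (T V') y \<nu>"
        by (rule tendsto_unique[OF F_nonbot approx_pointwise[OF T(3)[OF V yy(3)] W(2) yy(2) \<nu>]
              approx_pointwise[OF T(3)[OF V' yy(4)] W(2) yy(2) \<nu>]])
      then show ?thesis
        using coeff_restr[OF W(2) T(1)[OF V] o _ T(2)[OF V] yy(1,2) \<nu>]
          coeff_restr[OF W(2) T(1)[OF V'] o _ T(2)[OF V'] yy(1,2) \<nu>] by simp
    qed
    then show "\<exists>W \<Phi> Y. spl W \<Phi> \<and> openin (base \<M>) Y \<and> x \<in> Y \<and> Y \<subseteq> V \<inter> V' \<inter> W \<and>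
        (\<forall>y\<in>Y. \<forall>\<nu>\<in>multi. coeff \<Phi> W (V \<inter> V') (restr \<M> V (V \<inter> V') (T V)) y \<nu> =
            coeff \<Phi> W (V \<inter> V') (restr \<M> V' (V \<inter> V') (T V')) y \<nu>)"
      using W x VW[OF W(2) o] by (intro exI[of _ W] exI[of _ \<Phi>] exI[of _ "V \<inter> V' \<inter> W"]) simp
  qed
  have "\<exists>t\<in>Sec (\<Union>C). \<forall>V\<in>C. restr \<M> (\<Union>C) V t = T V"
  proof -
    have glue: "\<forall>\<C>\<subseteq>opens \<M>. \<forall>s. (\<forall>V\<in>\<C>. s V \<in> Sec V) \<longrightarrow>
        (\<forall>V\<in>\<C>. \<forall>W\<in>\<C>. restr \<M> V (V \<inter> W) (s V) = restr \<M> W (V \<inter> W) (s W)) \<longrightarrow>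
        (\<exists>t\<in>Sec (\<Union>\<C>). \<forall>V\<in>\<C>. restr \<M> (\<Union>\<C>) V t = s V)"
      using sheaf unfolding superalgebra_sheaf_def by (elim conjE)
    show ?thesis
      by (rule glue[rule_format, OF CO, of T]) (rule T(2), assumption, rule compat)
  qed
  then obtain t where t: "t \<in> Sec (gpre U)" "\<forall>V\<in>C. restr \<M> (gpre U) V t = T V" unfolding UC by blast
  have gO: "openin (base \<M>) (gpre U)" by (rule gpre_open[OF U])
  have "approx F \<phi> U s (gpre U) t x" if x: "x \<in> gpre U" for x
  proof -
    obtain V where V: "V \<in> C" "x \<in> V" using x UC by blast
    have Vg: "V \<subseteq> gpre U" using V(1) by (auto simp: C_def)
    show ?thesis
    proof (rule approx_transfer[OF T(3)[OF V] T(1)[OF V(1)] gO x])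
      fix W \<Phi> y \<nu> assume "spl W \<Phi>" "y \<in> V" "y \<in> W" "\<nu> \<in> multi"
      then show "coeff \<Phi> W V (T V) y \<nu> = coeff \<Phi> W (gpre U) t y \<nu>"
        using coeff_restr[OF _ gO T(1)[OF V(1)] Vg t(1), of W \<Phi> y \<nu>] t(2) V(1) by simp
    qed
  qed
  with t(1) show ?thesis by blast
qed

lemma pre_lim: "pre lim_morphism U = gpre U"
  by (auto simp: preimage_def limit_morphism_def limit_pre_def)

lemma fst_lim: "x \<in> topspace (base \<M>) \<Longrightarrow> fst lim_morphism x = g x"
  by (simp add: limit_morphism_def)

lemma snd_lim:
  assumes U: "openin (base \<M>) U" and s: "s \<in> Sec U"
  shows "snd lim_morphism U s \<in> Sec (gpre U)"
    and "x \<in> gpre U \<Longrightarrow> approx F \<phi> U s (gpre U) (snd lim_morphism U s) x"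
  using someI_ex[OF global_limit[OF U s]] U s by (auto simp: limit_morphism_def)

lemma lim_pointwise:
  assumes U: "openin (base \<M>) U" and s: "s \<in> Sec U" and x: "x \<in> gpre U" "x \<in> W" and W: "spl W \<Phi>" and \<nu>: "\<nu> \<in> multi"
  shows "((\<lambda>\<alpha>. pc (\<phi> \<alpha>) \<Phi> W U s x \<nu>) \<longlongrightarrow> coeff \<Phi> W (gpre U) (snd lim_morphism U s) x \<nu>) F"
  by (rule approx_pointwise[OF snd_lim(2)[OF U s x(1)] W x(2) \<nu>])

lemma eventually_in_pre:
  assumes U: "openin (base \<M>) U" and x: "x \<in> gpre U"
  shows "eventually (\<lambda>\<alpha>. smor (\<phi> \<alpha>) \<and> x \<in> pre (\<phi> \<alpha>) U) F"
proof -
  have xt: "x \<in> topspace (base \<M>)" and gx: "g x \<in> U" using x by (auto simp: limit_pre_def)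
  have "eventually (\<lambda>\<alpha>. fst (\<phi> \<alpha>) x \<in> U) F" by (rule limitinD[OF conv_continuously_limit[OF body xt] U gx])
  with smor_ev show ?thesis by eventually_elim (use xt in \<open>simp add: pre_iff\<close>)
qed

text \<open>
  Each condition on a morphism is an identity between coefficients at a point, that is, an equation
  between finitely many numbers, and passes to the limit.
\<close>

lemma smor_lim: "smor lim_morphism"
  unfolding supermorphism_def
proof (intro conjI ballI impI)
  have hg: "holo_map g"
    by (rule conv_continuously_holo_map[OF F_nonbot body]) (use smor_ev in \<open>eventually_elim, simp add: holo_map_smor\<close>)
  show "holomorphic_map \<M> \<M> (fst lim_morphism)"
  proof (rule holomorphic_mapI)
    show "continuous_map (base \<M>) (base \<M>) (fst lim_morphism)"
      by (rule continuous_map_eq[OF conv_continuously_continuous[OF F_nonbot body]]) (simp add: fst_lim)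
    fix V f assume V: "openin (base \<M>) V" and f: "holo V f"
    have eq: "{x \<in> topspace (base \<M>). fst lim_morphism x \<in> V} = gpre V" by (auto simp: limit_pre_def fst_lim)
    have "holo (gpre V) (\<lambda>x. f (g x))" using hg V f by (simp add: holo_map_def limit_pre_def)
    then have "holo (gpre V) (\<lambda>x. f (fst lim_morphism x))"
      by (rule holo_cong[OF gpre_open[OF V], rotated]) (simp add: limit_pre_def fst_lim)
    then show "holo {x \<in> topspace (base \<M>). fst lim_morphism x \<in> V} (\<lambda>x. f (fst lim_morphism x))"
      by (simp only: eq)
  qed
  fix U assume "U \<in> opens \<M>"
  then have U: "openin (base \<M>) U" by simp
  have gO: "openin (base \<M>) (gpre U)" by (rule gpre_open[OF U])
  let ?L = "snd lim_morphism U"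
  show "?L \<in> extensional (Sec U)" using U by (simp add: limit_morphism_def)
  have mult: "?L (s \<otimes>\<^bsub>sections \<M> U\<^esub> t) = ?L s \<otimes>\<^bsub>sections \<M> (gpre U)\<^esub> ?L t" if s: "s \<in> Sec U" and t: "t \<in> Sec U" for s t
  proof (rule coeff_eqI_everywhere[OF gO])
    have st: "s \<otimes>\<^bsub>sections \<M> U\<^esub> t \<in> Sec U" using U s t by simp
    show "?L (s \<otimes>\<^bsub>sections \<M> U\<^esub> t) \<in> Sec (gpre U)" by (rule snd_lim(1)[OF U st])
    show "?L s \<otimes>\<^bsub>sections \<M> (gpre U)\<^esub> ?L t \<in> Sec (gpre U)" using gO snd_lim(1)[OF U] s t by simp
    fix W \<Phi> y \<nu> assume W: "spl W \<Phi>" and y: "y \<in> gpre U" "y \<in> W" and \<nu>: "\<nu> \<in> multi"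
    have sub: "\<mu> \<in> multi" if "\<mu> \<in> Pow \<nu>" for \<mu> using that \<nu> by auto
    have "((\<lambda>\<alpha>. wedge (pc (\<phi> \<alpha>) \<Phi> W U s y) (pc (\<phi> \<alpha>) \<Phi> W U t y) \<nu>) \<longlongrightarrow>
        wedge (coeff \<Phi> W (gpre U) (?L s) y) (coeff \<Phi> W (gpre U) (?L t) y) \<nu>) F"
      unfolding wedge_def
    proof (intro tendsto_sum tendsto_mult tendsto_const)
      fix \<mu> assume \<mu>: "\<mu> \<in> Pow \<nu>"
      show "((\<lambda>\<alpha>. pc (\<phi> \<alpha>) \<Phi> W U s y \<mu>) \<longlongrightarrow> coeff \<Phi> W (gpre U) (?L s) y \<mu>) F"
        by (rule lim_pointwise[OF U s y W sub[OF \<mu>]])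
      show "((\<lambda>\<alpha>. pc (\<phi> \<alpha>) \<Phi> W U t y (\<nu> - \<mu>)) \<longlongrightarrow> coeff \<Phi> W (gpre U) (?L t) y (\<nu> - \<mu>)) F"
        by (rule lim_pointwise[OF U t y W]) (use \<nu> in auto)
    qed
    then have "((\<lambda>\<alpha>. pc (\<phi> \<alpha>) \<Phi> W U (s \<otimes>\<^bsub>sections \<M> U\<^esub> t) y \<nu>) \<longlongrightarrow>
        wedge (coeff \<Phi> W (gpre U) (?L s) y) (coeff \<Phi> W (gpre U) (?L t) y) \<nu>) F"
    proof (rule Lim_transform_eventually)
      show "eventually (\<lambda>\<alpha>. wedge (pc (\<phi> \<alpha>) \<Phi> W U s y) (pc (\<phi> \<alpha>) \<Phi> W U t y) \<nu> =
          pc (\<phi> \<alpha>) \<Phi> W U (s \<otimes>\<^bsub>sections \<M> U\<^esub> t) y \<nu>) F"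
        using eventually_in_pre[OF U y(1)]
        by eventually_elim (use pc_mult[OF _ W U _ y(2) s t \<nu>] in simp)
    qed
    then show "coeff \<Phi> W (gpre U) (?L (s \<otimes>\<^bsub>sections \<M> U\<^esub> t)) y \<nu> =
        coeff \<Phi> W (gpre U) (?L s \<otimes>\<^bsub>sections \<M> (gpre U)\<^esub> ?L t) y \<nu>"
      unfolding coeff_mult[OF W gO snd_lim(1)[OF U s] snd_lim(1)[OF U t] y \<nu>]
      by (rule tendsto_unique[OF F_nonbot lim_pointwise[OF U st y W \<nu>]])
  qed
  have add: "?L (s \<oplus>\<^bsub>sections \<M> U\<^esub> t) = ?L s \<oplus>\<^bsub>sections \<M> (gpre U)\<^esub> ?L t" if s: "s \<in> Sec U" and t: "t \<in> Sec U" for s t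
  proof (rule coeff_eqI_everywhere[OF gO])
    have st: "s \<oplus>\<^bsub>sections \<M> U\<^esub> t \<in> Sec U" using U s t by simp
    show "?L (s \<oplus>\<^bsub>sections \<M> U\<^esub> t) \<in> Sec (gpre U)" by (rule snd_lim(1)[OF U st])
    show "?L s \<oplus>\<^bsub>sections \<M> (gpre U)\<^esub> ?L t \<in> Sec (gpre U)" using gO snd_lim(1)[OF U] s t by simp
    fix W \<Phi> y \<nu> assume W: "spl W \<Phi>" and y: "y \<in> gpre U" "y \<in> W" and \<nu>: "\<nu> \<in> multi"
    have "((\<lambda>\<alpha>. pc (\<phi> \<alpha>) \<Phi> W U s y \<nu> + pc (\<phi> \<alpha>) \<Phi> W U t y \<nu>) \<longlongrightarrow>
        coeff \<Phi> W (gpre U) (?L s) y \<nu> + coeff \<Phi> W (gpre U) (?L t) y \<nu>) F"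
      by (intro tendsto_add lim_pointwise[OF U s y W \<nu>] lim_pointwise[OF U t y W \<nu>])
    then have "((\<lambda>\<alpha>. pc (\<phi> \<alpha>) \<Phi> W U (s \<oplus>\<^bsub>sections \<M> U\<^esub> t) y \<nu>) \<longlongrightarrow>
        coeff \<Phi> W (gpre U) (?L s) y \<nu> + coeff \<Phi> W (gpre U) (?L t) y \<nu>) F"
    proof (rule Lim_transform_eventually)
      show "eventually (\<lambda>\<alpha>. pc (\<phi> \<alpha>) \<Phi> W U s y \<nu> + pc (\<phi> \<alpha>) \<Phi> W U t y \<nu> =
          pc (\<phi> \<alpha>) \<Phi> W U (s \<oplus>\<^bsub>sections \<M> U\<^esub> t) y \<nu>) F"
        using eventually_in_pre[OF U y(1)]
        by eventually_elim (use pc_add[OF _ W U _ y(2) s t \<nu>] in simp)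
    qed
    then show "coeff \<Phi> W (gpre U) (?L (s \<oplus>\<^bsub>sections \<M> U\<^esub> t)) y \<nu> =
        coeff \<Phi> W (gpre U) (?L s \<oplus>\<^bsub>sections \<M> (gpre U)\<^esub> ?L t) y \<nu>"
      unfolding coeff_add[OF W gO snd_lim(1)[OF U s] snd_lim(1)[OF U t] y \<nu>]
      by (rule tendsto_unique[OF F_nonbot lim_pointwise[OF U st y W \<nu>]])
  qed
  have smult: "?L (c \<odot>\<^bsub>sections \<M> U\<^esub> s) = c \<odot>\<^bsub>sections \<M> (gpre U)\<^esub> ?L s" if s: "s \<in> Sec U" for c s
  proof (rule coeff_eqI_everywhere[OF gO])
    have cs: "c \<odot>\<^bsub>sections \<M> U\<^esub> s \<in> Sec U" by (rule sections_smult_closed[OF U s])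
    show "?L (c \<odot>\<^bsub>sections \<M> U\<^esub> s) \<in> Sec (gpre U)" by (rule snd_lim(1)[OF U cs])
    show "c \<odot>\<^bsub>sections \<M> (gpre U)\<^esub> ?L s \<in> Sec (gpre U)" by (rule sections_smult_closed[OF gO snd_lim(1)[OF U s]])
    fix W \<Phi> y \<nu> assume W: "spl W \<Phi>" and y: "y \<in> gpre U" "y \<in> W" and \<nu>: "\<nu> \<in> multi"
    have "((\<lambda>\<alpha>. c * pc (\<phi> \<alpha>) \<Phi> W U s y \<nu>) \<longlongrightarrow> c * coeff \<Phi> W (gpre U) (?L s) y \<nu>) F"
      by (intro tendsto_mult tendsto_const lim_pointwise[OF U s y W \<nu>])
    then have "((\<lambda>\<alpha>. pc (\<phi> \<alpha>) \<Phi> W U (c \<odot>\<^bsub>sections \<M> U\<^esub> s) y \<nu>) \<longlongrightarrow> c * coeff \<Phi> W (gpre U) (?L s) y \<nu>) F"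
    proof (rule Lim_transform_eventually)
      show "eventually (\<lambda>\<alpha>. c * pc (\<phi> \<alpha>) \<Phi> W U s y \<nu> = pc (\<phi> \<alpha>) \<Phi> W U (c \<odot>\<^bsub>sections \<M> U\<^esub> s) y \<nu>) F"
        using eventually_in_pre[OF U y(1)]
        by eventually_elim (use pc_smult[OF _ W U _ y(2) s \<nu>] in simp)
    qed
    then show "coeff \<Phi> W (gpre U) (?L (c \<odot>\<^bsub>sections \<M> U\<^esub> s)) y \<nu> = coeff \<Phi> W (gpre U) (c \<odot>\<^bsub>sections \<M> (gpre U)\<^esub> ?L s) y \<nu>"
      unfolding coeff_smult[OF W gO snd_lim(1)[OF U s] y \<nu>]
      by (rule tendsto_unique[OF F_nonbot lim_pointwise[OF U cs y W \<nu>]])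
  qed
  have one: "?L \<one>\<^bsub>sections \<M> U\<^esub> = \<one>\<^bsub>sections \<M> (gpre U)\<^esub>"
  proof (rule coeff_eqI_everywhere[OF gO])
    have o: "\<one>\<^bsub>sections \<M> U\<^esub> \<in> Sec U" using U by simp
    show "?L \<one>\<^bsub>sections \<M> U\<^esub> \<in> Sec (gpre U)" by (rule snd_lim(1)[OF U o])
    show "\<one>\<^bsub>sections \<M> (gpre U)\<^esub> \<in> Sec (gpre U)" using gO by simp
    fix W \<Phi> y \<nu> assume W: "spl W \<Phi>" and y: "y \<in> gpre U" "y \<in> W" and \<nu>: "\<nu> \<in> multi"
    have "((\<lambda>\<alpha>. pc (\<phi> \<alpha>) \<Phi> W U \<one>\<^bsub>sections \<M> U\<^esub> y \<nu>) \<longlongrightarrow> unit_coeff {} \<nu>) F"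
    proof (rule Lim_transform_eventually[OF tendsto_const])
      show "eventually (\<lambda>\<alpha>. unit_coeff {} \<nu> = pc (\<phi> \<alpha>) \<Phi> W U \<one>\<^bsub>sections \<M> U\<^esub> y \<nu>) F"
        using eventually_in_pre[OF U y(1)]
        by eventually_elim (use pc_one[OF _ W U _ y(2) \<nu>] in simp)
    qed
    then show "coeff \<Phi> W (gpre U) (?L \<one>\<^bsub>sections \<M> U\<^esub>) y \<nu> = coeff \<Phi> W (gpre U) \<one>\<^bsub>sections \<M> (gpre U)\<^esub> y \<nu>"
      unfolding coeff_one[OF W gO y \<nu>]
      by (rule tendsto_unique[OF F_nonbot lim_pointwise[OF U o y W \<nu>]])
  qed
  have grade: "?L s \<in> grading \<M> (gpre U) i" if s: "s \<in> grading \<M> U i" for s i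
  proof -
    have sU: "s \<in> Sec U" using s grading_subset[OF U] by blast
    show ?thesis
    proof (rule grading_if_coeff[OF gO snd_lim(1)[OF U sU]])
      fix W \<Phi> y \<nu> assume W: "spl W \<Phi>" and y: "y \<in> gpre U" "y \<in> W" and \<nu>: "\<nu> \<in> multi" "of_nat (card \<nu>) \<noteq> i"
      have "((\<lambda>\<alpha>. pc (\<phi> \<alpha>) \<Phi> W U s y \<nu>) \<longlongrightarrow> 0) F"
      proof (rule Lim_transform_eventually[OF tendsto_const])
        show "eventually (\<lambda>\<alpha>. 0 = pc (\<phi> \<alpha>) \<Phi> W U s y \<nu>) F"
          using eventually_in_pre[OF U y(1)]
        proof eventually_elim
          case (elim \<alpha>)
          then have sm: "smor (\<phi> \<alpha>)" and yp: "y \<in> pre (\<phi> \<alpha>) U" by auto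
          have "snd (\<phi> \<alpha>) U s \<in> grading \<M> (pre (\<phi> \<alpha>) U) i"
            by (rule superalgebra_hom_grading[OF smor_hom(1)[OF sm U] s])
          from grading_coeff[OF W pre_open[OF sm U] this yp y(2) \<nu>] show ?case by (simp add: pc_def)
        qed
      qed
      then show "coeff \<Phi> W (gpre U) (?L s) y \<nu> = 0"
        by (rule tendsto_unique[OF F_nonbot lim_pointwise[OF U sU y W \<nu>(1)]])
    qed
  qed
  show "superalgebra_hom (sections \<M> U) (grading \<M> U) (sections \<M> (pre lim_morphism U))
      (grading \<M> (pre lim_morphism U)) (snd lim_morphism U)"
    unfolding superalgebra_hom_def pre_lim
  proof (intro conjI allI ballI)
    show "?L \<in> Ring.ring_hom (sections \<M> U) (sections \<M> (gpre U))"
      by (rule ring_hom_memI) (use mult add one snd_lim(1)[OF U] in auto)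
    show "?L (c \<odot>\<^bsub>sections \<M> U\<^esub> a) = c \<odot>\<^bsub>sections \<M> (gpre U)\<^esub> ?L a" if "a \<in> Sec U" for c a
      by (rule smult[OF that])
    show "?L ` grading \<M> U i \<subseteq> grading \<M> (gpre U) i" for i using grade by blast
  qed
  fix V s assume "V \<in> opens \<M>" and VU: "V \<subseteq> U" and s: "s \<in> Sec U"
  then have V: "openin (base \<M>) V" by simp
  have gV: "openin (base \<M>) (gpre V)" "gpre V \<subseteq> gpre U" using gpre_open[OF V] VU by (auto simp: limit_pre_def)
  have sV: "restr \<M> U V s \<in> Sec V" by (rule restr_closed[OF U V VU s])
  show "snd lim_morphism V (restr \<M> U V s) =
      restr \<M> (pre lim_morphism U) (pre lim_morphism V) (snd lim_morphism U s)"
    unfolding pre_lim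
  proof (rule coeff_eqI_everywhere[OF gV(1) snd_lim(1)[OF V sV] restr_closed[OF gO gV snd_lim(1)[OF U s]]])
    fix W \<Phi> y \<nu> assume W: "spl W \<Phi>" and y: "y \<in> gpre V" "y \<in> W" and \<nu>: "\<nu> \<in> multi"
    have yU: "y \<in> gpre U" using y gV by blast
    have "((\<lambda>\<alpha>. pc (\<phi> \<alpha>) \<Phi> W V (restr \<M> U V s) y \<nu>) \<longlongrightarrow> coeff \<Phi> W (gpre U) (?L s) y \<nu>) F"
    proof (rule Lim_transform_eventually[OF lim_pointwise[OF U s yU y(2) W \<nu>]])
      show "eventually (\<lambda>\<alpha>. pc (\<phi> \<alpha>) \<Phi> W U s y \<nu> = pc (\<phi> \<alpha>) \<Phi> W V (restr \<M> U V s) y \<nu>) F"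
        using eventually_in_pre[OF V y(1)]
        by eventually_elim (use pc_restr[OF _ W V _ y(2) U VU s \<nu>] in simp)
    qed
    then show "coeff \<Phi> W (gpre V) (snd lim_morphism V (restr \<M> U V s)) y \<nu> =
        coeff \<Phi> W (gpre V) (restr \<M> (gpre U) (gpre V) (?L s)) y \<nu>"
      unfolding coeff_restr[OF W gO gV snd_lim(1)[OF U s] y \<nu>]
      by (rule tendsto_unique[OF F_nonbot lim_pointwise[OF V sV y W \<nu>]])
  qed
qed (auto simp: limit_morphism_def)

end

end


section \<open>Nondegenerate morphisms are isomorphisms\<close>

lemma right_inverse_imp_left_inverse:
  fixes A B :: "nat \<Rightarrow> nat \<Rightarrow> complex"
  assumes AB: "\<And>i l. i < N \<Longrightarrow> l < N \<Longrightarrow> (\<Sum>k<N. A i k * B k l) = (if i = l then 1 else 0)"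
    and il: "i < N" "l < N"
  shows "(\<Sum>k<N. B i k * A k l) = (if i = l then 1 else 0)"
proof -
  let ?A = "mat N N (\<lambda>(i, j). A i j)" and ?B = "mat N N (\<lambda>(i, j). B i j)"
  have "?A * ?B = 1\<^sub>m N"
    by (rule eq_matI) (simp_all add: scalar_prod_def AB atLeast0LessThan)
  then have BA: "?B * ?A = 1\<^sub>m N"
    by (rule mat_mult_left_right_inverse[rotated 2]) simp_all
  have "(\<Sum>k<N. B i k * A k l) = (?B * ?A) $$ (i, l)"
    using il by (simp add: scalar_prod_def atLeast0LessThan)
  also have "\<dots> = (if i = l then 1 else 0)" unfolding BA using il by simp
  finally show ?thesis .
qed

lemma wedge_diff: "wedge a b \<nu> - wedge a' b' \<nu> = wedge (\<lambda>\<mu>. a \<mu> - a' \<mu>) b \<nu> + wedge a' (\<lambda>\<mu>. b \<mu> - b' \<mu>) \<nu>"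
  by (simp add: wedge_def algebra_simps flip: sum_subtractf sum.distrib)

lemma order_ge_add: "order_ge N k a \<Longrightarrow> order_ge N k b \<Longrightarrow> order_ge N k (\<lambda>\<nu>. a \<nu> + b \<nu>)"
  by (auto simp: order_ge_def)

lemma order_ge_scale: "order_ge N k a \<Longrightarrow> order_ge N k (\<lambda>\<nu>. c * a \<nu>)"
  by (auto simp: order_ge_def)

lemma order_ge_cong:
  "order_ge N k a \<Longrightarrow> (\<And>\<nu>. \<nu> \<subseteq> {..<N} \<Longrightarrow> a \<nu> = b \<nu>) \<Longrightarrow> order_ge N k b"
  by (auto simp: order_ge_def)

lemma order_ge_wedge_diff:
  assumes a: "order_ge N k (\<lambda>\<mu>. a \<mu> - a' \<mu>)" and b: "order_ge N l b"
    and a': "order_ge N k' a'" and bb: "order_ge N l' (\<lambda>\<mu>. b \<mu> - b' \<mu>)"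
    and j: "j \<le> k + l" "j \<le> k' + l'"
  shows "order_ge N j (\<lambda>\<nu>. wedge a b \<nu> - wedge a' b' \<nu>)"
  unfolding wedge_diff
  by (intro order_ge_add order_ge_mono[OF order_ge_wedge[OF a b] j(1)] order_ge_mono[OF order_ge_wedge[OF a' bb] j(2)])

lemma order_ge_unit: "order_ge N (card \<nu>) (unit_coeff \<nu>)"
  by (auto simp: order_ge_def unit_coeff_def)

text \<open>Every other product involves a coefficient of \<open>y\<close> below its order.\<close>

lemma wedge_lowest_degree:
  assumes y: "order_ge N (card \<nu>) y" and \<nu>: "\<nu> \<subseteq> {..<N}"
  shows "wedge x y \<nu> = x {} * y \<nu>"
proof -
  have fin: "finite \<nu>" using \<nu> finite_subset by blast
  have "wedge x y \<nu> = (\<Sum>\<mu>\<in>{{}}. wedge_sign \<mu> (\<nu> - \<mu>) * x \<mu> * y (\<nu> - \<mu>))"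
    unfolding wedge_def
  proof (rule sum.mono_neutral_right)
    show "\<forall>\<mu>\<in>Pow \<nu> - {{}}. wedge_sign \<mu> (\<nu> - \<mu>) * x \<mu> * y (\<nu> - \<mu>) = 0"
    proof
      fix \<mu> assume "\<mu> \<in> Pow \<nu> - {{}}"
      then have "\<nu> - \<mu> \<subset> \<nu>" by auto
      then have "card (\<nu> - \<mu>) < card \<nu>" using fin by (simp add: psubset_card_mono)
      moreover have "\<nu> - \<mu> \<subseteq> {..<N}" using \<nu> by auto
      ultimately have "y (\<nu> - \<mu>) = 0" using y by (simp add: order_ge_def)
      then show "wedge_sign \<mu> (\<nu> - \<mu>) * x \<mu> * y (\<nu> - \<mu>) = 0" by simp
    qed
  qed (use fin in auto)
  then show ?thesis by simp
qed

text \<open>The Laplace expansion: only the terms \<open>\<theta>\<^sup>\<mu> \<theta>\<^sub>k\<close> with \<open>\<mu>\<close> the complement of \<open>k\<close> survive.\<close>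

lemma wedge_codimension_one:
  assumes b: "order_ge N (N - 1) b" and a: "a {} = 0"
  shows "wedge b a {..<N} = (\<Sum>k<N. wedge_sign ({..<N} - {k}) {k} * b ({..<N} - {k}) * a {k})"
proof -
  let ?f = "\<lambda>k. {..<N} - {k}"
  have "wedge b a {..<N} = (\<Sum>\<mu>\<in>?f ` {..<N}. wedge_sign \<mu> ({..<N} - \<mu>) * b \<mu> * a ({..<N} - \<mu>))"
    unfolding wedge_def
  proof (rule sum.mono_neutral_right)
    show "\<forall>\<mu>\<in>Pow {..<N} - ?f ` {..<N}. wedge_sign \<mu> ({..<N} - \<mu>) * b \<mu> * a ({..<N} - \<mu>) = 0"
    proof
      fix \<mu> assume \<mu>: "\<mu> \<in> Pow {..<N} - ?f ` {..<N}"
      then have sub: "\<mu> \<subseteq> {..<N}" and fin: "finite \<mu>" using finite_subset by auto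
      have cN: "card ({..<N} - \<mu>) = N - card \<mu>" using sub fin by (simp add: card_Diff_subset)
      have le: "card \<mu> \<le> N" using card_mono[OF _ sub] by simp
      consider "card \<mu> < N - 1" | "card \<mu> = N" | "N - card \<mu> = 1" using le by linarith
      then show "wedge_sign \<mu> ({..<N} - \<mu>) * b \<mu> * a ({..<N} - \<mu>) = 0"
      proof cases
        case 1 then show ?thesis using b sub by (simp add: order_ge_def)
      next
        case 2
        then have "\<mu> = {..<N}" using sub by (simp add: card_subset_eq)
        then show ?thesis using a by simp
      next
        case 3
        then obtain k where k: "{..<N} - \<mu> = {k}" using cN by (metis card_1_singletonE)
        then have "k < N" "\<mu> = ?f k" using sub by auto
        then show ?thesis using \<mu> by blast
      qed
    qed
  qed auto
  also have "\<dots> = (\<Sum>k<N. wedge_sign (?f k) ({..<N} - ?f k) * b (?f k) * a ({..<N} - ?f k))"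
    by (subst sum.reindex) (auto simp: inj_on_def)
  also have "\<dots> = (\<Sum>k<N. wedge_sign (?f k) {k} * b (?f k) * a {k})"
  proof (rule sum.cong)
    fix k assume "k \<in> {..<N}"
    then have "{..<N} - ?f k = {k}" by auto
    then show "wedge_sign (?f k) ({..<N} - ?f k) * b (?f k) * a ({..<N} - ?f k) = wedge_sign (?f k) {k} * b (?f k) * a {k}"
      by simp
  qed simp
  finally show ?thesis .
qed

context compact_super
begin

abbreviation top :: "nat set" where "top \<equiv> {..<n}"

context
  fixes \<psi> h W \<Phi> Z \<Psi> V'
  assumes \<psi>: "smor \<psi>" and h: "holo_map h"
    and inv1: "\<And>y. y \<in> topspace (base \<M>) \<Longrightarrow> h y \<in> topspace (base \<M>) \<and> fst \<psi> (h y) = y"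
    and inv2: "\<And>x. x \<in> topspace (base \<M>) \<Longrightarrow> h (fst \<psi> x) = x"
    and W: "spl W \<Phi>" and Z: "spl Z \<Psi>" and V': "openin (base \<M>) V'" "V' \<subseteq> Z" and VW': "pre \<psi> V' \<subseteq> W"
    and nondeg: "\<And>x. x \<in> pre \<psi> V' \<Longrightarrow> pc \<psi> \<Phi> W V' (monomial_sec \<Psi> Z V' top) x top \<noteq> 0"
begin

abbreviation pull where "pull \<equiv> pc \<psi> \<Phi> W V'"
abbreviation src where "src \<equiv> pre \<psi> V'"

lemma src_open: "openin (base \<M>) src" by (rule pre_open[OF \<psi> V'(1)])

lemma in_W: "x \<in> src \<Longrightarrow> x \<in> W" using VW' by blast

lemmas pull_rules = \<psi> W V'(1)

lemma h_in: "y \<in> V' \<Longrightarrow> h y \<in> src"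
  using inv1 openin_subset[OF V'(1)] by (auto simp: pre_iff)

lemma pull_holo: "t \<in> Sec V' \<Longrightarrow> \<nu> \<in> multi \<Longrightarrow> holo src (\<lambda>x. pull t x \<nu>)"
  using coeff_holo[OF W src_open smor_closed[OF \<psi> V'(1)], of t \<nu>] VW' by (simp add: pc_def inf.absorb1)

lemma monomial_sec_closed': "monomial_sec \<Psi> Z V' \<mu> \<in> Sec V'" by (rule monomial_sec_closed[OF Z V'])

lemma pull_monomial_order: "x \<in> src \<Longrightarrow> \<mu> \<in> multi \<Longrightarrow> order_ge n (card \<mu>) (pull (monomial_sec \<Psi> Z V' \<mu>) x)"
  by (rule pc_monomial_sec_order[OF \<psi> W Z V' _ in_W])

text \<open>
  Injectivity: take a nonzero coefficient \<open>t\<^sub>\<nu>\<close> of least degree. Multiplying \<open>t\<close> by the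
  complementary monomial leaves \<open>\<plusminus> t\<^sub>\<nu> \<theta>\<^bsup>top\<^esup>\<close>, whose pullback does not vanish.
\<close>

lemma local_injective:
  assumes t: "t \<in> Sec V'" and z: "\<And>x \<nu>. x \<in> src \<Longrightarrow> \<nu> \<in> multi \<Longrightarrow> pull t x \<nu> = 0"
    and y0: "y0 \<in> V'" and \<nu>0: "\<nu>0 \<in> multi"
  shows "coeff \<Psi> Z V' t y0 \<nu>0 = 0"
proof (rule ccontr)
  assume nz0: "coeff \<Psi> Z V' t y0 \<nu>0 \<noteq> 0"
  define P where "P k \<longleftrightarrow> (\<exists>y\<in>V'. \<exists>\<nu>\<in>multi. card \<nu> = k \<and> coeff \<Psi> Z V' t y \<nu> \<noteq> 0)" for k
  have "P (card \<nu>0)" using y0 \<nu>0 nz0 by (auto simp: P_def)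
  define k where "k = (LEAST k. P k)"
  have "P k" unfolding k_def by (rule LeastI) fact
  then obtain y \<nu> where y: "y \<in> V'" and \<nu>: "\<nu> \<in> multi" "card \<nu> = k" and nz: "coeff \<Psi> Z V' t y \<nu> \<noteq> 0"
    by (auto simp: P_def)
  have low: "coeff \<Psi> Z V' t y' \<mu> = 0" if "y' \<in> V'" "\<mu> \<in> multi" "card \<mu> < k" for y' \<mu>
    using not_less_Least[of "card \<mu>" P] that by (auto simp: P_def k_def)
  have fin: "finite \<nu>" using \<nu> finite_subset by blast
  define \<sigma> where "\<sigma> = top - \<nu>"
  have \<sigma>: "\<sigma> \<in> multi" by (auto simp: \<sigma>_def)
  let ?f = "\<lambda>y. wedge_sign \<nu> \<sigma> * coeff \<Psi> Z V' t y \<nu>"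
  have V'Z: "V' \<inter> Z = V'" using V' by blast
  have f: "holo V' ?f" using holo_mult[OF holo_const coeff_holo[OF Z V'(1) t \<nu>(1)]] V'Z by simp
  have fC: "function_sec \<Psi> Z V' ?f \<in> Sec V'" by (rule function_sec_closed[OF Z V' f])
  have "t \<otimes>\<^bsub>sections \<M> V'\<^esub> monomial_sec \<Psi> Z V' \<sigma> = function_sec \<Psi> Z V' ?f \<otimes>\<^bsub>sections \<M> V'\<^esub> monomial_sec \<Psi> Z V' top"
  proof (rule coeff_eqI_splitting[OF Z V'])
    fix w \<rho> assume w: "w \<in> V'" and \<rho>: "\<rho> \<in> multi"
    then have wZ: "w \<in> Z" using V' by blast
    have finr: "finite \<rho>" using \<rho> finite_subset by blast
    have sub: "\<tau> \<in> multi" if "\<tau> \<subseteq> \<rho>" for \<tau> using that \<rho> by auto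
    have "coeff \<Psi> Z V' (t \<otimes>\<^bsub>sections \<M> V'\<^esub> monomial_sec \<Psi> Z V' \<sigma>) w \<rho> = wedge (coeff \<Psi> Z V' t w) (unit_coeff \<sigma>) \<rho>"
      unfolding coeff_mult[OF Z V'(1) t monomial_sec_closed' w wZ \<rho>]
      by (rule wedge_cong) (simp_all add: coeff_monomial_sec[OF Z V' w sub])
    also have "\<dots> = ?f w * unit_coeff top \<rho>"
    proof (cases "\<rho> = top")
      case True
      have "wedge (coeff \<Psi> Z V' t w) (unit_coeff \<sigma>) top =
          (\<Sum>\<mu>\<in>{\<nu>}. wedge_sign \<mu> (top - \<mu>) * coeff \<Psi> Z V' t w \<mu> * unit_coeff \<sigma> (top - \<mu>))"
        unfolding wedge_def
      proof (rule sum.mono_neutral_right)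
        show "\<forall>\<mu>\<in>Pow top - {\<nu>}. wedge_sign \<mu> (top - \<mu>) * coeff \<Psi> Z V' t w \<mu> * unit_coeff \<sigma> (top - \<mu>) = 0"
        proof
          fix \<mu> assume "\<mu> \<in> Pow top - {\<nu>}"
          then have "top - \<mu> \<noteq> \<sigma>" using \<nu>(1) unfolding \<sigma>_def by blast
          then show "wedge_sign \<mu> (top - \<mu>) * coeff \<Psi> Z V' t w \<mu> * unit_coeff \<sigma> (top - \<mu>) = 0"
            by (simp add: unit_coeff_def)
        qed
      qed (use \<nu> in auto)
      then show ?thesis using True by (simp add: unit_coeff_def \<sigma>_def)
    next
      case False
      have "wedge (coeff \<Psi> Z V' t w) (unit_coeff \<sigma>) \<rho> = 0"
        unfolding wedge_def
      proof (rule sum.neutral, rule ballI)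
        fix \<mu> assume \<mu>: "\<mu> \<in> Pow \<rho>"
        show "wedge_sign \<mu> (\<rho> - \<mu>) * coeff \<Psi> Z V' t w \<mu> * unit_coeff \<sigma> (\<rho> - \<mu>) = 0"
        proof (cases "\<rho> - \<mu> = \<sigma>")
          case True
          then have "\<mu> \<subset> \<nu>" using \<mu> \<rho> False unfolding \<sigma>_def by blast
          then have "card \<mu> < k" using \<nu>(2) fin psubset_card_mono by blast
          then have "coeff \<Psi> Z V' t w \<mu> = 0" using low[OF w] \<mu> \<rho> by auto
          then show ?thesis by simp
        qed (simp add: unit_coeff_def)
      qed
      then show ?thesis using False by (simp add: unit_coeff_def)
    qed
    also have "\<dots> = coeff \<Psi> Z V' (function_sec \<Psi> Z V' ?f \<otimes>\<^bsub>sections \<M> V'\<^esub> monomial_sec \<Psi> Z V' top) w \<rho>"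
      unfolding coeff_function_sec_mult[OF Z V' f monomial_sec_closed' w \<rho>] coeff_monomial_sec[OF Z V' w \<rho>] ..
    finally show "coeff \<Psi> Z V' (t \<otimes>\<^bsub>sections \<M> V'\<^esub> monomial_sec \<Psi> Z V' \<sigma>) w \<rho> =
        coeff \<Psi> Z V' (function_sec \<Psi> Z V' ?f \<otimes>\<^bsub>sections \<M> V'\<^esub> monomial_sec \<Psi> Z V' top) w \<rho>" .
  qed (use t fC monomial_sec_closed' V'(1) in simp_all)
  define x where "x = h y"
  have x: "x \<in> src" unfolding x_def by (rule h_in[OF y])
  have xy: "fst \<psi> x = y" using inv1 y openin_subset[OF V'(1)] by (auto simp: x_def)
  have topm: "top \<in> multi" by simp
  have yZ: "fst \<psi> x \<in> Z" using xy y V' by blast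
  have "pull (t \<otimes>\<^bsub>sections \<M> V'\<^esub> monomial_sec \<Psi> Z V' \<sigma>) x top = 0"
    unfolding pc_mult[OF pull_rules x in_W[OF x] t monomial_sec_closed' topm] wedge_def
    by (rule sum.neutral) (use z[OF x] in auto)
  moreover have "pull (function_sec \<Psi> Z V' ?f \<otimes>\<^bsub>sections \<M> V'\<^esub> monomial_sec \<Psi> Z V' top) x top =
      pull (function_sec \<Psi> Z V' ?f) x {} * pull (monomial_sec \<Psi> Z V' top) x top"
    unfolding pc_mult[OF pull_rules x in_W[OF x] fC monomial_sec_closed' topm]
    by (rule wedge_lowest_degree) (use pull_monomial_order[OF x topm] in auto)
  moreover have "pull (function_sec \<Psi> Z V' ?f) x {} = ?f y"
    using pc_body[OF \<psi> W Z V'(1) fC x in_W[OF x] yZ] coeff_function_sec[OF Z V' f y, of "{}"] by (simp add: xy)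
  ultimately show False
    using \<open>t \<otimes>\<^bsub>sections \<M> V'\<^esub> monomial_sec \<Psi> Z V' \<sigma> = _\<close> nondeg[OF x] nz wedge_sign_nonzero[of \<nu> \<sigma>] by simp
qed

text \<open>
  Surjectivity is proved by successive approximation: a family of coefficients on the source is
  realised by a pullback up to order \<open>k\<close>, and the error is then corrected in degree \<open>k\<close>.
\<close>

definition pulled_back :: "nat \<Rightarrow> ('p \<Rightarrow> nat set \<Rightarrow> complex) \<Rightarrow> bool" where
  "pulled_back k r \<longleftrightarrow> (\<exists>t\<in>Sec V'. \<forall>x\<in>src. order_ge n k (\<lambda>\<nu>. r x \<nu> - pull t x \<nu>))"

lemma pulled_back_add:
  assumes "pulled_back k r" "pulled_back k r'"
  shows "pulled_back k (\<lambda>x \<nu>. r x \<nu> + r' x \<nu>)"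
proof -
  obtain t t' where t: "t \<in> Sec V'" "\<forall>x\<in>src. order_ge n k (\<lambda>\<nu>. r x \<nu> - pull t x \<nu>)"
    "t' \<in> Sec V'" "\<forall>x\<in>src. order_ge n k (\<lambda>\<nu>. r' x \<nu> - pull t' x \<nu>)"
    using assms by (auto simp: pulled_back_def)
  show ?thesis
    unfolding pulled_back_def
  proof (intro bexI[of _ "t \<oplus>\<^bsub>sections \<M> V'\<^esub> t'"] ballI)
    fix x assume x: "x \<in> src"
    have "order_ge n k (\<lambda>\<nu>. (r x \<nu> - pull t x \<nu>) + (r' x \<nu> - pull t' x \<nu>))"
      by (intro order_ge_add) (use t x in auto)
    then show "order_ge n k (\<lambda>\<nu>. r x \<nu> + r' x \<nu> - pull (t \<oplus>\<^bsub>sections \<M> V'\<^esub> t') x \<nu>)"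
      by (rule order_ge_cong) (simp add: pc_add[OF pull_rules x in_W[OF x] t(1,3)])
  qed (use t V' in simp)
qed

lemma pulled_back_zero: "pulled_back k (\<lambda>x \<nu>. 0)"
  unfolding pulled_back_def
proof (intro bexI[of _ "0 \<odot>\<^bsub>sections \<M> V'\<^esub> \<one>\<^bsub>sections \<M> V'\<^esub>"] ballI)
  fix x assume x: "x \<in> src"
  show "order_ge n k (\<lambda>\<nu>. 0 - pull (0 \<odot>\<^bsub>sections \<M> V'\<^esub> \<one>\<^bsub>sections \<M> V'\<^esub>) x \<nu>)"
    using V'(1) by (simp add: order_ge_def pc_smult[OF pull_rules x in_W[OF x]])
qed (use V' in \<open>simp add: sections_smult_closed\<close>)

lemma pulled_back_sum:
  "(\<And>i. i \<in> I \<Longrightarrow> pulled_back k (r i)) \<Longrightarrow> pulled_back k (\<lambda>x \<nu>. \<Sum>i\<in>I. r i x \<nu>)"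
  by (induction I rule: infinite_finite_induct) (auto intro: pulled_back_zero pulled_back_add)

lemma pulled_back_scale:
  assumes "pulled_back k r"
  shows "pulled_back k (\<lambda>x \<nu>. c * r x \<nu>)"
proof -
  obtain t where t: "t \<in> Sec V'" "\<forall>x\<in>src. order_ge n k (\<lambda>\<nu>. r x \<nu> - pull t x \<nu>)"
    using assms by (auto simp: pulled_back_def)
  show ?thesis
    unfolding pulled_back_def
  proof (intro bexI[of _ "c \<odot>\<^bsub>sections \<M> V'\<^esub> t"] ballI)
    fix x assume x: "x \<in> src"
    have "order_ge n k (\<lambda>\<nu>. c * (r x \<nu> - pull t x \<nu>))"
      by (intro order_ge_scale) (use t x in auto)
    then show "order_ge n k (\<lambda>\<nu>. c * r x \<nu> - pull (c \<odot>\<^bsub>sections \<M> V'\<^esub> t) x \<nu>)"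
      by (rule order_ge_cong) (simp add: pc_smult[OF pull_rules x in_W[OF x] t(1)] right_diff_distrib)
  qed (use t V' in \<open>simp add: sections_smult_closed\<close>)
qed

lemma pulled_back_approx:
  assumes "pulled_back k r" "\<And>x. x \<in> src \<Longrightarrow> order_ge n k (\<lambda>\<nu>. r' x \<nu> - r x \<nu>)"
  shows "pulled_back k r'"
proof -
  obtain t where t: "t \<in> Sec V'" "\<forall>x\<in>src. order_ge n k (\<lambda>\<nu>. r x \<nu> - pull t x \<nu>)"
    using assms(1) by (auto simp: pulled_back_def)
  have "order_ge n k (\<lambda>\<nu>. r' x \<nu> - pull t x \<nu>)" if x: "x \<in> src" for x
  proof -
    have "order_ge n k (\<lambda>\<nu>. (r' x \<nu> - r x \<nu>) + (r x \<nu> - pull t x \<nu>))"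
      by (intro order_ge_add assms(2)[OF x]) (use t x in auto)
    then show ?thesis by (rule order_ge_cong) simp
  qed
  with t(1) show ?thesis by (auto simp: pulled_back_def)
qed

text \<open>
  The inverse \<open>h\<close> of the underlying map transports a function to the target; the body of its pullback
  is the function itself.
\<close>

lemma lift_function:
  assumes f: "holo src f"
  shows "function_sec \<Psi> Z V' (\<lambda>y. f (h y)) \<in> Sec V'"
    and "x \<in> src \<Longrightarrow> order_ge n 1 (\<lambda>\<nu>. f x * unit_coeff {} \<nu> - pull (function_sec \<Psi> Z V' (\<lambda>y. f (h y))) x \<nu>)"
proof -
  have fh: "holo V' (\<lambda>y. f (h y))"
    by (rule holo_mapD[OF h src_open f openin_subset[OF V'(1)]]) (use h_in in blast)
  show c: "function_sec \<Psi> Z V' (\<lambda>y. f (h y)) \<in> Sec V'" by (rule function_sec_closed[OF Z V' fh])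
  assume x: "x \<in> src"
  then have px: "fst \<psi> x \<in> V'" "x \<in> topspace (base \<M>)" by (auto simp: pre_iff)
  have pz: "fst \<psi> x \<in> Z" using px V' by blast
  have "pull (function_sec \<Psi> Z V' (\<lambda>y. f (h y))) x {} = f x"
    unfolding pc_body[OF \<psi> W Z V'(1) c x in_W[OF x] pz]
    by (subst coeff_function_sec[OF Z V' fh px(1)]) (simp_all add: inv2[OF px(2)])
  then show "order_ge n 1 (\<lambda>\<nu>. f x * unit_coeff {} \<nu> - pull (function_sec \<Psi> Z V' (\<lambda>y. f (h y))) x \<nu>)"
    by (simp add: order_ge_1 unit_coeff_def)
qed

text \<open>
  Functions on the source are not pullbacks, but \<open>lift_function\<close> makes them so up to order \<open>1\<close>; a
  factor of order \<open>k\<close> turns this error into one of order \<open>k + 1\<close>.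
\<close>

lemma pulled_back_function_mult:
  assumes f: "holo src f" and s: "s \<in> Sec V'" "\<And>x. x \<in> src \<Longrightarrow> order_ge n k (r x)"
      "\<And>x. x \<in> src \<Longrightarrow> order_ge n (Suc k) (\<lambda>\<nu>. r x \<nu> - pull s x \<nu>)"
  shows "pulled_back (Suc k) (\<lambda>x \<nu>. f x * r x \<nu>)"
  unfolding pulled_back_def
proof (intro bexI ballI)
  let ?L = "function_sec \<Psi> Z V' (\<lambda>y. f (h y))"
  have L: "?L \<in> Sec V'" by (rule lift_function(1)[OF f])
  show "?L \<otimes>\<^bsub>sections \<M> V'\<^esub> s \<in> Sec V'" using L s V' by simp
  fix x assume x: "x \<in> src"
  have "order_ge n (Suc k) (\<lambda>\<nu>. wedge (\<lambda>\<nu>. f x * unit_coeff {} \<nu>) (r x) \<nu> - wedge (pull ?L x) (pull s x) \<nu>)"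
    by (rule order_ge_wedge_diff[OF lift_function(2)[OF f x] s(2)[OF x] order_ge_0 s(3)[OF x]]) simp_all
  then show "order_ge n (Suc k) (\<lambda>\<nu>. f x * r x \<nu> - pull (?L \<otimes>\<^bsub>sections \<M> V'\<^esub> s) x \<nu>)"
  proof (rule order_ge_cong)
    fix \<nu> assume \<nu>: "\<nu> \<subseteq> {..<n}"
    then have "finite \<nu>" using finite_subset by blast
    then have "wedge (\<lambda>\<nu>. f x * unit_coeff {} \<nu>) (r x) \<nu> = f x * r x \<nu>"
      by (subst wedge_scalar_left) (auto simp: unit_coeff_def)
    then show "wedge (\<lambda>\<nu>. f x * unit_coeff {} \<nu>) (r x) \<nu> - wedge (pull ?L x) (pull s x) \<nu> =
        f x * r x \<nu> - pull (?L \<otimes>\<^bsub>sections \<M> V'\<^esub> s) x \<nu>"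
      using \<nu> by (simp add: pc_mult[OF pull_rules x in_W[OF x] L s(1)])
  qed
qed

text \<open>
  The linear part \<open>A\<close> of the pullback of the odd coordinates is inverted by Cramer's rule: the
  minors are coefficients of the pullbacks of the monomials of degree \<open>n - 1\<close>.
\<close>

lemma odd_Jacobian_inverse:
  obtains C where "\<And>k j. k < n \<Longrightarrow> j < n \<Longrightarrow> holo src (C k j)"
    "\<And>x k i. x \<in> src \<Longrightarrow> k < n \<Longrightarrow> i < n \<Longrightarrow>
       (\<Sum>j<n. C k j x * pull (monomial_sec \<Psi> Z V' {j}) x {i}) = (if k = i then 1 else 0)"
proof -
  let ?e = "monomial_sec \<Psi> Z V'"
  define sg where "sg k = wedge_sign (top - {k}) {k}" for k
  define d where "d x = pull (?e top) x top" for x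
  define C where "C k l x = sg k * pull (?e (top - {l})) x (top - {k}) * inverse (sg l * d x)" for k l x
  have C_hol: "holo src (C k l)" if "k < n" "l < n" for k l
    unfolding C_def d_def
    by (intro holo_mult holo_const holo_inverse pull_holo monomial_sec_closed')
       (use nondeg wedge_sign_nonzero in \<open>auto simp: sg_def\<close>)
  have key: "(\<Sum>k<n. pull (?e {j}) x {k} * C k l x) = (if j = l then 1 else 0)"
    if x: "x \<in> src" and j: "j < n" and l: "l < n" for x j l
  proof -
    have topm: "top \<in> multi" "top - {l} \<in> multi" "{j} \<in> multi" using j by auto
    have nz: "sg l * d x \<noteq> 0" using nondeg[OF x] wedge_sign_nonzero by (simp add: sg_def d_def)
    have fxZ: "fst \<psi> x \<in> Z" and fxV: "fst \<psi> x \<in> V'" using x V' by (auto simp: pre_iff)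
    have a0: "pull (?e {j}) x {} = 0"
      unfolding pc_body[OF \<psi> W Z V'(1) monomial_sec_closed' x in_W[OF x] fxZ]
      by (subst coeff_monomial_sec[OF Z V' fxV]) (auto simp: unit_coeff_def)
    have cl: "card (top - {l}) = n - 1" using l by simp
    have "(\<Sum>k<n. sg k * pull (?e (top - {l})) x (top - {k}) * pull (?e {j}) x {k}) =
        wedge (pull (?e (top - {l})) x) (pull (?e {j}) x) top"
      unfolding sg_def
      by (rule wedge_codimension_one[symmetric]) (use pull_monomial_order[OF x topm(2)] cl a0 in simp_all)
    also have "\<dots> = pull (?e (top - {l}) \<otimes>\<^bsub>sections \<M> V'\<^esub> ?e {j}) x top"
      by (rule pc_mult[OF pull_rules x in_W[OF x] monomial_sec_closed' monomial_sec_closed' topm(1), symmetric])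
    also have "\<dots> = (if j = l then sg l * d x else 0)"
    proof (cases "j = l")
      case True
      have "(top - {l}) \<union> {l} = top" using l by auto
      then have "?e (top - {l}) \<otimes>\<^bsub>sections \<M> V'\<^esub> ?e {j} = sg l \<odot>\<^bsub>sections \<M> V'\<^esub> ?e top"
        using monomial_sec_mult[OF Z V' topm(2,3)] True by (simp add: sg_def)
      then show ?thesis using True pc_smult[OF pull_rules x in_W[OF x] monomial_sec_closed' topm(1)] by (simp add: d_def)
    next
      case False
      then have "(top - {l}) \<inter> {j} \<noteq> {}" using j by auto
      then have "?e (top - {l}) \<otimes>\<^bsub>sections \<M> V'\<^esub> ?e {j} = 0 \<odot>\<^bsub>sections \<M> V'\<^esub> \<one>\<^bsub>sections \<M> V'\<^esub>"
        by (rule monomial_sec_mult_overlap[OF Z V' topm(2,3)])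
      then show ?thesis using False pc_smult[OF pull_rules x in_W[OF x] _ topm(1), of "\<one>\<^bsub>sections \<M> V'\<^esub>" 0] V'(1) by simp
    qed
    finally have E: "(\<Sum>k<n. sg k * pull (?e (top - {l})) x (top - {k}) * pull (?e {j}) x {k}) = (if j = l then sg l * d x else 0)" .
    have "(\<Sum>k<n. sg k * pull (?e (top - {l})) x (top - {k}) * pull (?e {j}) x {k}) * inverse (sg l * d x) =
        (if j = l then 1 else 0)"
      unfolding E by (cases "j = l") (simp_all only: simp_thms if_True if_False mult_zero_left right_inverse[OF nz])
    moreover have "(\<Sum>k<n. sg k * pull (?e (top - {l})) x (top - {k}) * pull (?e {j}) x {k}) * inverse (sg l * d x) =
        (\<Sum>k<n. pull (?e {j}) x {k} * C k l x)"
      unfolding C_def sum_distrib_right by (rule sum.cong) (simp_all add: mult_ac)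
    ultimately show ?thesis by simp
  qed
  show thesis
  proof (rule that[of C])
    show "(\<Sum>j<n. C k j x * pull (?e {j}) x {i}) = (if k = i then 1 else 0)" if "x \<in> src" "k < n" "i < n" for x k i
      by (rule right_inverse_imp_left_inverse[of n "\<lambda>j k. pull (?e {j}) x {k}"]) (use key that in auto)
  qed (use C_hol in auto)
qed

text \<open>The inverse of the odd Jacobian combines the \<open>\<psi>\<^sup>*(\<theta>\<^sub>j)\<close> to \<open>\<theta>\<^sub>k\<close>, up to terms of order \<open>2\<close>.\<close>

lemma pulled_back_generator:
  assumes k: "k < n"
  shows "pulled_back 2 (\<lambda>x. unit_coeff {k})"
proof -
  obtain C where C: "\<And>k j. k < n \<Longrightarrow> j < n \<Longrightarrow> holo src (C k j)"
    "\<And>x k i. x \<in> src \<Longrightarrow> k < n \<Longrightarrow> i < n \<Longrightarrow>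
       (\<Sum>j<n. C k j x * pull (monomial_sec \<Psi> Z V' {j}) x {i}) = (if k = i then 1 else 0)"
    using odd_Jacobian_inverse by blast
  let ?r = "\<lambda>j x \<nu>. C k j x * pull (monomial_sec \<Psi> Z V' {j}) x \<nu>"
  have ord1: "order_ge n 1 (pull (monomial_sec \<Psi> Z V' {j}) x)" if "x \<in> src" "j < n" for x j
    using pull_monomial_order[OF that(1), of "{j}"] that(2) by simp
  have "pulled_back (Suc 1) (?r j)" if j: "j < n" for j
    by (rule pulled_back_function_mult[OF C(1)[OF k j] monomial_sec_closed'[of "{j}"] ord1[OF _ j]]) (simp_all add: order_ge_def)
  then have "pulled_back 2 (\<lambda>x \<nu>. \<Sum>j<n. ?r j x \<nu>)"
    by (intro pulled_back_sum) (simp add: numeral_2_eq_2)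
  then show ?thesis
  proof (rule pulled_back_approx)
    fix x assume x: "x \<in> src"
    show "order_ge n 2 (\<lambda>\<nu>. unit_coeff {k} \<nu> - (\<Sum>j<n. ?r j x \<nu>))"
      unfolding order_ge_def
    proof (intro allI impI)
      fix \<nu> assume \<nu>: "\<nu> \<subseteq> {..<n}" "card \<nu> < 2"
      have fin: "finite \<nu>" using \<nu> finite_subset by blast
      consider "\<nu> = {}" | "card \<nu> = 1" using \<nu>(2) fin by (cases "card \<nu>") auto
      then show "unit_coeff {k} \<nu> - (\<Sum>j<n. ?r j x \<nu>) = 0"
      proof cases
        case 1
        then show ?thesis using ord1[OF x] by (simp add: unit_coeff_def order_ge_1)
      next
        case 2
        then obtain i where i: "\<nu> = {i}" by (metis card_1_singletonE)
        then have "i < n" using \<nu> by auto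
        then show ?thesis using C(2)[OF x k] i by (simp add: unit_coeff_def)
      qed
    qed
  qed
qed

text \<open>
  Products of the approximations to the generators: multiplied by the other factor, each error stays
  beyond the degree of the product.
\<close>

lemma pulled_back_monomial:
  assumes "\<nu> \<in> multi"
  shows "\<exists>t\<in>Sec V'. \<forall>x\<in>src. order_ge n (Suc (card \<nu>)) (\<lambda>\<rho>. unit_coeff \<nu> \<rho> - pull t x \<rho>)"
proof -
  have "finite \<nu>" using assms finite_subset by blast
  then have "pulled_back (Suc (card \<nu>)) (\<lambda>x. unit_coeff \<nu>)" using assms
  proof (induction \<nu>)
    case empty
    show ?case
      unfolding pulled_back_def
      by (rule bexI[of _ "\<one>\<^bsub>sections \<M> V'\<^esub>"])
         (use V'(1) in \<open>simp_all add: order_ge_def pc_one[OF pull_rules _ in_W]\<close>)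
  next
    case (insert j \<nu>)
    have \<nu>: "\<nu> \<in> multi" and j: "j < n" and fin: "finite \<nu>" using insert by auto
    obtain t1 where t1: "t1 \<in> Sec V'" "\<And>x. x \<in> src \<Longrightarrow> order_ge n (Suc (card \<nu>)) (\<lambda>\<rho>. unit_coeff \<nu> \<rho> - pull t1 x \<rho>)"
      using insert.IH[OF \<nu>] by (auto simp: pulled_back_def)
    obtain t2 where t2: "t2 \<in> Sec V'" "\<And>x. x \<in> src \<Longrightarrow> order_ge n 2 (\<lambda>\<rho>. unit_coeff {j} \<rho> - pull t2 x \<rho>)"
      using pulled_back_generator[OF j] by (auto simp: pulled_back_def)
    have "pulled_back (Suc (Suc (card \<nu>))) (\<lambda>x. wedge (unit_coeff \<nu>) (unit_coeff {j}))"
      unfolding pulled_back_def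
    proof (intro bexI[of _ "t1 \<otimes>\<^bsub>sections \<M> V'\<^esub> t2"] ballI)
      fix x assume x: "x \<in> src"
      have "order_ge n (card \<nu>) (\<lambda>\<rho>. unit_coeff \<nu> \<rho> + (-1) * (unit_coeff \<nu> \<rho> - pull t1 x \<rho>))"
        by (intro order_ge_add order_ge_unit order_ge_scale order_ge_mono[OF t1(2)[OF x]]) simp
      then have o: "order_ge n (card \<nu>) (pull t1 x)" by (rule order_ge_cong) simp
      have "order_ge n (Suc (Suc (card \<nu>))) (\<lambda>\<rho>. wedge (unit_coeff \<nu>) (unit_coeff {j}) \<rho> - wedge (pull t1 x) (pull t2 x) \<rho>)"
        by (rule order_ge_wedge_diff[OF t1(2)[OF x] order_ge_unit o t2(2)[OF x]]) simp_all
      then show "order_ge n (Suc (Suc (card \<nu>)))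
          (\<lambda>\<rho>. wedge (unit_coeff \<nu>) (unit_coeff {j}) \<rho> - pull (t1 \<otimes>\<^bsub>sections \<M> V'\<^esub> t2) x \<rho>)"
        by (rule order_ge_cong) (simp add: pc_mult[OF pull_rules x in_W[OF x] t1(1) t2(1)])
    qed (use t1 t2 V'(1) in simp)
    from pulled_back_scale[OF this, of "wedge_sign \<nu> {j}"]
    have "pulled_back (Suc (Suc (card \<nu>))) (\<lambda>x. unit_coeff (insert j \<nu>))"
    proof (rule pulled_back_approx)
      fix x assume "x \<in> src"
      show "order_ge n (Suc (Suc (card \<nu>)))
          (\<lambda>\<rho>. unit_coeff (insert j \<nu>) \<rho> - wedge_sign \<nu> {j} * wedge (unit_coeff \<nu>) (unit_coeff {j}) \<rho>)"
        unfolding order_ge_def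
      proof (intro allI impI)
        fix \<rho> assume "\<rho> \<subseteq> {..<n}"
        then have "finite \<rho>" using finite_subset by blast
        then show "unit_coeff (insert j \<nu>) \<rho> - wedge_sign \<nu> {j} * wedge (unit_coeff \<nu>) (unit_coeff {j}) \<rho> = 0"
          using insert.hyps fin by (simp add: wedge_unit wedge_sign_square unit_coeff_def)
      qed
    qed
    then show ?case using insert.hyps by simp
  qed
  then show ?thesis by (simp add: pulled_back_def)
qed

lemma pulled_back_all:
  assumes r: "\<And>\<nu>. \<nu> \<in> multi \<Longrightarrow> holo src (\<lambda>x. r x \<nu>)"
  shows "pulled_back k r"
proof (induction k)
  case 0
  show ?case by (rule pulled_back_approx[OF pulled_back_zero]) simp
next
  case (Suc k)
  then obtain t where t: "t \<in> Sec V'" "\<And>x. x \<in> src \<Longrightarrow> order_ge n k (\<lambda>\<nu>. r x \<nu> - pull t x \<nu>)"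
    by (auto simp: pulled_back_def)
  define r' where "r' x \<nu> = r x \<nu> + (-1) * pull t x \<nu>" for x \<nu>
  have r'h: "holo src (\<lambda>x. r' x \<nu>)" if "\<nu> \<in> multi" for \<nu>
    unfolding r'_def by (intro holo_add holo_mult holo_const r pull_holo t that)
  have r'o: "order_ge n k (r' x)" if "x \<in> src" for x
    by (rule order_ge_cong[OF t(2)[OF that]]) (simp add: r'_def)
  \<comment> \<open>The error \<open>r'\<close> has order \<open>k\<close>; its part of degree \<open>k\<close> is a combination of monomials with
    functions as coefficients.\<close>
  let ?S = "{\<nu> \<in> multi. card \<nu> = k}"
  have "pulled_back (Suc k) (\<lambda>x \<rho>. \<Sum>\<nu>\<in>?S. r' x \<nu> * unit_coeff \<nu> \<rho>)"
  proof (rule pulled_back_sum)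
    fix \<nu> assume \<nu>: "\<nu> \<in> ?S"
    then obtain s where s: "s \<in> Sec V'" "\<And>x. x \<in> src \<Longrightarrow> order_ge n (Suc k) (\<lambda>\<rho>. unit_coeff \<nu> \<rho> - pull s x \<rho>)"
      using pulled_back_monomial[of \<nu>] by auto
    show "pulled_back (Suc k) (\<lambda>x \<rho>. r' x \<nu> * unit_coeff \<nu> \<rho>)"
      by (rule pulled_back_function_mult[OF r'h s(1) _ s(2)]) (use \<nu> order_ge_unit[of n \<nu>] in auto)
  qed
  then have "pulled_back (Suc k) r'"
  proof (rule pulled_back_approx)
    fix x assume x: "x \<in> src"
    show "order_ge n (Suc k) (\<lambda>\<rho>. r' x \<rho> - (\<Sum>\<nu>\<in>?S. r' x \<nu> * unit_coeff \<nu> \<rho>))"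
      unfolding order_ge_def
    proof (intro allI impI)
      fix \<rho> assume \<rho>: "\<rho> \<subseteq> {..<n}" "card \<rho> < Suc k"
      have "(\<Sum>\<nu>\<in>?S. r' x \<nu> * unit_coeff \<nu> \<rho>) = (\<Sum>\<nu>\<in>?S. if \<rho> = \<nu> then r' x \<nu> else 0)"
        by (rule sum.cong) (auto simp: unit_coeff_def)
      also have "\<dots> = (if \<rho> \<in> ?S then r' x \<rho> else 0)" by (simp add: sum.delta)
      also have "\<dots> = r' x \<rho>"
        using \<rho> r'o[OF x] by (auto simp: order_ge_def)
      finally show "r' x \<rho> - (\<Sum>\<nu>\<in>?S. r' x \<nu> * unit_coeff \<nu> \<rho>) = 0" by simp
    qed
  qed
  moreover have "pulled_back (Suc k) (pull t)"
    unfolding pulled_back_def by (rule bexI[of _ t]) (use t in \<open>simp_all add: order_ge_def\<close>)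
  ultimately have "pulled_back (Suc k) (\<lambda>x \<nu>. r' x \<nu> + pull t x \<nu>)" by (rule pulled_back_add)
  then show ?case by (simp add: r'_def)
qed

lemma local_surjective:
  assumes r: "r \<in> Sec src"
  shows "\<exists>t\<in>Sec V'. snd \<psi> V' t = r"
proof -
  have VW: "src \<inter> W = src" using VW' by blast
  have "pulled_back (Suc n) (coeff \<Phi> W src r)"
    by (rule pulled_back_all) (use coeff_holo[OF W src_open r] VW in simp)
  then obtain t where t: "t \<in> Sec V'" "\<And>x. x \<in> src \<Longrightarrow> order_ge n (Suc n) (\<lambda>\<nu>. coeff \<Phi> W src r x \<nu> - pull t x \<nu>)"
    by (auto simp: pulled_back_def)
  have "snd \<psi> V' t = r"
  proof (rule coeff_eqI_splitting[OF W src_open VW' smor_closed[OF \<psi> V'(1) t(1)] r])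
    fix y \<nu> assume y: "y \<in> src" and \<nu>: "\<nu> \<in> multi"
    have "coeff \<Phi> W src r y \<nu> - pull t y \<nu> = 0"
      by (rule order_ge_large[OF t(2)[OF y]]) (use \<nu> in auto)
    then show "coeff \<Phi> W src (snd \<psi> V' t) y \<nu> = coeff \<Phi> W src r y \<nu>" by (simp add: pc_def)
  qed
  with t(1) show ?thesis by blast
qed

end


context
  fixes \<psi> h
  assumes \<psi>: "smor \<psi>" and h: "holo_map h"
    and inv1: "\<And>y. y \<in> topspace (base \<M>) \<Longrightarrow> h y \<in> topspace (base \<M>) \<and> fst \<psi> (h y) = y"
    and inv2: "\<And>x. x \<in> topspace (base \<M>) \<Longrightarrow> h (fst \<psi> x) = x"
    and nondeg: "\<And>p. p \<in> topspace (base \<M>) \<Longrightarrow> \<exists>W \<Phi> Z \<Psi> Q. spl W \<Phi> \<and> p \<in> W \<and> spl Z \<Psi> \<and>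
        openin (base \<M>) Q \<and> fst \<psi> p \<in> Q \<and> Q \<subseteq> Z \<and> pc \<psi> \<Phi> W Q (monomial_sec \<Psi> Z Q top) p top \<noteq> 0"
begin

lemma hpre_open: "openin (base \<M>) U \<Longrightarrow> openin (base \<M>) {x \<in> topspace (base \<M>). h x \<in> U}"
  using h holo_const[of U 0] unfolding holo_map_def by blast

text \<open>
  The nonvanishing of a holomorphic coefficient at one point persists in a neighbourhood, which is
  the preimage of a neighbourhood in the target.
\<close>

lemma nondegenerate_neighbourhood:
  assumes U: "openin (base \<M>) U" and y: "y \<in> U"
  obtains V' W \<Phi> Z \<Psi> where "openin (base \<M>) V'" "y \<in> V'" "V' \<subseteq> U" "spl W \<Phi>" "spl Z \<Psi>" "V' \<subseteq> Z" "pre \<psi> V' \<subseteq> W"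
    "\<forall>x\<in>pre \<psi> V'. pc \<psi> \<Phi> W V' (monomial_sec \<Psi> Z V' top) x top \<noteq> 0"
proof -
  have yt: "y \<in> topspace (base \<M>)" using y openin_subset[OF U] by blast
  have p: "h y \<in> topspace (base \<M>)" "fst \<psi> (h y) = y" using inv1[OF yt] by auto
  obtain W \<Phi> Z \<Psi> Q where W: "spl W \<Phi>" "h y \<in> W" and Z: "spl Z \<Psi>" and Q: "openin (base \<M>) Q" "fst \<psi> (h y) \<in> Q" "Q \<subseteq> Z"
    and nz: "pc \<psi> \<Phi> W Q (monomial_sec \<Psi> Z Q top) (h y) top \<noteq> 0"
    using nondeg[OF p(1)] by (elim exE conjE) (rule that)
  have eC: "monomial_sec \<Psi> Z Q top \<in> Sec Q" by (rule monomial_sec_closed[OF Z Q(1,3)])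
  have topm: "top \<in> multi" by simp
  have hol: "holo (pre \<psi> Q \<inter> W) (\<lambda>x. pc \<psi> \<Phi> W Q (monomial_sec \<Psi> Z Q top) x top)"
    unfolding pc_def by (rule coeff_holo[OF W(1) pre_open[OF \<psi> Q(1)] smor_closed[OF \<psi> Q(1) eC] topm])
  define V0 where "V0 = {x \<in> pre \<psi> Q \<inter> W. pc \<psi> \<Phi> W Q (monomial_sec \<Psi> Z Q top) x top \<in> - {0}}"
  have V0: "openin (base \<M>) V0"
    unfolding V0_def by (rule holo_continuous[OF VW[OF W(1) pre_open[OF \<psi> Q(1)]] hol]) auto
  define V' where "V' = Q \<inter> U \<inter> {x \<in> topspace (base \<M>). h x \<in> V0}"
  have V': "openin (base \<M>) V'" unfolding V'_def by (intro openin_Int Q(1) U hpre_open V0)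
  have hy: "h y \<in> V0" using p Q W nz by (simp add: V0_def pre_iff)
  have inV0: "x \<in> V0" if x: "x \<in> pre \<psi> V'" for x
  proof -
    have "x \<in> topspace (base \<M>)" "h (fst \<psi> x) \<in> V0" using x by (auto simp: pre_iff V'_def)
    then show ?thesis using inv2 by simp
  qed
  have QV': "V' \<subseteq> Q" and V'Z: "V' \<subseteq> Z" using Q by (auto simp: V'_def)
  show thesis
  proof (rule that[OF V' _ _ W(1) Z V'Z])
    show "y \<in> V'" using hy p yt Q y by (simp add: V'_def)
    show "V' \<subseteq> U" by (auto simp: V'_def)
    show "pre \<psi> V' \<subseteq> W" using inV0 by (auto simp: V0_def)
    show "\<forall>x\<in>pre \<psi> V'. pc \<psi> \<Phi> W V' (monomial_sec \<Psi> Z V' top) x top \<noteq> 0"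
    proof
      fix x assume x: "x \<in> pre \<psi> V'"
      have xW: "x \<in> W" and nzx: "pc \<psi> \<Phi> W Q (monomial_sec \<Psi> Z Q top) x top \<noteq> 0" using inV0[OF x] by (auto simp: V0_def)
      have "pc \<psi> \<Phi> W V' (restr \<M> Q V' (monomial_sec \<Psi> Z Q top)) x top = pc \<psi> \<Phi> W Q (monomial_sec \<Psi> Z Q top) x top"
        by (rule pc_restr[OF \<psi> W(1) V' x xW Q(1) QV' eC topm])
      then show "pc \<psi> \<Phi> W V' (monomial_sec \<Psi> Z V' top) x top \<noteq> 0"
        using nzx by (simp add: restr_monomial_sec[OF Z Q(1,3) V' QV'])
    qed
  qed
qed

lemma pullback_injective:
  assumes U: "openin (base \<M>) U" and s: "s \<in> Sec U" and t: "t \<in> Sec U" and eq: "snd \<psi> U s = snd \<psi> U t"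
  shows "s = t"
proof (rule coeff_eqI[OF U s t])
  fix y assume y: "y \<in> U"
  obtain V' W \<Phi> Z \<Psi> where V': "openin (base \<M>) V'" "y \<in> V'" "V' \<subseteq> U" and W: "spl W \<Phi>" and Z: "spl Z \<Psi>" "V' \<subseteq> Z"
    and VW: "pre \<psi> V' \<subseteq> W" and nd: "\<forall>x\<in>pre \<psi> V'. pc \<psi> \<Phi> W V' (monomial_sec \<Psi> Z V' top) x top \<noteq> 0"
    by (rule nondegenerate_neighbourhood[OF U y]) (rule that)
  let ?s = "restr \<M> U V' s" and ?t = "restr \<M> U V' t"
  have sC: "?s \<in> Sec V'" and tC: "?t \<in> Sec V'" using restr_closed[OF U V'(1,3)] s t by auto
  have tC': "(- 1) \<odot>\<^bsub>sections \<M> V'\<^esub> ?t \<in> Sec V'" by (rule sections_smult_closed[OF V'(1) tC])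
  let ?u = "?s \<oplus>\<^bsub>sections \<M> V'\<^esub> ((- 1) \<odot>\<^bsub>sections \<M> V'\<^esub> ?t)"
  have uC: "?u \<in> Sec V'" using sC tC' V' by simp
  have Tu: "pc \<psi> \<Phi> W V' ?u x \<nu> = 0" if x: "x \<in> pre \<psi> V'" and \<nu>: "\<nu> \<in> multi" for x \<nu>
  proof -
    have xW: "x \<in> W" using x VW by blast
    show ?thesis
      unfolding pc_add[OF \<psi> W V'(1) x xW sC tC' \<nu>] pc_smult[OF \<psi> W V'(1) x xW tC \<nu>]
        pc_restr[OF \<psi> W V'(1) x xW U V'(3) s \<nu>] pc_restr[OF \<psi> W V'(1) x xW U V'(3) t \<nu>]
      by (simp add: pc_def eq)
  qed
  have "coeff \<Psi> Z U s y' \<nu> = coeff \<Psi> Z U t y' \<nu>" if y': "y' \<in> V'" and \<nu>: "\<nu> \<in> multi" for y' \<nu>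
  proof -
    have y'Z: "y' \<in> Z" using y' Z by blast
    have "coeff \<Psi> Z V' ?u y' \<nu> = 0"
      by (rule local_injective[OF \<psi> h inv1 inv2 W Z(1) V'(1) Z(2) VW _ uC Tu y' \<nu>]) (use nd in auto)
    then show ?thesis
      unfolding coeff_add[OF Z(1) V'(1) sC tC' y' y'Z \<nu>] coeff_smult[OF Z(1) V'(1) tC y' y'Z \<nu>]
        coeff_restr[OF Z(1) U V'(1,3) s y' y'Z \<nu>] coeff_restr[OF Z(1) U V'(1,3) t y' y'Z \<nu>] by simp
  qed
  then show "\<exists>W \<Phi> Y. spl W \<Phi> \<and> openin (base \<M>) Y \<and> y \<in> Y \<and> Y \<subseteq> U \<inter> W \<and>
      (\<forall>y\<in>Y. \<forall>\<nu>\<in>multi. coeff \<Phi> W U s y \<nu> = coeff \<Phi> W U t y \<nu>)"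
    using V' Z by (intro exI[of _ Z] exI[of _ \<Psi>] exI[of _ V']) simp
qed

text \<open>Local solutions exist by \<open>local_surjective\<close>; injectivity makes them unique, hence compatible.\<close>

lemma pullback_surjective:
  assumes U: "openin (base \<M>) U" and r: "r \<in> Sec (pre \<psi> U)"
  shows "\<exists>t\<in>Sec U. snd \<psi> U t = r"
proof -
  have pU: "openin (base \<M>) (pre \<psi> U)" by (rule pre_open[OF \<psi> U])
  define C where "C = {V. openin (base \<M>) V \<and> V \<subseteq> U \<and> (\<exists>t. t \<in> Sec V \<and> snd \<psi> V t = restr \<M> (pre \<psi> U) (pre \<psi> V) r)}"
  have UC: "\<Union>C = U"
  proof
    show "U \<subseteq> \<Union>C"
    proof
      fix y assume y: "y \<in> U"
      obtain V' W \<Phi> Z \<Psi> where V': "openin (base \<M>) V'" "y \<in> V'" "V' \<subseteq> U" and W: "spl W \<Phi>" and Z: "spl Z \<Psi>" "V' \<subseteq> Z"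
        and VW: "pre \<psi> V' \<subseteq> W" and nd: "\<forall>x\<in>pre \<psi> V'. pc \<psi> \<Phi> W V' (monomial_sec \<Psi> Z V' top) x top \<noteq> 0"
        by (rule nondegenerate_neighbourhood[OF U y]) (rule that)
      have rV: "restr \<M> (pre \<psi> U) (pre \<psi> V') r \<in> Sec (pre \<psi> V')"
        by (rule restr_closed[OF pU pre_open[OF \<psi> V'(1)] pre_mono[OF V'(3)] r])
      have "\<exists>t\<in>Sec V'. snd \<psi> V' t = restr \<M> (pre \<psi> U) (pre \<psi> V') r"
        by (rule local_surjective[OF \<psi> h inv1 inv2 W Z(1) V'(1) Z(2) VW _ rV]) (use nd in auto)
      then show "y \<in> \<Union>C" using V' by (auto simp: C_def)
    qed
  qed (auto simp: C_def)
  define T where "T V = (SOME t. t \<in> Sec V \<and> snd \<psi> V t = restr \<M> (pre \<psi> U) (pre \<psi> V) r)" for V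
  have T: "openin (base \<M>) V" "V \<subseteq> U" "T V \<in> Sec V" "snd \<psi> V (T V) = restr \<M> (pre \<psi> U) (pre \<psi> V) r" if "V \<in> C" for V
  proof -
    have ex: "\<exists>t. t \<in> Sec V \<and> snd \<psi> V t = restr \<M> (pre \<psi> U) (pre \<psi> V) r" and o: "openin (base \<M>) V" "V \<subseteq> U"
      using that by (auto simp: C_def)
    show "openin (base \<M>) V" "V \<subseteq> U" by (rule o)+
    show "T V \<in> Sec V" "snd \<psi> V (T V) = restr \<M> (pre \<psi> U) (pre \<psi> V) r"
      using someI_ex[OF ex] unfolding T_def[symmetric] by auto
  qed
  have CO: "C \<subseteq> opens \<M>" using T(1) by auto
  have compat: "restr \<M> V (V \<inter> V') (T V) = restr \<M> V' (V \<inter> V') (T V')" if V: "V \<in> C" and V': "V' \<in> C" for V V'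
  proof -
    have o: "openin (base \<M>) (V \<inter> V')" using T(1)[OF V] T(1)[OF V'] by blast
    have sub: "V \<inter> V' \<subseteq> V" "V \<inter> V' \<subseteq> V'" by auto
    have *: "snd \<psi> (V \<inter> V') (restr \<M> V1 (V \<inter> V') (T V1)) = restr \<M> (pre \<psi> U) (pre \<psi> (V \<inter> V')) r"
      if V1: "V1 \<in> C" and s1: "V \<inter> V' \<subseteq> V1" for V1
      unfolding smor_natural[OF \<psi> T(1)[OF V1] o s1 T(3)[OF V1]] T(4)[OF V1]
      by (rule restr_restr[OF pU pre_open[OF \<psi> T(1)[OF V1]] pre_open[OF \<psi> o] pre_mono[OF s1] pre_mono[OF T(2)[OF V1]] r])
    show ?thesis
      by (rule pullback_injective[OF o restr_closed[OF T(1)[OF V] o sub(1) T(3)[OF V]]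
            restr_closed[OF T(1)[OF V'] o sub(2) T(3)[OF V']]])
         (simp only: *[OF V sub(1)] *[OF V' sub(2)])
  qed
  have "\<exists>t\<in>Sec (\<Union>C). \<forall>V\<in>C. restr \<M> (\<Union>C) V t = T V"
  proof -
    have glue: "\<forall>\<C>\<subseteq>opens \<M>. \<forall>s. (\<forall>V\<in>\<C>. s V \<in> Sec V) \<longrightarrow>
        (\<forall>V\<in>\<C>. \<forall>W\<in>\<C>. restr \<M> V (V \<inter> W) (s V) = restr \<M> W (V \<inter> W) (s W)) \<longrightarrow>
        (\<exists>t\<in>Sec (\<Union>\<C>). \<forall>V\<in>\<C>. restr \<M> (\<Union>\<C>) V t = s V)"
      using sheaf unfolding superalgebra_sheaf_def by (elim conjE)
    show ?thesis
      by (rule glue[rule_format, OF CO, of T]) (rule T(3), assumption, rule compat)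
  qed
  then obtain t where t: "t \<in> Sec U" "\<forall>V\<in>C. restr \<M> U V t = T V" unfolding UC by blast
  have "snd \<psi> U t = r"
  proof (rule coeff_eqI[OF pU smor_closed[OF \<psi> U t(1)] r])
    fix x assume x: "x \<in> pre \<psi> U"
    then have "fst \<psi> x \<in> \<Union>C" using UC by (simp add: pre_iff)
    then obtain V where V: "V \<in> C" "fst \<psi> x \<in> V" by blast
    have pV: "openin (base \<M>) (pre \<psi> V)" "pre \<psi> V \<subseteq> pre \<psi> U"
      using pre_open[OF \<psi> T(1)[OF V(1)]] pre_mono[OF T(2)[OF V(1)], of \<psi>] by auto
    have e: "restr \<M> (pre \<psi> U) (pre \<psi> V) (snd \<psi> U t) = restr \<M> (pre \<psi> U) (pre \<psi> V) r"
      using smor_natural[OF \<psi> U T(1,2)[OF V(1)] t(1)] t(2) V(1) T(4)[OF V(1)] by simp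
    have xt: "x \<in> topspace (base \<M>)" and xV: "x \<in> pre \<psi> V" using x V by (auto simp: pre_iff)
    obtain W \<Phi> where W: "x \<in> W" "spl W \<Phi>" using spl_exists[OF xt] by blast
    have "coeff \<Phi> W (pre \<psi> U) (snd \<psi> U t) y \<nu> = coeff \<Phi> W (pre \<psi> U) r y \<nu>" if y: "y \<in> pre \<psi> V \<inter> W" and \<nu>: "\<nu> \<in> multi" for y \<nu>
    proof -
      have yy: "y \<in> pre \<psi> V" "y \<in> W" using y by auto
      show ?thesis
        using coeff_restr[OF W(2) pU pV smor_closed[OF \<psi> U t(1)] yy \<nu>] coeff_restr[OF W(2) pU pV r yy \<nu>] e by simp
    qed
    then show "\<exists>W \<Phi> Y. spl W \<Phi> \<and> openin (base \<M>) Y \<and> x \<in> Y \<and> Y \<subseteq> pre \<psi> U \<inter> W \<and>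
        (\<forall>y\<in>Y. \<forall>\<nu>\<in>multi. coeff \<Phi> W (pre \<psi> U) (snd \<psi> U t) y \<nu> = coeff \<Phi> W (pre \<psi> U) r y \<nu>)"
      using W xV pV VW[OF W(2) pV(1)] by (intro exI[of _ W] exI[of _ \<Phi>] exI[of _ "pre \<psi> V \<inter> W"]) auto
  qed
  with t(1) show ?thesis by blast
qed

definition hpre where "hpre U = {x \<in> topspace (base \<M>). h x \<in> U}"

lemma pre_hpre: "openin (base \<M>) U \<Longrightarrow> pre \<psi> (hpre U) = U"
  using openin_subset[of "base \<M>" U] inv2 smor_topspace[OF \<psi>] by (auto simp: pre_iff hpre_def)

lemma hpre_pre: "openin (base \<M>) U \<Longrightarrow> hpre (pre \<psi> U) = U"
  using openin_subset[of "base \<M>" U] inv1 by (auto simp: pre_iff hpre_def)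

definition inv_morphism where
  "inv_morphism = (restrict h (topspace (base \<M>)),
     \<lambda>U\<in>opens \<M>. \<lambda>s\<in>Sec U. inv_into (Sec (hpre U)) (snd \<psi> (hpre U)) s)"

lemma pre_inv: "pre inv_morphism U = hpre U"
  by (auto simp: preimage_def inv_morphism_def hpre_def)

lemma snd_inv:
  assumes U: "openin (base \<M>) U" and s: "s \<in> Sec U"
  shows "snd inv_morphism U s \<in> Sec (hpre U)" and "snd \<psi> (hpre U) (snd inv_morphism U s) = s"
proof -
  have "s \<in> snd \<psi> (hpre U) ` Sec (hpre U)"
    using pullback_surjective[of "hpre U" s] hpre_open[OF U] s by (auto simp: pre_hpre[OF U] hpre_def[symmetric])
  then show "snd inv_morphism U s \<in> Sec (hpre U)" "snd \<psi> (hpre U) (snd inv_morphism U s) = s"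
    using U s by (simp_all add: inv_morphism_def inv_into_into f_inv_into_f)
qed

lemma snd_inv_eqI:
  assumes U: "openin (base \<M>) U" and t: "t \<in> Sec (hpre U)" and eq: "snd \<psi> (hpre U) t = s"
  shows "snd inv_morphism U s = t"
proof -
  have hU: "openin (base \<M>) (hpre U)" unfolding hpre_def by (rule hpre_open[OF U])
  have s: "s \<in> Sec U" using smor_closed[OF \<psi> hU t] eq pre_hpre[OF U] by simp
  show ?thesis
    by (rule pullback_injective[OF hU snd_inv(1)[OF U s] t]) (simp add: snd_inv(2)[OF U s] eq)
qed

lemma smor_inv: "smor inv_morphism"
  unfolding supermorphism_def
proof (intro conjI ballI impI)
  show "holomorphic_map \<M> \<M> (fst inv_morphism)"
  proof (rule holomorphic_mapI)
    have "continuous_map (base \<M>) (base \<M>) h"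
      unfolding continuous_map_def using hpre_open inv1 by auto
    then show "continuous_map (base \<M>) (base \<M>) (fst inv_morphism)"
      by (rule continuous_map_eq) (simp add: inv_morphism_def)
    fix V f assume V: "openin (base \<M>) V" and f: "holo V f"
    have eq: "{x \<in> topspace (base \<M>). fst inv_morphism x \<in> V} = {x \<in> topspace (base \<M>). h x \<in> V}"
      by (auto simp: inv_morphism_def)
    have "holo {x \<in> topspace (base \<M>). h x \<in> V} (\<lambda>x. f (h x))" using h V f by (simp add: holo_map_def)
    then have "holo {x \<in> topspace (base \<M>). h x \<in> V} (\<lambda>x. f (fst inv_morphism x))"
      by (rule holo_cong[OF hpre_open[OF V], rotated]) (simp add: inv_morphism_def)
    then show "holo {x \<in> topspace (base \<M>). fst inv_morphism x \<in> V} (\<lambda>x. f (fst inv_morphism x))"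
      by (simp only: eq)
  qed
  fix U assume "U \<in> opens \<M>"
  then have U: "openin (base \<M>) U" by simp
  have hU: "openin (base \<M>) (hpre U)" unfolding hpre_def by (rule hpre_open[OF U])
  let ?I = "snd inv_morphism U"
  note hom = smor_hom[OF \<psi> hU, unfolded pre_hpre[OF U]]
  show "?I \<in> extensional (Sec U)" using U by (simp add: inv_morphism_def)
  have grade: "?I s \<in> grading \<M> (hpre U) i" if s: "s \<in> grading \<M> U i" for s i
  proof -
    interpret R: ring "sections \<M> (hpre U)" by (rule sections_ring[OF hU])
    interpret S: ring "sections \<M> U" by (rule sections_ring[OF U])
    have sU: "s \<in> Sec U" using s grading_subset[OF U] by blast
    have zero_in: "\<zero>\<^bsub>sections \<M> U\<^esub> \<in> grading \<M> U j" for j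
      using subgroup.one_closed[OF submodule.axioms(1)[OF grading_submodule[OF U, of j]]] by simp
    have uniq: "\<exists>!p. p \<in> grading \<M> V 0 \<times> grading \<M> V 1 \<and> u = fst p \<oplus>\<^bsub>sections \<M> V\<^esub> snd p"
      if "openin (base \<M>) V" "u \<in> Sec V" for V u
      using sections_superalgebra[OF that(1)] that(2) by (simp add: superalgebra_def)
    obtain p where "p \<in> grading \<M> (hpre U) 0 \<times> grading \<M> (hpre U) 1 \<and> ?I s = fst p \<oplus>\<^bsub>sections \<M> (hpre U)\<^esub> snd p"
      using uniq[OF hU snd_inv(1)[OF U sU]] by (rule ex1E) (rule that)
    then obtain a b where ab: "a \<in> grading \<M> (hpre U) 0" "b \<in> grading \<M> (hpre U) 1" "?I s = a \<oplus>\<^bsub>sections \<M> (hpre U)\<^esub> b"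
      using that[of "fst p" "snd p"] by (simp add: mem_Times_iff)
    have abS: "a \<in> Sec (hpre U)" "b \<in> Sec (hpre U)" using ab grading_subset[OF hU] by auto
    let ?a = "snd \<psi> (hpre U) a" and ?b = "snd \<psi> (hpre U) b"
    have im: "?a \<in> grading \<M> U 0" "?b \<in> grading \<M> U 1"
      by (rule superalgebra_hom_grading[OF hom(1)], rule ab)+
    have sum: "s = ?a \<oplus>\<^bsub>sections \<M> U\<^esub> ?b"
      using snd_inv(2)[OF U sU] ring_hom_add[OF hom(2) abS] ab(3) by simp
    have zero: "snd \<psi> (hpre U) \<zero>\<^bsub>sections \<M> (hpre U)\<^esub> = \<zero>\<^bsub>sections \<M> U\<^esub>"
      by (rule ring_hom_zero[OF hom(2) R.ring_axioms S.ring_axioms])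
    have pairs: "(x, y) = (x', y')"
      if "x \<in> grading \<M> U 0" "y \<in> grading \<M> U 1" "x' \<in> grading \<M> U 0" "y' \<in> grading \<M> U 1"
         "s = x \<oplus>\<^bsub>sections \<M> U\<^esub> y" "s = x' \<oplus>\<^bsub>sections \<M> U\<^esub> y'" for x y x' y'
      by (rule ex1E[OF uniq[OF U sU]]) (use that in \<open>metis SigmaI fst_conv snd_conv\<close>)
    have "i = 0 \<or> i = 1" by (cases i) auto
    then show ?thesis
    proof
      assume i: "i = 0"
      have "(?a, ?b) = (s, \<zero>\<^bsub>sections \<M> U\<^esub>)"
        by (rule pairs) (use im s sU sum zero_in i in auto)
      then have "snd \<psi> (hpre U) b = snd \<psi> (hpre U) \<zero>\<^bsub>sections \<M> (hpre U)\<^esub>" using zero by simp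
      then have "b = \<zero>\<^bsub>sections \<M> (hpre U)\<^esub>" using pullback_injective[OF hU abS(2)] by simp
      then show ?thesis using ab abS i by simp
    next
      assume i: "i = 1"
      have "(?a, ?b) = (\<zero>\<^bsub>sections \<M> U\<^esub>, s)"
        by (rule pairs) (use im s sU sum zero_in i in auto)
      then have "snd \<psi> (hpre U) a = snd \<psi> (hpre U) \<zero>\<^bsub>sections \<M> (hpre U)\<^esub>" using zero by simp
      then have "a = \<zero>\<^bsub>sections \<M> (hpre U)\<^esub>" using pullback_injective[OF hU abS(1)] by simp
      then show ?thesis using ab abS i by simp
    qed
  qed
  show "superalgebra_hom (sections \<M> U) (grading \<M> U) (sections \<M> (pre inv_morphism U))
      (grading \<M> (pre inv_morphism U)) (snd inv_morphism U)"
    unfolding superalgebra_hom_def pre_inv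
  proof (intro conjI allI ballI)
    show "?I \<in> Ring.ring_hom (sections \<M> U) (sections \<M> (hpre U))"
    proof (rule ring_hom_memI)
      fix s t assume s: "s \<in> Sec U" and t: "t \<in> Sec U"
      show "?I s \<in> Sec (hpre U)" by (rule snd_inv(1)[OF U s])
      show "?I (s \<otimes>\<^bsub>sections \<M> U\<^esub> t) = ?I s \<otimes>\<^bsub>sections \<M> (hpre U)\<^esub> ?I t"
        by (rule snd_inv_eqI[OF U])
           (use hU snd_inv[OF U s] snd_inv[OF U t] ring_hom_mult[OF hom(2)] in simp_all)
      show "?I (s \<oplus>\<^bsub>sections \<M> U\<^esub> t) = ?I s \<oplus>\<^bsub>sections \<M> (hpre U)\<^esub> ?I t"
        by (rule snd_inv_eqI[OF U])
           (use hU snd_inv[OF U s] snd_inv[OF U t] ring_hom_add[OF hom(2)] in simp_all)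
    next
      show "?I \<one>\<^bsub>sections \<M> U\<^esub> = \<one>\<^bsub>sections \<M> (hpre U)\<^esub>"
        by (rule snd_inv_eqI[OF U]) (use hU ring_hom_one[OF hom(2)] in simp_all)
    qed
    show "?I (c \<odot>\<^bsub>sections \<M> U\<^esub> a) = c \<odot>\<^bsub>sections \<M> (hpre U)\<^esub> ?I a" if a: "a \<in> Sec U" for c a
      by (rule snd_inv_eqI[OF U])
         (use hU snd_inv[OF U a] hom(1) in \<open>simp_all add: sections_smult_closed superalgebra_hom_def\<close>)
    show "?I ` grading \<M> U i \<subseteq> grading \<M> (hpre U) i" for i using grade by blast
  qed
  fix V s assume "V \<in> opens \<M>" and VU: "V \<subseteq> U" and s: "s \<in> Sec U"
  then have V: "openin (base \<M>) V" by simp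
  have hV: "openin (base \<M>) (hpre V)" unfolding hpre_def by (rule hpre_open[OF V])
  have sub: "hpre V \<subseteq> hpre U" using VU by (auto simp: hpre_def)
  show "snd inv_morphism V (restr \<M> U V s) =
      restr \<M> (pre inv_morphism U) (pre inv_morphism V) (snd inv_morphism U s)"
    unfolding pre_inv
  proof (rule snd_inv_eqI[OF V restr_closed[OF hU hV sub snd_inv(1)[OF U s]]])
    show "snd \<psi> (hpre V) (restr \<M> (hpre U) (hpre V) (?I s)) = restr \<M> U V s"
      using smor_natural[OF \<psi> hU hV sub snd_inv(1)[OF U s]] snd_inv(2)[OF U s] pre_hpre U V by simp
  qed
qed (auto simp: inv_morphism_def)

lemma nondegenerate_automorphism: "\<psi> \<in> automorphisms \<M>"
  unfolding automorphisms_def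
proof (intro CollectI conjI exI[of _ inv_morphism] \<psi> smor_inv)
  show "comp_morphism \<M> \<psi> inv_morphism = id_morphism \<M>"
    unfolding comp_morphism_def id_morphism_def
  proof (intro prod_eqI)
    show "fst (\<lambda>p\<in>topspace (base \<M>). fst \<psi> (fst inv_morphism p), \<lambda>U\<in>opens \<M>. \<lambda>s\<in>Sec U. snd inv_morphism (pre \<psi> U) (snd \<psi> U s)) =
        fst (\<lambda>p\<in>topspace (base \<M>). p, \<lambda>U\<in>opens \<M>. \<lambda>s\<in>Sec U. s)"
      using inv1 by (auto simp: inv_morphism_def)
    have "snd inv_morphism (pre \<psi> U) (snd \<psi> U s) = s" if U: "openin (base \<M>) U" and s: "s \<in> Sec U" for U s
      by (rule snd_inv_eqI[OF pre_open[OF \<psi> U]]) (simp_all add: hpre_pre[OF U] s)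
    then show "snd (\<lambda>p\<in>topspace (base \<M>). fst \<psi> (fst inv_morphism p), \<lambda>U\<in>opens \<M>. \<lambda>s\<in>Sec U. snd inv_morphism (pre \<psi> U) (snd \<psi> U s)) =
        snd (\<lambda>p\<in>topspace (base \<M>). p, \<lambda>U\<in>opens \<M>. \<lambda>s\<in>Sec U. s)"
      by (auto simp: fun_eq_iff restrict_def)
  qed
  show "comp_morphism \<M> inv_morphism \<psi> = id_morphism \<M>"
    unfolding comp_morphism_def id_morphism_def
  proof (intro prod_eqI)
    show "fst (\<lambda>p\<in>topspace (base \<M>). fst inv_morphism (fst \<psi> p), \<lambda>U\<in>opens \<M>. \<lambda>s\<in>Sec U. snd \<psi> (pre inv_morphism U) (snd inv_morphism U s)) =
        fst (\<lambda>p\<in>topspace (base \<M>). p, \<lambda>U\<in>opens \<M>. \<lambda>s\<in>Sec U. s)"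
      using inv2 smor_topspace[OF \<psi>] by (auto simp: inv_morphism_def)
    show "snd (\<lambda>p\<in>topspace (base \<M>). fst inv_morphism (fst \<psi> p), \<lambda>U\<in>opens \<M>. \<lambda>s\<in>Sec U. snd \<psi> (pre inv_morphism U) (snd inv_morphism U s)) =
        snd (\<lambda>p\<in>topspace (base \<M>). p, \<lambda>U\<in>opens \<M>. \<lambda>s\<in>Sec U. s)"
      by (auto simp: fun_eq_iff restrict_def pre_inv snd_inv(2))
  qed
qed

end

lemma automorphism_inverse:
  assumes "\<phi> \<in> automorphisms \<M>"
  obtains \<xi> where "smor \<phi>" "smor \<xi>" "\<forall>x\<in>topspace (base \<M>). fst \<phi> (fst \<xi> x) = x" "\<forall>x\<in>topspace (base \<M>). fst \<xi> (fst \<phi> x) = x"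
    "\<forall>U s. openin (base \<M>) U \<longrightarrow> s \<in> Sec U \<longrightarrow> snd \<phi> (pre \<xi> U) (snd \<xi> U s) = s"
proof -
  obtain \<xi> where \<xi>: "smor \<phi>" "smor \<xi>" "comp_morphism \<M> \<phi> \<xi> = id_morphism \<M>" "comp_morphism \<M> \<xi> \<phi> = id_morphism \<M>"
    using assms by (auto simp: automorphisms_def)
  have 1: "\<forall>x\<in>topspace (base \<M>). fst \<phi> (fst \<xi> x) = x"
  proof
    fix x assume x: "x \<in> topspace (base \<M>)"
    have "fst (comp_morphism \<M> \<phi> \<xi>) x = fst (id_morphism \<M>) x" using \<xi>(3) by simp
    then show "fst \<phi> (fst \<xi> x) = x" using x by (simp add: comp_morphism_def id_morphism_def)
  qed
  have 2: "\<forall>x\<in>topspace (base \<M>). fst \<xi> (fst \<phi> x) = x"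
  proof
    fix x assume x: "x \<in> topspace (base \<M>)"
    have "fst (comp_morphism \<M> \<xi> \<phi>) x = fst (id_morphism \<M>) x" using \<xi>(4) by simp
    then show "fst \<xi> (fst \<phi> x) = x" using x by (simp add: comp_morphism_def id_morphism_def)
  qed
  have 3: "\<forall>U s. openin (base \<M>) U \<longrightarrow> s \<in> Sec U \<longrightarrow> snd \<phi> (pre \<xi> U) (snd \<xi> U s) = s"
  proof (intro allI impI)
    fix U s assume U: "openin (base \<M>) U" and s: "s \<in> Sec U"
    have "snd (comp_morphism \<M> \<xi> \<phi>) U s = snd (id_morphism \<M>) U s" using \<xi>(4) by simp
    then show "snd \<phi> (pre \<xi> U) (snd \<xi> U s) = s" using U s by (simp add: comp_morphism_def id_morphism_def)
  qed
  show thesis by (rule that[OF \<xi>(1,2) 1 2 3])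
qed

text \<open>
  The inverse takes \<open>\<theta>\<^bsup>top\<^esup>\<close> to a multiple \<open>f \<theta>\<^bsup>top\<^esup>\<close>, since it can only raise the order;
  pulling this back, \<open>\<theta>\<^bsup>top\<^esup>\<close> is a multiple of \<open>\<phi>\<^sup>*(\<theta>\<^bsup>top\<^esup>)\<close>.
\<close>

lemma automorphism_nondegenerate:
  assumes \<phi>: "\<phi> \<in> automorphisms \<M>" and W: "spl W \<Phi>" and Z: "spl Z \<Psi>" and Q: "openin (base \<M>) Q" "Q \<subseteq> Z"
    and p: "p \<in> pre \<phi> Q" "p \<in> W"
  shows "pc \<phi> \<Phi> W Q (monomial_sec \<Psi> Z Q top) p top \<noteq> 0"
proof -
  obtain \<xi> where \<xi>: "smor \<phi>" "smor \<xi>" "\<forall>x\<in>topspace (base \<M>). fst \<phi> (fst \<xi> x) = x" "\<forall>x\<in>topspace (base \<M>). fst \<xi> (fst \<phi> x) = x"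
    "\<forall>U s. openin (base \<M>) U \<longrightarrow> s \<in> Sec U \<longrightarrow> snd \<phi> (pre \<xi> U) (snd \<xi> U s) = s"
    by (rule automorphism_inverse[OF \<phi>]) (rule that)
  define P where "P = pre \<phi> Q \<inter> W"
  have P: "openin (base \<M>) P" "P \<subseteq> W" "p \<in> P"
    using VW[OF W pre_open[OF \<xi>(1) Q(1)]] p by (auto simp: P_def)
  have PT: "P \<subseteq> topspace (base \<M>)" by (rule openin_subset[OF P(1)])
  let ?R = "pre \<xi> P"
  have RO: "openin (base \<M>) ?R" by (rule pre_open[OF \<xi>(2) P(1)])
  have RQ: "?R \<subseteq> Q" using \<xi>(3) by (auto simp: pre_iff P_def)
  have RZ: "?R \<subseteq> Z" using RQ Q by blast
  have RZ': "?R \<inter> Z = ?R" using RZ by blast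
  have pR: "pre \<phi> ?R = P"
    using \<xi>(4) PT smor_topspace[OF \<xi>(1)] by (auto simp: pre_iff)
  have topm: "top \<in> multi" by simp
  let ?e = "monomial_sec \<Phi> W P top" and ?E = "monomial_sec \<Psi> Z ?R top"
  have eC: "?e \<in> Sec P" by (rule monomial_sec_closed[OF W P(1,2)])
  have EC: "?E \<in> Sec ?R" by (rule monomial_sec_closed[OF Z RO RZ])
  let ?u = "snd \<xi> P ?e"
  have uC: "?u \<in> Sec ?R" by (rule smor_closed[OF \<xi>(2) P(1) eC])
  define f where "f y = coeff \<Psi> Z ?R ?u y top" for y
  have f: "holo ?R f" unfolding f_def using coeff_holo[OF Z RO uC topm] RZ' by simp
  have fC: "function_sec \<Psi> Z ?R f \<in> Sec ?R" by (rule function_sec_closed[OF Z RO RZ f])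
  have u: "?u = function_sec \<Psi> Z ?R f \<otimes>\<^bsub>sections \<M> ?R\<^esub> ?E"
  proof (rule coeff_eqI_splitting[OF Z RO RZ uC])
    fix y \<nu> assume y: "y \<in> ?R" and \<nu>: "\<nu> \<in> multi"
    have yZ: "y \<in> Z" using y RZ by blast
    have "order_ge n (card top) (pc \<xi> \<Psi> Z P ?e y)" by (rule pc_monomial_sec_order[OF \<xi>(2) Z W P(1,2) y yZ topm])
    then have o: "order_ge n n (coeff \<Psi> Z ?R ?u y)" by (simp add: pc_def order_ge_def)
    show "coeff \<Psi> Z ?R ?u y \<nu> = coeff \<Psi> Z ?R (function_sec \<Psi> Z ?R f \<otimes>\<^bsub>sections \<M> ?R\<^esub> ?E) y \<nu>"
      unfolding coeff_function_sec_mult[OF Z RO RZ f EC y \<nu>] coeff_monomial_sec[OF Z RO RZ y \<nu>]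
    proof (cases "\<nu> = top")
      case False
      then have "\<nu> \<subset> top" using \<nu> by auto
      then have "card \<nu> < n" using psubset_card_mono[of top \<nu>] by simp
      then show "coeff \<Psi> Z ?R ?u y \<nu> = f y * unit_coeff top \<nu>"
        using o \<nu> False by (simp add: order_ge_def unit_coeff_def)
    qed (simp add: f_def unit_coeff_def)
  qed (use fC EC RO in simp)
  have pR': "p \<in> pre \<phi> ?R" using pR P by simp
  have "pc \<phi> \<Phi> W ?R ?u p top = 1"
    using \<xi>(5) P eC coeff_monomial_sec[OF W P(1,2,3) topm] by (simp add: pc_def pR unit_coeff_def)
  moreover have "pc \<phi> \<Phi> W ?R ?u p top = pc \<phi> \<Phi> W ?R (function_sec \<Psi> Z ?R f) p {} * pc \<phi> \<Phi> W ?R ?E p top"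
    unfolding u pc_mult[OF \<xi>(1) W RO pR' p(2) fC EC topm]
    by (rule wedge_lowest_degree) (use pc_monomial_sec_order[OF \<xi>(1) W Z RO RZ pR' p(2) topm] in auto)
  ultimately have "pc \<phi> \<Phi> W ?R ?E p top \<noteq> 0" by auto
  moreover have "?E = restr \<M> Q ?R (monomial_sec \<Psi> Z Q top)" by (rule restr_monomial_sec[OF Z Q RO RQ, symmetric])
  moreover have "pc \<phi> \<Phi> W ?R (restr \<M> Q ?R (monomial_sec \<Psi> Z Q top)) p top = pc \<phi> \<Phi> W Q (monomial_sec \<Psi> Z Q top) p top"
    by (rule pc_restr[OF \<xi>(1) W RO pR' p(2) Q(1) RQ monomial_sec_closed[OF Z Q] topm])
  ultimately show ?thesis by simp
qed


section \<open>Compact neighbourhoods\<close>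

lemma spl_subset:
  assumes W: "spl W \<Phi>" and W': "openin (base \<M>) W'" "W' \<subseteq> W"
  shows "spl W' \<Phi>"
  using assms unfolding local_splitting_def
  by (intro conjI) (auto dest: subset_trans[of _ W' W])

lemma chart_inv_subset:
  assumes at: "(D, \<kappa>) \<in> atlas \<M>" and D': "D' \<subseteq> D" and z: "z \<in> \<kappa> ` D'"
  shows "inv_into D' \<kappa> z = inv_into D \<kappa> z"
proof -
  obtain x where x: "x \<in> D'" "z = \<kappa> x" using z by blast
  have "inj_on \<kappa> D'" using chart_inj[OF at] D' inj_on_subset by blast
  then show ?thesis using x D' at by auto
qed

lemma coordinate_system_exists:
  assumes at: "(D, \<kappa>) \<in> atlas \<M>" and W: "spl W \<Phi>"
  shows "coordinate_system \<M> (D \<inter> W) \<kappa> \<Phi>" and "spl (D \<inter> W) \<Phi>"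
proof -
  let ?D = "D \<inter> W"
  have DO: "openin (base \<M>) ?D" using chart_homeomorphic(2)[OF at] spl_open[OF W] by blast
  show s: "spl ?D \<Phi>" by (rule spl_subset[OF W DO]) simp
  have "topological_chart \<M> ?D \<kappa>"
    unfolding topological_chart_def
  proof (intro conjI DO)
    show "openin (top_of_set (cspace m)) (\<kappa> ` ?D)" by (rule chart_image_open[OF at spl_open[OF W]])
    have "homeomorphic_map (subtopology (subtopology (base \<M>) D) ?D) (subtopology (top_of_set (\<kappa> ` D)) (\<kappa> ` ?D)) \<kappa>"
    proof (rule homeomorphic_map_subtopologies[OF chart_homeomorphic(1)[OF at]])
      have "D \<subseteq> topspace (base \<M>)" by (rule openin_subset[OF chart_homeomorphic(2)[OF at]])
      then show "\<kappa> ` (topspace (subtopology (base \<M>) D) \<inter> ?D) = topspace (top_of_set (\<kappa> ` D)) \<inter> \<kappa> ` ?D"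
        by (auto simp: topspace_subtopology)
    qed
    moreover have "subtopology (subtopology (base \<M>) D) ?D = subtopology (base \<M>) ?D"
      by (simp add: subtopology_subtopology)
    moreover have "subtopology (top_of_set (\<kappa> ` D)) (\<kappa> ` ?D) = top_of_set (\<kappa> ` ?D)"
      by (simp add: subtopology_subtopology inf.absorb2 image_mono)
    ultimately show "homeomorphic_map (subtopology (base \<M>) ?D) (top_of_set (\<kappa> ` ?D)) \<kappa>" by simp
  qed
  moreover have "holomorphic_transition m ?D \<kappa> E \<mu>" "holomorphic_transition m E \<mu> ?D \<kappa>" if at': "(E, \<mu>) \<in> atlas \<M>" for E \<mu>
  proof -
    have EO: "openin (base \<M>) E" by (rule chart_homeomorphic(2)[OF at'])
    show "holomorphic_transition m ?D \<kappa> E \<mu>"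
      unfolding holomorphic_transition_def
    proof (intro allI impI)
      fix i assume i: "i < m"
      have "holomorphic_several m (\<kappa> ` (D \<inter> E)) (\<lambda>z. \<mu> (inv_into D \<kappa> z) i)"
        using atlas_transition[OF at at'] i by (simp add: holomorphic_transition_def)
      then have "holomorphic_several m (\<kappa> ` (?D \<inter> E)) (\<lambda>z. \<mu> (inv_into D \<kappa> z) i)"
        by (rule holomorphic_several_subset) blast
      moreover have "?D \<inter> E = D \<inter> (W \<inter> E)" by blast
      moreover have "openin (top_of_set (cspace m)) (\<kappa> ` (D \<inter> (W \<inter> E)))"
        by (rule chart_image_open[OF at openin_Int[OF spl_open[OF W] EO]])
      ultimately show "holomorphic_several m (\<kappa> ` (?D \<inter> E)) (\<lambda>z. \<mu> (inv_into ?D \<kappa> z) i)"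
        by (elim holomorphic_several_cong[rotated 2]) (auto simp: chart_inv_subset[OF at, of ?D])
    qed
    show "holomorphic_transition m E \<mu> ?D \<kappa>"
      using atlas_transition[OF at' at] unfolding holomorphic_transition_def
      by (auto elim!: holomorphic_several_subset)
  qed
  ultimately show "coordinate_system \<M> ?D \<kappa> \<Phi>"
    using s by (auto simp: coordinate_system_def holomorphic_chart_def)
qed

lemma coordinate_neighbourhood:
  assumes "p \<in> topspace (base \<M>)"
  obtains D \<kappa> W \<Phi> where "(D, \<kappa>) \<in> atlas \<M>" "p \<in> W" "W \<subseteq> D" "spl W \<Phi>" "coordinate_system \<M> W \<kappa> \<Phi>"
proof -
  obtain D \<kappa> where D: "(D, \<kappa>) \<in> atlas \<M>" "p \<in> D" using atlas_cover[OF assms] by blast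
  obtain W \<Phi> where W: "p \<in> W" "spl W \<Phi>" using spl_exists[OF assms] by blast
  show thesis by (rule that[of D \<kappa> "D \<inter> W" \<Phi>]) (use D W coordinate_system_exists[OF D(1) W(2)] in auto)
qed

abbreviation AT where "AT \<equiv> automorphism_topology \<M>"
abbreviation Aut where "Aut \<equiv> automorphisms \<M>"

lemma subbasic_open:
  assumes "coordinate_system \<M> W \<kappa> \<Phi>" "compactin (base \<M>) K" "K \<subseteq> W" "openin (base \<M>) U" "f \<in> Sec U"
    "\<And>\<nu>. \<nu> \<in> multi \<Longrightarrow> open (\<Omega> \<nu>)"
  shows "openin AT (automorphism_subbasic \<M> W \<Phi> K U f \<Omega>)"
  unfolding automorphism_topology_def
  by (rule topology_generated_by_Basis) (use assms multi_indices_eq in blast)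

lemma subbasic_iff:
  "\<phi> \<in> automorphism_subbasic \<M> W \<Phi> K U f \<Omega> \<longleftrightarrow>
     \<phi> \<in> Aut \<and> fst \<phi> ` K \<subseteq> U \<and> (\<forall>x\<in>K. \<forall>\<nu>\<in>multi. pc \<phi> \<Phi> W U f x \<nu> \<in> \<Omega> \<nu>)"
  unfolding automorphism_subbasic_def multi_indices_eq pullback_coeff_eq[abs_def] by (auto simp: image_subset_iff pullback_coeff_eq)

lemma AT_topspace_subset: "topspace AT \<subseteq> Aut"
  unfolding automorphism_topology_def by (auto simp: automorphism_subbasic_def)

text \<open>
  The empty compact set imposes no condition, so all of \<open>Aut\<close> is a member of the subbase, as soon as
  there is a coordinate system at all.
\<close>

lemma Aut_open:
  assumes "topspace AT \<noteq> {}"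
  shows "openin AT Aut"
proof -
  obtain W \<kappa> \<Phi> where W: "coordinate_system \<M> W \<kappa> \<Phi>"
    using assms unfolding automorphism_topology_def by auto
  have e: "openin (base \<M>) {}" by simp
  have "openin AT (automorphism_subbasic \<M> W \<Phi> {} {} \<one>\<^bsub>sections \<M> {}\<^esub> (\<lambda>_. UNIV))"
    by (rule subbasic_open[OF W]) (use e in simp_all)
  moreover have "automorphism_subbasic \<M> W \<Phi> {} {} \<one>\<^bsub>sections \<M> {}\<^esub> (\<lambda>_. UNIV) = Aut"
    using subbasic_iff by auto
  ultimately show ?thesis by simp
qed

text \<open>
  The subbase speaks of compact sets inside one coordinate domain, and a general \<open>K\<close> is a finite union
  of such sets.
\<close>

lemma compact_open_nbhd:
  assumes ne: "topspace AT \<noteq> {}" and K: "compactin (base \<M>) K" and U: "openin (base \<M>) U"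
  shows "openin AT {\<phi> \<in> Aut. fst \<phi> ` K \<subseteq> U}"
proof -
  have KT: "K \<subseteq> topspace (base \<M>)" by (rule compactin_subset_topspace[OF K])
  have "\<exists>A. \<forall>x\<in>K. openin (base \<M>) (A x) \<and> x \<in> A x \<and> (\<exists>W \<kappa> \<Phi>. coordinate_system \<M> W \<kappa> \<Phi> \<and> base \<M> closure_of (A x) \<subseteq> W)"
  proof (rule bchoice, rule ballI)
    fix x assume "x \<in> K"
    then have xt: "x \<in> topspace (base \<M>)" using KT by blast
    obtain D \<kappa> W \<Phi> where W: "(D, \<kappa>) \<in> atlas \<M>" "x \<in> W" "W \<subseteq> D" "spl W \<Phi>" "coordinate_system \<M> W \<kappa> \<Phi>"
      by (rule coordinate_neighbourhood[OF xt]) (rule that)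
    obtain B where "openin (base \<M>) B" "x \<in> B" "base \<M> closure_of B \<subseteq> W"
      using shrink_open[OF spl_open[OF W(4)] W(2)] by blast
    then show "\<exists>A. openin (base \<M>) A \<and> x \<in> A \<and> (\<exists>W \<kappa> \<Phi>. coordinate_system \<M> W \<kappa> \<Phi> \<and> base \<M> closure_of A \<subseteq> W)"
      using W(5) by blast
  qed
  then obtain A where A: "\<And>x. x \<in> K \<Longrightarrow> openin (base \<M>) (A x)" "\<And>x. x \<in> K \<Longrightarrow> x \<in> A x"
    "\<And>x. x \<in> K \<Longrightarrow> \<exists>W \<kappa> \<Phi>. coordinate_system \<M> W \<kappa> \<Phi> \<and> base \<M> closure_of (A x) \<subseteq> W"
    by blast
  have "\<exists>\<F>. finite \<F> \<and> \<F> \<subseteq> A ` K \<and> K \<subseteq> \<Union>\<F>"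
    by (rule compactinD[OF K]) (use A in auto)
  then obtain \<F> where \<F>: "finite \<F>" "\<F> \<subseteq> A ` K" "K \<subseteq> \<Union>\<F>" by blast
  obtain K0 where K0: "finite K0" "K0 \<subseteq> K" "\<F> = A ` K0" using finite_subset_image[OF \<F>(1,2)] by blast
  let ?N = "\<lambda>x. {\<phi> \<in> Aut. fst \<phi> ` (base \<M> closure_of (A x) \<inter> K) \<subseteq> U}"
  have o: "openin AT (?N x)" if x: "x \<in> K0" for x
  proof -
    have xK: "x \<in> K" using x K0 by blast
    obtain W \<kappa> \<Phi> where W: "coordinate_system \<M> W \<kappa> \<Phi>" "base \<M> closure_of (A x) \<subseteq> W" using A(3)[OF xK] by blast
    have c: "compactin (base \<M>) (base \<M> closure_of (A x) \<inter> K)"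
      by (rule closed_Int_compactin[OF closedin_closure_of K])
    have "openin AT (automorphism_subbasic \<M> W \<Phi> (base \<M> closure_of (A x) \<inter> K) U \<one>\<^bsub>sections \<M> U\<^esub> (\<lambda>_. UNIV))"
      by (rule subbasic_open[OF W(1) c _ U]) (use W U in auto)
    moreover have "automorphism_subbasic \<M> W \<Phi> (base \<M> closure_of (A x) \<inter> K) U \<one>\<^bsub>sections \<M> U\<^esub> (\<lambda>_. UNIV) = ?N x"
      unfolding set_eq_iff subbasic_iff by simp
    ultimately show ?thesis by simp
  qed
  have "{\<phi> \<in> Aut. fst \<phi> ` K \<subseteq> U} = Aut \<inter> (\<Inter>x\<in>K0. ?N x)"
  proof
    show "Aut \<inter> (\<Inter>x\<in>K0. ?N x) \<subseteq> {\<phi> \<in> Aut. fst \<phi> ` K \<subseteq> U}"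
    proof
      fix \<phi> assume \<phi>: "\<phi> \<in> Aut \<inter> (\<Inter>x\<in>K0. ?N x)"
      have "fst \<phi> y \<in> U" if y: "y \<in> K" for y
      proof -
        obtain x where x: "x \<in> K0" "y \<in> A x" using y \<F>(3) K0(3) by blast
        have "A x \<subseteq> base \<M> closure_of (A x)" using x K0 A(1) by (intro closure_of_subset openin_subset) auto
        then show ?thesis using \<phi> x y by blast
      qed
      then show "\<phi> \<in> {\<phi> \<in> Aut. fst \<phi> ` K \<subseteq> U}" using \<phi> by auto
    qed
  qed auto
  moreover have "openin AT (Aut \<inter> (\<Inter>x\<in>K0. ?N x))"
  proof (cases "K0 = {}")
    case True then show ?thesis using Aut_open[OF ne] by simp
  next
    case False
    then have "openin AT (\<Inter>x\<in>K0. ?N x)" using o K0(1) by (intro openin_INT2) auto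
    then show ?thesis using Aut_open[OF ne] by blast
  qed
  ultimately show ?thesis by simp
qed

text \<open>
  The conditions at one point, in closed form. On \<open>A\<close>, the closure of a neighbourhood \<open>B\<close> of
  the point, \<open>\<phi>\<close> has values in the compact set \<open>G\<close> in the domain \<open>E \<inter> Z\<close> of the coordinates
  \<open>(\<mu>, \<theta>)\<close>; the pullbacks of the coordinates and of the monomials \<open>\<theta>\<^sup>\<rho>\<close> are bounded by \<open>R\<close>,
  and the coefficient of \<open>\<phi>\<^sup>*(\<theta>\<^bsup>top\<^esup>)\<close> at \<open>\<theta>\<^bsup>top\<^esup>\<close> stays away from \<open>0\<close>. The condition on
  \<open>L\<close> says that the inverse maps \<open>L\<close> into \<open>B\<close>.
\<close>

definition control_set where
  "control_set W \<Phi> E \<mu> Z \<Psi> A B G L R \<delta> = {\<phi> \<in> Aut.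
     fst \<phi> ` A \<subseteq> G \<and> fst \<phi> ` (topspace (base \<M>) - B) \<inter> L = {} \<and>
     (\<forall>x\<in>A. \<forall>\<nu>\<in>multi.
        (\<forall>i<m. cmod (pc \<phi> \<Phi> W (E \<inter> Z) (function_sec \<Psi> Z (E \<inter> Z) (\<lambda>y. \<mu> y i)) x \<nu>) \<le> R) \<and>
        (\<forall>\<rho>\<in>multi. cmod (pc \<phi> \<Phi> W (E \<inter> Z) (monomial_sec \<Psi> Z (E \<inter> Z) \<rho>) x \<nu>) \<le> R)) \<and>
     (\<forall>x\<in>A. \<delta> \<le> cmod (pc \<phi> \<Phi> W (E \<inter> Z) (monomial_sec \<Psi> Z (E \<inter> Z) top) x top))}"

text \<open>
  The closure \<open>A\<close> also lies in a chart domain \<open>D\<close>: the inverse automorphisms map \<open>L\<close> into \<open>A\<close>, a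
  compact part of one chart, and so converge like the automorphisms themselves.
\<close>

definition is_control :: "'p set \<Rightarrow> 'p set \<Rightarrow> ('p, 's, 'p, 's) morphism set \<Rightarrow> bool" where
  "is_control B L C \<longleftrightarrow> (\<exists>D \<kappa> W \<Phi> E \<mu> Z \<Psi> A G R \<delta>.
     (D, \<kappa>) \<in> atlas \<M> \<and> spl W \<Phi> \<and> (E, \<mu>) \<in> atlas \<M> \<and> spl Z \<Psi> \<and>
     openin (base \<M>) B \<and> openin (base \<M>) L \<and> B \<subseteq> A \<and> compactin (base \<M>) A \<and> A \<subseteq> W \<and> A \<subseteq> D \<and>
     compactin (base \<M>) G \<and> G \<subseteq> E \<inter> Z \<and> (0::real) \<le> R \<and> (0::real) < \<delta> \<and>
     C = control_set W \<Phi> E \<mu> Z \<Psi> A B G L R \<delta>)"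

text \<open>
  Each condition of a control holds in a neighbourhood of \<open>\<phi>\<close>, since a strict version of it is open in
  the topology on automorphisms.
\<close>

lemma control_exists:
  assumes \<phi>: "\<phi> \<in> topspace AT" and p: "p \<in> topspace (base \<M>)"
  shows "\<exists>B L C N. is_control B L C \<and> p \<in> B \<and> fst \<phi> p \<in> L \<and> openin AT N \<and> \<phi> \<in> N \<and> N \<subseteq> C"
proof -
  have ne: "topspace AT \<noteq> {}" using \<phi> by blast
  have \<phi>A: "\<phi> \<in> Aut" using \<phi> AT_topspace_subset by blast
  obtain \<xi> where \<xi>: "smor \<phi>" "smor \<xi>" "\<forall>x\<in>topspace (base \<M>). fst \<phi> (fst \<xi> x) = x" "\<forall>x\<in>topspace (base \<M>). fst \<xi> (fst \<phi> x) = x"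
    "\<forall>U s. openin (base \<M>) U \<longrightarrow> s \<in> Sec U \<longrightarrow> snd \<phi> (pre \<xi> U) (snd \<xi> U s) = s"
    by (rule automorphism_inverse[OF \<phi>A]) (rule that)
  define q where "q = fst \<phi> p"
  have q: "q \<in> topspace (base \<M>)" unfolding q_def by (rule smor_topspace[OF \<xi>(1) p])
  obtain D \<kappa> W \<Phi> where W: "(D, \<kappa>) \<in> atlas \<M>" "p \<in> W" "W \<subseteq> D" "spl W \<Phi>" "coordinate_system \<M> W \<kappa> \<Phi>"
    by (rule coordinate_neighbourhood[OF p]) (rule that)
  obtain E \<mu> where at: "(E, \<mu>) \<in> atlas \<M>" and qE: "q \<in> E" using atlas_cover[OF q] by blast
  obtain Z \<Psi> where qZ: "q \<in> Z" and Z: "spl Z \<Psi>" using spl_exists[OF q] by blast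
  let ?Q = "E \<inter> Z"
  have QO: "openin (base \<M>) ?Q" using chart_homeomorphic(2)[OF at] spl_open[OF Z] by blast
  have QZ: "?Q \<subseteq> Z" by blast
  have qQ: "q \<in> ?Q" using qE qZ by simp
  obtain G0 where G0: "openin (base \<M>) G0" "q \<in> G0" "base \<M> closure_of G0 \<subseteq> ?Q" using shrink_open[OF QO qQ] by blast
  let ?G = "base \<M> closure_of G0"
  have G0G: "G0 \<subseteq> ?G" by (rule closure_of_subset[OF openin_subset[OF G0(1)]])
  let ?f = "\<lambda>i. function_sec \<Psi> Z ?Q (\<lambda>y. \<mu> y i)" and ?e = "monomial_sec \<Psi> Z ?Q"
  have fC: "?f i \<in> Sec ?Q" if "i < m" for i
    by (rule function_sec_closed[OF Z QO QZ holo_subset[OF holo_coordinate[OF at that]]]) simp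
  have eC: "?e \<rho> \<in> Sec ?Q" for \<rho> by (rule monomial_sec_closed[OF Z QO QZ])
  let ?S = "pre \<phi> ?Q \<inter> W"
  have pQ: "openin (base \<M>) (pre \<phi> ?Q)" by (rule pre_open[OF \<xi>(1) QO])
  have SO: "openin (base \<M>) ?S" by (rule VW[OF W(4) pQ])
  have pS: "p \<in> ?S" using p W qQ by (simp add: pre_iff q_def)
  have hol: "holo ?S (\<lambda>x. pc \<phi> \<Phi> W ?Q s x \<nu>)" if "s \<in> Sec ?Q" "\<nu> \<in> multi" for s \<nu>
    unfolding pc_def by (rule coeff_holo[OF W(4) pQ smor_closed[OF \<xi>(1) QO that(1)] that(2)])
  obtain Y1 R1 where Y1: "openin (base \<M>) Y1" "p \<in> Y1" "Y1 \<subseteq> ?S" "0 \<le> R1"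
    "\<forall>j\<in>{..<m} \<times> multi. \<forall>y\<in>Y1. cmod (pc \<phi> \<Phi> W ?Q (?f (fst j)) y (snd j)) \<le> R1"
    by (rule finite_family_locally_bounded[OF SO pS, of "{..<m} \<times> multi" "\<lambda>j y. pc \<phi> \<Phi> W ?Q (?f (fst j)) y (snd j)"])
       (simp, clarify, rule hol, simp_all add: fC that)
  obtain Y2 R2 where Y2: "openin (base \<M>) Y2" "p \<in> Y2" "Y2 \<subseteq> ?S" "0 \<le> R2"
    "\<forall>j\<in>multi \<times> multi. \<forall>y\<in>Y2. cmod (pc \<phi> \<Phi> W ?Q (?e (fst j)) y (snd j)) \<le> R2"
    by (rule finite_family_locally_bounded[OF SO pS, of "multi \<times> multi" "\<lambda>j y. pc \<phi> \<Phi> W ?Q (?e (fst j)) y (snd j)"])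
       (simp, clarify, rule hol, simp_all add: eC that)
  \<comment> \<open>Larger than the bounds that hold for \<open>\<phi>\<close>, so that the strict inequality is an open condition.\<close>
  define R where "R = R1 + R2 + 1"
  have topm: "top \<in> multi" by simp
  have pp: "p \<in> pre \<phi> ?Q" using pS by blast
  have nz: "pc \<phi> \<Phi> W ?Q (?e top) p top \<noteq> 0"
    by (rule automorphism_nondegenerate[OF \<phi>A W(4) Z QO QZ pp W(2)])
  define \<delta> where "\<delta> = cmod (pc \<phi> \<Phi> W ?Q (?e top) p top) / 2"
  have \<delta>: "\<delta> > 0" using nz by (simp add: \<delta>_def)
  let ?\<Delta> = "{z::complex. \<delta> < cmod z}"
  have \<Delta>O: "open ?\<Delta>" by (intro open_Collect_less continuous_intros)
  define Y where "Y = Y1 \<inter> Y2 \<inter> {x \<in> ?S. pc \<phi> \<Phi> W ?Q (?e top) x top \<in> ?\<Delta>} \<inter> pre \<phi> G0"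
  have YO: "openin (base \<M>) Y"
    unfolding Y_def by (intro openin_Int Y1 Y2 holo_continuous[OF SO hol[OF eC topm] \<Delta>O] pre_open[OF \<xi>(1) G0(1)])
  have pY: "p \<in> Y" using Y1 Y2 pS \<delta> G0 p by (simp add: Y_def pre_iff q_def \<delta>_def)
  obtain B where B: "openin (base \<M>) B" "p \<in> B" "base \<M> closure_of B \<subseteq> Y" using shrink_open[OF YO pY] by blast
  let ?A = "base \<M> closure_of B"
  have BA: "B \<subseteq> ?A" by (rule closure_of_subset[OF openin_subset[OF B(1)]])
  have AW: "?A \<subseteq> W" using B(3) Y1(3) by (auto simp: Y_def)
  have L0: "openin (base \<M>) (pre \<xi> B)" by (rule pre_open[OF \<xi>(2) B(1)])
  have qL0: "q \<in> pre \<xi> B" using q \<xi>(4) p B(2) by (simp add: pre_iff q_def)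
  obtain L where L: "openin (base \<M>) L" "q \<in> L" "base \<M> closure_of L \<subseteq> pre \<xi> B" using shrink_open[OF L0 qL0] by blast
  have LL: "L \<subseteq> base \<M> closure_of L" by (rule closure_of_subset[OF openin_subset[OF L(1)]])
  define N1 where "N1 = {\<psi> \<in> Aut. fst \<psi> ` ?A \<subseteq> G0}"
  \<comment> \<open>The condition on inverses, in terms of \<open>\<psi>\<close>: the compact complement of \<open>B\<close> misses \<open>L\<close>.\<close>
  define N2 where "N2 = {\<psi> \<in> Aut. fst \<psi> ` (topspace (base \<M>) - B) \<subseteq> topspace (base \<M>) - base \<M> closure_of L}"
  define N3 where "N3 = (\<Inter>i\<in>{..<m}. automorphism_subbasic \<M> W \<Phi> ?A ?Q (?f i) (\<lambda>_. ball 0 R))"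
  define N4 where "N4 = (\<Inter>\<rho>\<in>multi. automorphism_subbasic \<M> W \<Phi> ?A ?Q (?e \<rho>) (\<lambda>_. ball 0 R))"
  define N5 where "N5 = automorphism_subbasic \<M> W \<Phi> ?A ?Q (?e top) (\<lambda>\<nu>. if \<nu> = top then ?\<Delta> else UNIV)"
  define C where "C = control_set W \<Phi> E \<mu> Z \<Psi> ?A B ?G L R \<delta>"
  have AutO: "openin AT Aut" by (rule Aut_open[OF ne])
  have O1: "openin AT N1" unfolding N1_def by (rule compact_open_nbhd[OF ne compactin_closure G0(1)])
  have O2: "openin AT N2"
    unfolding N2_def
  proof (rule compact_open_nbhd[OF ne])
    show "compactin (base \<M>) (topspace (base \<M>) - B)"
      by (rule closedin_compact_space[OF compact_base]) (use B(1) in \<open>simp add: closedin_diff\<close>)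
    show "openin (base \<M>) (topspace (base \<M>) - base \<M> closure_of L)" by (simp add: openin_diff)
  qed
  have O3: "openin AT (Aut \<inter> N3)"
  proof (cases "m = 0")
    case True then show ?thesis using AutO by (simp add: N3_def)
  next
    case False
    have "openin AT N3"
      unfolding N3_def
      by (rule openin_INT2) (use False subbasic_open[OF W(5) compactin_closure AW QO fC] in auto)
    then show ?thesis using AutO by blast
  qed
  have O4: "openin AT N4"
    unfolding N4_def by (rule openin_INT2) (use subbasic_open[OF W(5) compactin_closure AW QO eC] in auto)
  have O5: "openin AT N5"
    unfolding N5_def by (rule subbasic_open[OF W(5) compactin_closure AW QO eC]) (use \<Delta>O in auto)
  define N where "N = N1 \<inter> N2 \<inter> (Aut \<inter> N3) \<inter> N4 \<inter> N5"
  have NO: "openin AT N" unfolding N_def by (intro openin_Int O1 O2 O3 O4 O5)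
  have AQ: "fst \<phi> ` ?A \<subseteq> ?Q" using B(3) Y1(3) by (auto simp: Y_def pre_iff)
  have \<phi>N: "\<phi> \<in> N"
    unfolding N_def
  proof (intro IntI \<phi>A)
    show "\<phi> \<in> N1" using \<phi>A B(3) by (auto simp: N1_def Y_def pre_iff)
    have "fst \<phi> x \<notin> base \<M> closure_of L" if x: "x \<in> topspace (base \<M>)" "x \<notin> B" for x
    proof
      assume "fst \<phi> x \<in> base \<M> closure_of L"
      then have "fst \<xi> (fst \<phi> x) \<in> B" using L(3) by (auto simp: pre_iff)
      then show False using \<xi>(4) x by simp
    qed
    then show "\<phi> \<in> N2" using \<phi>A smor_topspace[OF \<xi>(1)] by (auto simp: N2_def)
    have b1: "cmod (pc \<phi> \<Phi> W ?Q (?f i) x \<nu>) < R" if "x \<in> ?A" "i < m" "\<nu> \<in> multi" for x i \<nu>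
    proof -
      have "x \<in> Y1" using that(1) B(3) by (auto simp: Y_def)
      then have "cmod (pc \<phi> \<Phi> W ?Q (?f i) x \<nu>) \<le> R1" using Y1(5) that by fastforce
      then show ?thesis using Y2(4) by (simp add: R_def)
    qed
    show "\<phi> \<in> N3" unfolding N3_def using \<phi>A AQ b1 by (auto simp: subbasic_iff)
    have b2: "cmod (pc \<phi> \<Phi> W ?Q (?e \<rho>) x \<nu>) < R" if "x \<in> ?A" "\<rho> \<in> multi" "\<nu> \<in> multi" for x \<rho> \<nu>
    proof -
      have "x \<in> Y2" using that(1) B(3) by (auto simp: Y_def)
      then have "cmod (pc \<phi> \<Phi> W ?Q (?e \<rho>) x \<nu>) \<le> R2" using Y2(5) that by fastforce
      then show ?thesis using Y1(4) by (simp add: R_def)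
    qed
    show "\<phi> \<in> N4" unfolding N4_def using \<phi>A AQ b2 by (auto simp: subbasic_iff)
    have "\<delta> < cmod (pc \<phi> \<Phi> W ?Q (?e top) x top)" if "x \<in> ?A" for x
      using that B(3) by (auto simp: Y_def)
    then show "\<phi> \<in> N5" unfolding N5_def using \<phi>A AQ by (auto simp: subbasic_iff)
  qed
  have "N \<subseteq> C"
  proof
    fix \<psi> assume \<psi>: "\<psi> \<in> N"
    have A1: "\<psi> \<in> Aut" and A2: "fst \<psi> ` ?A \<subseteq> G0" using \<psi> by (auto simp: N_def N1_def)
    have A3: "fst \<psi> ` (topspace (base \<M>) - B) \<inter> L = {}" using \<psi> LL by (auto simp: N_def N2_def)
    have A4: "cmod (pc \<psi> \<Phi> W ?Q (?f i) x \<nu>) \<le> R" if "x \<in> ?A" "i < m" "\<nu> \<in> multi" for x i \<nu>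
    proof -
      have "\<psi> \<in> automorphism_subbasic \<M> W \<Phi> ?A ?Q (?f i) (\<lambda>_. ball 0 R)" using \<psi> that by (auto simp: N_def N3_def)
      then have "pc \<psi> \<Phi> W ?Q (?f i) x \<nu> \<in> ball 0 R" using that unfolding subbasic_iff by blast
      then show ?thesis by simp
    qed
    have A5: "cmod (pc \<psi> \<Phi> W ?Q (?e \<rho>) x \<nu>) \<le> R" if "x \<in> ?A" "\<rho> \<in> multi" "\<nu> \<in> multi" for x \<rho> \<nu>
    proof -
      have "\<psi> \<in> automorphism_subbasic \<M> W \<Phi> ?A ?Q (?e \<rho>) (\<lambda>_. ball 0 R)" using \<psi> that by (auto simp: N_def N4_def)
      then have "pc \<psi> \<Phi> W ?Q (?e \<rho>) x \<nu> \<in> ball 0 R" using that unfolding subbasic_iff by blast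
      then show ?thesis by simp
    qed
    have A6: "\<delta> \<le> cmod (pc \<psi> \<Phi> W ?Q (?e top) x top)" if "x \<in> ?A" for x
    proof -
      have "\<psi> \<in> N5" using \<psi> by (simp add: N_def)
      then have "pc \<psi> \<Phi> W ?Q (?e top) x top \<in> (if top = top then ?\<Delta> else UNIV)"
        unfolding N5_def subbasic_iff using that topm by blast
      then show ?thesis by simp
    qed
    show "\<psi> \<in> C"
      unfolding C_def control_set_def using A1 A2 G0G A3 A4 A5 A6 by (intro CollectI conjI ballI allI impI) auto
  qed
  moreover have "is_control B L C"
    unfolding is_control_def
  proof (intro exI conjI)
    show "C = control_set W \<Phi> E \<mu> Z \<Psi> ?A B ?G L R \<delta>" by (rule C_def)
    show "(D, \<kappa>) \<in> atlas \<M>" "spl W \<Phi>" "(E, \<mu>) \<in> atlas \<M>" "spl Z \<Psi>" by (rule W at Z)+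
    show "openin (base \<M>) B" "openin (base \<M>) L" "B \<subseteq> ?A" "?A \<subseteq> W" by (rule B L BA AW)+
    show "compactin (base \<M>) ?A" "compactin (base \<M>) ?G" by (rule compactin_closure)+
    show "?A \<subseteq> D" using AW W(3) by blast
    show "?G \<subseteq> ?Q" by (rule G0(3))
    show "0 \<le> R" using Y1(4) Y2(4) by (simp add: R_def)
    show "0 < \<delta>" by (rule \<delta>)
  qed
  ultimately show ?thesis using B(2) L(2) NO \<phi>N unfolding q_def by blast
qed


lemma control_setD:
  assumes "\<phi> \<in> control_set W \<Phi> E \<mu> Z \<Psi> A B G L R \<delta>"
  shows "\<phi> \<in> Aut" and "x \<in> A \<Longrightarrow> fst \<phi> x \<in> G"
    and "x \<in> topspace (base \<M>) \<Longrightarrow> x \<notin> B \<Longrightarrow> fst \<phi> x \<notin> L"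
    and "x \<in> A \<Longrightarrow> \<nu> \<in> multi \<Longrightarrow> i < m \<Longrightarrow> cmod (pc \<phi> \<Phi> W (E \<inter> Z) (function_sec \<Psi> Z (E \<inter> Z) (\<lambda>y. \<mu> y i)) x \<nu>) \<le> R"
    and "x \<in> A \<Longrightarrow> \<nu> \<in> multi \<Longrightarrow> \<rho> \<in> multi \<Longrightarrow> cmod (pc \<phi> \<Phi> W (E \<inter> Z) (monomial_sec \<Psi> Z (E \<inter> Z) \<rho>) x \<nu>) \<le> R"
    and "x \<in> A \<Longrightarrow> \<delta> \<le> cmod (pc \<phi> \<Phi> W (E \<inter> Z) (monomial_sec \<Psi> Z (E \<inter> Z) top) x top)"
  using assms unfolding control_set_def by blast+

text \<open>
  Chosen for all morphisms at once, so that the inverses form a family indexed by the automorphisms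
  and converge along the same ultrafilters.
\<close>

definition inverse_body :: "('p, 's, 'p, 's) morphism \<Rightarrow> 'p \<Rightarrow> 'p" where
  "inverse_body \<phi> = (SOME h. holo_map h \<and> (\<forall>x\<in>topspace (base \<M>). h x \<in> topspace (base \<M>) \<and> fst \<phi> (h x) = x \<and> h (fst \<phi> x) = x))"

lemma inverse_body:
  assumes "\<phi> \<in> Aut"
  shows "holo_map (inverse_body \<phi>)"
    and "x \<in> topspace (base \<M>) \<Longrightarrow> inverse_body \<phi> x \<in> topspace (base \<M>)"
    and "x \<in> topspace (base \<M>) \<Longrightarrow> fst \<phi> (inverse_body \<phi> x) = x"
    and "x \<in> topspace (base \<M>) \<Longrightarrow> inverse_body \<phi> (fst \<phi> x) = x"
proof -
  obtain \<xi> where \<xi>: "smor \<phi>" "smor \<xi>" "\<forall>x\<in>topspace (base \<M>). fst \<phi> (fst \<xi> x) = x" "\<forall>x\<in>topspace (base \<M>). fst \<xi> (fst \<phi> x) = x"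
    "\<forall>U s. openin (base \<M>) U \<longrightarrow> s \<in> Sec U \<longrightarrow> snd \<phi> (pre \<xi> U) (snd \<xi> U s) = s"
    by (rule automorphism_inverse[OF assms]) (rule that)
  have "\<exists>h. holo_map h \<and> (\<forall>x\<in>topspace (base \<M>). h x \<in> topspace (base \<M>) \<and> fst \<phi> (h x) = x \<and> h (fst \<phi> x) = x)"
    using holo_map_smor[OF \<xi>(2)] smor_topspace[OF \<xi>(2)] \<xi>(3,4) by (intro exI[of _ "fst \<xi>"]) simp
  from someI_ex[OF this] show "holo_map (inverse_body \<phi>)"
    "x \<in> topspace (base \<M>) \<Longrightarrow> inverse_body \<phi> x \<in> topspace (base \<M>)"
    "x \<in> topspace (base \<M>) \<Longrightarrow> fst \<phi> (inverse_body \<phi> x) = x"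
    "x \<in> topspace (base \<M>) \<Longrightarrow> inverse_body \<phi> (fst \<phi> x) = x"
    unfolding inverse_body_def[symmetric] by blast+
qed

lemma is_control_open: "is_control B L C \<Longrightarrow> openin (base \<M>) B \<and> openin (base \<M>) L"
  unfolding is_control_def by (elim exE conjE) (intro conjI)

lemma Aut_smor: "\<phi> \<in> Aut \<Longrightarrow> smor \<phi>" by (simp add: automorphisms_def)

text \<open>
  Convergence has to be tested on the subbase. For a compact set \<open>K\<close> in a coordinate domain, the
  coefficients converge continuously at each point of \<open>K\<close>, and finitely many of the neighbourhoods
  on which they are good enough cover \<open>K\<close>.
\<close>

lemma converges_in_AT:
  assumes F: "ultrafilter F" and ev: "eventually (\<lambda>\<phi>. \<phi> \<in> Aut) F"
    and body: "conv_continuously F fst g" and ctrl: "controlled F (\<lambda>\<phi>. \<phi>) g"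
    and lim: "limit_morphism F (\<lambda>\<phi>. \<phi>) g \<in> Aut" and ne: "topspace AT \<noteq> {}"
  shows "limitin AT (\<lambda>\<phi>. \<phi>) (limit_morphism F (\<lambda>\<phi>. \<phi>) g) F"
  unfolding automorphism_topology_def
proof (rule limitin_topology_generated_by)
  let ?\<psi> = "limit_morphism F (\<lambda>\<phi>. \<phi>) g"
  have sm: "eventually (\<lambda>\<phi>. smor \<phi>) F" using ev by eventually_elim (rule Aut_smor)
  note ctx = F sm body ctrl
  let ?S = "{automorphism_subbasic \<M> W \<Phi> K U f \<Omega> | W \<kappa> \<Phi> K U f \<Omega>.
          coordinate_system \<M> W \<kappa> \<Phi> \<and> compactin (base \<M>) K \<and> K \<subseteq> W \<and>
          openin (base \<M>) U \<and> f \<in> Sec U \<and> (\<forall>\<nu>\<in>multi_indices \<M>. open (\<Omega> \<nu>))}"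
  have TS: "topspace AT = \<Union>?S" unfolding automorphism_topology_def by (rule topology_generated_by_topspace)
  have "?\<psi> \<in> topspace AT" by (rule subsetD[OF openin_subset[OF Aut_open[OF ne]] lim])
  then show "?\<psi> \<in> \<Union>?S" by (simp only: TS)
  fix S assume "S \<in> ?S" and \<psi>S: "?\<psi> \<in> S"
  then obtain W \<kappa> \<Phi> K U f \<Omega> where S: "S = automorphism_subbasic \<M> W \<Phi> K U f \<Omega>"
    and cs: "coordinate_system \<M> W \<kappa> \<Phi>" and K: "compactin (base \<M>) K" "K \<subseteq> W"
    and U: "openin (base \<M>) U" and f: "f \<in> Sec U" and \<Omega>: "\<forall>\<nu>\<in>multi_indices \<M>. open (\<Omega> \<nu>)"
    by blast
  have W: "spl W \<Phi>" using cs by (simp add: coordinate_system_def)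
  let ?t = "snd ?\<psi> U f"
  have gO: "openin (base \<M>) (limit_pre g U)" by (rule gpre_open[OF ctx U])
  have tC: "?t \<in> Sec (limit_pre g U)" by (rule snd_lim(1)[OF ctx U f])
  have pc\<psi>: "pc ?\<psi> \<Phi> W U f x \<nu> = coeff \<Phi> W (limit_pre g U) ?t x \<nu>" for x \<nu>
    by (simp add: pc_def pre_lim[OF ctx])
  have KT: "K \<subseteq> topspace (base \<M>)" by (rule compactin_subset_topspace[OF K(1)])
  have mem: "fst ?\<psi> ` K \<subseteq> U" "\<forall>x\<in>K. \<forall>\<nu>\<in>multi. coeff \<Phi> W (limit_pre g U) ?t x \<nu> \<in> \<Omega> \<nu>"
    using \<psi>S unfolding S subbasic_iff pc\<psi> by auto
  have Kg: "K \<subseteq> limit_pre g U"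
  proof
    fix x assume x: "x \<in> K"
    then have xt: "x \<in> topspace (base \<M>)" using KT by blast
    have "fst ?\<psi> x \<in> U" using mem(1) x by blast
    then show "x \<in> limit_pre g U" using fst_lim[OF ctx xt] xt by (simp add: limit_pre_def)
  qed
  have "\<exists>Y. \<forall>x\<in>K. openin (base \<M>) (Y x) \<and> x \<in> Y x \<and>
      eventually (\<lambda>\<phi>. fst \<phi> ` Y x \<subseteq> U \<and> (\<forall>y\<in>Y x. \<forall>\<nu>\<in>multi. pc \<phi> \<Phi> W U f y \<nu> \<in> \<Omega> \<nu>)) F"
  proof (rule bchoice, rule ballI)
    fix x assume x: "x \<in> K"
    have xW: "x \<in> W" and xg: "x \<in> limit_pre g U" using x K Kg by auto
    have "\<forall>\<nu>. \<exists>e. \<nu> \<in> multi \<longrightarrow> e > 0 \<and> ball (coeff \<Phi> W (limit_pre g U) ?t x \<nu>) e \<subseteq> \<Omega> \<nu>"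
    proof
      fix \<nu>
      show "\<exists>e. \<nu> \<in> multi \<longrightarrow> e > 0 \<and> ball (coeff \<Phi> W (limit_pre g U) ?t x \<nu>) e \<subseteq> \<Omega> \<nu>"
      proof (cases "\<nu> \<in> multi")
        case True
        then have "open (\<Omega> \<nu>)" "coeff \<Phi> W (limit_pre g U) ?t x \<nu> \<in> \<Omega> \<nu>" using \<Omega> mem(2) x by (auto simp: multi_indices_eq)
        then show ?thesis using open_contains_ball by blast
      qed blast
    qed
    then obtain e where e: "\<And>\<nu>. \<nu> \<in> multi \<Longrightarrow> e \<nu> > 0" "\<And>\<nu>. \<nu> \<in> multi \<Longrightarrow> ball (coeff \<Phi> W (limit_pre g U) ?t x \<nu>) (e \<nu>) \<subseteq> \<Omega> \<nu>"
      unfolding choice_iff by blast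
    define d where "d = Min (e ` multi) / 2"
    have fin: "finite (e ` multi)" "e ` multi \<noteq> {}" by auto
    have dpos: "d > 0" unfolding d_def using e(1) by (simp add: Min_gr_iff[OF fin])
    have d2: "2 * d \<le> e \<nu>" if "\<nu> \<in> multi" for \<nu>
    proof -
      have "Min (e ` multi) \<le> e \<nu>" by (rule Min_le) (use that in auto)
      then show ?thesis by (simp add: d_def)
    qed
    have "approx F (\<lambda>\<phi>. \<phi>) U f (limit_pre g U) ?t x" by (rule snd_lim(2)[OF ctx U f xg])
    then have "\<exists>Y. openin (base \<M>) Y \<and> x \<in> Y \<and> Y \<subseteq> limit_pre g U \<inter> W \<and> eventually (\<lambda>\<phi>. fst \<phi> ` Y \<subseteq> U \<and>
       (\<forall>y\<in>Y. \<forall>\<nu>\<in>multi. cmod (pc \<phi> \<Phi> W U f y \<nu> - coeff \<Phi> W (limit_pre g U) ?t y \<nu>) < d)) F"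
      using W xW dpos by (simp add: approx_def)
    then obtain Y where Y: "openin (base \<M>) Y" "x \<in> Y" "Y \<subseteq> limit_pre g U \<inter> W" "eventually (\<lambda>\<phi>. fst \<phi> ` Y \<subseteq> U \<and>
       (\<forall>y\<in>Y. \<forall>\<nu>\<in>multi. cmod (pc \<phi> \<Phi> W U f y \<nu> - coeff \<Phi> W (limit_pre g U) ?t y \<nu>) < d)) F"
      by (elim exE conjE) (rule that)
    define Y' where "Y' = Y \<inter> (\<Inter>\<nu>\<in>multi. {y \<in> limit_pre g U \<inter> W. coeff \<Phi> W (limit_pre g U) ?t y \<nu> \<in> ball (coeff \<Phi> W (limit_pre g U) ?t x \<nu>) d})"
    have Y'O: "openin (base \<M>) Y'"
      unfolding Y'_def
      by (intro openin_Int Y(1) openin_INT2 holo_continuous[OF VW[OF W gO] coeff_holo[OF W gO tC] open_ball]) auto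
    have xY': "x \<in> Y'" using Y(2) xW xg dpos by (simp add: Y'_def)
    have "eventually (\<lambda>\<phi>. fst \<phi> ` Y' \<subseteq> U \<and> (\<forall>y\<in>Y'. \<forall>\<nu>\<in>multi. pc \<phi> \<Phi> W U f y \<nu> \<in> \<Omega> \<nu>)) F"
      using Y(4)
    proof eventually_elim
      case (elim \<phi>)
      have "pc \<phi> \<Phi> W U f y \<nu> \<in> \<Omega> \<nu>" if y: "y \<in> Y'" and \<nu>: "\<nu> \<in> multi" for y \<nu>
      proof -
        have yY: "y \<in> Y" and "coeff \<Phi> W (limit_pre g U) ?t y \<nu> \<in> ball (coeff \<Phi> W (limit_pre g U) ?t x \<nu>) d"
          using y \<nu> unfolding Y'_def by blast+
        moreover have "dist (coeff \<Phi> W (limit_pre g U) ?t y \<nu>) (pc \<phi> \<Phi> W U f y \<nu>) < d"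
          using elim yY \<nu> by (simp add: dist_norm norm_minus_commute)
        ultimately have "dist (coeff \<Phi> W (limit_pre g U) ?t x \<nu>) (pc \<phi> \<Phi> W U f y \<nu>) < d + d"
          using dist_triangle[of "coeff \<Phi> W (limit_pre g U) ?t x \<nu>" "pc \<phi> \<Phi> W U f y \<nu>" "coeff \<Phi> W (limit_pre g U) ?t y \<nu>"] by simp
        then have "pc \<phi> \<Phi> W U f y \<nu> \<in> ball (coeff \<Phi> W (limit_pre g U) ?t x \<nu>) (e \<nu>)" using d2[OF \<nu>] by simp
        then show ?thesis using e(2)[OF \<nu>] by blast
      qed
      moreover have "fst \<phi> ` Y' \<subseteq> U" using elim by (auto simp: Y'_def)
      ultimately show ?case by blast
    qed
    with Y'O xY' show "\<exists>Y. openin (base \<M>) Y \<and> x \<in> Y \<and>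
      eventually (\<lambda>\<phi>. fst \<phi> ` Y \<subseteq> U \<and> (\<forall>y\<in>Y. \<forall>\<nu>\<in>multi. pc \<phi> \<Phi> W U f y \<nu> \<in> \<Omega> \<nu>)) F"
      by (intro exI[of _ Y'] conjI)
  qed
  then obtain Y where Y: "\<And>x. x \<in> K \<Longrightarrow> openin (base \<M>) (Y x)" "\<And>x. x \<in> K \<Longrightarrow> x \<in> Y x"
      "\<And>x. x \<in> K \<Longrightarrow> eventually (\<lambda>\<phi>. fst \<phi> ` Y x \<subseteq> U \<and> (\<forall>y\<in>Y x. \<forall>\<nu>\<in>multi. pc \<phi> \<Phi> W U f y \<nu> \<in> \<Omega> \<nu>)) F"
    by blast
  have "\<exists>\<F>. finite \<F> \<and> \<F> \<subseteq> Y ` K \<and> K \<subseteq> \<Union>\<F>"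
    by (rule compactinD[OF K(1)]) (use Y in auto)
  then obtain \<F> where \<F>: "finite \<F>" "\<F> \<subseteq> Y ` K" "K \<subseteq> \<Union>\<F>" by blast
  obtain K0 where K0: "finite K0" "K0 \<subseteq> K" "\<F> = Y ` K0" using finite_subset_image[OF \<F>(1,2)] by blast
  have "eventually (\<lambda>\<phi>. \<forall>x\<in>K0. fst \<phi> ` Y x \<subseteq> U \<and> (\<forall>y\<in>Y x. \<forall>\<nu>\<in>multi. pc \<phi> \<Phi> W U f y \<nu> \<in> \<Omega> \<nu>)) F"
    by (rule eventually_ball_finite[OF K0(1)]) (use Y(3) K0(2) in blast)
  with ev show "eventually (\<lambda>\<phi>. \<phi> \<in> S) F"
  proof eventually_elim
    case (elim \<phi>)
    have "fst \<phi> y \<in> U \<and> (\<forall>\<nu>\<in>multi. pc \<phi> \<Phi> W U f y \<nu> \<in> \<Omega> \<nu>)" if y: "y \<in> K" for y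
    proof -
      obtain x where "x \<in> K0" "y \<in> Y x" using y \<F>(3) K0(3) by blast
      then show ?thesis using elim(2) by blast
    qed
    with elim(1) show ?case unfolding S subbasic_iff by blast
  qed
qed

text \<open>
  The controls yield limits \<open>g\<close> and \<open>h\<close> of the underlying maps and of their inverses, and make the
  family controlled, hence convergent to a morphism \<open>\<psi>\<close> over \<open>g\<close>. As \<open>g\<close> and \<open>h\<close> are inverse to
  each other and the lower bound \<open>\<delta>\<close> persists, \<open>\<psi>\<close> is an automorphism; it satisfies the controls
  because they are closed conditions.
\<close>

lemma ultrafilter_limit_in_controls:
  assumes ne: "topspace AT \<noteq> {}" and F: "ultrafilter F"
    and P0: "finite P0" "\<And>p. p \<in> P0 \<Longrightarrow> is_control (B p) (L p) (C p)"
    and cover: "topspace (base \<M>) \<subseteq> (\<Union>p\<in>P0. B p)" "topspace (base \<M>) \<subseteq> (\<Union>p\<in>P0. L p)"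
    and ev: "eventually (\<lambda>\<phi>. \<phi> \<in> Aut \<inter> (\<Inter>p\<in>P0. C p)) F"
  shows "\<exists>\<psi>\<in>Aut \<inter> (\<Inter>p\<in>P0. C p). limitin AT (\<lambda>\<phi>. \<phi>) \<psi> F"
proof -
  have F0: "F \<noteq> bot" using F by (simp add: ultrafilter_def)
  have evA: "eventually (\<lambda>\<phi>. \<phi> \<in> Aut) F" using ev by eventually_elim simp
  have sm: "eventually (\<lambda>\<phi>. smor \<phi>) F" using evA by eventually_elim (rule Aut_smor)
  have evC: "eventually (\<lambda>\<phi>. \<phi> \<in> C p) F" if "p \<in> P0" for p
    using ev by eventually_elim (use that in blast)
  obtain g where g: "conv_continuously F fst g"
  proof (rule conv_continuously_exists[OF F])
    fix y assume "y \<in> topspace (base \<M>)"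
    then obtain p where p: "p \<in> P0" "y \<in> B p" using cover(1) by blast
    from P0(2)[OF p(1)] obtain D \<kappa> W \<Phi> E \<mu> Z \<Psi> A G R \<delta> where
      I: "(E, \<mu>) \<in> atlas \<M>" "openin (base \<M>) (B p)" "B p \<subseteq> A"
        "compactin (base \<M>) G" "G \<subseteq> E \<inter> Z" "C p = control_set W \<Phi> E \<mu> Z \<Psi> A (B p) G (L p) R \<delta>"
      unfolding is_control_def by (elim exE conjE) (rule that)
    have "eventually (\<lambda>\<phi>. holo_map (fst \<phi>) \<and> fst \<phi> ` B p \<subseteq> G) F"
      using sm evC[OF p(1)]
    proof eventually_elim
      case (elim \<phi>)
      have "fst \<phi> x \<in> G" if "x \<in> B p" for x
        using control_setD(2)[OF elim(2)[unfolded I(6)]] that I(3) by blast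
      then show ?case using holo_map_smor[OF elim(1)] by blast
    qed
    moreover have "G \<subseteq> E" using I(5) by blast
    ultimately show "\<exists>Y E \<mu> K. openin (base \<M>) Y \<and> y \<in> Y \<and> (E, \<mu>) \<in> atlas \<M> \<and>
        compactin (base \<M>) K \<and> K \<subseteq> E \<and> eventually (\<lambda>\<alpha>. holo_map (fst \<alpha>) \<and> fst \<alpha> ` Y \<subseteq> K) F"
      using I p(2) by (intro exI conjI)
  qed (rule that)
  obtain h where h: "conv_continuously F inverse_body h"
  proof (rule conv_continuously_exists[OF F])
    fix y assume y: "y \<in> topspace (base \<M>)"
    then obtain p where p: "p \<in> P0" "y \<in> L p" using cover(2) by blast
    from P0(2)[OF p(1)] obtain D \<kappa> W \<Phi> E \<mu> Z \<Psi> A G R \<delta> where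
      I: "(D, \<kappa>) \<in> atlas \<M>" "openin (base \<M>) (L p)" "B p \<subseteq> A"
        "compactin (base \<M>) A" "A \<subseteq> D" "C p = control_set W \<Phi> E \<mu> Z \<Psi> A (B p) G (L p) R \<delta>"
      unfolding is_control_def by (elim exE conjE) (rule that)
    have LT: "L p \<subseteq> topspace (base \<M>)" by (rule openin_subset[OF I(2)])
    have "eventually (\<lambda>\<phi>. holo_map (inverse_body \<phi>) \<and> inverse_body \<phi> ` L p \<subseteq> A) F"
      using evA evC[OF p(1)]
    proof eventually_elim
      case (elim \<phi>)
      have "inverse_body \<phi> x \<in> B p" if x: "x \<in> L p" for x
      proof (rule ccontr)
        have xt: "x \<in> topspace (base \<M>)" using x LT by blast
        assume "inverse_body \<phi> x \<notin> B p"
        then have "fst \<phi> (inverse_body \<phi> x) \<notin> L p"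
          by (rule control_setD(3)[OF elim(2)[unfolded I(6)] inverse_body(2)[OF elim(1) xt]])
        then show False using x inverse_body(3)[OF elim(1) xt] by simp
      qed
      then show ?case using inverse_body(1)[OF elim(1)] I(3) by blast
    qed
    with I p(2) show "\<exists>Y E \<mu> K. openin (base \<M>) Y \<and> y \<in> Y \<and> (E, \<mu>) \<in> atlas \<M> \<and>
        compactin (base \<M>) K \<and> K \<subseteq> E \<and> eventually (\<lambda>\<alpha>. holo_map (inverse_body \<alpha>) \<and> inverse_body \<alpha> ` Y \<subseteq> K) F"
      by (intro exI conjI)
  qed (rule that)
  have gT: "g x \<in> topspace (base \<M>)" and hT: "h x \<in> topspace (base \<M>)" if "x \<in> topspace (base \<M>)" for x
    using g h that by (auto simp: conv_continuously_def)
  have gh: "g (h y) = y" if "y \<in> topspace (base \<M>)" for y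
    by (rule conv_continuously_inverse[OF F0 g h _ that]) (use evA in \<open>eventually_elim, simp add: inverse_body\<close>)
  have hg: "h (g y) = y" if "y \<in> topspace (base \<M>)" for y
    by (rule conv_continuously_inverse[OF F0 h g _ that]) (use evA in \<open>eventually_elim, simp add: inverse_body\<close>)
  have hh: "holo_map h"
    by (rule conv_continuously_holo_map[OF F0 h]) (use evA in \<open>eventually_elim, simp add: inverse_body\<close>)
  have gG: "g x \<in> G" if p: "p \<in> P0" and C: "C p = control_set W \<Phi> E \<mu> Z \<Psi> A (B p) G (L p) R \<delta>"
      and G: "compactin (base \<M>) G" and x: "x \<in> A" "x \<in> topspace (base \<M>)" for p W \<Phi> E \<mu> Z \<Psi> A G R \<delta> x
  proof (rule limit_in_closed[OF F0 conv_continuously_limit[OF g x(2)]])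
    show "closedin (base \<M>) G" by (rule compactin_imp_closedin[OF Hausdorff_base G])
    show "eventually (\<lambda>\<phi>. fst \<phi> x \<in> G) F"
      using evC[OF p] by eventually_elim (rule control_setD(2)[OF _ x(1)], simp add: C)
  qed
  have ctrl: "controlled F (\<lambda>\<phi>. \<phi>) g"
    unfolding controlled_def
  proof
    fix y assume y: "y \<in> topspace (base \<M>)"
    then obtain p where p: "p \<in> P0" "y \<in> B p" using cover(1) by blast
    from P0(2)[OF p(1)] obtain D \<kappa> W \<Phi> E \<mu> Z \<Psi> A G R \<delta> where
      I: "spl W \<Phi>" "(E, \<mu>) \<in> atlas \<M>" "spl Z \<Psi>" "openin (base \<M>) (B p)" "B p \<subseteq> A" "A \<subseteq> W"
        "compactin (base \<M>) G" "G \<subseteq> E \<inter> Z" "(0::real) \<le> R" "C p = control_set W \<Phi> E \<mu> Z \<Psi> A (B p) G (L p) R \<delta>"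
      unfolding is_control_def by (elim exE conjE) (rule that)
    have yA: "y \<in> A" using p I by blast
    have gy: "g y \<in> E \<inter> Z" using gG[OF p(1) I(10) I(7) yA y] I(8) by blast
    have "eventually (\<lambda>\<phi>. \<forall>x\<in>B p. \<forall>\<nu>\<in>multi.
        (\<forall>i<m. cmod (pc \<phi> \<Phi> W (E \<inter> Z) (function_sec \<Psi> Z (E \<inter> Z) (\<lambda>y. \<mu> y i)) x \<nu>) \<le> R) \<and>
        (\<forall>\<rho>\<in>multi. cmod (pc \<phi> \<Phi> W (E \<inter> Z) (monomial_sec \<Psi> Z (E \<inter> Z) \<rho>) x \<nu>) \<le> R)) F"
      using evC[OF p(1)]
    proof eventually_elim
      case (elim \<phi>)
      note e = elim[unfolded I(10)]
      show ?case
      proof (intro ballI conjI allI impI)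
        fix x \<nu> i assume "x \<in> B p" "\<nu> \<in> multi" "i < m"
        then show "cmod (pc \<phi> \<Phi> W (E \<inter> Z) (function_sec \<Psi> Z (E \<inter> Z) (\<lambda>y. \<mu> y i)) x \<nu>) \<le> R"
          using I(5) by (intro control_setD(4)[OF e]) auto
      next
        fix x \<nu> \<rho> assume "x \<in> B p" "\<nu> \<in> multi" "\<rho> \<in> multi"
        then show "cmod (pc \<phi> \<Phi> W (E \<inter> Z) (monomial_sec \<Psi> Z (E \<inter> Z) \<rho>) x \<nu>) \<le> R"
          using I(5) by (intro control_setD(5)[OF e]) auto
      qed
    qed
    moreover have "B p \<subseteq> W" using I by blast
    ultimately show "\<exists>W \<Phi> E \<mu> Z \<Psi> Y R. spl W \<Phi> \<and> (E, \<mu>) \<in> atlas \<M> \<and> spl Z \<Psi> \<and> g y \<in> E \<inter> Z \<and>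
     openin (base \<M>) Y \<and> y \<in> Y \<and> Y \<subseteq> W \<and> (0::real) \<le> R \<and>
     eventually (\<lambda>\<alpha>. \<forall>x\<in>Y. \<forall>\<nu>\<in>multi.
        (\<forall>i<m. cmod (pc \<alpha> \<Phi> W (E \<inter> Z) (function_sec \<Psi> Z (E \<inter> Z) (\<lambda>y. \<mu> y i)) x \<nu>) \<le> R) \<and>
        (\<forall>\<rho>\<in>multi. cmod (pc \<alpha> \<Phi> W (E \<inter> Z) (monomial_sec \<Psi> Z (E \<inter> Z) \<rho>) x \<nu>) \<le> R)) F"
      using I(1-4,9) gy p(2) by (intro exI conjI)
  qed
  note ctx = F sm g ctrl
  define \<psi> where "\<psi> = limit_morphism F (\<lambda>\<phi>. \<phi>) g"
  have \<psi>: "smor \<psi>" unfolding \<psi>_def by (rule smor_lim[OF ctx])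
  have f\<psi>: "fst \<psi> x = g x" if "x \<in> topspace (base \<M>)" for x unfolding \<psi>_def by (rule fst_lim[OF ctx that])
  have plim: "((\<lambda>\<phi>. pc \<phi> \<Phi> W U s x \<nu>) \<longlongrightarrow> pc \<psi> \<Phi> W U s x \<nu>) F"
    if "openin (base \<M>) U" "s \<in> Sec U" "x \<in> topspace (base \<M>)" "g x \<in> U" "x \<in> W" "spl W \<Phi>" "\<nu> \<in> multi" for U s x W \<Phi> \<nu>
  proof -
    have "x \<in> limit_pre g U" using that by (simp add: limit_pre_def)
    from lim_pointwise[OF ctx that(1,2) this that(5,6,7)] show ?thesis
      by (simp add: \<psi>_def pc_def pre_lim[OF ctx])
  qed
  have in_C: "(\<forall>x\<in>A. \<delta> \<le> cmod (pc \<psi> \<Phi> W (E \<inter> Z) (monomial_sec \<Psi> Z (E \<inter> Z) top) x top)) \<and> (\<psi> \<in> Aut \<longrightarrow> \<psi> \<in> C p)"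
    if p: "p \<in> P0" and C: "C p = control_set W \<Phi> E \<mu> Z \<Psi> A (B p) G (L p) R \<delta>"
      and I: "spl W \<Phi>" "(E, \<mu>) \<in> atlas \<M>" "spl Z \<Psi>" "openin (base \<M>) (L p)" "compactin (base \<M>) A" "A \<subseteq> W"
        "compactin (base \<M>) G" "G \<subseteq> E \<inter> Z" for p W \<Phi> E \<mu> Z \<Psi> A G R \<delta>
  proof -
    let ?Q = "E \<inter> Z"
    have QO: "openin (base \<M>) ?Q" using chart_homeomorphic(2)[OF I(2)] spl_open[OF I(3)] by blast
    have QZ: "?Q \<subseteq> Z" by blast
    have AT: "x \<in> topspace (base \<M>)" if "x \<in> A" for x using compactin_subset_topspace[OF I(5)] that by blast
    have gA: "g x \<in> G" if "x \<in> A" for x by (rule gG[OF p C I(7) that AT[OF that]])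
    have fC: "function_sec \<Psi> Z ?Q (\<lambda>y. \<mu> y i) \<in> Sec ?Q" if "i < m" for i
      by (rule function_sec_closed[OF I(3) QO QZ holo_subset[OF holo_coordinate[OF I(2) that]]]) simp
    have eC: "monomial_sec \<Psi> Z ?Q \<rho> \<in> Sec ?Q" for \<rho> by (rule monomial_sec_closed[OF I(3) QO QZ])
    have pl: "((\<lambda>\<phi>. cmod (pc \<phi> \<Phi> W ?Q s x \<nu>)) \<longlongrightarrow> cmod (pc \<psi> \<Phi> W ?Q s x \<nu>)) F"
      if "s \<in> Sec ?Q" "x \<in> A" "\<nu> \<in> multi" for s x \<nu>
    proof (rule tendsto_norm, rule plim[OF QO that(1) AT[OF that(2)] _ _ I(1) that(3)])
      show "g x \<in> ?Q" using gA[OF that(2)] I(8) by blast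
      show "x \<in> W" using that(2) I(6) by blast
    qed
    note evp = evC[OF p, unfolded C]
    have topm: "top \<in> multi" by simp
    have 1: "\<delta> \<le> cmod (pc \<psi> \<Phi> W ?Q (monomial_sec \<Psi> Z ?Q top) x top)" if x: "x \<in> A" for x
      by (rule tendsto_lowerbound[OF pl[OF eC x topm] _ F0])
         (rule eventually_mono[OF evp], rule control_setD(6)[OF _ x])
    have 2: "cmod (pc \<psi> \<Phi> W ?Q (function_sec \<Psi> Z ?Q (\<lambda>y. \<mu> y i)) x \<nu>) \<le> R" if x: "x \<in> A" and i: "i < m" and \<nu>: "\<nu> \<in> multi" for x i \<nu>
      by (rule tendsto_upperbound[OF pl[OF fC[OF i] x \<nu>] _ F0])
         (rule eventually_mono[OF evp], rule control_setD(4)[OF _ x \<nu> i])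
    have 3: "cmod (pc \<psi> \<Phi> W ?Q (monomial_sec \<Psi> Z ?Q \<rho>) x \<nu>) \<le> R" if x: "x \<in> A" and \<rho>: "\<rho> \<in> multi" and \<nu>: "\<nu> \<in> multi" for x \<rho> \<nu>
      by (rule tendsto_upperbound[OF pl[OF eC x \<nu>] _ F0])
         (rule eventually_mono[OF evp], rule control_setD(5)[OF _ x \<nu> \<rho>])
    have 4: "fst \<psi> x \<notin> L p" if x: "x \<in> topspace (base \<M>)" "x \<notin> B p" for x
    proof
      assume "fst \<psi> x \<in> L p"
      then have "g x \<in> L p" using f\<psi>[OF x(1)] by simp
      then have "eventually (\<lambda>\<phi>. fst \<phi> x \<in> L p) F" by (rule limitinD[OF conv_continuously_limit[OF g x(1)] I(4)])
      with evp have "eventually (\<lambda>_. False) F"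
        by eventually_elim (use control_setD(3)[OF _ x] in blast)
      then show False using F0 by (simp add: trivial_limit_def)
    qed
    have 5: "fst \<psi> ` A \<subseteq> G" using gA f\<psi> AT by auto
    have "\<psi> \<in> C p" if "\<psi> \<in> Aut"
      unfolding C control_set_def using that 1 2 3 4 5 by (intro CollectI conjI ballI allI impI) auto
    then show ?thesis using 1 by blast
  qed
  have \<psi>A: "\<psi> \<in> Aut"
  proof (rule nondegenerate_automorphism[OF \<psi> hh])
    show "h y \<in> topspace (base \<M>) \<and> fst \<psi> (h y) = y" if "y \<in> topspace (base \<M>)" for y
      using hT[OF that] gh[OF that] f\<psi> by simp
    show "h (fst \<psi> x) = x" if "x \<in> topspace (base \<M>)" for x using hg[OF that] f\<psi>[OF that] by simp
    fix y assume y: "y \<in> topspace (base \<M>)"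
    then obtain p where p: "p \<in> P0" "y \<in> B p" using cover(1) by blast
    from P0(2)[OF p(1)] obtain D \<kappa> W \<Phi> E \<mu> Z \<Psi> A G R \<delta> where
      I: "spl W \<Phi>" "(E, \<mu>) \<in> atlas \<M>" "spl Z \<Psi>" "openin (base \<M>) (L p)" "compactin (base \<M>) A" "A \<subseteq> W"
        "compactin (base \<M>) G" "G \<subseteq> E \<inter> Z" "B p \<subseteq> A" "0 < \<delta>" "C p = control_set W \<Phi> E \<mu> Z \<Psi> A (B p) G (L p) R \<delta>"
      unfolding is_control_def by (elim exE conjE) (rule that)
    have yA: "y \<in> A" using p I by blast
    have QO: "openin (base \<M>) (E \<inter> Z)" using chart_homeomorphic(2)[OF I(2)] spl_open[OF I(3)] by blast
    have "\<delta> \<le> cmod (pc \<psi> \<Phi> W (E \<inter> Z) (monomial_sec \<Psi> Z (E \<inter> Z) top) y top)"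
      using in_C[OF p(1) I(11) I(1-8)] yA by blast
    then have nz: "pc \<psi> \<Phi> W (E \<inter> Z) (monomial_sec \<Psi> Z (E \<inter> Z) top) y top \<noteq> 0" using I(10) by auto
    have "fst \<psi> y \<in> E \<inter> Z" using gG[OF p(1) I(11) I(7) yA y] I(8) f\<psi>[OF y] by auto
    moreover have "y \<in> W" using yA I by blast
    moreover have "E \<inter> Z \<subseteq> Z" by blast
    ultimately show "\<exists>W \<Phi> Z \<Psi> Q. spl W \<Phi> \<and> y \<in> W \<and> spl Z \<Psi> \<and>
        openin (base \<M>) Q \<and> fst \<psi> y \<in> Q \<and> Q \<subseteq> Z \<and> pc \<psi> \<Phi> W Q (monomial_sec \<Psi> Z Q top) y top \<noteq> 0"
      using I(1,3) QO nz by (intro exI conjI)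
  qed
  have "\<psi> \<in> C p" if p: "p \<in> P0" for p
  proof -
    from P0(2)[OF p] obtain D \<kappa> W \<Phi> E \<mu> Z \<Psi> A G R \<delta> where
      I: "spl W \<Phi>" "(E, \<mu>) \<in> atlas \<M>" "spl Z \<Psi>" "openin (base \<M>) (L p)" "compactin (base \<M>) A" "A \<subseteq> W"
        "compactin (base \<M>) G" "G \<subseteq> E \<inter> Z" "C p = control_set W \<Phi> E \<mu> Z \<Psi> A (B p) G (L p) R \<delta>"
      unfolding is_control_def by (elim exE conjE) (rule that)
    show ?thesis using in_C[OF p I(9) I(1-8)] \<psi>A by blast
  qed
  moreover have "limitin AT (\<lambda>\<phi>. \<phi>) \<psi> F"
    unfolding \<psi>_def by (rule converges_in_AT[OF F evA g ctrl _ ne]) (use \<psi>A in \<open>simp add: \<psi>_def\<close>)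
  ultimately show ?thesis using \<psi>A by blast
qed

text \<open>
  By compactness of the manifold, finitely many controls around \<open>\<phi>\<close> suffice for their sets \<open>B\<close> to cover
  it and, as \<open>\<phi>\<close> is onto, for their sets \<open>L\<close> to cover it as well.
\<close>

lemma locally_compact_AT: "locally_compact_space AT"
  unfolding locally_compact_space_def
proof
  fix \<phi> assume \<phi>: "\<phi> \<in> topspace AT"
  have ne: "topspace AT \<noteq> {}" using \<phi> by blast
  have \<phi>A: "\<phi> \<in> Aut" using \<phi> AT_topspace_subset by blast
  have AutO: "openin AT Aut" by (rule Aut_open[OF ne])
  let ?M = "topspace (base \<M>)"
  have "\<forall>p\<in>?M. \<exists>D. is_control (fst D) (fst (snd D)) (fst (snd (snd D))) \<and> p \<in> fst D \<and> fst \<phi> p \<in> fst (snd D) \<and>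
      openin AT (snd (snd (snd D))) \<and> \<phi> \<in> snd (snd (snd D)) \<and> snd (snd (snd D)) \<subseteq> fst (snd (snd D))"
    using control_exists[OF \<phi>] by (simp add: split_paired_Ex)
  from bchoice[OF this] obtain T where T: "\<forall>p\<in>?M. is_control (fst (T p)) (fst (snd (T p))) (fst (snd (snd (T p)))) \<and> p \<in> fst (T p) \<and>
      fst \<phi> p \<in> fst (snd (T p)) \<and> openin AT (snd (snd (snd (T p)))) \<and> \<phi> \<in> snd (snd (snd (T p))) \<and>
      snd (snd (snd (T p))) \<subseteq> fst (snd (snd (T p)))"
    by (rule exE)
  define B L C N where "B p = fst (T p)" and "L p = fst (snd (T p))" and "C p = fst (snd (snd (T p)))"
    and "N p = snd (snd (snd (T p)))" for p
  have D: "is_control (B p) (L p) (C p)" "p \<in> B p" "fst \<phi> p \<in> L p" "openin AT (N p)" "\<phi> \<in> N p" "N p \<subseteq> C p"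
    if "p \<in> ?M" for p
    using bspec[OF T that] by (simp_all add: B_def L_def C_def N_def)
  have O: "openin (base \<M>) (B p)" "openin (base \<M>) (L p)" if "p \<in> ?M" for p
    using is_control_open[OF D(1)[OF that]] by simp_all
  have Mc: "compactin (base \<M>) ?M" using compact_base by (simp add: compact_space_def)
  have sub: "\<exists>P. finite P \<and> P \<subseteq> ?M \<and> ?M \<subseteq> (\<Union>p\<in>P. S p)"
    if S: "\<And>p. p \<in> ?M \<Longrightarrow> openin (base \<M>) (S p)" and cov: "?M \<subseteq> (\<Union>p\<in>?M. S p)" for S
  proof -
    have "\<exists>\<F>. finite \<F> \<and> \<F> \<subseteq> S ` ?M \<and> ?M \<subseteq> \<Union>\<F>"
      by (rule compactinD[OF Mc]) (use S cov in auto)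
    then obtain \<F> where \<F>: "finite \<F>" "\<F> \<subseteq> S ` ?M" "?M \<subseteq> \<Union>\<F>" by blast
    obtain P where "finite P" "P \<subseteq> ?M" "\<F> = S ` P" using finite_subset_image[OF \<F>(1,2)] by blast
    then show ?thesis using \<F>(3) by blast
  qed
  have cov1: "?M \<subseteq> (\<Union>p\<in>?M. B p)" using D(2) by blast
  obtain P1 where P1: "finite P1" "P1 \<subseteq> ?M" "?M \<subseteq> (\<Union>p\<in>P1. B p)"
  proof -
    have "\<exists>P. finite P \<and> P \<subseteq> ?M \<and> ?M \<subseteq> (\<Union>p\<in>P. B p)" by (rule sub[OF _ cov1]) (rule O(1))
    then show thesis by (elim exE conjE) (rule that)
  qed
  have onto: "?M \<subseteq> (\<Union>p\<in>?M. L p)"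
  proof
    fix y assume y: "y \<in> ?M"
    have "fst \<phi> (inverse_body \<phi> y) \<in> L (inverse_body \<phi> y)" by (rule D(3)[OF inverse_body(2)[OF \<phi>A y]])
    then show "y \<in> (\<Union>p\<in>?M. L p)" using inverse_body(2,3)[OF \<phi>A y] by auto
  qed
  obtain P2 where P2: "finite P2" "P2 \<subseteq> ?M" "?M \<subseteq> (\<Union>p\<in>P2. L p)"
  proof -
    have "\<exists>P. finite P \<and> P \<subseteq> ?M \<and> ?M \<subseteq> (\<Union>p\<in>P. L p)" by (rule sub[OF _ onto]) (rule O(2))
    then show thesis by (elim exE conjE) (rule that)
  qed
  define P0 where "P0 = P1 \<union> P2"
  have P0: "finite P0" "P0 \<subseteq> ?M" and c1: "?M \<subseteq> (\<Union>p\<in>P0. B p)" and c2: "?M \<subseteq> (\<Union>p\<in>P0. L p)"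
    using P1 P2 unfolding P0_def by blast+
  define K where "K = Aut \<inter> (\<Inter>p\<in>P0. C p)"
  have "compactin AT K"
  proof (rule compactin_if_ultrafilters_converge)
    show "K \<subseteq> topspace AT" using openin_subset[OF AutO] by (auto simp: K_def)
    fix F assume F: "ultrafilter F" and ev: "eventually (\<lambda>x. x \<in> K) F"
    show "\<exists>l\<in>K. limitin AT (\<lambda>x. x) l F"
      unfolding K_def
      by (rule ultrafilter_limit_in_controls[OF ne F P0(1) _ c1 c2]) (use D(1) P0(2) ev in \<open>auto simp: K_def\<close>)
  qed
  moreover have "openin AT (Aut \<inter> (\<Inter>p\<in>P0. N p))"
  proof (cases "P0 = {}")
    case True then show ?thesis using AutO by simp
  next
    case False
    have "openin AT (\<Inter>p\<in>P0. N p)"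
      by (rule openin_INT2[OF P0(1) False]) (use D(4) P0(2) in blast)
    then show ?thesis using AutO by blast
  qed
  moreover have "\<phi> \<in> Aut \<inter> (\<Inter>p\<in>P0. N p)" using \<phi>A D(5) P0(2) by blast
  moreover have "Aut \<inter> (\<Inter>p\<in>P0. N p) \<subseteq> K" unfolding K_def using D(6) P0(2) by blast
  ultimately show "\<exists>U K. openin AT U \<and> compactin AT K \<and> \<phi> \<in> U \<and> U \<subseteq> K" by blast
qed

end

theorem lemma3p5:
  fixes \<M> :: "('p, 's) superspace"
  assumes "compact_supermanifold \<M>"
  shows "locally_compact_space (automorphism_topology \<M>)"
proof -
  interpret compact_super \<M> by (rule compact_super.intro[OF assms])
  show ?thesis by (rule locally_compact_AT)
qed

end
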